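(* Let $(R,\mathfrak m)$ be an excellent Noetherian local ring of prime characteristic $p>0$ that is quasi-unmixed in the sense that its $\mathfrak m$-adic completion is reduced and equidimensional. Let $I,J$ be $\mathfrak m$-primary ideals of $R$. Then \[ e_{\rm HK}(IJ)\le \ell^*(J)\cdot e_{\rm HK}(I)+e_{\rm HK}(J). \]
   Context: Let $d=\dim R$ and let $q=p^e$ range over powers of $p$. For an ideal $\mathfrak a$, the bracket power $\mathfrak a^{[q]}$ is the ideal generated by the $q$th powers of all elements of $\mathfrak a$. With $\lambda_R$ denoting length, the Hilbert-Kunz multiplicity of an $\mathfrak m$-primary ideal $\mathfrak a$ is $e_{\rm HK}(\mathfrak a)=\lim_{q\to\infty}\lambda_R(R/\mathfrak a^{[q]})/q^d$ (this limit exists). The tight closure $\mathfrak a^*$ is the ideal of all $x\in R$ for which there is $c\in R$, not in any minimal prime of $R$, with $cx^q\in\mathfrak a^{[q]}$ for all sufficiently large $q=p^e$. A $*$-reduction of $\mathfrak a$ is an ideal $K\subseteq\mathfrak a$ with $K^*=\mathfrak a^*$; it is a minimal $*$-reduction if it is minimal under inclusion among $*$-reductions of $\mathfrak a$ (under the given hypotheses on $R$ minimal $*$-reductions always exist). The $*$-spread $\ell^*(\mathfrak a)$ is the minimum, over all minimal $*$-reductions $K$ of $\mathfrak a$, of the minimal number of generators of $K$. *)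

theory Defs
  imports Complex_Main "HOL-Algebra.Algebra" "HOL-Library.Extended_Real"
begin

section \<open>Commutative algebra\<close>

definition has_characteristic :: "('a, 'b) ring_scheme \<Rightarrow> nat \<Rightarrow> bool"
  where "has_characteristic R p \<longleftrightarrow> (\<forall>n::nat. [n] \<cdot>\<^bsub>R\<^esub> \<one>\<^bsub>R\<^esub> = \<zero>\<^bsub>R\<^esub> \<longleftrightarrow> p dvd n)"

definition local_ring :: "('a, 'b) ring_scheme \<Rightarrow> bool"
  where "local_ring R \<longleftrightarrow> cring R \<and> (\<exists>!M. maximalideal M R)"

definition max_ideal :: "('a, 'b) ring_scheme \<Rightarrow> 'a set"
  where "max_ideal R = (THE M. maximalideal M R)"

definition minimal_prime :: "'a set \<Rightarrow> ('a, 'b) ring_scheme \<Rightarrow> bool"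
  where "minimal_prime P R \<longleftrightarrow>
    primeideal P R \<and> (\<forall>Q. primeideal Q R \<longrightarrow> Q \<subseteq> P \<longrightarrow> Q = P)"

definition radical_of :: "('a, 'b) ring_scheme \<Rightarrow> 'a set \<Rightarrow> 'a set"
  where "radical_of R I = {x \<in> carrier R. \<exists>n::nat. x [^]\<^bsub>R\<^esub> n \<in> I}"

definition primary_ideal :: "'a set \<Rightarrow> ('a, 'b) ring_scheme \<Rightarrow> bool"
  where "primary_ideal I R \<longleftrightarrow> ideal I R \<and> I \<noteq> carrier R \<and>
    (\<forall>a\<in>carrier R. \<forall>b\<in>carrier R. a \<otimes>\<^bsub>R\<^esub> b \<in> I \<longrightarrow> a \<in> I \<or> b \<in> radical_of R I)"

definition max_primary :: "'a set \<Rightarrow> ('a, 'b) ring_scheme \<Rightarrow> bool"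
  where "max_primary I R \<longleftrightarrow> primary_ideal I R \<and> radical_of R I = max_ideal R"

definition min_num_gens :: "('a, 'b) ring_scheme \<Rightarrow> 'a set \<Rightarrow> nat"
  where "min_num_gens R I =
    (LEAST n. \<exists>A \<subseteq> carrier R. finite A \<and> card A = n \<and> Idl\<^bsub>R\<^esub> A = I)"

definition prime_chain :: "('a, 'b) ring_scheme \<Rightarrow> nat \<Rightarrow> (nat \<Rightarrow> 'a set) \<Rightarrow> bool"
  where "prime_chain R n C \<longleftrightarrow> (\<forall>i\<le>n. primeideal (C i) R) \<and> (\<forall>i<n. C i \<subset> C (Suc i))"

definition krull_dim :: "('a, 'b) ring_scheme \<Rightarrow> enat"
  where "krull_dim R = Sup {enat n | n. \<exists>C. prime_chain R n C}"

definition reduced_ring :: "('a, 'b) ring_scheme \<Rightarrow> bool"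
  where "reduced_ring R \<longleftrightarrow> cring R \<and>
    (\<forall>x\<in>carrier R. \<forall>n::nat. x [^]\<^bsub>R\<^esub> n = \<zero>\<^bsub>R\<^esub> \<longrightarrow> x = \<zero>\<^bsub>R\<^esub>)"

definition equidimensional :: "('a, 'b) ring_scheme \<Rightarrow> bool"
  where "equidimensional R \<longleftrightarrow> (\<forall>P. minimal_prime P R \<longrightarrow> krull_dim (R Quot P) = krull_dim R)"


subsection \<open>Length\<close>

definition module_length :: "('a, 'b) ring_scheme \<Rightarrow> ('a, 'c, 'd) module_scheme \<Rightarrow> enat"
  where "module_length R M = Sup {enat n | n. \<exists>N.
    (\<forall>i\<le>n. submodule (N i) R M) \<and> (\<forall>i<n. N i \<subset> N (Suc i))}"

definition quotient_module :: "('a, 'b) ring_scheme \<Rightarrow> 'a set \<Rightarrow> ('a, 'a set) module"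
  where "quotient_module R I =
    \<lparr>carrier = carrier (R Quot I), monoid.mult = monoid.mult (R Quot I), one = monoid.one (R Quot I),
     ring.zero = ring.zero (R Quot I), ring.add = ring.add (R Quot I),
     smult = (\<lambda>a U. (I +>\<^bsub>R\<^esub> a) \<otimes>\<^bsub>R Quot I\<^esub> U)\<rparr>"


subsection \<open>Localization at a prime\<close>

definition loc_frac :: "('a, 'b) ring_scheme \<Rightarrow> 'a set \<Rightarrow> 'a \<Rightarrow> 'a \<Rightarrow> ('a \<times> 'a) set"
  where "loc_frac R P a s = {(b, t). b \<in> carrier R \<and> t \<in> carrier R - P \<and>
    (\<exists>u \<in> carrier R - P. u \<otimes>\<^bsub>R\<^esub> (t \<otimes>\<^bsub>R\<^esub> a) = u \<otimes>\<^bsub>R\<^esub> (s \<otimes>\<^bsub>R\<^esub> b))}"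

definition localization :: "('a, 'b) ring_scheme \<Rightarrow> 'a set \<Rightarrow> ('a \<times> 'a) set ring"
  where "localization R P =
    \<lparr>carrier = {loc_frac R P a s | a s. a \<in> carrier R \<and> s \<in> carrier R - P},
     monoid.mult = (\<lambda>U V. \<Union>(a, s)\<in>U. \<Union>(b, t)\<in>V. loc_frac R P (a \<otimes>\<^bsub>R\<^esub> b) (s \<otimes>\<^bsub>R\<^esub> t)),
     one = loc_frac R P \<one>\<^bsub>R\<^esub> \<one>\<^bsub>R\<^esub>,
     ring.zero = loc_frac R P \<zero>\<^bsub>R\<^esub> \<one>\<^bsub>R\<^esub>,
     ring.add = (\<lambda>U V. \<Union>(a, s)\<in>U. \<Union>(b, t)\<in>V.
       loc_frac R P (a \<otimes>\<^bsub>R\<^esub> t \<oplus>\<^bsub>R\<^esub> b \<otimes>\<^bsub>R\<^esub> s) (s \<otimes>\<^bsub>R\<^esub> t))\<rparr>"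

definition residue_field :: "('a, 'b) ring_scheme \<Rightarrow> 'a set \<Rightarrow> ('a \<times> 'a) set set ring"
  where "residue_field R P = localization R P Quot max_ideal (localization R P)"

definition to_residue_field :: "('a, 'b) ring_scheme \<Rightarrow> 'a set \<Rightarrow> 'a \<Rightarrow> ('a \<times> 'a) set set"
  where "to_residue_field R P a =
    max_ideal (localization R P) +>\<^bsub>localization R P\<^esub> loc_frac R P a \<one>\<^bsub>R\<^esub>"


subsection \<open>Adic completion\<close>

abbreviation ideal_power :: "('a, 'b) ring_scheme \<Rightarrow> 'a set \<Rightarrow> nat \<Rightarrow> 'a set"
  where "ideal_power R I n \<equiv> I [^]\<^bsub>ideals_set R\<^esub> n"

text \<open>The inverse limit of the rings \<open>R Quot I^n\<close>; the transition maps send a coset of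
  \<open>I^(n+1)\<close> to the coset of \<open>I^n\<close> containing it.\<close>

definition completion :: "('a, 'b) ring_scheme \<Rightarrow> 'a set \<Rightarrow> (nat \<Rightarrow> 'a set) ring"
  where "completion R I =
    \<lparr>carrier = {x. (\<forall>n. x n \<in> carrier (R Quot ideal_power R I n)) \<and> (\<forall>n. x (Suc n) \<subseteq> x n)},
     monoid.mult = (\<lambda>x y n. x n \<otimes>\<^bsub>R Quot ideal_power R I n\<^esub> y n),
     one = (\<lambda>n. \<one>\<^bsub>R Quot ideal_power R I n\<^esub>),
     ring.zero = (\<lambda>n. \<zero>\<^bsub>R Quot ideal_power R I n\<^esub>),
     ring.add = (\<lambda>x y n. x n \<oplus>\<^bsub>R Quot ideal_power R I n\<^esub> y n)\<rparr>"

definition to_completion :: "('a, 'b) ring_scheme \<Rightarrow> 'a set \<Rightarrow> 'a \<Rightarrow> nat \<Rightarrow> 'a set"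
  where "to_completion R I a = (\<lambda>n. ideal_power R I n +>\<^bsub>R\<^esub> a)"


subsection \<open>Tensor product of algebras\<close>

text \<open>For ring homomorphisms \<open>f : R \<rightarrow> A\<close> and \<open>g : R \<rightarrow> B\<close>, the tensor product of \<open>A\<close> and \<open>B\<close>
  over \<open>R\<close> is the free abelian group on \<open>A \<times> B\<close>, multiplied componentwise, modulo the relations
  of \<open>R\<close>-bilinearity (whose additive span is already an ideal).\<close>

definition free_pair_ring ::
    "('a, 'b) ring_scheme \<Rightarrow> ('c, 'd) ring_scheme \<Rightarrow> (('a \<times> 'c) \<Rightarrow>\<^sub>0 int) ring"
  where "free_pair_ring A B =
    \<lparr>carrier = carrier (free_Abelian_group (carrier A \<times> carrier B)),
     monoid.mult = (\<lambda>x y. frag_extend (\<lambda>(a, b). frag_extend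
       (\<lambda>(a', b'). frag_of (a \<otimes>\<^bsub>A\<^esub> a', b \<otimes>\<^bsub>B\<^esub> b')) y) x),
     one = frag_of (\<one>\<^bsub>A\<^esub>, \<one>\<^bsub>B\<^esub>),
     ring.zero = 0,
     ring.add = (+)\<rparr>"

definition tensor_relations ::
    "('r, 's) ring_scheme \<Rightarrow> ('a, 'b) ring_scheme \<Rightarrow> ('r \<Rightarrow> 'a) \<Rightarrow> ('c, 'd) ring_scheme \<Rightarrow> ('r \<Rightarrow> 'c)
      \<Rightarrow> (('a \<times> 'c) \<Rightarrow>\<^sub>0 int) set"
  where "tensor_relations R A f B g =
      {frag_of (a \<oplus>\<^bsub>A\<^esub> a', b) - frag_of (a, b) - frag_of (a', b) | a a' b.
         a \<in> carrier A \<and> a' \<in> carrier A \<and> b \<in> carrier B}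
    \<union> {frag_of (a, b \<oplus>\<^bsub>B\<^esub> b') - frag_of (a, b) - frag_of (a, b') | a b b'.
         a \<in> carrier A \<and> b \<in> carrier B \<and> b' \<in> carrier B}
    \<union> {frag_of (f r \<otimes>\<^bsub>A\<^esub> a, b) - frag_of (a, g r \<otimes>\<^bsub>B\<^esub> b) | r a b.
         r \<in> carrier R \<and> a \<in> carrier A \<and> b \<in> carrier B}"

definition tensor_product ::
    "('r, 's) ring_scheme \<Rightarrow> ('a, 'b) ring_scheme \<Rightarrow> ('r \<Rightarrow> 'a) \<Rightarrow> ('c, 'd) ring_scheme \<Rightarrow> ('r \<Rightarrow> 'c)
      \<Rightarrow> (('a \<times> 'c) \<Rightarrow>\<^sub>0 int) set ring"
  where "tensor_product R A f B g =
    free_pair_ring A B Quot (Idl\<^bsub>free_pair_ring A B\<^esub> (tensor_relations R A f B g))"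

definition pure_tensor ::
    "('r, 's) ring_scheme \<Rightarrow> ('a, 'b) ring_scheme \<Rightarrow> ('r \<Rightarrow> 'a) \<Rightarrow> ('c, 'd) ring_scheme \<Rightarrow> ('r \<Rightarrow> 'c)
      \<Rightarrow> 'a \<Rightarrow> 'c \<Rightarrow> (('a \<times> 'c) \<Rightarrow>\<^sub>0 int) set"
  where "pure_tensor R A f B g a b =
    (Idl\<^bsub>free_pair_ring A B\<^esub> (tensor_relations R A f B g)) +>\<^bsub>free_pair_ring A B\<^esub> frag_of (a, b)"


section \<open>Excellent rings\<close>

definition regular_local_ring :: "('a, 'b) ring_scheme \<Rightarrow> bool"
  where "regular_local_ring R \<longleftrightarrow> local_ring R \<and> noetherian_ring R \<and>
    enat (min_num_gens R (max_ideal R)) = krull_dim R"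

definition regular_ring :: "('a, 'b) ring_scheme \<Rightarrow> bool"
  where "regular_ring R \<longleftrightarrow> cring R \<and> noetherian_ring R \<and>
    (\<forall>P. primeideal P R \<longrightarrow> regular_local_ring (localization R P))"

definition finite_type_algebra ::
    "('a, 'b) ring_scheme \<Rightarrow> ('c, 'd) ring_scheme \<Rightarrow> ('a \<Rightarrow> 'c) \<Rightarrow> bool"
  where "finite_type_algebra R S h \<longleftrightarrow> cring S \<and> h \<in> ring_hom R S \<and>
    (\<exists>U \<subseteq> carrier S. finite U \<and> generate_ring S (h ` carrier R \<union> U) = carrier S)"

definition catenary :: "('a, 'b) ring_scheme \<Rightarrow> bool"
  where "catenary R \<longleftrightarrow> (\<forall>P Q. primeideal P R \<longrightarrow> primeideal Q R \<longrightarrow> P \<subseteq> Q \<longrightarrow>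
    (\<exists>n. \<forall>m C. prime_chain R m C \<and> C 0 = P \<and> C m = Q \<longrightarrow>
      m \<le> n \<and>
      ((\<forall>i<m. \<not> (\<exists>P'. primeideal P' R \<and> C i \<subset> P' \<and> P' \<subset> C (Suc i))) \<longrightarrow> m = n)))"

text \<open>In the next two definitions the finite type algebras range over the carrier type
  \<open>'a list\<close>. This loses nothing: for nontrivial \<open>R\<close> a finite type \<open>R\<close>-algebra is a quotient of a
  polynomial ring over \<open>R\<close> in finitely many variables, so its cardinality is at most that of
  \<open>'a list\<close> and it is isomorphic to an algebra with carrier in that type.\<close>

definition universally_catenary :: "('a, 'b) ring_scheme \<Rightarrow> bool"
  where "universally_catenary R \<longleftrightarrow>
    (\<forall>(S :: 'a list ring) h. finite_type_algebra R S h \<longrightarrow> catenary S)"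

text \<open>J-2: the regular locus of the spectrum of every finite type algebra is Zariski open, that
  is, the set of primes not containing some subset \<open>E\<close>.\<close>

definition J2_ring :: "('a, 'b) ring_scheme \<Rightarrow> bool"
  where "J2_ring R \<longleftrightarrow>
    (\<forall>(S :: 'a list ring) h. finite_type_algebra R S h \<longrightarrow>
      (\<exists>E \<subseteq> carrier S. {P. primeideal P S \<and> regular_local_ring (localization S P)} =
                       {P. primeideal P S \<and> \<not> E \<subseteq> P}))"

text \<open>For the same reason, up to isomorphism every finite extension \<open>L\<close> of a field \<open>k\<close> with
  elements of type \<open>'k\<close> has its carrier in \<open>'k list\<close>.\<close>

definition geometrically_regular ::
    "('k, 'l) ring_scheme \<Rightarrow> ('a, 'b) ring_scheme \<Rightarrow> ('k \<Rightarrow> 'a) \<Rightarrow> bool"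
  where "geometrically_regular k A j \<longleftrightarrow>
    (\<forall>(L :: 'k list ring) h.
      field L \<and> h \<in> ring_hom k L \<and> ring.finite_dimension L (h ` carrier k) (carrier L) \<longrightarrow>
      regular_ring (tensor_product k A j L h))"

text \<open>A G-ring has geometrically regular formal fibres: for primes \<open>P\<close> of \<open>R\<close> and \<open>Q\<close> of \<open>R_P\<close>,
  the fibre over \<open>Q\<close> of the map from \<open>R_P\<close> to its completion is geometrically regular over the
  residue field of \<open>Q\<close>. (Flatness of that map is automatic, \<open>R\<close> being Noetherian.)\<close>

definition geom_regular_fibres ::
    "('a, 'b) ring_scheme \<Rightarrow> ('c, 'd) ring_scheme \<Rightarrow> ('a \<Rightarrow> 'c) \<Rightarrow> bool"
  where "geom_regular_fibres A B f \<longleftrightarrow>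
    (\<forall>Q. primeideal Q A \<longrightarrow>
      geometrically_regular (residue_field A Q)
        (tensor_product A B f (residue_field A Q) (to_residue_field A Q))
        (pure_tensor A B f (residue_field A Q) (to_residue_field A Q) \<one>\<^bsub>B\<^esub>))"

definition G_ring :: "('a, 'b) ring_scheme \<Rightarrow> bool"
  where "G_ring R \<longleftrightarrow> cring R \<and> noetherian_ring R \<and>
    (\<forall>P. primeideal P R \<longrightarrow>
      geom_regular_fibres (localization R P)
        (completion (localization R P) (max_ideal (localization R P)))
        (to_completion (localization R P) (max_ideal (localization R P))))"

definition excellent_ring :: "('a, 'b) ring_scheme \<Rightarrow> bool"
  where "excellent_ring R \<longleftrightarrow>
    cring R \<and> noetherian_ring R \<and> universally_catenary R \<and> G_ring R \<and> J2_ring R"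


section \<open>Hilbert-Kunz multiplicity and tight closure\<close>

definition bracket_power :: "('a, 'b) ring_scheme \<Rightarrow> 'a set \<Rightarrow> nat \<Rightarrow> 'a set"
  where "bracket_power R I q = Idl\<^bsub>R\<^esub> {x [^]\<^bsub>R\<^esub> q | x. x \<in> I}"

definition HK_mult :: "nat \<Rightarrow> ('a, 'b) ring_scheme \<Rightarrow> 'a set \<Rightarrow> real"
  where "HK_mult p R I = lim (\<lambda>e.
    real (the_enat (module_length R (quotient_module R (bracket_power R I (p ^ e)))))
      / real (p ^ e) ^ the_enat (krull_dim R))"

definition tight_closure :: "nat \<Rightarrow> ('a, 'b) ring_scheme \<Rightarrow> 'a set \<Rightarrow> 'a set"
  where "tight_closure p R I = {x \<in> carrier R.
    \<exists>c \<in> carrier R. (\<forall>P. minimal_prime P R \<longrightarrow> c \<notin> P) \<and>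
      (\<forall>\<^sub>F e in sequentially. c \<otimes>\<^bsub>R\<^esub> x [^]\<^bsub>R\<^esub> (p ^ e) \<in> bracket_power R I (p ^ e))}"

definition star_reduction :: "nat \<Rightarrow> ('a, 'b) ring_scheme \<Rightarrow> 'a set \<Rightarrow> 'a set \<Rightarrow> bool"
  where "star_reduction p R I K \<longleftrightarrow>
    ideal K R \<and> K \<subseteq> I \<and> tight_closure p R K = tight_closure p R I"

definition minimal_star_reduction :: "nat \<Rightarrow> ('a, 'b) ring_scheme \<Rightarrow> 'a set \<Rightarrow> 'a set \<Rightarrow> bool"
  where "minimal_star_reduction p R I K \<longleftrightarrow> star_reduction p R I K \<and>
    (\<forall>K'. star_reduction p R I K' \<longrightarrow> K' \<subseteq> K \<longrightarrow> K' = K)"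

text \<open>A minimum over a set of natural numbers, taken in \<open>enat\<close>. It is attained whenever a minimal
  *-reduction exists.\<close>

definition star_spread :: "nat \<Rightarrow> ('a, 'b) ring_scheme \<Rightarrow> 'a set \<Rightarrow> enat"
  where "star_spread p R I = Inf {enat (min_num_gens R K) | K. minimal_star_reduction p R I K}"

end

theory Submission
  imports Defs "HOL-Library.Set_Algebras"
begin

text \<open>Let \<open>q = p^e\<close>, let \<open>H\<close> be a minimal *-reduction of \<open>J\<close> with \<open>n\<close> generators and filter
  \<open>R \<supseteq> J^[q] \<supseteq> H^[q] + (IJ)^[q] \<supseteq> (IJ)^[q]\<close>. The last layer is generated by \<open>n\<close> elements killed
  by \<open>I^[q]\<close>. The middle one is generated by a fixed number of elements, and tight closure provides an
  element \<open>c\<close> outside all minimal primes such that they are killed by \<open>(c) + I^[q]\<close>, an ideal of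
  colength \<open>O(q^(d-1))\<close>. Dividing lengths by \<open>q^d\<close> and passing to the limit gives the inequality.

  That the limits exist is Monsky's theorem. Lengths are computed over the completion, which is module
  finite over a ring of power series \<open>A\<close> over a coefficient field. For a domain, the Frobenius
  endomorphism shows that the colength at \<open>p q\<close> is at most \<open>p^d\<close> times the colength at \<open>q\<close>, up to
  \<open>O(q^(d-1))\<close>, so the normalised colengths converge; a radical ideal reduces to this case by
  splitting off primes and discarding \<open>A\<close>-torsion. Expanding in \<open>A\<close> also bounds colengths below by a
  multiple of \<open>q^d\<close>, so multiplicities are positive; this settles the case of an infinite *-spread,
  which arises by convention if \<open>J\<close> has no minimal *-reduction.

  The algebra takes place in type-class rings modulo ideals. A completion is such a ring together with
  a filtration \<open>M\<close>, its zero ideal being \<open>NN = (\<Inter>n. M n)\<close>.\<close>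

text \<open>The residue field is arbitrary, so a domain need not be finite over its subring of
  \<open>p\<close>-th powers, and comparing it with its module of \<open>p\<close>-th roots is not
  possible. The substitute is an additive map \<open>\<theta>\<close> with
  \<open>\<theta> (g * b) = g ^ p * \<theta> b\<close>, modulo the prime, for \<open>g\<close> in a
  subring \<open>S\<close>: coordinates over a basis of the domain over \<open>S\<close> are raised
  to the power \<open>p\<close>. Colengths are dimensions over a coefficient field inside
  \<open>A\<close>, and \<open>A\<close> modulo the \<open>p\<close>-th powers of its
  \<open>d\<close> parameters has dimension \<open>p ^ d\<close> whatever the residue field is.
  Inseparability over \<open>A\<close> would make the \<open>A\<close>-span of the values of
  \<open>\<theta>\<close> too small. Taking for \<open>S\<close> the subring generated over
  \<open>A\<close> by \<open>p ^ e0\<close>-th powers with \<open>e0\<close> large removes it, which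
  is why the comparison starts at \<open>e0\<close>.

  Quotient rings are avoided in the type-class part: spans, independence, invertibility and
  primality are stated relative to an ideal, so that passing to a further quotient only enlarges
  this ideal.\<close>

definition sring :: "'b::comm_ring_1 set \<Rightarrow> bool" where
  "sring K \<longleftrightarrow> 1 \<in> K \<and> (\<forall>a\<in>K. \<forall>b\<in>K. a - b \<in> K \<and> a * b \<in> K)"

definition smod :: "'b::comm_ring_1 set \<Rightarrow> 'b set \<Rightarrow> bool" where
  "smod K U \<longleftrightarrow> 0 \<in> U \<and> (\<forall>a\<in>U. \<forall>b\<in>U. a + b \<in> U) \<and> (\<forall>k\<in>K. \<forall>a\<in>U. k * a \<in> U)"

text \<open>Ideals are the submodules over the whole ring, so the lemmas on \<open>smod\<close>
  serve for both; \<open>rideal_smod\<close> views an ideal as a submodule over any subring.\<close>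

abbreviation rideal :: "'b::comm_ring_1 set \<Rightarrow> bool" where
  "rideal \<equiv> smod UNIV"

lemma sring_UNIV[simp]: "sring UNIV" by (simp add: sring_def)
lemma sring_0: "sring K \<Longrightarrow> 0 \<in> K" unfolding sring_def by (metis cancel_comm_monoid_add_class.diff_cancel)
lemma sring_1: "sring K \<Longrightarrow> 1 \<in> K" unfolding sring_def by blast
lemma sring_diff: "sring K \<Longrightarrow> a \<in> K \<Longrightarrow> b \<in> K \<Longrightarrow> a - b \<in> K" unfolding sring_def by blast
lemma sring_mult: "sring K \<Longrightarrow> a \<in> K \<Longrightarrow> b \<in> K \<Longrightarrow> a * b \<in> K" unfolding sring_def by blast
lemma sring_uminus: "sring K \<Longrightarrow> a \<in> K \<Longrightarrow> - a \<in> K"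
  using sring_diff[OF _ sring_0, of K a] by simp
lemma sring_add: "sring K \<Longrightarrow> a \<in> K \<Longrightarrow> b \<in> K \<Longrightarrow> a + b \<in> K"
  using sring_diff[of K a "- b"] sring_uminus[of K b] by simp
lemma sring_power: "sring K \<Longrightarrow> a \<in> K \<Longrightarrow> a ^ n \<in> K"
  by (induction n) (auto intro: sring_1 sring_mult)
lemma sring_sum: "sring K \<Longrightarrow> (\<And>i. i \<in> I \<Longrightarrow> f i \<in> K) \<Longrightarrow> sum f I \<in> K"
  by (induction I rule: infinite_finite_induct) (auto intro: sring_0 sring_add)

lemma smod_0: "smod K U \<Longrightarrow> 0 \<in> U" unfolding smod_def by blast
lemma smod_add: "smod K U \<Longrightarrow> a \<in> U \<Longrightarrow> b \<in> U \<Longrightarrow> a + b \<in> U" unfolding smod_def by blast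
lemma smod_scale: "smod K U \<Longrightarrow> k \<in> K \<Longrightarrow> a \<in> U \<Longrightarrow> k * a \<in> U" unfolding smod_def by blast
lemma smod_uminus: "smod K U \<Longrightarrow> sring K \<Longrightarrow> a \<in> U \<Longrightarrow> - a \<in> U"
  using smod_scale[of K U "- 1" a] sring_uminus[of K 1] sring_1[of K] by simp
lemma smod_diff: "smod K U \<Longrightarrow> sring K \<Longrightarrow> a \<in> U \<Longrightarrow> b \<in> U \<Longrightarrow> a - b \<in> U"
  using smod_add[of K U a "- b"] smod_uminus[of K U b] by simp
lemma smod_sum: "smod K U \<Longrightarrow> (\<And>i. i \<in> I \<Longrightarrow> f i \<in> U) \<Longrightarrow> sum f I \<in> U"
  by (induction I rule: infinite_finite_induct) (auto intro: smod_0 smod_add)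
lemma smod_mono: "smod L U \<Longrightarrow> K \<subseteq> L \<Longrightarrow> smod K U" unfolding smod_def by blast
lemma rideal_smod: "rideal U \<Longrightarrow> smod K U" by (erule smod_mono) simp
lemma rideal_uminus: "rideal U \<Longrightarrow> a \<in> U \<Longrightarrow> - a \<in> U" by (rule smod_uminus) auto
lemma rideal_diff: "rideal U \<Longrightarrow> a \<in> U \<Longrightarrow> b \<in> U \<Longrightarrow> a - b \<in> U" by (rule smod_diff) auto
lemma rideal_multl: "rideal U \<Longrightarrow> a \<in> U \<Longrightarrow> k * a \<in> U" by (rule smod_scale) auto
lemma rideal_multr: "rideal U \<Longrightarrow> a \<in> U \<Longrightarrow> a * k \<in> U"
  using rideal_multl[of U a k] by (simp add: mult.commute)
lemma smod_UNIV[simp]: "smod K UNIV" by (simp add: smod_def)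
lemma rideal_1: "rideal U \<Longrightarrow> 1 \<in> U \<Longrightarrow> U = UNIV" using rideal_multl[of U 1] by auto
lemma smod_Int: "smod K U \<Longrightarrow> smod K V \<Longrightarrow> smod K (U \<inter> V)" unfolding smod_def by blast
lemma smod_sring: "sring K \<Longrightarrow> smod K K" unfolding smod_def by (auto intro: sring_0 sring_add sring_mult)
lemma smod_cong: "smod K U \<Longrightarrow> sring K \<Longrightarrow> a - b \<in> U \<Longrightarrow> a \<in> U \<longleftrightarrow> b \<in> U"
  using smod_add[of K U "a - b" b] smod_diff[of K U a "a - b"] by auto

lemma smod_set_plus: "smod K U \<Longrightarrow> smod K V \<Longrightarrow> smod K (U + V)"
proof -
  assume U: "smod K U" and V: "smod K V"
  show ?thesis
    unfolding smod_def
  proof (intro conjI ballI)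
    show "0 \<in> U + V" using set_plus_intro[OF smod_0[OF U] smod_0[OF V]] by simp
  next
    fix a b assume "a \<in> U + V" "b \<in> U + V"
    obtain u v where a: "a = u + v" and uv: "u \<in> U" "v \<in> V"
      by (rule set_plus_elim[OF \<open>a \<in> U + V\<close>])
    obtain u' v' where b: "b = u' + v'" and uv': "u' \<in> U" "v' \<in> V"
      by (rule set_plus_elim[OF \<open>b \<in> U + V\<close>])
    have "a + b = (u + u') + (v + v')" using a b by simp
    then show "a + b \<in> U + V"
      using set_plus_intro[OF smod_add[OF U uv(1) uv'(1)] smod_add[OF V uv(2) uv'(2)]] by simp
  next
    fix k a assume k: "k \<in> K" "a \<in> U + V"
    obtain u v where a: "a = u + v" and uv: "u \<in> U" "v \<in> V"
      by (rule set_plus_elim[OF k(2)])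
    have "k * a = k * u + k * v" using a by (simp add: algebra_simps)
    then show "k * a \<in> U + V"
      using set_plus_intro[OF smod_scale[OF U k(1) uv(1)] smod_scale[OF V k(1) uv(2)]] by simp
  qed
qed

lemma set_plus_absorb: "smod K U \<Longrightarrow> V \<subseteq> U \<Longrightarrow> W \<subseteq> U \<Longrightarrow> V + W \<subseteq> U"
  unfolding set_plus_def by (auto intro: smod_add)

lemma set_plus_upper1: "0 \<in> V \<Longrightarrow> U \<subseteq> U + (V::'b::comm_ring_1 set)"
  by (metis add.right_neutral set_plus_intro subsetI)
text \<open>\<open>cmb K U vs\<close> is \<open>U\<close> plus the \<open>K\<close>-linear combinations of \<open>vs\<close>; with \<open>K = UNIV\<close> it is
  the ideal generated by \<open>U\<close> and \<open>vs\<close>.\<close>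

primrec cmb :: "'b::comm_ring_1 set \<Rightarrow> 'b set \<Rightarrow> 'b list \<Rightarrow> 'b set" where
  "cmb K U [] = U"
| "cmb K U (v # vs) = {k * v + w |k w. k \<in> K \<and> w \<in> cmb K U vs}"

lemma cmb_ConsI: "k \<in> K \<Longrightarrow> w \<in> cmb K U vs \<Longrightarrow> t = k * v + w \<Longrightarrow> t \<in> cmb K U (v # vs)"
  by auto

lemma cmb_ConsE: "t \<in> cmb K U (v # vs) \<Longrightarrow> (\<And>k w. k \<in> K \<Longrightarrow> w \<in> cmb K U vs \<Longrightarrow> t = k * v + w \<Longrightarrow> thesis) \<Longrightarrow> thesis"
  by auto

text \<open>The set \<open>K\<close> of coefficients is kept apart from the acting ring
  \<open>L\<close> because \<open>K\<close> may itself be an ideal: Nakayama's lemma for complete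
  rings takes coefficients in \<open>M k\<close>.\<close>

lemma cmb_smod: "sring L \<Longrightarrow> smod L U \<Longrightarrow> smod L K \<Longrightarrow> smod L (cmb K U vs)"
proof (induction vs)
  case (Cons v vs)
  then have IH: "smod L (cmb K U vs)" by blast
  show ?case
    unfolding smod_def
  proof (intro conjI ballI)
    show "0 \<in> cmb K U (v # vs)"
      by (rule cmb_ConsI[OF smod_0[OF Cons.prems(3)] smod_0[OF IH]]) simp
  next
    fix a b assume "a \<in> cmb K U (v # vs)" "b \<in> cmb K U (v # vs)"
    then obtain k w k' w' where "a = k * v + w" "b = k' * v + w'" "k \<in> K" "k' \<in> K"
      "w \<in> cmb K U vs" "w' \<in> cmb K U vs" by auto
    then show "a + b \<in> cmb K U (v # vs)"
      by (intro cmb_ConsI[of "k + k'" _ "w + w'"] smod_add[OF IH] smod_add[OF Cons.prems(3)])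
        (auto simp: algebra_simps)
  next
    fix l a assume l: "l \<in> L" "a \<in> cmb K U (v # vs)"
    then obtain k w where "a = k * v + w" "k \<in> K" "w \<in> cmb K U vs" by auto
    then show "l * a \<in> cmb K U (v # vs)"
      by (intro cmb_ConsI[of "l * k" _ "l * w"] smod_scale[OF IH l(1)] smod_scale[OF Cons.prems(3) l(1)])
        (auto simp: algebra_simps)
  qed
qed auto

lemma cmb_smod': "sring K \<Longrightarrow> smod K U \<Longrightarrow> smod K (cmb K U vs)"
  by (rule cmb_smod) (auto intro: smod_sring)

lemma cmb_rideal: "rideal U \<Longrightarrow> rideal (cmb UNIV U vs)"
  by (rule cmb_smod) auto

lemma cmb_base: "0 \<in> K \<Longrightarrow> U \<subseteq> cmb K U vs"
proof (induction vs)
  case (Cons v vs)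
  then have "u \<in> cmb K U (v # vs)" if "u \<in> U" for u
    using that Cons by (intro cmb_ConsI[of 0 _ u]) auto
  then show ?case by blast
qed auto

lemma cmb_mem: "v \<in> set vs \<Longrightarrow> sring K \<Longrightarrow> 0 \<in> U \<Longrightarrow> v \<in> cmb K U vs"
proof (induction vs)
  case (Cons w vs)
  show ?case
  proof (cases "v = w")
    case True
    then show ?thesis
      using cmb_base[OF sring_0[OF Cons.prems(2)], of U vs] Cons.prems sring_1[OF Cons.prems(2)]
      by (intro cmb_ConsI[of 1 _ 0]) auto
  next
    case False
    then show ?thesis
      using Cons sring_0[OF Cons.prems(2)] by (intro cmb_ConsI[of 0 _ v]) auto
  qed
qed auto

lemma cmb_least: "smod K W \<Longrightarrow> U \<subseteq> W \<Longrightarrow> set vs \<subseteq> W \<Longrightarrow> cmb K U vs \<subseteq> W"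
  by (induction vs) (auto intro!: smod_add smod_scale)

lemma cmb_le: "sring L \<Longrightarrow> smod L U' \<Longrightarrow> K \<subseteq> L \<Longrightarrow> U \<subseteq> cmb L U' ws \<Longrightarrow> set vs \<subseteq> cmb L U' ws
    \<Longrightarrow> cmb K U vs \<subseteq> cmb L U' ws"
  by (rule cmb_least) (auto intro: smod_mono cmb_smod')

lemma cmb_mono: "K \<subseteq> L \<Longrightarrow> U \<subseteq> U' \<Longrightarrow> cmb K U vs \<subseteq> cmb L U' vs"
  by (induction vs) auto

lemma cmb_append: "cmb K U (vs @ ws) = cmb K (cmb K U ws) vs"
  by (induction vs) auto

lemma cmb_singleton_mem: "k \<in> K \<Longrightarrow> u \<in> U \<Longrightarrow> k * v + u \<in> cmb K U [v]"
  by auto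

text \<open>Coordinates become a function of the index. In this form they can be selected by a
  choice principle and passed to a limit one by one.\<close>

lemma cmb_iff: "t \<in> cmb K U vs \<longleftrightarrow>
    (\<exists>c. (\<forall>i<length vs. c i \<in> K) \<and> t - (\<Sum>i<length vs. c i * vs ! i) \<in> U)"
proof (induction vs arbitrary: t)
  case (Cons v vs)
  show ?case
  proof
    assume "t \<in> cmb K U (v # vs)"
    then obtain k w where kw: "t = k * v + w" "k \<in> K" "w \<in> cmb K U vs" by auto
    then obtain c where c: "\<forall>i<length vs. c i \<in> K" "w - (\<Sum>i<length vs. c i * vs ! i) \<in> U"
      using Cons by blast
    show "\<exists>c. (\<forall>i<length (v # vs). c i \<in> K) \<and> t - (\<Sum>i<length (v # vs). c i * (v # vs) ! i) \<in> U"
      using c kw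
      by (intro exI[of _ "\<lambda>i. case i of 0 \<Rightarrow> k | Suc j \<Rightarrow> c j"])
        (auto simp: sum.lessThan_Suc_shift algebra_simps split: nat.splits simp del: sum.lessThan_Suc)
  next
    assume "\<exists>c. (\<forall>i<length (v # vs). c i \<in> K) \<and> t - (\<Sum>i<length (v # vs). c i * (v # vs) ! i) \<in> U"
    then obtain c where c: "\<forall>i<length (v # vs). c i \<in> K"
      "t - (\<Sum>i<length (v # vs). c i * (v # vs) ! i) \<in> U" by blast
    have "t - c 0 * v - (\<Sum>i<length vs. c (Suc i) * vs ! i) \<in> U"
      using c(2) by (simp add: sum.lessThan_Suc_shift algebra_simps del: sum.lessThan_Suc)
    then have "t - c 0 * v \<in> cmb K U vs"
      unfolding Cons using c(1) by (intro exI[of _ "\<lambda>i. c (Suc i)"]) auto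
    then show "t \<in> cmb K U (v # vs)"
      using c(1) by (intro cmb_ConsI[of "c 0" _ "t - c 0 * v"]) auto
  qed
qed auto

lemma cmb_sub_mono:
  assumes "sring L" "smod L U'" "K \<subseteq> L" "U \<subseteq> U'" "set vs \<subseteq> set ws \<union> U'"
  shows "cmb K U vs \<subseteq> cmb L U' ws"
proof (rule cmb_le[OF assms(1-3)])
  show *: "U \<subseteq> cmb L U' ws" "set vs \<subseteq> cmb L U' ws"
    using cmb_base[OF sring_0[OF assms(1)], of U' ws] cmb_mem[OF _ assms(1) smod_0[OF assms(2)], of _ ws] assms(4,5)
    by blast+
qed

text \<open>A generator can be absorbed into the base. Inductions on lists of generators use this to
  enlarge \<open>U\<close> while the list shrinks.\<close>

lemma cmb_swap: "sring K \<Longrightarrow> smod K U \<Longrightarrow> cmb K U (v # vs) = cmb K (cmb K U [v]) vs"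
  unfolding cmb_append[symmetric] by (intro equalityI cmb_sub_mono) auto

lemma cmb_times: "smod K U \<Longrightarrow> t \<in> cmb K U vs \<Longrightarrow> (\<And>u. u \<in> U \<Longrightarrow> c * u \<in> U')
    \<Longrightarrow> c * t \<in> cmb K U' (map ((*) c) vs)"
proof (induction vs arbitrary: t)
  case (Cons v vs)
  then obtain k w where kw: "t = k * v + w" "k \<in> K" "w \<in> cmb K U vs" by auto
  then have "c * w \<in> cmb K U' (map ((*) c) vs)" using Cons by blast
  then show ?case using kw
    by (simp only: list.map, intro cmb_ConsI[of k _ "c * w"]) (auto simp: algebra_simps)
qed auto

subsection \<open>Codimension\<close>

definition fmod :: "'b::comm_ring_1 set \<Rightarrow> 'b set \<Rightarrow> bool" where
  "fmod K P \<longleftrightarrow> sring K \<and> rideal P \<and> (\<forall>k\<in>K - P. \<exists>l\<in>K. k * l - 1 \<in> P)"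

lemma fmod_sring: "fmod K P \<Longrightarrow> sring K" and fmod_rideal: "fmod K P \<Longrightarrow> rideal P"
  unfolding fmod_def by auto

lemma fmod_mono: "fmod K P \<Longrightarrow> P \<subseteq> Q \<Longrightarrow> rideal Q \<Longrightarrow> fmod K Q"
  unfolding fmod_def by blast

lemma fmod_cancel:
  assumes "fmod K P" "smod K W" "P \<subseteq> W" "k \<in> K" "k * v \<in> W" "v \<notin> W"
  shows "k \<in> P"
proof (rule ccontr)
  assume "k \<notin> P"
  then obtain l where l: "l \<in> K" "k * l - 1 \<in> P" using assms unfolding fmod_def by blast
  have "l * (k * v) \<in> W" using assms(2,5) l smod_scale by blast
  moreover have "l * (k * v) - v \<in> W"
    using rideal_multl[OF fmod_rideal[OF assms(1)] l(2), of v] assms(3)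
    by (auto simp: algebra_simps)
  ultimately have "l * (k * v) - (l * (k * v) - v) \<in> W"
    using smod_diff[OF assms(2) fmod_sring[OF assms(1)]] by blast
  then show False using assms by simp
qed

text \<open>Steinitz exchange sorted along \<open>W\<close>: each generator is either used up for
  \<open>W\<close> over \<open>U\<close> or survives modulo \<open>W\<close>. The lengths add up
  exactly, which gives the nontrivial inequality in the additivity of codimension.\<close>

lemma cmb_exchange:
  assumes F: "fmod K P"
  shows "smod K U \<Longrightarrow> smod K W \<Longrightarrow> P \<subseteq> U \<Longrightarrow> U \<subseteq> W \<Longrightarrow> W \<subseteq> cmb K U vs \<Longrightarrow>
   \<exists>ws zs. cmb K U vs \<subseteq> cmb K W ws \<and> set zs \<subseteq> W \<and> W \<subseteq> cmb K U zs \<and> length ws + length zs = length vs"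
proof (induction vs arbitrary: U W)
  case Nil
  then show ?case by (intro exI[of _ "[]"]) auto
next
  case (Cons v vs)
  note K = fmod_sring[OF F]
  define U' where "U' = cmb K U [v]"
  define W' where "W' = cmb K W [v]"
  have eq: "cmb K U (v # vs) = cmb K U' vs" unfolding U'_def by (rule cmb_swap[OF K Cons.prems(1)])
  have sU': "smod K U'" and sW': "smod K W'" unfolding U'_def W'_def using Cons.prems K
    by (auto intro: cmb_smod' simp del: cmb.simps)
  have UU': "U \<subseteq> U'" and WW': "W \<subseteq> W'" unfolding U'_def W'_def by (auto intro!: cmb_base sring_0 K simp del: cmb.simps)
  have U'W': "U' \<subseteq> W'" unfolding U'_def W'_def using Cons.prems by (intro cmb_mono) auto
  have v: "v \<in> cmb K U (v # vs)" by (rule cmb_mem) (use K smod_0 Cons.prems in auto)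
  have "W' \<subseteq> cmb K U' vs" unfolding W'_def
    using Cons.prems v unfolding eq[symmetric] by (intro cmb_least cmb_smod' K) auto
  with Cons.IH[OF sU' sW' _ U'W'] UU' Cons.prems(3) obtain ws zs where
    IH: "cmb K U' vs \<subseteq> cmb K W' ws" "set zs \<subseteq> W'" "W' \<subseteq> cmb K U' zs" "length ws + length zs = length vs"
    by blast
  show ?case
  proof (cases "v \<in> W")
    case True
    then have "W' \<subseteq> W" unfolding W'_def using Cons.prems by (intro cmb_least) auto
    then have W: "W' = W" using WW' by blast
    have "cmb K U (v # zs) = cmb K U' zs" unfolding U'_def by (rule cmb_swap[OF K Cons.prems(1)])
    then show ?thesis using IH W eq True
      by (intro exI[of _ ws] exI[of _ "v # zs"]) auto
  next
    case False
    \<comment> \<open>The generators found for \<open>W'\<close> involve \<open>v\<close>;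
      subtracting multiples of \<open>v\<close> moves them into \<open>W\<close>. As
      \<open>v\<close> is not in \<open>W\<close>, its coefficient in an element of \<open>W\<close>
      must be zero modulo \<open>P\<close>, so nothing is lost.\<close>
    have "\<forall>z\<in>set zs. \<exists>k\<in>K. \<exists>z'\<in>W. z = k * v + z'"
      using IH(2) unfolding W'_def by fastforce
    then obtain kf zf where kz: "\<And>z. z \<in> set zs \<Longrightarrow> kf z \<in> K \<and> zf z \<in> W \<and> z = kf z * v + zf z" by metis
    define zs' where "zs' = map zf zs"
    have zs': "set zs' \<subseteq> W" unfolding zs'_def using kz by auto
    have sub: "cmb K U' zs \<subseteq> cmb K U (v # zs')"
    proof (rule cmb_le[OF K Cons.prems(1) order.refl])
      show "U' \<subseteq> cmb K U (v # zs')" unfolding U'_def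
        using K Cons.prems(1) smod_0[OF Cons.prems(1)]
        by (intro cmb_sub_mono) auto
      show "set zs \<subseteq> cmb K U (v # zs')"
      proof
        fix z assume z: "z \<in> set zs"
        then have "zf z \<in> cmb K U zs'" unfolding zs'_def
          by (intro cmb_mem K smod_0[OF Cons.prems(1)]) auto
        then show "z \<in> cmb K U (v # zs')" using kz[OF z] by auto
      qed
    qed
    have "W \<subseteq> cmb K U zs'"
    proof
      fix w assume w: "w \<in> W"
      then have "w \<in> cmb K U (v # zs')" using WW' IH(3) sub by blast
      then obtain k z where kz: "w = k * v + z" "k \<in> K" "z \<in> cmb K U zs'" by auto
      have "z \<in> W" using kz(3) cmb_least[OF Cons.prems(2,4) zs'] by blast
      then have "k * v \<in> W" using w kz(1) smod_diff[OF Cons.prems(2) K w, of z] by simp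
      then have "k \<in> P" using fmod_cancel[OF F Cons.prems(2) _ kz(2) _ False] Cons.prems by blast
      then have "k * v \<in> U" using rideal_multr[OF fmod_rideal[OF F]] Cons.prems(3) by blast
      then have "k * v \<in> cmb K U zs'" using cmb_base[OF sring_0[OF K]] by blast
      then show "w \<in> cmb K U zs'" using kz smod_add[OF cmb_smod'[OF K Cons.prems(1)]] by blast
    qed
    moreover have "cmb K U (v # vs) \<subseteq> cmb K W (v # ws)"
      unfolding eq using IH(1) cmb_swap[OF K Cons.prems(2), of v ws] unfolding W'_def by blast
    ultimately show ?thesis using zs' IH(4)
      by (intro exI[of _ "v # ws"] exI[of _ zs']) (auto simp: zs'_def)
  qed
qed

definition dimle :: "'b::comm_ring_1 set \<Rightarrow> 'b set \<Rightarrow> 'b set \<Rightarrow> nat \<Rightarrow> bool" where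
  "dimle K V U n \<longleftrightarrow> (\<exists>vs. length vs \<le> n \<and> V \<subseteq> cmb K U vs)"

text \<open>A least number of generators, which may lie outside \<open>V\<close>. Without some bound
  \<open>dimle\<close> its value is meaningless; hence the finiteness statements that accompany it
  throughout.\<close>

definition cod :: "'b::comm_ring_1 set \<Rightarrow> 'b set \<Rightarrow> 'b set \<Rightarrow> nat" where
  "cod K V U = (LEAST n. dimle K V U n)"

lemma dimle_mono: "dimle K V U m \<Longrightarrow> m \<le> n \<Longrightarrow> dimle K V U n"
  unfolding dimle_def by (meson le_trans)

lemma dimle_subset: "dimle K V U m \<Longrightarrow> V' \<subseteq> V \<Longrightarrow> U \<subseteq> U' \<Longrightarrow> dimle K V' U' m"
  unfolding dimle_def using cmb_mono[of K K U U'] by (meson order.refl order.trans)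

lemma dimle_refl: "V \<subseteq> U \<Longrightarrow> dimle K V U 0"
  unfolding dimle_def by auto

lemma dimle_trans: "dimle K V W m \<Longrightarrow> dimle K W U n \<Longrightarrow> dimle K V U (m + n)"
  unfolding dimle_def
proof (elim exE conjE)
  fix vs ws assume *: "length vs \<le> m" "V \<subseteq> cmb K W vs" "length ws \<le> n" "W \<subseteq> cmb K U ws"
  show "\<exists>vs. length vs \<le> m + n \<and> V \<subseteq> cmb K U vs"
    using * cmb_mono[of K K W "cmb K U ws" vs] by (intro exI[of _ "vs @ ws"]) (auto simp: cmb_append)
qed

lemma dimle_split:
  assumes "fmod K P" "smod K U" "smod K W" "smod K V" "P \<subseteq> U" "U \<subseteq> W" "W \<subseteq> V" "dimle K V U n"
  shows "\<exists>m k. dimle K V W m \<and> dimle K W U k \<and> m + k = n"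
proof -
  obtain vs where vs: "length vs \<le> n" "V \<subseteq> cmb K U vs" using assms unfolding dimle_def by blast
  from cmb_exchange[OF assms(1-3,5,6), of vs] vs assms(7) obtain ws zs where
    "cmb K U vs \<subseteq> cmb K W ws" "W \<subseteq> cmb K U zs" "length ws + length zs = length vs" by blast
  \<comment> \<open>The slack \<open>n - length vs\<close> is put into the first bound so that the
    two bounds sum to exactly \<open>n\<close>.\<close>
  then have "dimle K V W (length ws + (n - length vs))" "dimle K W U (length zs)"
    using vs unfolding dimle_def by (meson le_add1 order.trans, blast)
  then show ?thesis using vs \<open>length ws + length zs = length vs\<close>
    by (intro exI[of _ "length ws + (n - length vs)"] exI[of _ "length zs"]) auto
qed

lemma dimle_0: "dimle K V U 0 \<longleftrightarrow> V \<subseteq> U" unfolding dimle_def by auto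

lemma cod_le: "dimle K V U n \<Longrightarrow> cod K V U \<le> n"
  unfolding cod_def by (rule Least_le)

lemma dimle_cod: "dimle K V U n \<Longrightarrow> dimle K V U (cod K V U)"
  unfolding cod_def by (rule LeastI)

lemma cod_add:
  assumes "fmod K P" "smod K U" "smod K W" "smod K V" "P \<subseteq> U" "U \<subseteq> W" "W \<subseteq> V" "dimle K V U n"
  shows "cod K V U = cod K V W + cod K W U"
proof (rule antisym)
  obtain m k where mk: "dimle K V W m" "dimle K W U k" "m + k = cod K V U"
    using dimle_split[OF assms(1-7) dimle_cod[OF assms(8)]] by blast
  then show "cod K V W + cod K W U \<le> cod K V U"
    using cod_le[OF mk(1)] cod_le[OF mk(2)] by linarith
  show "cod K V U \<le> cod K V W + cod K W U"
    by (rule cod_le[OF dimle_trans[OF dimle_cod[OF mk(1)] dimle_cod[OF mk(2)]]])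
qed

subsection \<open>Linear dependence over a subring\<close>

text \<open>Only the image of \<open>A\<close> in the quotient by \<open>P\<close> is a domain; the
  whole quotient may have zero divisors, as for a ring with several components that is finite over
  power series.\<close>

definition pdom :: "'b::comm_ring_1 set \<Rightarrow> 'b set \<Rightarrow> bool" where
  "pdom A P \<longleftrightarrow> sring A \<and> rideal P \<and> 1 \<notin> P \<and> (\<forall>a\<in>A. \<forall>b\<in>A. a * b \<in> P \<longrightarrow> a \<in> P \<or> b \<in> P)"

lemma pdom_sring: "pdom A P \<Longrightarrow> sring A" and pdom_rideal: "pdom A P \<Longrightarrow> rideal P"
  and pdom_1: "pdom A P \<Longrightarrow> 1 \<notin> P"
  and pdom_mult: "pdom A P \<Longrightarrow> a \<in> A - P \<Longrightarrow> b \<in> A - P \<Longrightarrow> a * b \<in> A - P"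
  unfolding pdom_def sring_def by blast+

lemma pdom_1_mem: "pdom A P \<Longrightarrow> 1 \<in> A - P"
  using pdom_sring pdom_1 sring_1 by blast

lemma pdom_power: "pdom A P \<Longrightarrow> a \<in> A - P \<Longrightarrow> a ^ n \<in> A - P"
  by (induction n) (simp_all only: power_0 power_Suc pdom_1_mem pdom_mult not_False_eq_True)

text \<open>Gaussian elimination without division: a pivot clears the last column, and the induction
  treats the remaining rows with one column less.\<close>

lemma matrix_relation:
  assumes A: "pdom A P"
  shows "finite I \<Longrightarrow> n < card I \<Longrightarrow> (\<And>i j. i \<in> I \<Longrightarrow> j < n \<Longrightarrow> M i j \<in> A) \<Longrightarrow>
    \<exists>d. (\<forall>i\<in>I. d i \<in> A) \<and> (\<exists>i\<in>I. d i \<notin> P) \<and> (\<forall>j<n. (\<Sum>i\<in>I. d i * M i j) \<in> P)"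
proof (induction n arbitrary: I M)
  case 0
  then obtain i where "i \<in> I" by fastforce
  then show ?case using pdom_1_mem[OF A] by (intro exI[of _ "\<lambda>_. 1"]) auto
next
  case (Suc n)
  note S = pdom_sring[OF A] and P = pdom_rideal[OF A]
  show ?case
  proof (cases "\<forall>i\<in>I. M i n \<in> P")
    case True
    obtain d where d: "\<forall>i\<in>I. d i \<in> A" "\<exists>i\<in>I. d i \<notin> P" "\<forall>j<n. (\<Sum>i\<in>I. d i * M i j) \<in> P"
      using Suc.IH[of I M] Suc.prems by auto
    have "(\<Sum>i\<in>I. d i * M i n) \<in> P"
      using True by (intro smod_sum[OF P] rideal_multl[OF P]) auto
    then show ?thesis using d by (intro exI[of _ d]) (auto simp: less_Suc_eq)
  next
    case False
    then obtain i0 where i0: "i0 \<in> I" "M i0 n \<notin> P" by blast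
    define \<alpha> where "\<alpha> = M i0 n"
    define I' where "I' = I - {i0}"
    have \<alpha>: "\<alpha> \<in> A - P" unfolding \<alpha>_def using i0 Suc.prems by auto
    have I': "finite I'" "n < card I'" unfolding I'_def using Suc.prems i0 by auto
    define M' where "M' = (\<lambda>i j. \<alpha> * M i j - M i n * M i0 j)"
    have "M' i j \<in> A" if "i \<in> I'" "j < n" for i j
      unfolding M'_def using that \<alpha> i0 Suc.prems unfolding I'_def
      by (auto intro!: sring_diff[OF S] sring_mult[OF S])
    then obtain d where d: "\<forall>i\<in>I'. d i \<in> A" "\<exists>i\<in>I'. d i \<notin> P" "\<forall>j<n. (\<Sum>i\<in>I'. d i * M' i j) \<in> P"
      using Suc.IH[OF I'] by blast
    \<comment> \<open>The coefficient of the pivot row makes the last column cancel; the other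
      coefficients acquire the factor \<open>\<alpha>\<close>, which keeps a nonzero one outside
      \<open>P\<close>.\<close>
    define d' where "d' = (\<lambda>i. if i = i0 then - (\<Sum>i\<in>I'. d i * M i n) else \<alpha> * d i)"
    have 1: "\<forall>i\<in>I. d' i \<in> A"
      unfolding d'_def using \<alpha> d Suc.prems unfolding I'_def
      by (auto intro!: sring_uminus[OF S] sring_mult[OF S] sring_sum[OF S])
    obtain i1 where "i1 \<in> I'" "d i1 \<notin> P" using d by blast
    then have 2: "\<exists>i\<in>I. d' i \<notin> P"
      using pdom_mult[OF A \<alpha>, of "d i1"] d(1) unfolding d'_def I'_def by auto
    have eq: "(\<Sum>i\<in>I. d' i * M i j) = (\<Sum>i\<in>I'. d i * M' i j)" for j
    proof -
      have "(\<Sum>i\<in>I. d' i * M i j) = d' i0 * M i0 j + (\<Sum>i\<in>I'. d' i * M i j)"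
        unfolding I'_def using Suc.prems(1) i0(1) by (rule sum.remove)
      also have "(\<Sum>i\<in>I'. d' i * M i j) = (\<Sum>i\<in>I'. \<alpha> * d i * M i j)"
        by (rule sum.cong) (auto simp: d'_def I'_def)
      also have "d' i0 * M i0 j = (\<Sum>i\<in>I'. - (d i * M i n * M i0 j))"
        by (simp add: d'_def sum_distrib_right sum_negf)
      finally show ?thesis unfolding M'_def sum.distrib[symmetric]
        by (simp add: algebra_simps)
    qed
    have "(\<Sum>i\<in>I'. d i * M' i n) = 0" unfolding M'_def \<alpha>_def by (simp add: algebra_simps)
    then have "\<forall>j<Suc n. (\<Sum>i\<in>I. d' i * M i j) \<in> P"
      unfolding eq using d(3) smod_0[OF P] by (auto simp: less_Suc_eq)
    then show ?thesis using 1 2 by blast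
  qed
qed

definition lindep :: "'b::comm_ring_1 set \<Rightarrow> 'b set \<Rightarrow> 'b list \<Rightarrow> bool" where
  "lindep A P ts \<longleftrightarrow> (\<forall>c. (\<forall>i<length ts. c i \<in> A) \<longrightarrow> (\<Sum>i<length ts. c i * ts ! i) \<in> P \<longrightarrow>
     (\<forall>i<length ts. c i \<in> P))"

lemma lindepD: "lindep A P ts \<Longrightarrow> (\<And>i. i < length ts \<Longrightarrow> c i \<in> A) \<Longrightarrow>
    (\<Sum>i<length ts. c i * ts ! i) \<in> P \<Longrightarrow> i < length ts \<Longrightarrow> c i \<in> P"
  unfolding lindep_def by blast

lemma lindep_Nil[simp]: "lindep A P []" by (simp add: lindep_def)

lemma lindep_subring: "lindep S P ts \<Longrightarrow> A \<subseteq> S \<Longrightarrow> lindep A P ts"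
  unfolding lindep_def by blast

lemma dep_of_gens:
  assumes A: "pdom A P" and ts: "set ts \<subseteq> cmb A P us" and len: "length us < length ts"
  shows "\<not> lindep A P ts"
proof
  assume L: "lindep A P ts"
  note P = pdom_rideal[OF A]
  have "\<forall>i<length ts. \<exists>c. (\<forall>j<length us. c j \<in> A) \<and> ts ! i - (\<Sum>j<length us. c j * us ! j) \<in> P"
    using ts unfolding cmb_iff[symmetric] by (meson nth_mem subsetD)
  then obtain M where M: "\<And>i j. i < length ts \<Longrightarrow> j < length us \<Longrightarrow> M i j \<in> A"
    "\<And>i. i < length ts \<Longrightarrow> ts ! i - (\<Sum>j<length us. M i j * us ! j) \<in> P" by metis
  obtain d where d: "\<forall>i\<in>{..<length ts}. d i \<in> A" "\<exists>i\<in>{..<length ts}. d i \<notin> P"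
    "\<forall>j<length us. (\<Sum>i<length ts. d i * M i j) \<in> P"
    using matrix_relation[OF A, of "{..<length ts}" "length us" M] len M(1) by auto
  have "(\<Sum>i<length ts. d i * ts ! i) =
      (\<Sum>i<length ts. d i * (ts ! i - (\<Sum>j<length us. M i j * us ! j))) +
      (\<Sum>i<length ts. \<Sum>j<length us. d i * M i j * us ! j)"
    by (simp add: sum.distrib[symmetric] algebra_simps sum_distrib_left)
  also have "(\<Sum>i<length ts. \<Sum>j<length us. d i * M i j * us ! j) =
      (\<Sum>j<length us. (\<Sum>i<length ts. d i * M i j) * us ! j)"
    by (subst sum.swap) (simp add: sum_distrib_right)
  finally have "(\<Sum>i<length ts. d i * ts ! i) \<in> P"
    using M(2) d(3)
    by (metis (no_types, lifting) smod_add[OF P] smod_sum[OF P] rideal_multl[OF P] rideal_multr[OF P] lessThan_iff)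
  then show False using lindepD[OF L, of d] d by auto
qed

lemma lindep_Cons_dep:
  assumes A: "pdom A P" and L: "lindep A P ts" and nL: "\<not> lindep A P (t # ts)"
  shows "\<exists>d\<in>A - P. d * t \<in> cmb A P ts"
proof -
  note P = pdom_rideal[OF A]
  obtain c where c: "\<forall>i<length (t # ts). c i \<in> A" "(\<Sum>i<length (t # ts). c i * (t # ts) ! i) \<in> P"
    "\<exists>i<length (t # ts). c i \<notin> P" using nL unfolding lindep_def by blast
  have s: "c 0 * t + (\<Sum>i<length ts. c (Suc i) * ts ! i) \<in> P"
    using c(2) by (simp add: sum.lessThan_Suc_shift del: sum.lessThan_Suc)
  have "c 0 \<notin> P"
  proof
    assume "c 0 \<in> P"
    then have "(\<Sum>i<length ts. c (Suc i) * ts ! i) \<in> P"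
      using rideal_diff[OF P s rideal_multr[OF P], of "c 0" t] by simp
    then have "c (Suc i) \<in> P" if "i < length ts" for i
      using lindepD[OF L, of "\<lambda>i. c (Suc i)" i] c(1) that by auto
    then show False using c(3) \<open>c 0 \<in> P\<close> by (metis Suc_less_eq length_Cons not0_implies_Suc)
  qed
  moreover have "c 0 * t \<in> cmb A P ts"
    unfolding cmb_iff using c(1) s sring_uminus[OF pdom_sring[OF A]]
    by (intro exI[of _ "\<lambda>i. - c (Suc i)"]) (auto simp: sum_negf)
  ultimately show ?thesis using c(1) by (intro bexI[of _ "c 0"]) auto
qed

lemma lindep_scale:
  assumes A: "pdom A P" and a: "a \<in> A - P" and L: "lindep A P ts"
  shows "lindep A P (map ((*) a) ts)"
  unfolding lindep_def
proof (intro allI impI)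
  fix c i assume c: "\<forall>i<length (map ((*) a) ts). c i \<in> A"
    "(\<Sum>i<length (map ((*) a) ts). c i * map ((*) a) ts ! i) \<in> P" "i < length (map ((*) a) ts)"
  have "(\<Sum>i<length ts. (a * c i) * ts ! i) \<in> P"
    using c(2) by (simp add: algebra_simps)
  then have "a * c i \<in> P"
    using lindepD[OF L, of "\<lambda>i. a * c i" i] c a sring_mult[OF pdom_sring[OF A]] by auto
  then show "c i \<in> P" using pdom_mult[OF A a, of "c i"] c by auto
qed

lemma ex_max_list:
  assumes "Q []" "\<And>ts. Q ts \<Longrightarrow> length ts \<le> n"
  shows "\<exists>ts. Q ts \<and> (\<forall>t. \<not> Q (t # ts))"
proof -
  obtain m where m: "\<exists>ts. Q ts \<and> length ts = m" "\<forall>k. (\<exists>ts. Q ts \<and> length ts = k) \<longrightarrow> k \<le> m"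
    using Nat.ex_has_greatest_nat[where P = "\<lambda>k. \<exists>ts. Q ts \<and> length ts = k" and k = 0 and b = n] assms by auto
  then show ?thesis by fastforce
qed

lemma common_multiple:
  assumes A: "pdom A P" and W: "smod A W"
  shows "(\<forall>u\<in>set us. \<exists>d\<in>A - P. d * f u \<in> W) \<Longrightarrow> \<exists>a\<in>A - P. \<forall>u\<in>set us. a * f u \<in> W"
proof (induction us)
  case Nil
  then show ?case using pdom_1_mem[OF A] by auto
next
  case (Cons u us)
  then obtain a d where "a \<in> A - P" "\<forall>u\<in>set us. a * f u \<in> W" "d \<in> A - P" "d * f u \<in> W" by auto
  then have "d * a * f v \<in> W" if "v \<in> set (u # us)" for v
    using smod_scale[OF W, of a "d * f u"] smod_scale[OF W, of d "a * f v"] that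
    by (auto simp: ac_simps)
  then show ?case using pdom_mult[OF A \<open>d \<in> A - P\<close> \<open>a \<in> A - P\<close>] by blast
qed

subsection \<open>Frobenius and boxes of monomials\<close>

lemma power_cong_ideal:
  assumes P: "rideal P" and "a - b \<in> P" shows "a ^ n - b ^ n \<in> P"
proof (induction n)
  case (Suc n)
  have "a ^ Suc n - b ^ Suc n = a * (a ^ n - b ^ n) + (a - b) * b ^ n" by (simp add: algebra_simps)
  then show ?case using smod_add[OF P rideal_multl[OF P Suc] rideal_multr[OF P assms(2)]] by simp
qed (use smod_0[OF P] in simp)

lemma frob_add:
  fixes a b :: "'b::comm_ring_1"
  assumes P: "rideal P" and p: "Factorial_Ring.prime p" "of_nat p \<in> P"
  shows "(a + b) ^ (p ^ e) - (a ^ (p ^ e) + b ^ (p ^ e)) \<in> P"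
proof (induction e)
  case (Suc e)
  have *: "(a + b) ^ p - (a ^ p + b ^ p) \<in> P" for a b
  proof -
    have p0: "p > 0" using p(1) prime_gt_0_nat by blast
    have "(a + b) ^ p = (\<Sum>k\<le>p. of_nat (p choose k) * a ^ k * b ^ (p - k))"
      by (rule binomial_ring)
    also have "{..p} = insert 0 (insert p {0<..<p})" using p0 by auto
    also have "(\<Sum>k\<in>\<dots>. of_nat (p choose k) * a ^ k * b ^ (p - k)) =
       b ^ p + (a ^ p + (\<Sum>k\<in>{0<..<p}. of_nat (p choose k) * a ^ k * b ^ (p - k)))"
      using p0 by simp
    finally have "(a + b) ^ p - (a ^ p + b ^ p) = (\<Sum>k\<in>{0<..<p}. of_nat (p choose k) * a ^ k * b ^ (p - k))"
      by simp
    moreover have "of_nat (p choose k) * a ^ k * b ^ (p - k) \<in> P" if "k \<in> {0<..<p}" for k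
    proof -
      have "p dvd (p choose k)" using that p(1) by (intro dvd_choose_prime) auto
      then obtain m where "p choose k = p * m" by blast
      then show ?thesis using p(2) by (auto intro!: rideal_multr[OF P])
    qed
    ultimately show ?thesis by (auto intro!: smod_sum[OF P])
  qed
  let ?q = "p ^ e"
  have "((a + b) ^ ?q) ^ p - (a ^ ?q + b ^ ?q) ^ p \<in> P"
    by (rule power_cong_ideal[OF P Suc])
  from smod_add[OF P this *[of "a ^ ?q" "b ^ ?q"]]
  have "((a + b) ^ ?q) ^ p - ((a ^ ?q) ^ p + (b ^ ?q) ^ p) \<in> P" by (simp add: algebra_simps)
  then show ?case by (simp add: power_mult[symmetric] mult.commute)
qed (use smod_0[OF P] in simp)

text \<open>Frobenius is additive modulo \<open>P\<close>, and the coefficients are replaced by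
  their own powers, which stay in the subring. So a Frobenius power of a relation over
  \<open>A\<close> is again a relation over \<open>A\<close>.\<close>

lemma frob_cmb:
  assumes P: "rideal P" and p: "Factorial_Ring.prime p" "of_nat p \<in> P" and S: "sring S"
  shows "t \<in> cmb S P ts \<Longrightarrow> t ^ (p ^ e) \<in> cmb S P (map (\<lambda>t. t ^ (p ^ e)) ts)"
proof (induction ts arbitrary: t)
  case Nil
  then show ?case using power_cong_ideal[OF P, of t 0 "p ^ e"] p(1) by (auto simp: power_0_left prime_gt_0_nat)
next
  case (Cons u ts)
  let ?q = "p ^ e"
  let ?C = "cmb S P (map (\<lambda>t. t ^ ?q) (u # ts))"
  obtain k w where kw: "k \<in> S" "w \<in> cmb S P ts" "t = k * u + w" using cmb_ConsE[OF Cons.prems] .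
  have C: "smod S ?C" by (rule cmb_smod'[OF S rideal_smod[OF P]])
  have "k ^ ?q * u ^ ?q + w ^ ?q \<in> ?C"
    using Cons.IH[OF kw(2)] sring_power[OF S kw(1)] by (simp only: list.map, intro cmb_ConsI[OF _ _ refl]) auto
  moreover have "t ^ ?q - (k ^ ?q * u ^ ?q + w ^ ?q) \<in> ?C"
    using frob_add[OF P p, of "k * u" w e] kw(3) subsetD[OF cmb_base[OF sring_0[OF S]]]
    by (auto simp: power_mult_distrib simp del: cmb.simps)
  ultimately show ?case using smod_cong[OF C S] by blast
qed

text \<open>In the filtration by the multiples of \<open>1, y, ..., y ^ n\<close>, each layer is an
  image of \<open>A\<close> modulo \<open>Y\<close> and \<open>y\<close>, hence spanned by a power
  of \<open>y\<close> times \<open>ms\<close>.\<close>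

lemma box1:
  assumes A: "sring A" and K: "sring K" "K \<subseteq> A" and Y: "smod A Y" and y: "y \<in> A"
    and gen: "A \<subseteq> cmb K (cmb A Y [y]) ms"
  shows "\<exists>ns. length ns = n * length ms \<and> A \<subseteq> cmb K (cmb A Y [y ^ n]) ns"
proof (induction n)
  case 0
  have "A \<subseteq> cmb A Y [1]" using smod_0[OF Y] by force
  then show ?case by (intro exI[of _ "[]"]) simp
next
  case (Suc n)
  then obtain ns where ns: "length ns = n * length ms" "A \<subseteq> cmb K (cmb A Y [y ^ n]) ns" by blast
  define ms' where "ms' = map ((*) (y ^ n)) ms"
  let ?Z = "cmb K (cmb A Y [y ^ Suc n]) ms'"
  have sub: "cmb A Y [y ^ n] \<subseteq> ?Z"
  proof
    fix t assume "t \<in> cmb A Y [y ^ n]"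
    then obtain a w where a: "a \<in> A" "w \<in> Y" "t = a * y ^ n + w" by auto
    have "y ^ n * a \<in> ?Z" unfolding ms'_def
    proof (rule cmb_times)
      show "smod K (cmb A Y [y])" using smod_mono[OF cmb_smod'[OF A Y] K(2)] .
      show "a \<in> cmb K (cmb A Y [y]) ms" using gen a by blast
    next
      fix u assume "u \<in> cmb A Y [y]"
      then obtain b v where b: "b \<in> A" "v \<in> Y" "u = b * y + v" by auto
      have "y ^ n * v \<in> Y" by (rule smod_scale[OF Y sring_power[OF A y] b(2)])
      then show "y ^ n * u \<in> cmb A Y [y ^ Suc n]"
        using b by (intro cmb_ConsI[of b _ "y ^ n * v"]) (auto simp: algebra_simps)
    qed
    moreover have "w \<in> ?Z"
      using a(2) cmb_base[OF sring_0[OF K(1)], of "cmb A Y [y ^ Suc n]" ms'] cmb_base[OF sring_0[OF A], of Y "[y ^ Suc n]"]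
      by blast
    moreover have "smod K ?Z" by (intro cmb_smod' K smod_mono[OF cmb_smod'[OF A Y] K(2)])
    ultimately show "t \<in> ?Z" using a(3) smod_add by (metis mult.commute)
  qed
  have "A \<subseteq> cmb K (cmb A Y [y ^ Suc n]) (ns @ ms')"
    unfolding cmb_append using ns(2) cmb_mono[OF order.refl sub, of K ns] by blast
  then show ?case using ns(1) by (intro exI[of _ "ns @ ms'"]) (auto simp: ms'_def)
qed

text \<open>The parameters are replaced by their powers one at a time, and each replacement
  multiplies the number of generators by \<open>n\<close>. This is the source of the polynomial
  growth of colengths.\<close>

lemma box:
  assumes A: "sring A" and K: "sring K" "K \<subseteq> A"
  shows "smod A W \<Longrightarrow> set ys \<subseteq> A \<Longrightarrow> A \<subseteq> cmb K (cmb A W ys) ms \<Longrightarrow>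
    \<exists>ns. length ns = length ms * n ^ length ys \<and> A \<subseteq> cmb K (cmb A W (map (\<lambda>y. y ^ n) ys)) ns"
proof (induction ys arbitrary: W)
  case Nil
  then show ?case by auto
next
  case (Cons y ys)
  define W1 where "W1 = cmb A W [y]"
  have W1: "smod A W1" unfolding W1_def by (rule cmb_smod'[OF A Cons.prems(1)])
  have eq: "cmb A W (y # zs) = cmb A W1 zs" for zs
    unfolding W1_def by (rule cmb_swap[OF A Cons.prems(1)])
  obtain ns where ns: "length ns = length ms * n ^ length ys" "A \<subseteq> cmb K (cmb A W1 (map (\<lambda>y. y ^ n) ys)) ns"
    using Cons.IH[OF W1] Cons.prems eq by auto
  define Y where "Y = cmb A W (map (\<lambda>y. y ^ n) ys)"
  have Y: "smod A Y" unfolding Y_def by (rule cmb_smod'[OF A Cons.prems(1)])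
  have e2: "cmb A W (z # map (\<lambda>y. y ^ n) ys) = cmb A Y [z]" for z unfolding Y_def by simp
  obtain ns' where "length ns' = n * length ns" "A \<subseteq> cmb K (cmb A Y [y ^ n]) ns'"
    using box1[OF A K Y, of y ns n] Cons.prems(2) ns(2) unfolding eq[symmetric] e2 by auto
  then show ?case using ns(1) e2[of "y ^ n"] by (intro exI[of _ ns']) auto
qed

lemma power_ge_mem: "rideal J \<Longrightarrow> x ^ w \<in> J \<Longrightarrow> w \<le> n \<Longrightarrow> x ^ n \<in> J"
  by (metis le_add_diff_inverse power_add rideal_multr)

lemma uniform_power:
  assumes J: "rideal J" and "\<forall>x\<in>set xs. \<exists>w. x ^ w \<in> J"
  shows "\<exists>w. \<forall>n\<ge>w. \<forall>x\<in>set xs. x ^ n \<in> J"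
  using assms(2)
proof (induction xs)
  case (Cons x xs)
  then obtain w v where "\<forall>n\<ge>w. \<forall>x\<in>set xs. x ^ n \<in> J" "x ^ v \<in> J" by auto
  then show ?case using power_ge_mem[OF J] by (intro exI[of _ "max w v"]) auto
qed auto

lemma le_prime_power: "Factorial_Ring.prime (p::nat) \<Longrightarrow> w \<le> p ^ w"
  using prime_gt_1_nat[of p] less_exp[of w] power_mono[of 2 p w] by simp

text \<open>A large Frobenius power replaces the multinomial expansion: it is additive, so it only
  has to send each generator into \<open>J\<close>.\<close>

lemma radical_trans:
  assumes P: "rideal P" and p: "Factorial_Ring.prime p" "of_nat p \<in> P" and J: "rideal J" "P \<subseteq> J"
    and xs: "\<forall>x\<in>set xs. \<exists>w. x ^ w \<in> J" and y: "y ^ v \<in> cmb UNIV P xs"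
  shows "\<exists>w. y ^ w \<in> J"
proof -
  obtain w where w: "\<forall>n\<ge>w. \<forall>x\<in>set xs. x ^ n \<in> J" using uniform_power[OF J(1) xs] by blast
  have "(y ^ v) ^ (p ^ w) \<in> cmb UNIV P (map (\<lambda>x. x ^ (p ^ w)) xs)"
    by (rule frob_cmb[OF P p sring_UNIV y])
  also have "\<dots> \<subseteq> J" using w le_prime_power[OF p(1)] J by (intro cmb_least) auto
  finally show ?thesis by (auto simp: power_mult[symmetric])
qed

declare cmb.simps(2)[simp del]

subsection \<open>Colengths of Frobenius powers in a domain\<close>

text \<open>Modulo \<open>P\<close>, the bracket power of the ideal generated by \<open>gs\<close>.
  The elements of \<open>P\<close> are not raised to a power, since they count as zero.\<close>

definition frobseq :: "nat \<Rightarrow> 'b::comm_ring_1 set \<Rightarrow> 'b list \<Rightarrow> nat \<Rightarrow> 'b set" where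
  "frobseq p P gs e = cmb UNIV P (map (\<lambda>g. g ^ (p ^ e)) gs)"

lemma frobseq_rideal: "rideal P \<Longrightarrow> rideal (frobseq p P gs e)"
  unfolding frobseq_def by (rule cmb_rideal)

lemma frobseq_base: "P \<subseteq> frobseq p P gs e"
  unfolding frobseq_def by (rule cmb_base) simp

text \<open>The powers of \<open>f\<close> are dependent over \<open>A\<close>. Cancelling the
  lowest power of \<open>f\<close> whose coefficient is outside \<open>P\<close> exhibits this
  coefficient as a multiple of \<open>f\<close>.\<close>

lemma nonzerodivisor_multiple:
  assumes pdomA: "pdom A P" and us: "UNIV = cmb A P us" and f: "\<And>t. f * t \<in> P \<Longrightarrow> t \<in> P"
  shows "\<exists>g. \<exists>a\<in>A - P. a - f * g \<in> P"
proof -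
  note P = pdom_rideal[OF pdomA]
  have fpow: "f ^ n * t \<in> P \<Longrightarrow> t \<in> P" for n t
    by (induction n) (use f in \<open>auto simp: mult.assoc\<close>)
  define n where "n = length us"
  define ts where "ts = map (\<lambda>i. f ^ i) [0..<Suc n]"
  have len: "length ts = Suc n" unfolding ts_def by simp
  have "\<not> lindep A P ts"
    by (rule dep_of_gens[OF pdomA]) (use us in \<open>auto simp: len n_def\<close>)
  then obtain c where c: "\<forall>i<Suc n. c i \<in> A" "(\<Sum>i<Suc n. c i * ts ! i) \<in> P" "\<exists>i<Suc n. c i \<notin> P"
    unfolding lindep_def len by blast
  have c2: "(\<Sum>i<Suc n. c i * f ^ i) \<in> P"
    using c(2) unfolding ts_def by (subst sum.cong[OF refl, of _ _ "\<lambda>i. c i * ts ! i"]) (auto simp: ts_def simp del: upt_Suc)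
  define j where "j = (LEAST i. i < Suc n \<and> c i \<notin> P)"
  have j: "j < Suc n" "c j \<notin> P" unfolding j_def using LeastI_ex[OF c(3)] by auto
  have below: "c i \<in> P" if "i < j" for i
    using not_less_Least[of i "\<lambda>i. i < Suc n \<and> c i \<notin> P"] that j(1) unfolding j_def by auto
  define h where "h = (\<Sum>i\<in>{Suc j..n}. c i * f ^ (i - Suc j))"
  have "{..<Suc n} = {..<j} \<union> {j..n}" using j by auto
  then have "(\<Sum>i<Suc n. c i * f ^ i) = (\<Sum>i\<in>{..<j} \<union> {j..n}. c i * f ^ i)" by simp
  also have "\<dots> = (\<Sum>i<j. c i * f ^ i) + (\<Sum>i\<in>{j..n}. c i * f ^ i)"
    by (rule sum.union_disjoint) auto
  also have "(\<Sum>i\<in>{j..n}. c i * f ^ i) = c j * f ^ j + (\<Sum>i\<in>{Suc j..n}. c i * f ^ i)"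
    by (rule sum.atLeast_Suc_atMost) (use j in simp)
  also have "(\<Sum>i\<in>{Suc j..n}. c i * f ^ i) = f ^ j * (f * h)"
    unfolding h_def sum_distrib_left
  proof (rule sum.cong[OF refl])
    fix i assume "i \<in> {Suc j..n}"
    then have "f ^ i = f ^ j * (f * f ^ (i - Suc j))"
      unfolding power_Suc[symmetric] power_add[symmetric] by (simp add: Suc_diff_le)
    then show "c i * f ^ i = f ^ j * (f * (c i * f ^ (i - Suc j)))" by (simp add: algebra_simps)
  qed
  finally have "(\<Sum>i<j. c i * f ^ i) + f ^ j * (c j + f * h) \<in> P"
    using c2 by (simp add: algebra_simps)
  moreover have "(\<Sum>i<j. c i * f ^ i) \<in> P" using below by (intro smod_sum[OF P] rideal_multr[OF P]) auto
  ultimately have "f ^ j * (c j + f * h) \<in> P" using rideal_diff[OF P] by fastforce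
  then have "c j + f * h \<in> P" by (rule fpow)
  then show ?thesis using c(1) j by (intro exI[of _ "- h"] bexI[of _ "c j"]) auto
qed

text \<open>Noether normalisation in abstract form: \<open>A\<close> stands for the power series in
  \<open>xs\<close> over the field \<open>K\<close>, and \<open>us\<close> generates the whole ring
  over \<open>A\<close>. \<open>A2\<close> says that a nonzero nonunit \<open>c\<close> of
  \<open>A\<close> lowers the dimension: together with fewer than \<open>length xs\<close> further
  elements it generates an ideal whose radical contains \<open>xs\<close>. Finally \<open>gs\<close>
  generates the ideal whose Frobenius powers are measured.\<close>

locale nnbase =
  fixes P K A :: "'b::comm_ring_1 set" and xs us gs :: "'b list" and p :: nat
  assumes pdomA: "pdom A P" and KP: "fmod K P" and KA: "K \<subseteq> A" and xsA: "set xs \<subseteq> A"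
    and A_gen: "A \<subseteq> cmb A K xs" and us: "UNIV = cmb A P us"
    and A2: "c \<in> A - P \<Longrightarrow> (\<exists>b. c * b - 1 \<in> P) \<or>
      (\<exists>ys. length ys < length xs \<and> (\<forall>x\<in>set xs. \<exists>w. x ^ w \<in> cmb UNIV P (c # ys)) \<and>
         (\<forall>y\<in>set ys. \<exists>w. y ^ w \<in> cmb UNIV P xs))"
    and p: "Factorial_Ring.prime p" and p_mem: "of_nat p \<in> P"
    and gs: "x \<in> set xs \<Longrightarrow> \<exists>w. x ^ w \<in> cmb UNIV P gs"
begin

abbreviation "F \<equiv> frobseq p P gs"

lemma A: "sring A" and P: "rideal P" and P1: "1 \<notin> P"
  using pdomA unfolding pdom_def by auto

lemma K: "sring K" by (rule fmod_sring[OF KP])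

lemma F_rideal: "rideal (F e)" by (rule frobseq_rideal[OF P])
lemma P_F: "P \<subseteq> F e" by (rule frobseq_base)

lemma UNIV_xs: "UNIV = cmb K (cmb UNIV P xs) us"
proof -
  have "cmb A P us \<subseteq> cmb K (cmb UNIV P xs) us"
  proof -
    let ?Z = "cmb K (cmb UNIV P xs) us"
    have I: "rideal (cmb UNIV P xs)" by (rule cmb_rideal[OF P])
    have "t \<in> ?Z" if "t \<in> cmb A P vs" "set vs \<subseteq> set us" for t vs
      using that
    proof (induction vs arbitrary: t)
      case Nil
      then show ?case using cmb_base[OF sring_0[OF K], of "cmb UNIV P xs" us] cmb_base[of UNIV P xs] by auto
    next
      case (Cons v vs)
      obtain a w where a: "a \<in> A" "w \<in> cmb A P vs" "t = a * v + w" using cmb_ConsE[OF Cons.prems(1)] .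
      have "a \<in> cmb A K xs" using A_gen a by blast
      then obtain c where c: "a - (\<Sum>i<length xs. c i * xs ! i) \<in> K" unfolding cmb_iff by blast
      have "(\<Sum>i<length xs. c i * xs ! i) * v \<in> cmb UNIV P xs"
        by (intro rideal_multr[OF I] smod_sum[OF I] rideal_multl[OF I] cmb_mem) (auto simp: smod_0[OF P])
      then have 1: "(\<Sum>i<length xs. c i * xs ! i) * v \<in> ?Z"
        using cmb_base[OF sring_0[OF K], of "cmb UNIV P xs" us] by blast
      have Z: "smod K ?Z" by (intro cmb_smod' K rideal_smod[OF I])
      have "(a - (\<Sum>i<length xs. c i * xs ! i)) * v \<in> ?Z"
        by (intro smod_scale[OF Z c] cmb_mem K smod_0[OF I]) (use Cons.prems in auto)
      from smod_add[OF Z smod_add[OF Z this 1] Cons.IH[OF a(2)]] Cons.prems(2)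
      show ?case unfolding a(3) by (simp add: algebra_simps)
    qed
    then show ?thesis by blast
  qed
  then show ?thesis using us by blast
qed

lemma UNIV_pow: "\<exists>ms. UNIV = cmb K (cmb UNIV P (map (\<lambda>x. x ^ n) xs)) ms \<and> length ms = length us * n ^ length xs"
  using box[OF sring_UNIV K _ P, of xs us n] UNIV_xs by auto

text \<open>The generators \<open>us\<close> of the big ring do not enter, so the count has constant
  1. The Frobenius comparison needs this, since a larger constant would destroy convergence.\<close>

lemma A_pow: "\<exists>ms. A \<subseteq> cmb K (cmb A {0} (map (\<lambda>x. x ^ n) xs)) ms \<and> length ms = n ^ length xs"
proof -
  have "cmb A K ys \<subseteq> cmb K (cmb A {0} ys) [1]" if "set ys \<subseteq> A" for ys
  proof
    fix t assume "t \<in> cmb A K ys"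
    then obtain c where c: "\<forall>i<length ys. c i \<in> A" "t - (\<Sum>i<length ys. c i * ys ! i) \<in> K" unfolding cmb_iff by blast
    have "(\<Sum>i<length ys. c i * ys ! i) \<in> cmb A {0} ys" unfolding cmb_iff using c(1) by (intro exI[of _ c]) auto
    then show "t \<in> cmb K (cmb A {0} ys) [1]"
      by (intro cmb_ConsI[OF c(2), of "\<Sum>i<length ys. c i * ys ! i"]) auto
  qed
  then have "A \<subseteq> cmb K (cmb A {0} xs) [1]" using A_gen xsA by blast
  from box[OF A K KA _ xsA this, of n] show ?thesis by (auto simp: smod_def)
qed

text \<open>Modulo \<open>a\<close> the dimension drops, so monomials in fewer than
  \<open>length xs\<close> elements suffice, and the colength is smaller by a factor of order
  \<open>p ^ e\<close>.\<close>

lemma small_A: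
  assumes a: "a \<in> A - P"
  shows "\<exists>C. \<forall>e. \<exists>n. dimle K UNIV (cmb UNIV (F e) [a]) n \<and> n * p ^ e \<le> C * (p ^ e) ^ length xs"
proof -
  consider b where "a * b - 1 \<in> P" | ys where "length ys < length xs"
      "\<forall>x\<in>set xs. \<exists>w. x ^ w \<in> cmb UNIV P (a # ys)" "\<forall>y\<in>set ys. \<exists>w. y ^ w \<in> cmb UNIV P xs"
    using A2[OF a] by blast
  then show ?thesis
  proof cases
    case 1
    have "dimle K UNIV (cmb UNIV (F e) [a]) 0" for e
    proof -
      let ?Z = "cmb UNIV (F e) [a]"
      have Z: "rideal ?Z" by (rule cmb_rideal[OF F_rideal])
      have PZ: "P \<subseteq> ?Z" using P_F cmb_base[of UNIV "F e" "[a]"] by blast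
      have "a * b \<in> ?Z" by (intro rideal_multr[OF Z] cmb_mem) (use smod_0[OF F_rideal] in auto)
      then have "1 \<in> ?Z" using 1 PZ rideal_diff[OF Z, of "a * b" "a * b - 1"] by auto
      then show ?thesis using rideal_1[OF Z] by (auto intro: dimle_refl)
    qed
    then show ?thesis by (intro exI[of _ 0] allI exI[of _ 0]) auto
  next
    case 2
    define P' where "P' = cmb UNIV P [a]"
    have P': "rideal P'" unfolding P'_def by (rule cmb_rideal[OF P])
    have PP': "P \<subseteq> P'" unfolding P'_def by (rule cmb_base) simp
    have aP': "a \<in> P'" unfolding P'_def by (rule cmb_mem) (auto simp: smod_0[OF P])
    define J where "J = cmb UNIV P' ys"
    have J: "rideal J" unfolding J_def by (rule cmb_rideal[OF P'])
    have PJ: "P' \<subseteq> J" unfolding J_def by (rule cmb_base) simp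
    have ysJ: "set ys \<subseteq> J" unfolding J_def by (intro subsetI cmb_mem) (auto simp: smod_0[OF P'])
    have "cmb UNIV P (a # ys) \<subseteq> J"
      by (rule cmb_least[OF J order.trans[OF PP' PJ]]) (use ysJ subsetD[OF PJ aP'] in simp)
    then have "\<forall>x\<in>set xs. \<exists>w. x ^ w \<in> J" using 2 by blast
    then obtain w where w: "\<forall>x\<in>set xs. x ^ w \<in> J" using uniform_power[OF J] by blast
    obtain ms where ms: "UNIV = cmb K (cmb UNIV P (map (\<lambda>x. x ^ w) xs)) ms" using UNIV_pow by blast
    have "cmb UNIV P (map (\<lambda>x. x ^ w) xs) \<subseteq> J"
      using w PP' PJ by (intro cmb_least[OF J]) auto
    then have UJ: "UNIV \<subseteq> cmb K (cmb UNIV P' ys) ms" using ms cmb_mono[of K K _ J ms] unfolding J_def by blast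
    have "\<forall>y\<in>set ys. \<exists>w. y ^ w \<in> cmb UNIV P gs"
      using radical_trans[OF P p p_mem cmb_rideal[OF P] cmb_base] gs 2(3) by blast
    then obtain t where t: "\<forall>y\<in>set ys. y ^ t \<in> cmb UNIV P gs"
      using uniform_power[OF cmb_rideal[OF P], of ys gs] by blast
    \<comment> \<open>Since \<open>y ^ t\<close> lies in the ideal of \<open>gs\<close>, the power
      \<open>y ^ (t * p ^ e)\<close> lies in its Frobenius power. Neither \<open>ms\<close> nor
      \<open>t\<close> depends on \<open>e\<close>.\<close>
    define C where "C = length ms * t ^ length ys"
    have "\<exists>n. dimle K UNIV (cmb UNIV (F e) [a]) n \<and> n * p ^ e \<le> C * (p ^ e) ^ length xs" for e
    proof -
      let ?q = "p ^ e"
      let ?Z = "cmb UNIV (F e) [a]"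
      have Z: "rideal ?Z" by (rule cmb_rideal[OF F_rideal])
      obtain ns where ns: "length ns = length ms * (t * ?q) ^ length ys"
        "UNIV \<subseteq> cmb K (cmb UNIV P' (map (\<lambda>y. y ^ (t * ?q)) ys)) ns"
        using box[OF sring_UNIV K _ P' _ UJ, of "t * ?q"] by auto
      have "cmb UNIV P' (map (\<lambda>y. y ^ (t * ?q)) ys) \<subseteq> ?Z"
      proof (rule cmb_least[OF Z])
        show "P' \<subseteq> ?Z" unfolding P'_def by (intro cmb_mono P_F) auto
        have "y ^ (t * ?q) \<in> F e" if "y \<in> set ys" for y
          using frob_cmb[OF P p p_mem sring_UNIV, of "y ^ t" gs e] t that
          unfolding frobseq_def by (simp add: power_mult)
        then show "set (map (\<lambda>y. y ^ (t * ?q)) ys) \<subseteq> ?Z" using cmb_base[of UNIV "F e" "[a]"] by auto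
      qed
      then have "dimle K UNIV ?Z (length ns)"
        unfolding dimle_def using ns(2) cmb_mono[OF order.refl, of _ ?Z K ns] by (intro exI[of _ ns]) blast
      moreover have "length ns * ?q \<le> C * ?q ^ length xs"
      proof -
        have "length ns * ?q = C * ?q ^ Suc (length ys)"
          unfolding ns(1) C_def by (simp add: power_mult_distrib algebra_simps)
        also have "\<dots> \<le> C * ?q ^ length xs"
          using 2(1) prime_gt_0_nat[OF p] by (intro mult_left_mono power_increasing) auto
        finally show ?thesis .
      qed
      ultimately show ?thesis by blast
    qed
    then show ?thesis by blast
  qed
qed

lemma finite_colength: "\<exists>C. \<forall>e. dimle K UNIV (F e) (C * (p ^ e) ^ length xs)"
proof -
  obtain t where t: "\<forall>x\<in>set xs. x ^ t \<in> cmb UNIV P gs"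
    using uniform_power[OF cmb_rideal[OF P], of xs gs] gs by blast
  have "dimle K UNIV (F e) (length us * t ^ length xs * (p ^ e) ^ length xs)" for e
  proof -
    let ?q = "p ^ e"
    obtain ms where ms: "UNIV = cmb K (cmb UNIV P (map (\<lambda>x. x ^ (t * ?q)) xs)) ms"
      "length ms = length us * (t * ?q) ^ length xs" using UNIV_pow by blast
    have "x ^ (t * ?q) \<in> F e" if "x \<in> set xs" for x
      using frob_cmb[OF P p p_mem sring_UNIV, of "x ^ t" gs e] t that
      unfolding frobseq_def by (simp add: power_mult)
    then have "cmb UNIV P (map (\<lambda>x. x ^ (t * ?q)) xs) \<subseteq> F e"
      using P_F by (intro cmb_least[OF F_rideal]) auto
    then show ?thesis unfolding dimle_def using ms cmb_mono[OF order.refl, of _ "F e" K ms]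
      by (intro exI[of _ ms]) (auto simp: power_mult_distrib)
  qed
  then show ?thesis by blast
qed

end

locale nndom = nnbase P K A xs us gs p for P K A :: "'b::comm_ring_1 set" and xs us gs p +
  assumes Pprime: "a * b \<in> P \<Longrightarrow> a \<in> P \<or> b \<in> P"
begin

lemma power_notin: "f \<notin> P \<Longrightarrow> f ^ n \<notin> P"
  by (induction n) (use P1 Pprime in auto)

lemma ex_multiple_in_A: "f \<notin> P \<Longrightarrow> \<exists>g. \<exists>a\<in>A - P. a - f * g \<in> P"
  by (rule nonzerodivisor_multiple[OF pdomA us]) (use Pprime in blast)

lemma small:
  assumes c: "c \<notin> P"
  shows "\<exists>C. \<forall>e. \<exists>n. dimle K UNIV (cmb UNIV (F e) [c]) n \<and> n * p ^ e \<le> C * (p ^ e) ^ length xs"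
proof -
  obtain g a where a: "a \<in> A - P" "a - c * g \<in> P" using ex_multiple_in_A[OF c] by blast
  have "cmb UNIV (F e) [a] \<subseteq> cmb UNIV (F e) [c]" for e
  proof (rule cmb_le[OF sring_UNIV F_rideal order.refl cmb_base])
    have "a = g * c + (a - c * g)" by (simp add: algebra_simps)
    then show "set [a] \<subseteq> cmb UNIV (F e) [c]" using a(2) P_F
      by (auto intro!: cmb_ConsI[of g _ "a - c * g"] simp: subset_iff)
  qed simp
  then show ?thesis using small_A[OF a(1)] dimle_subset[OF _ order.refl] by meson
qed

end

section \<open>A Frobenius-linear map on a domain and the growth of colengths\<close>

context nndom
begin

text \<open>A list all of whose Frobenius powers stay independent, of maximal length, absorbs inseparability:
  it generates all \<open>p ^ e0\<close>-th powers up to a denominator.\<close>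

lemma ex_stable_power:
  "\<exists>e0 vs. \<exists>a\<in>A - P. (\<forall>e. lindep A P (map (\<lambda>v. v ^ (p ^ e)) vs)) \<and>
     (\<forall>b. a * b ^ (p ^ e0) \<in> cmb A P (map (\<lambda>v. v ^ (p ^ e0)) vs))"
proof -
  define Q where "Q = (\<lambda>vs. \<forall>e. lindep A P (map (\<lambda>v. v ^ (p ^ e)) vs))"
  have "length vs \<le> length us" if "Q vs" for vs
  proof (rule ccontr)
    assume "\<not> length vs \<le> length us"
    then show False using dep_of_gens[OF pdomA, of "map (\<lambda>v. v ^ (p ^ 0)) vs" us] us
        spec[OF that[unfolded Q_def], of 0] by auto
  qed
  then obtain vs where vs: "Q vs" "\<And>t. \<not> Q (t # vs)"
    using ex_max_list[of Q "length us"] unfolding Q_def by auto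
  have pers: "\<exists>d\<in>A - P. d * u ^ (p ^ e') \<in> cmb A P (map (\<lambda>v. v ^ (p ^ e')) vs)"
    if d: "d \<in> A - P" "d * u ^ (p ^ e) \<in> cmb A P (map (\<lambda>v. v ^ (p ^ e)) vs)" and "e \<le> e'" for u e e' d
  proof -
    obtain k where k: "e' = e + k" using \<open>e \<le> e'\<close> le_Suc_ex by blast
    have "(d * u ^ (p ^ e)) ^ (p ^ k) \<in> cmb A P (map (\<lambda>v. v ^ (p ^ k)) (map (\<lambda>v. v ^ (p ^ e)) vs))"
      by (rule frob_cmb[OF P p p_mem A d(2)])
    then have "d ^ (p ^ k) * u ^ (p ^ e') \<in> cmb A P (map (\<lambda>v. v ^ (p ^ e')) vs)"
      by (simp add: power_mult_distrib power_mult[symmetric] power_add k comp_def)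
    then show ?thesis using pdom_power[OF pdomA d(1)] by blast
  qed
  have one: "\<exists>e. \<exists>d\<in>A - P. d * u ^ (p ^ e) \<in> cmb A P (map (\<lambda>v. v ^ (p ^ e)) vs)" for u
  proof -
    obtain e where "\<not> lindep A P (u ^ (p ^ e) # map (\<lambda>v. v ^ (p ^ e)) vs)"
      using vs(2)[of u] unfolding Q_def by auto
    then show ?thesis using lindep_Cons_dep[OF pdomA] vs(1) unfolding Q_def by blast
  qed
  have "\<exists>e0. \<forall>u\<in>set ws. \<exists>d\<in>A - P. d * u ^ (p ^ e0) \<in> cmb A P (map (\<lambda>v. v ^ (p ^ e0)) vs)" for ws
  proof (induction ws)
    case (Cons w ws)
    then obtain e0 where e0: "\<forall>u\<in>set ws. \<exists>d\<in>A - P. d * u ^ (p ^ e0) \<in> cmb A P (map (\<lambda>v. v ^ (p ^ e0)) vs)"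
      by blast
    obtain e d where e: "d \<in> A - P" "d * w ^ (p ^ e) \<in> cmb A P (map (\<lambda>v. v ^ (p ^ e)) vs)"
      using one[of w] by blast
    have "\<forall>u\<in>set (w # ws). \<exists>d\<in>A - P. d * u ^ (p ^ max e e0) \<in> cmb A P (map (\<lambda>v. v ^ (p ^ max e e0)) vs)"
      using pers[OF e max.cobounded1] pers[OF _ _ max.cobounded2] e0 by (metis set_ConsD)
    then show ?case by blast
  qed auto
  then obtain e0 where e0: "\<forall>u\<in>set us. \<exists>d\<in>A - P. d * u ^ (p ^ e0) \<in> cmb A P (map (\<lambda>v. v ^ (p ^ e0)) vs)"
    by blast
  define W where "W = cmb A P (map (\<lambda>v. v ^ (p ^ e0)) vs)"
  have W: "smod A W" unfolding W_def by (rule cmb_smod'[OF A rideal_smod[OF P]])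
  have PW: "P \<subseteq> W" unfolding W_def by (rule cmb_base[OF sring_0[OF A]])
  obtain a where a: "a \<in> A - P" "\<forall>u\<in>set us. a * u ^ (p ^ e0) \<in> W"
    using common_multiple[OF pdomA W, of us "\<lambda>u. u ^ (p ^ e0)"] e0 unfolding W_def by blast
  have "a * b ^ (p ^ e0) \<in> W" for b
  proof -
    have "b ^ (p ^ e0) \<in> cmb A P (map (\<lambda>v. v ^ (p ^ e0)) us)"
      by (rule frob_cmb[OF P p p_mem A]) (use us in blast)
    moreover have "cmb A P (map (\<lambda>v. v ^ (p ^ e0)) us) \<subseteq> {t. a * t \<in> W}"
    proof (rule cmb_least)
      show "smod A {t. a * t \<in> W}"
        using W unfolding smod_def by (auto simp: algebra_simps mult.left_commute[of a])
    qed (use a PW rideal_multl[OF P] in auto)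
    ultimately show ?thesis by blast
  qed
  then show ?thesis using a(1) vs(1) unfolding W_def Q_def by blast
qed

text \<open>For a finite field extension, being spanned by \<open>p\<close>-th powers means being
  separable. The \<open>p\<close>-th powers of the \<open>ws\<close> are independent and as numerous
  as the \<open>ws\<close>, which generate; by counting they generate too, up to a
  denominator.\<close>

lemma ex_separable_power:
  "\<exists>e0 vs. \<exists>c\<in>A - P. \<forall>b. c * b ^ (p ^ e0) \<in> cmb A P (map (\<lambda>v. (v ^ (p ^ e0)) ^ p) vs)"
proof -
  obtain e0 vs a where a: "a \<in> A - P" and ind: "\<And>e. lindep A P (map (\<lambda>v. v ^ (p ^ e)) vs)"
    and gen: "\<And>b. a * b ^ (p ^ e0) \<in> cmb A P (map (\<lambda>v. v ^ (p ^ e0)) vs)"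
    using ex_stable_power by blast
  define ws where "ws = map (\<lambda>v. v ^ (p ^ e0)) vs"
  define ws' where "ws' = map (\<lambda>v. (v ^ (p ^ e0)) ^ p) vs"
  define W' where "W' = cmb A P ws'"
  have W': "smod A W'" unfolding W'_def by (rule cmb_smod'[OF A rideal_smod[OF P]])
  have PW': "P \<subseteq> W'" unfolding W'_def by (rule cmb_base[OF sring_0[OF A]])
  have ind': "lindep A P ws'"
    using ind[of "Suc e0"] unfolding ws'_def by (simp add: power_mult[symmetric] mult.commute)
  have "\<exists>d\<in>A - P. d * w \<in> W'" if w: "w \<in> set ws" for w
  proof -
    have "set (map ((*) a) (w # ws')) \<subseteq> cmb A P ws"
    proof -
      have "a * (v ^ (p ^ e0)) ^ p \<in> cmb A P ws" for v
        using gen[of "v ^ p"] unfolding ws_def by (simp add: power_mult[symmetric] mult.commute)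
      moreover have "a * w \<in> cmb A P ws" using gen w unfolding ws_def by auto
      ultimately show ?thesis unfolding ws'_def by auto
    qed
    then have "\<not> lindep A P (map ((*) a) (w # ws'))"
      by (rule dep_of_gens[OF pdomA]) (simp add: ws_def ws'_def)
    then have "\<not> lindep A P (w # ws')" using lindep_scale[OF pdomA a] by blast
    then show ?thesis using lindep_Cons_dep[OF pdomA ind'] unfolding W'_def by blast
  qed
  then obtain d where d: "d \<in> A - P" "\<forall>w\<in>set ws. d * w \<in> W'"
    using common_multiple[OF pdomA W', of ws "\<lambda>w. w"] by blast
  have "cmb A P ws \<subseteq> {t. d * t \<in> W'}"
  proof (rule cmb_least)
    show "smod A {t. d * t \<in> W'}"
      using W' unfolding smod_def by (auto simp: algebra_simps mult.left_commute[of d])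
  qed (use d PW' rideal_multl[OF P] in auto)
  then have "d * (a * b ^ (p ^ e0)) \<in> W'" for b using gen unfolding ws_def by blast
  then have "(d * a) * b ^ (p ^ e0) \<in> W'" for b by (simp add: mult.assoc)
  then show ?thesis using pdom_mult[OF pdomA d(1) a] unfolding W'_def ws'_def by blast
qed

text \<open>The \<open>A\<close>-subalgebra generated by all \<open>q\<close>-th powers: a product
  of two \<open>q\<close>-th powers is again one, so linear combinations already form a
  ring.\<close>

definition powspan :: "nat \<Rightarrow> 'b set" where
  "powspan q = {s. \<exists>bs. s \<in> cmb A {0} (map (\<lambda>b. b ^ q) bs)}"

lemma smod_0_set: "smod L {0::'b}" by (simp add: smod_def)

lemma powspan_smod: "smod A (powspan q)"
  unfolding smod_def
proof (intro conjI ballI)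
  show "0 \<in> powspan q" unfolding powspan_def by (auto intro!: exI[of _ "[]"])
next
  fix a b assume "a \<in> powspan q" "b \<in> powspan q"
  then obtain as bs where ab: "a \<in> cmb A {0} (map (\<lambda>b. b ^ q) as)" "b \<in> cmb A {0} (map (\<lambda>b. b ^ q) bs)"
    unfolding powspan_def by blast
  let ?Z = "cmb A {0} (map (\<lambda>b. b ^ q) (as @ bs))"
  have "a \<in> ?Z" by (rule subsetD[OF cmb_sub_mono[OF A smod_0_set order.refl order.refl] ab(1)]) auto
  moreover have "b \<in> ?Z" by (rule subsetD[OF cmb_sub_mono[OF A smod_0_set order.refl order.refl] ab(2)]) auto
  ultimately have "a + b \<in> ?Z" by (rule smod_add[OF cmb_smod'[OF A smod_0_set]])
  then show "a + b \<in> powspan q" unfolding powspan_def by blast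
next
  fix k a assume "k \<in> A" "a \<in> powspan q"
  then show "k * a \<in> powspan q" unfolding powspan_def using smod_scale[OF cmb_smod'[OF A smod_0_set]] by blast
qed

lemma powspan_mem: "b ^ q \<in> powspan q"
  unfolding powspan_def using cmb_mem[of "b ^ q" "[b ^ q]" A "{0}"] A by (auto intro!: exI[of _ "[b]"])

lemma powspan_least:
  assumes "smod A W" "\<And>b. b ^ q \<in> W" shows "powspan q \<subseteq> W"
proof -
  have "cmb A {0} (map (\<lambda>b. b ^ q) bs) \<subseteq> W" for bs
    by (rule cmb_least[OF assms(1)]) (use assms smod_0[OF assms(1)] in auto)
  then show ?thesis unfolding powspan_def by blast
qed

lemma powspan_A: "A \<subseteq> powspan q"
  using smod_scale[OF powspan_smod _ powspan_mem[of 1 q]] by auto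

lemma powspan_sring: "sring (powspan q)"
  unfolding sring_def
proof (intro conjI ballI)
  show "1 \<in> powspan q" using powspan_A sring_1[OF A] by blast
next
  fix a b assume "a \<in> powspan q" "b \<in> powspan q"
  then show "a - b \<in> powspan q" by (rule smod_diff[OF powspan_smod A])
next
  have 1: "c ^ q * b \<in> powspan q" if "b \<in> powspan q" for b c
  proof -
    have "powspan q \<subseteq> {b. c ^ q * b \<in> powspan q}"
    proof (rule powspan_least)
      show "smod A {b. c ^ q * b \<in> powspan q}"
        using powspan_smod[of q] unfolding smod_def by (auto simp: algebra_simps mult.left_commute[of "c ^ q"])
      show "b ^ q \<in> {b. c ^ q * b \<in> powspan q}" for b
        using powspan_mem[of "c * b" q] by (simp add: power_mult_distrib)
    qed
    then show ?thesis using that by blast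
  qed
  fix a b assume ab: "a \<in> powspan q" "b \<in> powspan q"
  have "powspan q \<subseteq> {a. a * b \<in> powspan q}"
  proof (rule powspan_least)
    show "smod A {a. a * b \<in> powspan q}"
      using powspan_smod[of q] unfolding smod_def by (auto simp: distrib_right mult.assoc)
  qed (use 1 ab in auto)
  then show "a * b \<in> powspan q" using ab by blast
qed

text \<open>For one \<open>x\<close> after another, the current element is multiplied by the highest
  power of \<open>x\<close> that keeps it outside \<open>W\<close>; earlier conditions survive
  because \<open>W\<close> is an \<open>A\<close>-module.\<close>

lemma ex_socle_element:
  assumes W: "smod A W" and nil: "\<And>x b. x \<in> set xs \<Longrightarrow> \<exists>w. x ^ w * b \<in> W" and b: "b \<notin> W"
  shows "set ys \<subseteq> set xs \<Longrightarrow> \<exists>r. r \<notin> W \<and> (\<forall>x\<in>set ys. x * r \<in> W)"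
proof (induction ys)
  case Nil
  then show ?case using b by auto
next
  case (Cons x ys)
  then obtain r where r: "r \<notin> W" "\<forall>y\<in>set ys. y * r \<in> W" by auto
  define j where "j = (LEAST w. x ^ w * r \<in> W)"
  have j: "x ^ j * r \<in> W" unfolding j_def by (rule LeastI_ex) (use nil[of x r] Cons.prems in auto)
  have "j \<noteq> 0" using j r(1) by (cases j) auto
  then obtain i where i: "j = Suc i" by (cases j) auto
  have "x ^ i * r \<notin> W" using not_less_Least[of i "\<lambda>w. x ^ w * r \<in> W"] i unfolding j_def by auto
  moreover have "x * (x ^ i * r) \<in> W" using j i by (simp add: mult.assoc)
  moreover have "y * (x ^ i * r) \<in> W" if "y \<in> set ys" for y
    using smod_scale[OF W, of "x ^ i" "y * r"] r(2) that sring_power[OF A, of x i] xsA Cons.prems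
    by (auto simp: mult.left_commute)
  ultimately show ?case by (intro exI[of _ "x ^ i * r"]) auto
qed

end

lemma cmb_set_lift: "set vs \<subseteq> S \<Longrightarrow> set ws \<subseteq> S \<Longrightarrow> set (vs @ ws) \<subseteq> S" by auto

context nndom
begin

text \<open>The map \<open>\<theta>\<close> sends the Frobenius power at \<open>e0 + e\<close> into
  the next one. A one-generator step killed by \<open>xs\<close> in the source costs at most
  \<open>p ^ length xs\<close> in the \<open>A\<close>-span of the values of
  \<open>\<theta>\<close>, and this span contains all multiples of a fixed \<open>c'\<close> outside
  \<open>P\<close>. The rest is bounded by \<open>small\<close>.\<close>

lemma Frobenius_colength_step:
  "\<exists>e0 C. \<forall>e n. dimle K UNIV (F (e0 + e)) n \<longrightarrow>
     (\<exists>m. dimle K UNIV (F (e0 + Suc e)) (p ^ length xs * n + m) \<and>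
        m * p ^ (e0 + Suc e) \<le> C * (p ^ (e0 + Suc e)) ^ length xs)"
proof -
  obtain e0 vs c1 where c1: "c1 \<in> A - P"
    and c1_gen: "\<And>b. c1 * b ^ (p ^ e0) \<in> cmb A P (map (\<lambda>v. (v ^ (p ^ e0)) ^ p) vs)"
    using ex_separable_power by blast
  define q0 where "q0 = p ^ e0"
  define S where "S = powspan q0"
  define W' where "W' = cmb A P (map (\<lambda>v. (v ^ q0) ^ p) vs)"
  have S: "sring S" and AS: "A \<subseteq> S" unfolding S_def by (rule powspan_sring, rule powspan_A)
  have W': "smod A W'" unfolding W'_def by (rule cmb_smod'[OF A rideal_smod[OF P]])
  have c1S: "c1 * s \<in> W'" if "s \<in> S" for s
  proof -
    have "powspan q0 \<subseteq> {s. c1 * s \<in> W'}"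
    proof (rule powspan_least)
      show "smod A {s. c1 * s \<in> W'}"
        using W' unfolding smod_def by (auto simp: algebra_simps mult.left_commute[of c1])
      show "b ^ q0 \<in> {s. c1 * s \<in> W'}" for b
        using c1_gen[of b] unfolding W'_def q0_def by simp
    qed
    then show ?thesis using that unfolding S_def by blast
  qed
  have pdomS: "pdom S P" unfolding pdom_def using S P P1 Pprime by blast
  have "length ts \<le> length us" if "lindep S P ts" for ts
    using dep_of_gens[OF pdomA, of ts us] us lindep_subring[OF that AS] by (metis not_le subset_UNIV)
  \<comment> \<open>A basis of the fraction field over that of \<open>S\<close>; \<open>s\<close>
    below is a common denominator for expanding the whole ring in it.\<close>
  then obtain ts where ts: "lindep S P ts" "\<And>t. \<not> lindep S P (t # ts)"
    using ex_max_list[of "lindep S P" "length us"] by auto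
  define V where "V = cmb S P ts"
  have V: "smod S V" unfolding V_def by (rule cmb_smod'[OF S rideal_smod[OF P]])
  have PV: "P \<subseteq> V" unfolding V_def by (rule cmb_base[OF sring_0[OF S]])
  have "\<forall>u\<in>set us. \<exists>d\<in>S - P. d * u \<in> V"
    using lindep_Cons_dep[OF pdomS ts(1) ts(2)] unfolding V_def by blast
  then obtain s where s: "s \<in> S - P" "\<forall>u\<in>set us. s * u \<in> V"
    using common_multiple[OF pdomS V, of us "\<lambda>u. u"] by blast
  have sV: "s * b \<in> V" for b
  proof -
    have "cmb A P us \<subseteq> {t. s * t \<in> V}"
    proof (rule cmb_least)
      show "smod A {t. s * t \<in> V}"
        using smod_mono[OF V AS] unfolding smod_def by (auto simp: algebra_simps mult.left_commute[of s])
    qed (use s PV rideal_multl[OF P] in auto)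
    then show ?thesis using us by blast
  qed
  define m where "m = length ts"
  have "\<forall>b. \<exists>c. (\<forall>i<m. c i \<in> S) \<and> s * b - (\<Sum>i<m. c i * ts ! i) \<in> P"
    using sV unfolding V_def cmb_iff m_def by blast
  then obtain \<sigma> where \<sigma>: "\<And>b i. i < m \<Longrightarrow> \<sigma> b i \<in> S" "\<And>b. s * b - (\<Sum>i<m. \<sigma> b i * ts ! i) \<in> P"
    by metis
  \<comment> \<open>The coordinates \<open>\<sigma>\<close> are chosen arbitrarily, but independence
    of \<open>ts\<close> determines them, and hence \<open>\<theta>\<close>, modulo
    \<open>P\<close>. By \<open>coord\<close> any admissible coordinates compute
    \<open>\<theta>\<close>.\<close>
  define \<theta> where "\<theta> = (\<lambda>b. \<Sum>i<m. (\<sigma> b i) ^ p * ts ! i)"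
  have coord: "\<theta> b - (\<Sum>i<m. (c i) ^ p * ts ! i) \<in> P"
    if c: "\<And>i. i < m \<Longrightarrow> c i \<in> S" "s * b - (\<Sum>i<m. c i * ts ! i) \<in> P" for b c
  proof -
    have "(\<Sum>i<m. (\<sigma> b i - c i) * ts ! i) \<in> P"
      using rideal_diff[OF P c(2) \<sigma>(2)[of b]] by (simp add: algebra_simps sum_subtractf)
    then have d: "\<sigma> b i - c i \<in> P" if "i < m" for i
      using lindepD[OF ts(1), of "\<lambda>i. \<sigma> b i - c i" i] that \<sigma>(1) c(1) sring_diff[OF S]
      unfolding m_def by auto
    have "(\<Sum>i<m. ((\<sigma> b i) ^ p - (c i) ^ p) * ts ! i) \<in> P"
      using d by (intro smod_sum[OF P] rideal_multr[OF P] power_cong_ideal[OF P]) auto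
    then show ?thesis unfolding \<theta>_def by (simp add: algebra_simps sum_subtractf)
  qed
  have \<theta>_add: "\<theta> (b + b') - (\<theta> b + \<theta> b') \<in> P" for b b'
  proof -
    have 1: "\<theta> (b + b') - (\<Sum>i<m. (\<sigma> b i + \<sigma> b' i) ^ p * ts ! i) \<in> P"
    proof (rule coord)
      show "s * (b + b') - (\<Sum>i<m. (\<sigma> b i + \<sigma> b' i) * ts ! i) \<in> P"
        using smod_add[OF P \<sigma>(2)[of b] \<sigma>(2)[of b']] by (simp add: algebra_simps sum.distrib)
    qed (use \<sigma>(1) sring_add[OF S] in auto)
    have 2: "(\<Sum>i<m. ((\<sigma> b i + \<sigma> b' i) ^ p - (\<sigma> b i ^ p + \<sigma> b' i ^ p)) * ts ! i) \<in> P"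
      using frob_add[OF P p p_mem, of _ _ 1] by (intro smod_sum[OF P] rideal_multr[OF P]) auto
    show ?thesis using smod_add[OF P 1 2] unfolding \<theta>_def by (simp add: algebra_simps sum.distrib sum_subtractf)
  qed
  have \<theta>_scale: "\<theta> (g * b) - g ^ p * \<theta> b \<in> P" if g: "g \<in> S" for g b
  proof -
    have "\<theta> (g * b) - (\<Sum>i<m. (g * \<sigma> b i) ^ p * ts ! i) \<in> P"
    proof (rule coord)
      show "s * (g * b) - (\<Sum>i<m. g * \<sigma> b i * ts ! i) \<in> P"
        using rideal_multl[OF P \<sigma>(2)[of b], of g]
        by (simp add: algebra_simps sum_distrib_left)
    qed (use \<sigma>(1) g sring_mult[OF S] in auto)
    then show ?thesis unfolding \<theta>_def by (simp add: sum_distrib_left power_mult_distrib mult.assoc)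
  qed
  have \<theta>_P: "\<theta> b \<in> P" if "b \<in> P" for b
  proof -
    have "\<theta> b - (\<Sum>i<m. 0 ^ p * ts ! i) \<in> P"
      by (rule coord) (use that rideal_multl[OF P] sring_0[OF S] in auto)
    then show ?thesis using p by (simp add: power_0_left prime_gt_0_nat)
  qed
  have \<theta>_ideal: "t \<in> cmb UNIV P L \<Longrightarrow> set L \<subseteq> S \<Longrightarrow> \<theta> t \<in> cmb UNIV P (map (\<lambda>g. g ^ p) L)" for t L
  proof (induction L arbitrary: t)
    case Nil
    then show ?case using \<theta>_P by simp
  next
    case (Cons g L)
    let ?Z = "cmb UNIV P (map (\<lambda>g. g ^ p) (g # L))"
    obtain k w where kw: "w \<in> cmb UNIV P L" "t = k * g + w" using cmb_ConsE[OF Cons.prems(1)] .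
    have Z: "rideal ?Z" by (rule cmb_rideal[OF P])
    have PZ: "P \<subseteq> ?Z" by (rule cmb_base) simp
    have "\<theta> w \<in> ?Z" using Cons.IH[OF kw(1)] Cons.prems(2)
        cmb_sub_mono[OF sring_UNIV P order.refl order.refl, of "map (\<lambda>g. g ^ p) L" "map (\<lambda>g. g ^ p) (g # L)"] by auto
    moreover have "g ^ p * \<theta> k \<in> ?Z" by (intro rideal_multr[OF Z] cmb_mem) (auto simp: smod_0[OF P])
    then have "\<theta> (g * k) \<in> ?Z"
      using \<theta>_scale[of g k] Cons.prems(2) PZ smod_cong[OF Z sring_UNIV, of "\<theta> (g * k)" "g ^ p * \<theta> k"] by auto
    ultimately have "\<theta> (g * k) + \<theta> w \<in> ?Z" by (intro smod_add[OF Z])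
    then show ?case
      using \<theta>_add[of "g * k" w] PZ smod_cong[OF Z sring_UNIV, of "\<theta> (g * k + w)" "\<theta> (g * k) + \<theta> w"] kw(2)
      by (auto simp: mult.commute)
  qed
  have \<theta>_F: "\<theta> t \<in> F (e0 + Suc e)" if "t \<in> F (e0 + e)" for t e
  proof -
    \<comment> \<open>The generators of the Frobenius power are \<open>q0\<close>-th powers and so
      belong to \<open>S\<close>, where \<open>\<theta>\<close> is Frobenius-linear. This is the
      reason for the shift by \<open>e0\<close>.\<close>
    have "g ^ (p ^ (e0 + e)) \<in> S" for g
      using powspan_mem[of "g ^ (p ^ e)" q0] unfolding S_def q0_def
      by (simp add: power_mult[symmetric] power_add mult.commute)
    then show ?thesis using \<theta>_ideal[of t "map (\<lambda>g. g ^ (p ^ (e0 + e))) gs"] that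
      unfolding frobseq_def by (auto simp: comp_def power_mult[symmetric] mult.commute)
  qed
  \<comment> \<open>The last factor \<open>s\<close> expands an element in \<open>ts\<close>,
    \<open>c1\<close> turns its coordinates into combinations of \<open>p\<close>-th powers, and
    \<open>s ^ p\<close> is what \<open>\<theta>\<close> produces from a coordinate multiplied by
    \<open>s\<close>.\<close>
  define c' where "c' = s ^ p * c1 * s"
  have c': "c' \<notin> P" using s(1) c1 power_notin[of s p] Pprime unfolding c'_def by blast
  obtain C where C: "\<And>e. \<exists>n. dimle K UNIV (cmb UNIV (F e) [c']) n \<and> n * p ^ e \<le> C * (p ^ e) ^ length xs"
    using small[OF c'] by blast
  obtain ms where ms: "A \<subseteq> cmb K (cmb A {0} (map (\<lambda>x. x ^ p) xs)) ms" "length ms = p ^ length xs"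
    using A_pow by blast
  obtain t0 where t0: "\<forall>x\<in>set xs. x ^ t0 \<in> cmb UNIV P gs"
    using uniform_power[OF cmb_rideal[OF P], of xs gs] gs by blast
  have step: "\<exists>m. dimle K UNIV (F (e0 + Suc e)) (p ^ length xs * n + m) \<and>
        m * p ^ (e0 + Suc e) \<le> C * (p ^ (e0 + Suc e)) ^ length xs"
    if dim: "dimle K UNIV (F (e0 + e)) n" for e n
  proof -
    define U where "U = F (e0 + e)"
    define U' where "U' = F (e0 + Suc e)"
    have U: "rideal U" and U': "rideal U'" unfolding U_def U'_def by (rule F_rideal)+
    have PU: "P \<subseteq> U" and PU': "P \<subseteq> U'" unfolding U_def U'_def by (rule P_F)+
    have \<theta>U: "\<theta> t \<in> U'" if "t \<in> U" for t using \<theta>_F that unfolding U_def U'_def by blast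
    \<comment> \<open>\<open>U'\<close> plus the \<open>A\<close>-span of the values of
      \<open>\<theta>\<close> on \<open>W\<close>. The values alone do not form an
      \<open>A\<close>-module, since \<open>\<theta>\<close> turns a scalar into its
      \<open>p\<close>-th power.\<close>
    define G where "G = (\<lambda>W. {t. \<exists>bs. set bs \<subseteq> W \<and> t \<in> cmb A U' (map \<theta> bs)})"
    have G_smod: "smod A (G W)" for W
      unfolding smod_def
    proof (intro conjI ballI)
      show "0 \<in> G W" unfolding G_def by (auto intro!: exI[of _ "[]"] simp: smod_0[OF U'])
    next
      fix a b assume "a \<in> G W" "b \<in> G W"
      then obtain as bs where ab: "a \<in> cmb A U' (map \<theta> as)" "b \<in> cmb A U' (map \<theta> bs)" "set as \<subseteq> W" "set bs \<subseteq> W"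
        unfolding G_def by blast
      let ?Z = "cmb A U' (map \<theta> (as @ bs))"
      have "a \<in> ?Z" by (rule subsetD[OF cmb_sub_mono[OF A rideal_smod[OF U'] order.refl order.refl] ab(1)]) auto
      moreover have "b \<in> ?Z" by (rule subsetD[OF cmb_sub_mono[OF A rideal_smod[OF U'] order.refl order.refl] ab(2)]) auto
      ultimately have "a + b \<in> ?Z" by (rule smod_add[OF cmb_smod'[OF A rideal_smod[OF U']]])
      then show "a + b \<in> G W" unfolding G_def using cmb_set_lift[OF ab(3,4)] by blast
    next
      fix k a assume "k \<in> A" "a \<in> G W"
      then show "k * a \<in> G W" unfolding G_def using smod_scale[OF cmb_smod'[OF A rideal_smod[OF U']]] by blast
    qed
    have G_base: "U' \<subseteq> G W" for W unfolding G_def by (auto intro!: exI[of _ "[]"])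
    have G_mem: "\<theta> b \<in> G W" if "b \<in> W" for b W
      unfolding G_def using cmb_mem[of "\<theta> b" "[\<theta> b]" A U'] A that smod_0[OF U'] by (auto intro!: exI[of _ "[b]"])
    have G_least: "G W \<subseteq> Z" if "smod A Z" "U' \<subseteq> Z" "\<And>b. b \<in> W \<Longrightarrow> \<theta> b \<in> Z" for W Z
    proof -
      have "cmb A U' (map \<theta> bs) \<subseteq> Z" if "set bs \<subseteq> W" for bs
        by (rule cmb_least) (use that \<open>smod A Z\<close> \<open>U' \<subseteq> Z\<close> \<open>\<And>b. b \<in> W \<Longrightarrow> \<theta> b \<in> Z\<close> in auto)
      then show ?thesis unfolding G_def by blast
    qed
    have nil: "\<exists>w. x ^ w * b \<in> W" if "x \<in> set xs" "U \<subseteq> W" for x b W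
    proof -
      have "(x ^ t0) ^ (p ^ (e0 + e)) \<in> U"
        unfolding U_def frobseq_def by (rule frob_cmb[OF P p p_mem]) (use t0 that in auto)
      then have "x ^ (t0 * p ^ (e0 + e)) * b \<in> W" using rideal_multr[OF U] that by (auto simp: power_mult)
      then show ?thesis by blast
    qed
    have flag: "dimle K (G UNIV) (G W) (p ^ length xs * k)" if "smod A W" "U \<subseteq> W" "dimle K UNIV W k" for W k
      using that
    proof (induction k arbitrary: W)
      case 0
      then have "W = UNIV" using dimle_0[of K UNIV W] by auto
      then show ?case by (simp add: dimle_refl)
    next
      case (Suc k)
      show ?case
      proof (cases "W = UNIV")
        case True
        then show ?thesis using dimle_mono[OF dimle_refl] by (meson order.refl zero_le)
      next
        case False
        then obtain b where b: "b \<notin> W" by blast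
        obtain r where r: "r \<notin> W" "\<forall>x\<in>set xs. x * r \<in> W"
          using ex_socle_element[OF Suc.prems(1) nil[OF _ Suc.prems(2)] b order.refl] by blast
        define W1 where "W1 = cmb A W [r]"
        have W1: "smod A W1" unfolding W1_def by (rule cmb_smod'[OF A Suc.prems(1)])
        have WW1: "W \<subseteq> W1" unfolding W1_def by (rule cmb_base[OF sring_0[OF A]])
        have rW1: "r \<in> W1" unfolding W1_def by (rule cmb_mem) (use A smod_0[OF Suc.prems(1)] in auto)
        obtain m1 k1 where mk: "dimle K UNIV W1 m1" "dimle K W1 W k1" "m1 + k1 = Suc k"
          using dimle_split[OF KP smod_mono[OF Suc.prems(1) KA] smod_mono[OF W1 KA] smod_UNIV _ WW1 _ Suc.prems(3)] PU Suc.prems(2)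
          by blast
        have "k1 \<noteq> 0" using mk(2) r(1) rW1 dimle_0[of K W1 W] by (metis subsetD)
        then have "m1 \<le> k" using mk(3) by simp
        then have d1: "dimle K UNIV W1 k" by (rule dimle_mono[OF mk(1)])
        have IH: "dimle K (G UNIV) (G W1) (p ^ length xs * k)"
          using Suc.IH[OF W1 _ d1] WW1 Suc.prems(2) by blast
        \<comment> \<open>\<open>G W1\<close> is contained in \<open>G W\<close> plus the multiples
          of \<open>\<theta> r\<close>. As \<open>x * r\<close> is in \<open>W\<close>, the element
          \<open>x ^ p * \<theta> r\<close> is in \<open>G W\<close>, so the layer is an image of
          \<open>A\<close> modulo the \<open>p\<close>-th powers of \<open>xs\<close>, which
          \<open>ms\<close> spans over \<open>K\<close>.\<close>
        have "dimle K (G W1) (G W) (p ^ length xs)"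
        proof -
          define Z' where "Z' = cmb A (G W) [\<theta> r]"
          define Z where "Z = cmb K (G W) (map (\<lambda>m. m * \<theta> r) ms)"
          have Z': "smod A Z'" unfolding Z'_def by (rule cmb_smod'[OF A G_smod])
          have GZ': "G W \<subseteq> Z'" unfolding Z'_def by (rule cmb_base[OF sring_0[OF A]])
          have rZ': "\<theta> r \<in> Z'" unfolding Z'_def by (rule cmb_mem) (use A smod_0[OF G_smod] in auto)
          have 1: "G W1 \<subseteq> Z'"
          proof (rule G_least[OF Z'])
            show "U' \<subseteq> Z'" using G_base GZ' by blast
            fix b assume "b \<in> W1"
            then obtain a w where b: "a \<in> A" "w \<in> W" "b = a * r + w"
              unfolding W1_def by (auto elim!: cmb_ConsE)
            have PZ': "P \<subseteq> Z'" using PU' G_base GZ' by blast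
            have "a ^ p * \<theta> r \<in> Z'" by (rule smod_scale[OF Z' sring_power[OF A b(1)] rZ'])
            then have "\<theta> (a * r) \<in> Z'"
              using \<theta>_scale[of a r] AS b(1) PZ' smod_cong[OF Z' A, of "\<theta> (a * r)" "a ^ p * \<theta> r"] by blast
            then have "\<theta> (a * r) + \<theta> w \<in> Z'" using G_mem[OF b(2)] GZ' smod_add[OF Z'] by blast
            then show "\<theta> b \<in> Z'"
              using \<theta>_add[of "a * r" w] PZ' smod_cong[OF Z' A, of "\<theta> (a * r + w)" "\<theta> (a * r) + \<theta> w"] b(3) by blast
          qed
          have 2: "Z' \<subseteq> Z"
          proof
            have ZK: "smod K Z" unfolding Z_def by (rule cmb_smod'[OF K smod_mono[OF G_smod KA]])
            fix t assume "t \<in> Z'"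
            then obtain a w where t: "a \<in> A" "w \<in> G W" "t = a * \<theta> r + w"
              unfolding Z'_def by (auto elim!: cmb_ConsE)
            have "\<theta> r * a \<in> cmb K (G W) (map ((*) (\<theta> r)) ms)"
            proof (rule cmb_times[of _ "cmb A {0} (map (\<lambda>x. x ^ p) xs)"])
              show "smod K (cmb A {0} (map (\<lambda>x. x ^ p) xs))"
                by (rule smod_mono[OF cmb_smod'[OF A smod_0_set] KA])
              show "a \<in> cmb K (cmb A {0} (map (\<lambda>x. x ^ p) xs)) ms" using ms t by blast
              fix u assume u: "u \<in> cmb A {0} (map (\<lambda>x. x ^ p) xs)"
              have "cmb A {0} (map (\<lambda>x. x ^ p) xs) \<subseteq> {u. \<theta> r * u \<in> G W}"
              proof (rule cmb_least)
                show "smod A {u. \<theta> r * u \<in> G W}"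
                  using G_smod[of W] unfolding smod_def by (auto simp: algebra_simps mult.left_commute[of "\<theta> r"])
                have "x ^ p * \<theta> r \<in> G W" if x: "x \<in> set xs" for x
                proof -
                  have "\<theta> (x * r) \<in> G W" using r(2) x G_mem by blast
                  moreover have "\<theta> (x * r) - x ^ p * \<theta> r \<in> G W"
                    using \<theta>_scale[of x r] x xsA AS PU' G_base[of W] by blast
                  ultimately show ?thesis using smod_cong[OF G_smod A] by blast
                qed
                then show "set (map (\<lambda>x. x ^ p) xs) \<subseteq> {u. \<theta> r * u \<in> G W}" by (auto simp: mult.commute)
              qed (use smod_0[OF G_smod] in auto)
              then show "\<theta> r * u \<in> G W" using u by blast
            qed
            moreover have "(*) (\<theta> r) = (\<lambda>m. m * \<theta> r)" by (auto simp: mult.commute)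
            ultimately have "a * \<theta> r \<in> Z" unfolding Z_def by (simp only: mult.commute[of "\<theta> r" a])
            moreover have "w \<in> Z" unfolding Z_def using cmb_base[OF sring_0[OF K]] t(2) by blast
            ultimately show "t \<in> Z" unfolding t(3) by (rule smod_add[OF ZK])
          qed
          show ?thesis unfolding dimle_def using 1 2 ms(2) unfolding Z_def
            by (intro exI[of _ "map (\<lambda>m. m * \<theta> r) ms"]) auto
        qed
        from dimle_trans[OF IH this] show ?thesis by (simp add: algebra_simps)
      qed
    qed
    have "dimle K (G UNIV) (G U) (p ^ length xs * n)"
      by (rule flag[OF rideal_smod[OF U] order.refl]) (use dim in \<open>simp add: U_def\<close>)
    moreover have "G U \<subseteq> U'" by (rule G_least[OF rideal_smod[OF U'] order.refl \<theta>U])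
    ultimately have G1: "dimle K (G UNIV) U' (p ^ length xs * n)" by (rule dimle_subset[OF _ order.refl])
    have G2: "c' * b \<in> G UNIV" for b
    proof -
      note GS = G_smod[of UNIV]
      have PG: "P \<subseteq> G UNIV" using PU' G_base by blast
      have unit: "s ^ p * c1 * g * ts ! i \<in> G UNIV" if g: "g \<in> S" and i: "i < m" for g i
      proof -
        have h: "s ^ p * h ^ p * ts ! i \<in> G UNIV" if h: "h \<in> S" for h
        proof -
          have sh: "s * h \<in> S" using s h sring_mult[OF S] by blast
          have "(\<Sum>j<m. (if j = i then s * h else 0) * ts ! j) = (\<Sum>j<m. if j = i then s * h * ts ! j else 0)"
            by (rule sum.cong) auto
          also have "\<dots> = s * h * ts ! i" using i by (simp add: sum.delta)
          finally have e1: "(\<Sum>j<m. (if j = i then s * h else 0) * ts ! j) = s * h * ts ! i" .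
          have "\<theta> (h * ts ! i) - (\<Sum>j<m. (if j = i then s * h else 0) ^ p * ts ! j) \<in> P"
            by (rule coord) (use sh sring_0[OF S] smod_0[OF P] in \<open>auto simp: e1 mult.assoc\<close>)
          moreover have "(\<Sum>j<m. (if j = i then s * h else 0) ^ p * ts ! j) = (\<Sum>j<m. if j = i then (s * h) ^ p * ts ! j else 0)"
            using prime_gt_0_nat[OF p] by (intro sum.cong) (auto simp: power_0_left)
          moreover have "\<dots> = (s * h) ^ p * ts ! i" using i by (simp add: sum.delta)
          ultimately have "\<theta> (h * ts ! i) - (s * h) ^ p * ts ! i \<in> G UNIV" using PG by auto
          then show ?thesis using G_mem[of "h * ts ! i" UNIV] smod_cong[OF GS A, of "\<theta> (h * ts ! i)"]
            by (auto simp: power_mult_distrib)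
        qed
        have "W' \<subseteq> {w. s ^ p * w * ts ! i \<in> G UNIV}"
          unfolding W'_def
        proof (rule cmb_least)
          show "smod A {w. s ^ p * w * ts ! i \<in> G UNIV}"
            unfolding smod_def
          proof (intro conjI ballI; clarsimp)
            show "0 \<in> G UNIV" by (rule smod_0[OF GS])
            show "s ^ p * (a + b) * ts ! i \<in> G UNIV"
              if "s ^ p * a * ts ! i \<in> G UNIV" "s ^ p * b * ts ! i \<in> G UNIV" for a b
              using smod_add[OF GS that] by (simp add: algebra_simps)
            show "s ^ p * (k * a) * ts ! i \<in> G UNIV"
              if "k \<in> A" "s ^ p * a * ts ! i \<in> G UNIV" for k a
              using smod_scale[OF GS that] by (simp add: ac_simps)
          qed
          show "P \<subseteq> {w. s ^ p * w * ts ! i \<in> G UNIV}"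
            using PG rideal_multl[OF P] rideal_multr[OF P] by blast
          have "v ^ q0 \<in> S" for v unfolding S_def by (rule powspan_mem)
          then show "set (map (\<lambda>v. (v ^ q0) ^ p) vs) \<subseteq> {w. s ^ p * w * ts ! i \<in> G UNIV}"
            using h by auto
        qed
        then have "s ^ p * (c1 * g) * ts ! i \<in> G UNIV" using c1S[OF g] by blast
        then show ?thesis by (simp add: mult.assoc)
      qed
      have "(\<Sum>i<m. s ^ p * c1 * \<sigma> b i * ts ! i) \<in> G UNIV"
        using unit \<sigma>(1) by (intro smod_sum[OF GS]) auto
      then have "s ^ p * c1 * (\<Sum>i<m. \<sigma> b i * ts ! i) \<in> G UNIV" by (simp add: sum_distrib_left mult.assoc)
      moreover have "s ^ p * c1 * (s * b - (\<Sum>i<m. \<sigma> b i * ts ! i)) \<in> G UNIV"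
        using rideal_multl[OF P \<sigma>(2)] PG by blast
      ultimately have "s ^ p * c1 * (s * b - (\<Sum>i<m. \<sigma> b i * ts ! i)) + s ^ p * c1 * (\<Sum>i<m. \<sigma> b i * ts ! i) \<in> G UNIV"
        using smod_add[OF GS] by blast
      then show ?thesis unfolding c'_def by (simp add: algebra_simps)
    qed
    have "cmb UNIV U' [c'] \<subseteq> G UNIV"
    proof
      fix t assume "t \<in> cmb UNIV U' [c']"
      then obtain k w where "w \<in> U'" "t = k * c' + w" by (auto elim!: cmb_ConsE)
      then show "t \<in> G UNIV"
        using smod_add[OF G_smod G2[of k] subsetD[OF G_base, of w UNIV]] by (simp add: mult.commute)
    qed
    then have d1: "dimle K (cmb UNIV U' [c']) U' (p ^ length xs * n)" by (rule dimle_subset[OF G1 _ order.refl])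
    obtain k where k: "dimle K UNIV (cmb UNIV U' [c']) k"
      "k * p ^ (e0 + Suc e) \<le> C * (p ^ (e0 + Suc e)) ^ length xs"
      using C[of "e0 + Suc e"] unfolding U'_def by blast
    have "dimle K UNIV U' (p ^ length xs * n + k)"
      using dimle_trans[OF k(1) d1] by (simp only: add.commute)
    then show ?thesis using k(2) unfolding U'_def by blast
  qed
  then show ?thesis by blast
qed

end

text \<open>Adding the tail \<open>2 * C * (1/2) ^ e\<close> of the error series makes the sequence
  decreasing.\<close>

lemma convergent_quasi_decreasing:
  fixes a :: "nat \<Rightarrow> real"
  assumes "\<And>e. 0 \<le> a e" and "\<And>e. a (Suc e) \<le> a e + C * (1/2) ^ e"
  shows "convergent a"
proof -
  have C: "convergent (\<lambda>e. 2 * C * (1/2) ^ e)"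
    by (intro convergent_mult convergent_const) (auto intro!: convergentI LIMSEQ_power_zero)
  have dec: "decseq (\<lambda>e. a e + 2 * C * (1/2) ^ e)"
    by (rule decseq_SucI) (use assms(2) in \<open>simp add: algebra_simps\<close>)
  obtain B where B: "\<And>e. \<bar>2 * C * (1/2) ^ e\<bar> \<le> B"
    using convergent_imp_Bseq[OF C] unfolding Bseq_def by auto
  have "\<exists>Xx. (\<lambda>e. a e + 2 * C * (1/2) ^ e) \<longlonglongrightarrow> Xx"
  proof -
    have "- B \<le> a e + 2 * C * (1/2) ^ e" for e using assms(1)[of e] B[of e] by linarith
    then show ?thesis using decseq_convergent[OF dec] by metis
  qed
  then have "convergent (\<lambda>e. a e + 2 * C * (1/2) ^ e)" unfolding convergent_def .
  from convergent_diff[OF this C] show ?thesis by simp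
qed

text \<open>The factor \<open>p ^ d\<close> of the Frobenius step is absorbed by the normalisation,
  and its error term becomes at most a constant over \<open>2 ^ e\<close>.\<close>

theorem (in nndom) colength_converges:
  "convergent (\<lambda>e. real (cod K UNIV (F e)) / real (p ^ e) ^ length xs)"
proof -
  let ?d = "length xs"
  let ?a = "\<lambda>e. real (cod K UNIV (F e)) / real (p ^ e) ^ ?d"
  obtain e0 C where C: "\<And>e n. dimle K UNIV (F (e0 + e)) n \<Longrightarrow>
     \<exists>m. dimle K UNIV (F (e0 + Suc e)) (p ^ ?d * n + m) \<and> m * p ^ (e0 + Suc e) \<le> C * (p ^ (e0 + Suc e)) ^ ?d"
    using Frobenius_colength_step by blast
  have p2: "2 \<le> p" using prime_ge_2_nat[OF p] .
  have "convergent (\<lambda>e. ?a (e + e0))"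
  proof (rule convergent_quasi_decreasing)
    fix e
    show "0 \<le> ?a (e + e0)" by simp
    obtain n where "dimle K UNIV (F (e0 + e)) n" using finite_colength by blast
    then have "dimle K UNIV (F (e0 + e)) (cod K UNIV (F (e0 + e)))" by (rule dimle_cod)
    from C[OF this] obtain m where m: "dimle K UNIV (F (e0 + Suc e)) (p ^ ?d * cod K UNIV (F (e0 + e)) + m)"
      "m * p ^ (e0 + Suc e) \<le> C * (p ^ (e0 + Suc e)) ^ ?d" by blast
    define Q where "Q = real (p ^ (e0 + Suc e))"
    have Q: "Q > 0" using p2 unfolding Q_def by simp
    have le: "real (cod K UNIV (F (e0 + Suc e))) \<le> real p ^ ?d * cod K UNIV (F (e0 + e)) + m"
      using cod_le[OF m(1)] by (metis of_nat_add of_nat_le_iff of_nat_mult of_nat_power)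
    have "?a (e0 + Suc e) \<le> (real p ^ ?d * cod K UNIV (F (e0 + e)) + m) / Q ^ ?d"
      unfolding Q_def using le by (intro divide_right_mono) auto
    also have "\<dots> = ?a (e0 + e) + m / Q ^ ?d"
    proof -
      have "Q ^ ?d = real p ^ ?d * real (p ^ (e0 + e)) ^ ?d"
        unfolding Q_def by (simp add: power_mult_distrib[symmetric])
      then show ?thesis using p2 by (simp add: add_divide_distrib)
    qed
    also have "m / Q ^ ?d \<le> C / Q"
    proof -
      have "real m * Q \<le> C * Q ^ ?d" unfolding Q_def using m(2) by (metis of_nat_le_iff of_nat_mult of_nat_power)
      then show ?thesis using Q by (simp add: field_simps)
    qed
    also have "C / Q \<le> C * (1/2) ^ e"
    proof -
      have "(2::real) ^ e \<le> real p ^ e" using p2 by (intro power_mono) auto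
      also have "\<dots> \<le> real p ^ (e0 + Suc e)" using p2 by (intro power_increasing) auto
      also have "\<dots> = Q" unfolding Q_def by simp
      finally have "1 / Q \<le> 1 / 2 ^ e" by (intro divide_left_mono) (use Q in auto)
      then have "C * (1 / Q) \<le> C * (1 / 2 ^ e)" by (intro mult_left_mono) auto
      then show ?thesis by (simp add: power_one_over)
    qed
    finally show "?a (Suc e + e0) \<le> ?a (e + e0) + C * (1/2) ^ e" by (simp add: add.commute)
  qed
  then show ?thesis by (subst (asm) convergent_ignore_initial_segment)
qed

subsection \<open>Colengths of Frobenius powers modulo a radical ideal\<close>

text \<open>Differences that are smaller by a factor \<open>p ^ e\<close> disappear after
  normalisation. They need not be monotone or of one sign; two one-sided bounds suffice.\<close>

lemma convergent_close:
  fixes f g :: "nat \<Rightarrow> nat"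
  assumes p: "2 \<le> (p::nat)" and g: "convergent (\<lambda>e. real (g e) / real (p ^ e) ^ d)"
    and fg: "\<And>e. \<exists>n. f e \<le> g e + n \<and> n * p ^ e \<le> C * (p ^ e) ^ d"
    and gf: "\<And>e. \<exists>n. g e \<le> f e + n \<and> n * p ^ e \<le> D * (p ^ e) ^ d"
  shows "convergent (\<lambda>e. real (f e) / real (p ^ e) ^ d)"
proof -
  have small: "real x / real (p ^ e) ^ d - real y / real (p ^ e) ^ d \<le> B * (1/2) ^ e"
    if ex: "\<exists>n. x \<le> y + n \<and> n * p ^ e \<le> B * (p ^ e) ^ d" for x y B e :: nat
  proof -
    obtain n where n: "x \<le> y + n" "n * p ^ e \<le> B * (p ^ e) ^ d" using ex by blast
    define Q where "Q = real (p ^ e)"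
    have Q: "Q > 0" using p unfolding Q_def by simp
    have "real x / Q ^ d - real y / Q ^ d = (real x - real y) / Q ^ d" by (simp add: diff_divide_distrib)
    also have "\<dots> \<le> n / Q ^ d" using n(1) Q by (intro divide_right_mono) auto
    also have "\<dots> \<le> B / Q"
    proof -
      have "real n * Q \<le> B * Q ^ d" unfolding Q_def using n(2) by (metis of_nat_le_iff of_nat_mult of_nat_power)
      then show ?thesis using Q by (simp add: field_simps)
    qed
    also have "B / Q \<le> B * (1/2) ^ e"
    proof -
      have "(2::real) ^ e \<le> Q" unfolding Q_def using p by (simp add: power_mono)
      then have "1 / Q \<le> 1 / 2 ^ e" by (intro divide_left_mono) (use Q in auto)
      then have "B * (1 / Q) \<le> B * (1 / 2 ^ e)" by (intro mult_left_mono) auto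
      then show ?thesis by (simp add: power_one_over)
    qed
    finally show ?thesis unfolding Q_def .
  qed
  have "(\<lambda>e. real (f e) / real (p ^ e) ^ d - real (g e) / real (p ^ e) ^ d) \<longlonglongrightarrow> 0"
  proof (rule tendsto_sandwich)
    have z: "(\<lambda>e. real B * (1 / 2) ^ e) \<longlonglongrightarrow> 0" for B :: nat
      by (intro tendsto_mult_right_zero LIMSEQ_power_zero) auto
    show "\<forall>\<^sub>F e in sequentially. - (D * (1/2) ^ e) \<le> real (f e) / real (p ^ e) ^ d - real (g e) / real (p ^ e) ^ d"
      using small[OF gf] by (intro always_eventually allI) (simp add: algebra_simps)
    show "\<forall>\<^sub>F e in sequentially. real (f e) / real (p ^ e) ^ d - real (g e) / real (p ^ e) ^ d \<le> C * (1/2) ^ e"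
      using small[OF fg] by (intro always_eventually allI) simp
    show "(\<lambda>e. - (real D * (1 / 2) ^ e)) \<longlonglongrightarrow> 0" using tendsto_minus[OF z[of D]] by simp
    show "(\<lambda>e. real C * (1 / 2) ^ e) \<longlonglongrightarrow> 0" by (rule z)
  qed
  then have "convergent (\<lambda>e. real (f e) / real (p ^ e) ^ d - real (g e) / real (p ^ e) ^ d)"
    unfolding convergent_def by blast
  from convergent_add[OF this g] show ?thesis by simp
qed

text \<open>Multiplication by \<open>a\<close> maps the quotient by \<open>J\<close> onto this
  cyclic module.\<close>

lemma dimle_cyclic:
  assumes K: "sring K" and m: "dimle K UNIV J m" and J: "smod K J" "rideal J'" and aJ: "\<And>u. u \<in> J \<Longrightarrow> a * u \<in> J'"
  shows "dimle K (cmb UNIV J' [a]) J' m"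
proof -
  obtain vs where vs: "length vs \<le> m" "UNIV \<subseteq> cmb K J vs" using m unfolding dimle_def by blast
  have "cmb UNIV J' [a] \<subseteq> cmb K J' (map ((*) a) vs)"
  proof
    fix t assume "t \<in> cmb UNIV J' [a]"
    then obtain k w where t: "w \<in> J'" "t = k * a + w" by (auto elim!: cmb_ConsE)
    have "a * k \<in> cmb K J' (map ((*) a) vs)" by (rule cmb_times[OF J(1) _ aJ]) (use vs in auto)
    moreover have "w \<in> cmb K J' (map ((*) a) vs)" using t cmb_base[OF sring_0[OF K]] by blast
    ultimately have "a * k + w \<in> cmb K J' (map ((*) a) vs)"
      by (rule smod_add[OF cmb_smod'[OF K rideal_smod[OF J(2)]]])
    then show "t \<in> cmb K J' (map ((*) a) vs)" unfolding t(2) by (simp add: mult.commute)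
  qed
  then show ?thesis unfolding dimle_def using vs(1) by (intro exI[of _ "map ((*) a) vs"]) auto
qed

locale nnring = nnbase NN K A xs us gs p for NN K A :: "'b::comm_ring_1 set" and xs us gs p
begin

definition NI :: "'b set \<Rightarrow> nat \<Rightarrow> nat" where
  "NI I e = cod K UNIV (frobseq p I gs e)"

text \<open>The quotient by \<open>I\<close> is torsion-free over \<open>A\<close>.\<close>

definition tclosed :: "'b set \<Rightarrow> bool" where
  "tclosed I \<longleftrightarrow> (\<forall>a\<in>A - NN. \<forall>t. a * t \<in> I \<longrightarrow> t \<in> I)"

definition radical :: "'b set \<Rightarrow> bool" where
  "radical I \<longleftrightarrow> (\<forall>t n. t ^ n \<in> I \<longrightarrow> n \<noteq> 0 \<longrightarrow> t \<in> I)"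

definition conv :: "'b set \<Rightarrow> bool" where
  "conv I \<longleftrightarrow> convergent (\<lambda>e. real (NI I e) / real (p ^ e) ^ length xs)"

lemma frobseq_mono: "I \<subseteq> J \<Longrightarrow> frobseq p I gs e \<subseteq> frobseq p J gs e"
  unfolding frobseq_def by (rule cmb_mono) auto

lemma frobseq_pow: "rideal I \<Longrightarrow> g \<in> set gs \<Longrightarrow> g ^ (p ^ e) \<in> frobseq p I gs e"
  unfolding frobseq_def by (rule cmb_mem) (auto dest: smod_0)

lemma frobseq_times:
  assumes "rideal I" "rideal J" "\<And>u. u \<in> I \<Longrightarrow> a * u \<in> frobseq p J gs e" "u \<in> frobseq p I gs e"
  shows "a * u \<in> frobseq p J gs e"
proof -
  have "cmb UNIV I (map (\<lambda>g. g ^ (p ^ e)) gs) \<subseteq> {u. a * u \<in> frobseq p J gs e}"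
  proof (rule cmb_least)
    show "rideal {u. a * u \<in> frobseq p J gs e}"
      using frobseq_rideal[OF assms(2), of p gs e] unfolding smod_def by (auto simp: algebra_simps mult.left_commute[of a])
    show "set (map (\<lambda>g. g ^ p ^ e) gs) \<subseteq> {u. a * u \<in> frobseq p J gs e}"
      using frobseq_pow[OF assms(2)] rideal_multl[OF frobseq_rideal[OF assms(2)]] by auto
  qed (use assms in auto)
  then show ?thesis using assms(4) unfolding frobseq_def[of p I] by blast
qed

lemma finite_NI: "NN \<subseteq> I \<Longrightarrow> rideal I \<Longrightarrow> dimle K UNIV (frobseq p I gs e) (NI I e)"
  using finite_colength dimle_subset[OF _ order.refl frobseq_mono[of NN I e]] dimle_cod unfolding NI_def by blast

lemma pdomA_proper: "rideal I \<Longrightarrow> NN \<subseteq> I \<Longrightarrow> 1 \<notin> I \<Longrightarrow> A \<inter> I \<subseteq> NN \<Longrightarrow> pdom A I"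
  using pdomA sring_mult[of A] unfolding pdom_def by (meson IntI subsetD)

lemma tclosed_A: "rideal I \<Longrightarrow> tclosed I \<Longrightarrow> 1 \<notin> I \<Longrightarrow> A \<inter> I \<subseteq> NN"
  unfolding tclosed_def by (metis DiffI IntE mult.right_neutral subsetI)

lemma us': "NN \<subseteq> I \<Longrightarrow> UNIV = cmb A I us"
  using us cmb_mono[of A A NN I us] by blast

text \<open>If \<open>I\<close> contains an element of \<open>A\<close> outside \<open>NN\<close>,
  that element kills everything. Otherwise some \<open>a\<close> brings every element into the span
  of a maximal independent list, and there torsion elements vanish.\<close>

lemma uniform_torsion:
  assumes I: "rideal I" "NN \<subseteq> I"
  shows "\<exists>a\<in>A - NN. \<forall>t. (\<exists>b\<in>A - NN. b * t \<in> I) \<longrightarrow> a * t \<in> I"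
proof (cases "A \<inter> I \<subseteq> NN")
  case False
  then show ?thesis using rideal_multr[OF I(1)] by blast
next
  case True
  then have I1: "1 \<notin> I" using P1 sring_1[OF A] by blast
  note D = pdomA_proper[OF I I1 True]
  have "length ts \<le> length us" if "lindep A I ts" for ts
    using dep_of_gens[OF D, of ts us] us'[OF I(2)] that by (metis not_le subset_UNIV)
  then obtain ts where ts: "lindep A I ts" "\<And>t. \<not> lindep A I (t # ts)"
    using ex_max_list[of "lindep A I" "length us"] by auto
  let ?V = "cmb A I ts"
  have V: "smod A ?V" by (rule cmb_smod'[OF A rideal_smod[OF I(1)]])
  have IV: "I \<subseteq> ?V" by (rule cmb_base[OF sring_0[OF A]])
  obtain a where a: "a \<in> A - I" "\<forall>u\<in>set us. a * u \<in> ?V"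
    using common_multiple[OF D V, of us "\<lambda>u. u"] lindep_Cons_dep[OF D ts(1) ts(2)] by blast
  have "cmb A I us \<subseteq> {t. a * t \<in> ?V}"
  proof (rule cmb_least)
    show "smod A {t. a * t \<in> ?V}"
      using V unfolding smod_def by (auto simp: algebra_simps mult.left_commute[of a])
  qed (use a IV rideal_multl[OF I(1)] in auto)
  then have aV: "a * t \<in> ?V" for t using us'[OF I(2)] by blast
  have "a * t \<in> I" if b: "b \<in> A - NN" "b * t \<in> I" for b t
  proof -
    obtain c where c: "\<forall>i<length ts. c i \<in> A" "a * t - (\<Sum>i<length ts. c i * ts ! i) \<in> I"
      using aV[of t] unfolding cmb_iff by blast
    have "b * (a * t) - b * (a * t - (\<Sum>i<length ts. c i * ts ! i)) \<in> I"
      using rideal_diff[OF I(1) rideal_multl[OF I(1) b(2), of a] rideal_multl[OF I(1) c(2), of b]]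
      by (simp add: algebra_simps)
    then have "(\<Sum>i<length ts. (b * c i) * ts ! i) \<in> I"
      by (simp add: algebra_simps sum_distrib_left)
    then have "b * c i \<in> I" if "i < length ts" for i
      using lindepD[OF ts(1), of "\<lambda>i. b * c i"] c(1) b(1) sring_mult[OF A] that by auto
    then have "c i \<in> I" if "i < length ts" for i
      using pdom_mult[OF D, of b "c i"] b(1) True c(1) that by blast
    then have "(\<Sum>i<length ts. c i * ts ! i) \<in> I" by (intro smod_sum[OF I(1)] rideal_multr[OF I(1)]) auto
    then show "a * t \<in> I" using smod_cong[OF I(1) sring_UNIV c(2)] by blast
  qed
  then show ?thesis using a(1) I(2) by blast
qed

definition tc :: "'b set \<Rightarrow> 'b set" where
  "tc I = {t. \<exists>b\<in>A - NN. b * t \<in> I}"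

lemma tc_ideal: assumes I: "rideal I" shows "rideal (tc I)"
  unfolding smod_def
proof (intro conjI ballI)
  show "0 \<in> tc I" unfolding tc_def using smod_0[OF I] pdom_1_mem[OF pdomA] by auto
next
  fix b d assume "b \<in> tc I" "d \<in> tc I"
  then obtain a c where *: "a \<in> A - NN" "c \<in> A - NN" "a * b \<in> I" "c * d \<in> I" unfolding tc_def by blast
  have "(a * c) * (b + d) = c * (a * b) + a * (c * d)" by (simp add: algebra_simps)
  then have "(a * c) * (b + d) \<in> I"
    using smod_add[OF I rideal_multl[OF I *(3), of c] rideal_multl[OF I *(4), of a]] by simp
  then show "b + d \<in> tc I" unfolding tc_def using pdom_mult[OF pdomA *(1,2)] by blast
next
  fix k b assume "b \<in> tc I"
  then obtain a where *: "a \<in> A - NN" "a * b \<in> I" unfolding tc_def by blast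
  then show "k * b \<in> tc I" unfolding tc_def using rideal_multl[OF I *(2), of k] by (auto simp: mult.left_commute)
qed

lemma tc_tclosed: "tclosed (tc I)"
  unfolding tclosed_def tc_def
proof (intro ballI allI impI)
  fix a t assume a: "a \<in> A - NN" "a * t \<in> {t. \<exists>b\<in>A - NN. b * t \<in> I}"
  then obtain b where "b \<in> A - NN" "b * (a * t) \<in> I" by blast
  then show "t \<in> {t. \<exists>b\<in>A - NN. b * t \<in> I}"
    using pdom_mult[OF pdomA _ a(1), of b] by (auto simp: mult.assoc intro!: bexI[of _ "b * a"])
qed

lemma tc_base: "I \<subseteq> tc I" unfolding tc_def using pdom_1_mem[OF pdomA] by (auto intro!: bexI[of _ 1])

lemma tc_radical: assumes I: "rideal I" "radical I" shows "radical (tc I)"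
  unfolding radical_def tc_def
proof (clarsimp)
  fix t n b assume *: "b * t ^ n \<in> I" "0 < n" "b \<in> A" "b \<notin> NN"
  then obtain k where k: "n = Suc k" by (cases n) auto
  have "(b * t) ^ n = b ^ k * (b * t ^ n)" unfolding power_mult_distrib k by (simp add: algebra_simps)
  then have "(b * t) ^ n \<in> I" using rideal_multl[OF I(1) *(1)] by simp
  then show "\<exists>b\<in>A - NN. b * t \<in> I" using I(2) * unfolding radical_def by blast
qed

text \<open>Since \<open>a\<close> maps \<open>tc I\<close> into \<open>I\<close>, the part below
  \<open>a\<close> is an image of the quotient for \<open>tc I\<close>, while the part above
  \<open>a\<close> has small colength. So discarding torsion does not change the limit.\<close>

lemma conv_tc:
  assumes I: "rideal I" "NN \<subseteq> I" and c: "conv (tc I)" shows "conv I"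
proof -
  obtain a where a: "a \<in> A - NN" "\<And>t. t \<in> tc I \<Longrightarrow> a * t \<in> I"
    using uniform_torsion[OF I] unfolding tc_def by blast
  obtain C where C: "\<And>e. \<exists>n. dimle K UNIV (cmb UNIV (F e) [a]) n \<and> n * p ^ e \<le> C * (p ^ e) ^ length xs"
    using small_A[OF a(1)] by blast
  have tcI: "rideal (tc I)" "NN \<subseteq> tc I" using tc_ideal[OF I(1)] tc_base I(2) by auto
  have "NI I e \<le> NI (tc I) e + n" if n: "dimle K UNIV (cmb UNIV (F e) [a]) n" for e n
  proof -
    let ?J = "frobseq p I gs e"
    have "dimle K UNIV (cmb UNIV ?J [a]) n"
      by (rule dimle_subset[OF n order.refl cmb_mono[OF order.refl frobseq_mono[OF I(2)]]])
    moreover have "dimle K (cmb UNIV ?J [a]) ?J (NI (tc I) e)"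
    proof (rule dimle_cyclic[OF K finite_NI[OF tcI(2,1)] rideal_smod[OF frobseq_rideal[OF tcI(1)]] frobseq_rideal[OF I(1)]])
      show "a * u \<in> ?J" if "u \<in> frobseq p (tc I) gs e" for u
        by (rule frobseq_times[OF tcI(1) I(1) _ that]) (use a(2) frobseq_base in blast)
    qed
    ultimately have "dimle K UNIV ?J (n + NI (tc I) e)" by (rule dimle_trans)
    then show ?thesis using cod_le unfolding NI_def by (simp add: add.commute)
  qed
  then have 1: "\<exists>n. NI I e \<le> NI (tc I) e + n \<and> n * p ^ e \<le> C * (p ^ e) ^ length xs" for e
    using C by blast
  have "NI (tc I) e \<le> NI I e" for e
    using dimle_subset[OF finite_NI[OF I(2,1)] order.refl frobseq_mono[OF tc_base]] cod_le unfolding NI_def by blast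
  then have 2: "\<exists>n. NI (tc I) e \<le> NI I e + n \<and> n * p ^ e \<le> 0 * (p ^ e) ^ length xs" for e
    by (intro exI[of _ 0]) auto
  show ?thesis unfolding conv_def
    by (rule convergent_close[OF prime_ge_2_nat[OF p] c[unfolded conv_def] 1 2])
qed

lemma nndomI:
  assumes "rideal I" "NN \<subseteq> I" "1 \<notin> I" "tclosed I" "\<And>a b. a * b \<in> I \<Longrightarrow> a \<in> I \<or> b \<in> I"
  shows "nndom I K A xs us gs p"
proof (unfold_locales)
  show "pdom A I" by (rule pdomA_proper[OF assms(1-3) tclosed_A[OF assms(1,4,3)]])
  show "fmod K I" by (rule fmod_mono[OF KP assms(2,1)])
  have m: "cmb UNIV NN L \<subseteq> cmb UNIV I L" for L using assms(2) by (intro cmb_mono) auto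
  show "(\<exists>b. c * b - 1 \<in> I) \<or> (\<exists>ys. length ys < length xs \<and> (\<forall>x\<in>set xs. \<exists>w. x ^ w \<in> cmb UNIV I (c # ys)) \<and>
         (\<forall>y\<in>set ys. \<exists>w. y ^ w \<in> cmb UNIV I xs))" if "c \<in> A - I" for c
  proof -
    have "c \<in> A - NN" using that assms(2) by blast
    from A2[OF this] show ?thesis
    proof (elim disjE exE conjE)
      fix b assume "c * b - 1 \<in> NN"
      then show ?thesis using assms(2) by blast
    next
      fix ys assume ys: "length ys < length xs" "\<forall>x\<in>set xs. \<exists>w. x ^ w \<in> cmb UNIV NN (c # ys)"
        "\<forall>y\<in>set ys. \<exists>w. y ^ w \<in> cmb UNIV NN xs"
      have "\<forall>x\<in>set xs. \<exists>w. x ^ w \<in> cmb UNIV I (c # ys)" using ys(2) subsetD[OF m] by blast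
      moreover have "\<forall>y\<in>set ys. \<exists>w. y ^ w \<in> cmb UNIV I xs" using ys(3) subsetD[OF m] by blast
      ultimately show ?thesis using ys(1) by blast
    qed
  qed
  show "\<exists>w. x ^ w \<in> cmb UNIV I gs" if "x \<in> set xs" for x using gs[OF that] subsetD[OF m] by blast
qed (use KA xsA A_gen us'[OF assms(2)] p p_mem assms in auto)

text \<open>The rank over \<open>A\<close> of the quotient by \<open>I\<close>. It is the induction
  measure for splitting off primes, and its strict decrease replaces the ascending chain
  condition.\<close>

definition rk :: "'b set \<Rightarrow> nat" where
  "rk I = (GREATEST n. \<exists>ts. length ts = n \<and> lindep A I ts)"

lemma rk_props:
  assumes "rideal I" "NN \<subseteq> I" "1 \<notin> I" "tclosed I"
  shows "\<exists>ts. length ts = rk I \<and> lindep A I ts" "lindep A I ts \<Longrightarrow> length ts \<le> rk I"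
proof -
  note D = pdomA_proper[OF assms(1-3) tclosed_A[OF assms(1,4,3)]]
  have b: "\<And>n. \<exists>ts. length ts = n \<and> lindep A I ts \<Longrightarrow> n \<le> length us"
    using dep_of_gens[OF D, of _ us] us'[OF assms(2)] by (metis not_le subset_UNIV)
  show "\<exists>ts. length ts = rk I \<and> lindep A I ts"
    unfolding rk_def by (rule GreatestI_ex_nat[OF _ b]) (auto intro!: exI[of _ "[]"])
  show "lindep A I ts \<Longrightarrow> length ts \<le> rk I"
    unfolding rk_def by (rule Greatest_le_nat[OF _ b]) auto
qed

text \<open>An element \<open>b\<close> of \<open>J\<close> outside \<open>I\<close> extends a list
  that is independent modulo \<open>J\<close>. Modulo \<open>J\<close> it drops out of a relation,
  so the other coefficients vanish; torsion-freeness modulo \<open>I\<close> then kills its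
  own.\<close>

lemma rk_strict:
  assumes I: "rideal I" "NN \<subseteq> I" "tclosed I" and J: "rideal J" "1 \<notin> J" "tclosed J" and IJ: "I \<subset> J"
  shows "rk J < rk I"
proof -
  have NJ: "NN \<subseteq> J" and I1: "1 \<notin> I" using I IJ J by auto
  obtain ts where ts: "length ts = rk J" "lindep A J ts" using rk_props(1)[OF J(1) NJ J(2,3)] by blast
  obtain b where b: "b \<in> J" "b \<notin> I" using IJ by blast
  have "lindep A I (b # ts)"
    unfolding lindep_def
  proof (intro allI impI)
    fix c i assume c: "\<forall>i<length (b # ts). c i \<in> A" "(\<Sum>i<length (b # ts). c i * (b # ts) ! i) \<in> I" "i < length (b # ts)"
    have s: "c 0 * b + (\<Sum>i<length ts. c (Suc i) * ts ! i) \<in> I"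
      using c(2) by (simp add: sum.lessThan_Suc_shift del: sum.lessThan_Suc)
    then have "(\<Sum>i<length ts. c (Suc i) * ts ! i) \<in> J"
      using IJ rideal_diff[OF J(1) _ rideal_multl[OF J(1) b(1), of "c 0"], of "c 0 * b + (\<Sum>i<length ts. c (Suc i) * ts ! i)"] by auto
    then have "c (Suc i) \<in> J" if "i < length ts" for i
      using lindepD[OF ts(2), of "\<lambda>i. c (Suc i)"] c(1) that by auto
    then have "c (Suc i) \<in> A \<inter> J" if "i < length ts" for i
      using c(1) that by auto
    then have cs: "c (Suc i) \<in> I" if "i < length ts" for i
      using tclosed_A[OF J(1,3,2)] I(2) that by blast
    then have "(\<Sum>i<length ts. c (Suc i) * ts ! i) \<in> I"
      by (intro smod_sum[OF I(1)] rideal_multr[OF I(1)]) auto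
    then have "c 0 * b \<in> I" using rideal_diff[OF I(1) s] by fastforce
    then have "c 0 \<in> NN" using I(3) b(2) c(1) unfolding tclosed_def by auto
    then show "c i \<in> I" using cs I(2) c(3) by (cases i) auto
  qed
  then show ?thesis using rk_props(2)[OF I(1,2) I1 I(3), of "b # ts"] ts(1) by simp
qed

text \<open>The quotient by \<open>I\<close> embeds into the product of those by \<open>Q\<close>
  and \<open>C\<close> with a cokernel killed by \<open>a\<close>, because \<open>a\<close> is the
  sum of \<open>f * g\<close> in \<open>C\<close> and of an element of \<open>Q\<close>. Hence the
  colengths add up to an error bounded by \<open>small_A\<close>.\<close>

lemma conv_split:
  assumes I: "rideal I" "NN \<subseteq> I" and Q: "rideal Q" "I \<subseteq> Q" and C: "rideal C" "I \<subseteq> C" "Q \<inter> C \<subseteq> I"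
    and QC: "\<And>s t. s \<in> Q \<Longrightarrow> t \<in> C \<Longrightarrow> s * t \<in> I" and f: "f \<in> C" "\<And>s. s \<in> Q \<Longrightarrow> f * s \<in> I"
    and a: "a \<in> A - NN" "a - f * g \<in> Q"
    and conv: "conv Q" "conv C"
  shows "conv I"
proof -
  obtain D where D: "\<And>e. \<exists>n. dimle K UNIV (cmb UNIV (F e) [a]) n \<and> n * p ^ e \<le> D * (p ^ e) ^ length xs"
    using small_A[OF a(1)] by blast
  define \<beta> where "\<beta> = a - f * g"
  have NQ: "NN \<subseteq> Q" and NC: "NN \<subseteq> C" using I Q C by auto
  have up: "NI I e \<le> NI Q e + NI C e + n" if n: "dimle K UNIV (cmb UNIV (F e) [a]) n" for e n
  proof -
    let ?I = "frobseq p I gs e"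
    \<comment> \<open>Upper bound: \<open>\<beta>\<close> lies in \<open>Q\<close>, so it multiplies
      \<open>C\<close> into \<open>I\<close>, and \<open>f\<close> multiplies \<open>Q\<close> into
      \<open>I\<close>. Adjoining first \<open>\<beta>\<close> and then \<open>f\<close> costs the
      two colengths, and the ideal reached contains \<open>a = f * g + \<beta>\<close>.\<close>
    define J1 where "J1 = cmb UNIV ?I [\<beta>]"
    define J2 where "J2 = cmb UNIV J1 [f]"
    have rI: "rideal ?I" by (rule frobseq_rideal[OF I(1)])
    have r1: "rideal J1" unfolding J1_def by (rule cmb_rideal[OF rI])
    have r2: "rideal J2" unfolding J2_def by (rule cmb_rideal[OF r1])
    have I1: "?I \<subseteq> J1" unfolding J1_def by (rule cmb_base) simp
    have I2: "J1 \<subseteq> J2" unfolding J2_def by (rule cmb_base) simp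
    have "cmb UNIV (F e) [a] \<subseteq> J2"
    proof (rule cmb_least[OF r2])
      show "F e \<subseteq> J2" using I1 I2 frobseq_mono[OF I(2)] by blast
      have "\<beta> \<in> J2" using I2 unfolding J1_def by (intro subsetD[OF I2[unfolded J1_def]] cmb_mem) (use smod_0[OF rI] in auto)
      moreover have "f \<in> J2" unfolding J2_def by (intro cmb_mem) (use smod_0[OF r1] in auto)
      ultimately have "f * g + \<beta> \<in> J2" by (intro smod_add[OF r2] rideal_multr[OF r2])
      then show "set [a] \<subseteq> J2" unfolding \<beta>_def by simp
    qed
    then have d1: "dimle K UNIV J2 n" by (rule dimle_subset[OF n order.refl])
    have d2: "dimle K J2 J1 (NI Q e)" unfolding J2_def
    proof (rule dimle_cyclic[OF K finite_NI[OF NQ Q(1)] rideal_smod[OF frobseq_rideal[OF Q(1)]] r1])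
      show "f * u \<in> J1" if "u \<in> frobseq p Q gs e" for u
        using frobseq_times[OF Q(1) I(1) _ that, of f] f(2) frobseq_base I1 by blast
    qed
    have d3: "dimle K J1 ?I (NI C e)" unfolding J1_def
    proof (rule dimle_cyclic[OF K finite_NI[OF NC C(1)] rideal_smod[OF frobseq_rideal[OF C(1)]] rI])
      show "\<beta> * u \<in> ?I" if "u \<in> frobseq p C gs e" for u
        using frobseq_times[OF C(1) I(1) _ that, of \<beta>] QC a(2) frobseq_base unfolding \<beta>_def by blast
    qed
    have "dimle K UNIV ?I (n + NI Q e + NI C e)" by (rule dimle_trans[OF dimle_trans[OF d1 d2] d3])
    then show ?thesis using cod_le unfolding NI_def by fastforce
  qed
  have lo: "NI Q e + NI C e \<le> NI I e + n" if n: "dimle K UNIV (cmb UNIV (F e) [a]) n" for e n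
  proof -
    \<comment> \<open>Lower bound: the colengths of \<open>U\<close> and \<open>V\<close> add up to
      those of their sum and intersection. The sum contains \<open>a\<close>, so its colength is
      small; the intersection contains the Frobenius power for \<open>I\<close>.\<close>
    define U V where "U = frobseq p Q gs e" and "V = frobseq p C gs e"
    have rU: "rideal U" and rV: "rideal V" unfolding U_def V_def using frobseq_rideal Q(1) C(1) by auto
    define Xx where "Xx = U + V"
    have rX: "rideal Xx" unfolding Xx_def by (rule smod_set_plus[OF rU rV])
    have UX: "U \<subseteq> Xx" and VX: "V \<subseteq> Xx" unfolding Xx_def
      by (rule set_plus_upper1[OF smod_0[OF rV]], rule set_zero_plus2[OF smod_0[OF rU]])
    have NU: "NN \<subseteq> U" and NV: "NN \<subseteq> V" unfolding U_def V_def using NQ NC frobseq_base by blast+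
    have "cmb UNIV (F e) [a] \<subseteq> Xx"
    proof (rule cmb_least[OF rX])
      show "F e \<subseteq> Xx" using UX frobseq_mono[OF NQ] unfolding U_def by blast
      have "f * g \<in> Xx" using rideal_multr[OF C(1) f(1)] VX frobseq_base unfolding V_def by blast
      moreover have "a - f * g \<in> Xx" using a(2) UX frobseq_base unfolding U_def by blast
      ultimately show "set [a] \<subseteq> Xx" using smod_add[OF rX] by fastforce
    qed
    then have cX: "cod K UNIV Xx \<le> n" by (intro cod_le dimle_subset[OF n order.refl])
    have dU: "dimle K UNIV U (NI Q e)" and dV: "dimle K UNIV V (NI C e)"
      unfolding U_def V_def by (rule finite_NI[OF NQ Q(1)], rule finite_NI[OF NC C(1)])
    have IUV: "frobseq p I gs e \<subseteq> U \<inter> V" unfolding U_def V_def using frobseq_mono Q(2) C(2) by blast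
    have dUV: "dimle K UNIV (U \<inter> V) (NI I e)"
      by (rule dimle_subset[OF finite_NI[OF I(2,1)] order.refl IUV])
    have rUV: "rideal (U \<inter> V)" by (rule smod_Int[OF rU rV])
    have e1: "cod K UNIV U = cod K UNIV Xx + cod K Xx U"
      by (rule cod_add[OF KP rideal_smod[OF rU] rideal_smod[OF rX] smod_UNIV NU UX _ dU]) simp
    have e2: "cod K UNIV (U \<inter> V) = cod K UNIV V + cod K V (U \<inter> V)"
      by (rule cod_add[OF KP rideal_smod[OF rUV] rideal_smod[OF rV] smod_UNIV _ _ _ dUV]) (use NU NV in auto)
    obtain k where "dimle K V (U \<inter> V) k" using dimle_subset[OF dUV _ order.refl] by blast
    then have "dimle K V (U \<inter> V) (cod K V (U \<inter> V))" by (rule dimle_cod)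
    then obtain vs where vs: "length vs \<le> cod K V (U \<inter> V)" "V \<subseteq> cmb K (U \<inter> V) vs" unfolding dimle_def by blast
    have "Xx \<subseteq> cmb K U vs" unfolding Xx_def
      by (rule set_plus_absorb[OF cmb_smod'[OF K rideal_smod[OF rU]] cmb_base[OF sring_0[OF K]]])
        (use vs(2) cmb_mono[of K K "U \<inter> V" U vs] in blast)
    then have "cod K Xx U \<le> cod K V (U \<inter> V)" using vs(1) by (intro cod_le) (auto simp: dimle_def)
    moreover have "cod K UNIV (U \<inter> V) \<le> NI I e" by (rule cod_le[OF dUV])
    ultimately show ?thesis using e1 e2 cX unfolding NI_def U_def[symmetric] V_def[symmetric] by linarith
  qed
  have c: "convergent (\<lambda>e. real (NI Q e + NI C e) / real (p ^ e) ^ length xs)"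
    using convergent_add[OF conv[unfolded conv_def]] by (simp add: add_divide_distrib)
  show ?thesis unfolding conv_def
    by (rule convergent_close[OF prime_ge_2_nat[OF p] c, of _ D D]) (use up lo D in blast)+
qed

section \<open>Colon ideals and the splitting off of primes\<close>

definition quo :: "'b set \<Rightarrow> 'b set \<Rightarrow> 'b set" where
  "quo I S = {t. \<forall>s\<in>S. s * t \<in> I}"

lemma quo_ideal: assumes I: "rideal I" shows "rideal (quo I S)"
  unfolding smod_def quo_def
proof (intro conjI ballI CollectI)
  show "s * 0 \<in> I" for s using smod_0[OF I] by simp
next
  fix a b s assume "a \<in> {t. \<forall>s\<in>S. s * t \<in> I}" "b \<in> {t. \<forall>s\<in>S. s * t \<in> I}" "s \<in> S"
  then show "s * (a + b) \<in> I" using smod_add[OF I] by (simp add: distrib_left)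
next
  fix k a s assume "a \<in> {t. \<forall>s\<in>S. s * t \<in> I}" "s \<in> S"
  then show "s * (k * a) \<in> I" using rideal_multl[OF I, of "s * a" k] by (simp add: mult.left_commute)
qed

lemma quo_tclosed: "tclosed I \<Longrightarrow> tclosed (quo I S)"
  unfolding tclosed_def quo_def by (auto simp: mult.left_commute)

lemma quo_base: "rideal I \<Longrightarrow> I \<subseteq> quo I S" unfolding quo_def using rideal_multl by blast

lemma quo_radical: assumes I: "rideal I" "radical I" shows "radical (quo I S)"
  unfolding radical_def quo_def
proof (clarsimp)
  fix t n s assume *: "\<forall>s\<in>S. s * t ^ n \<in> I" "0 < n" "s \<in> S"
  then obtain k where k: "n = Suc k" by (cases n) auto
  have "(s * t) ^ n = s ^ k * (s * t ^ n)" unfolding power_mult_distrib k by (simp add: algebra_simps)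
  then have "(s * t) ^ n \<in> I" using rideal_multl[OF I(1)] * by simp
  then show "s * t \<in> I" using I(2) * unfolding radical_def by blast
qed

text \<open>A colon ideal \<open>quo I {f}\<close> of least rank is as large as possible, hence
  prime like an associated prime. Splitting off this prime \<open>Q\<close> leaves
  \<open>quo I Q\<close>, which has smaller rank, and radicality of \<open>I\<close> makes
  \<open>Q\<close> and \<open>quo I Q\<close> intersect in \<open>I\<close>.\<close>

lemma conv_tclosed:
  "rideal I \<Longrightarrow> NN \<subseteq> I \<Longrightarrow> tclosed I \<Longrightarrow> radical I \<Longrightarrow> conv I"
proof (induction "rk I" arbitrary: I rule: less_induct)
  case less
  note I = less.prems
  show ?case
  proof (cases "1 \<in> I")
    case True
    then have "I = UNIV" using rideal_1[OF I(1)] by blast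
    then have "frobseq p I gs e = UNIV" for e using frobseq_base[of I p gs e] by blast
    then have "NI I e = 0" for e unfolding NI_def using cod_le[OF dimle_refl[of UNIV UNIV K]] by simp
    then show ?thesis unfolding conv_def by (simp add: convergent_const)
  next
    case I1: False
    obtain f where f: "f \<notin> I" "\<And>f'. f' \<notin> I \<Longrightarrow> rk (quo I {f}) \<le> rk (quo I {f'})"
      using exists_least_iff[of "\<lambda>n. \<exists>f. f \<notin> I \<and> rk (quo I {f}) = n"] I1 by (metis not_le)
    define Q where "Q = quo I {f}"
    have Q: "rideal Q" "I \<subseteq> Q" "tclosed Q" unfolding Q_def using quo_ideal quo_base quo_tclosed I by auto
    have Q1: "1 \<notin> Q" unfolding Q_def quo_def using f(1) by simp
    have NQ: "NN \<subseteq> Q" using I(2) Q(2) by blast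
    have prime: "a \<in> Q \<or> b \<in> Q" if ab: "a * b \<in> Q" for a b
    proof (rule ccontr)
      assume "\<not> (a \<in> Q \<or> b \<in> Q)"
      then have fb: "f * b \<notin> I" and a: "a \<notin> Q" unfolding Q_def quo_def by auto
      have "Q \<subseteq> quo I {f * b}" unfolding Q_def quo_def using rideal_multr[OF I(1)] by (auto simp: mult.assoc mult.commute)
        (metis mult.assoc mult.commute)
      moreover have "a \<in> quo I {f * b}" using ab unfolding Q_def quo_def by (auto simp: ac_simps)
      ultimately have "Q \<subset> quo I {f * b}" using a by blast
      moreover have "1 \<notin> quo I {f * b}" using fb unfolding quo_def by simp
      ultimately have "rk (quo I {f * b}) < rk Q"
        by (intro rk_strict Q NQ quo_ideal quo_tclosed I)
      then show False using f(2)[OF fb] unfolding Q_def by simp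
    qed
    interpret Q: nndom Q K A xs us gs p by (rule nndomI[OF Q(1) NQ Q1 Q(3) prime])
    have convQ: "conv Q" unfolding conv_def NI_def by (rule Q.colength_converges)
    show ?thesis
    proof (cases "Q = I")
      case True
      then show ?thesis using convQ by simp
    next
      case False
      define C where "C = quo I Q"
      have C: "rideal C" "I \<subseteq> C" "tclosed C" "radical C" unfolding C_def
        using quo_ideal quo_base quo_tclosed quo_radical I by auto
      have fC: "f \<in> C" unfolding C_def Q_def quo_def by (auto simp: mult.commute)
      have C1: "1 \<notin> C" unfolding C_def quo_def using False Q(2) by auto
      have "I \<subset> C" using C(2) fC f(1) by blast
      then have "rk C < rk I" by (rule rk_strict[OF I(1-3) C(1) C1 C(3)])
      then have convC: "conv C" by (rule less.hyps) (use C I(2) in auto)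
      have "f \<notin> Q"
      proof
        assume "f \<in> Q"
        then have "f ^ 2 \<in> I" unfolding Q_def quo_def by (simp add: power2_eq_square)
        then show False using I(4) f(1) unfolding radical_def by (metis zero_neq_numeral)
      qed
      then obtain g a where a: "a \<in> A - Q" "a - f * g \<in> Q" using Q.ex_multiple_in_A by blast
      show ?thesis
      proof (rule conv_split[OF I(1,2) Q(1,2) C(1,2) _ _ fC _ _ a(2) convQ convC])
        show "Q \<inter> C \<subseteq> I"
        proof
          fix t assume "t \<in> Q \<inter> C"
          then have "t ^ 2 \<in> I" unfolding C_def quo_def by (simp add: power2_eq_square)
          then show "t \<in> I" using I(4) unfolding radical_def by (metis zero_neq_numeral)
        qed
        show "s * t \<in> I" if "s \<in> Q" "t \<in> C" for s t using that unfolding C_def quo_def by auto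
        show "f * s \<in> I" if "s \<in> Q" for s using that unfolding Q_def quo_def by auto
        show "a \<in> A - NN" using a(1) NQ by blast
      qed
    qed
  qed
qed

theorem colength_converges_radical:
  assumes "radical NN"
  shows "convergent (\<lambda>e. real (cod K UNIV (F e)) / real (p ^ e) ^ length xs)"
proof -
  have "conv NN"
    by (rule conv_tc[OF P order.refl], rule conv_tclosed)
      (use tc_ideal[OF P] tc_base tc_tclosed tc_radical[OF P assms] in auto)
  then show ?thesis unfolding conv_def NI_def .
qed

end

subsection \<open>Complete local rings and coefficient fields\<close>

text \<open>Cauchy sequences have limits, unique only modulo \<open>NN\<close>. Elements of
  \<open>M (i + j)\<close> are sums of products only up to an arbitrary \<open>M k\<close>, because
  the model knows them only approximately, and finite generation is assumed only for
  \<open>M 1\<close> modulo \<open>M 2\<close>.\<close>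

locale clr =
  fixes M :: "nat \<Rightarrow> 'b::comm_ring_1 set" and p :: nat
  assumes M_ideal: "rideal (M n)" and M_0: "M 0 = UNIV"
    and M_mult: "a \<in> M i \<Longrightarrow> b \<in> M j \<Longrightarrow> a * b \<in> M (i + j)"
    and M_dec: "M (Suc n) \<subseteq> M n"
    and M_1: "1 \<notin> M 1" and M_local: "a \<notin> M 1 \<Longrightarrow> \<exists>b. a * b - 1 \<in> M 1"
    and M_gen: "t \<in> M (i + j) \<Longrightarrow> \<exists>L. set L \<subseteq> {a * b |a b. a \<in> M i \<and> b \<in> M j} \<and> t \<in> cmb UNIV (M k) L"
    and M_fin: "\<exists>zs. set zs \<subseteq> M 1 \<and> M 1 \<subseteq> cmb UNIV (M 2) zs"
    and complete: "(\<And>i. s (Suc i) - s i \<in> M i) \<Longrightarrow> \<exists>l. \<forall>i. l - s i \<in> M i"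
    and p: "Factorial_Ring.prime p" and p_M: "of_nat p \<in> M n"
begin

definition NN :: "'b set" where "NN = (\<Inter>n. M n)"

lemma M_mono: "i \<le> j \<Longrightarrow> M j \<subseteq> M i"
  using lift_Suc_antimono_le[of M, OF M_dec] by blast

lemma NN_M: "NN \<subseteq> M n" unfolding NN_def by blast
lemma NN_I: "(\<And>n. t \<in> M n) \<Longrightarrow> t \<in> NN" unfolding NN_def by blast
lemma NN_ideal: "rideal NN"
  unfolding smod_def NN_def
  by (auto intro: smod_0[OF M_ideal] smod_add[OF M_ideal] rideal_multl[OF M_ideal])
lemma p_NN: "of_nat p \<in> NN" by (rule NN_I[OF p_M])
lemma M_sub: "rideal W \<Longrightarrow> (\<And>a b. a \<in> M i \<Longrightarrow> b \<in> M j \<Longrightarrow> a * b \<in> W) \<Longrightarrow> M k \<subseteq> W \<Longrightarrow> M (i + j) \<subseteq> W"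
proof
  fix t assume W: "rideal W" "\<And>a b. a \<in> M i \<Longrightarrow> b \<in> M j \<Longrightarrow> a * b \<in> W" "M k \<subseteq> W" and t: "t \<in> M (i + j)"
  obtain L where L: "set L \<subseteq> {a * b |a b. a \<in> M i \<and> b \<in> M j}" "t \<in> cmb UNIV (M k) L" using M_gen[OF t] by blast
  have "cmb UNIV (M k) L \<subseteq> W" by (rule cmb_least[OF W(1,3)]) (use L(1) W(2) in blast)
  then show "t \<in> W" using L(2) by blast
qed

lemma M1_prime: "a * b \<in> M 1 \<Longrightarrow> a \<in> M 1 \<or> b \<in> M 1"
proof (rule ccontr)
  assume ab: "a * b \<in> M 1" and "\<not> (a \<in> M 1 \<or> b \<in> M 1)"
  then obtain a' where a': "a * a' - 1 \<in> M 1" and b: "b \<notin> M 1" using M_local by blast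
  have "a' * (a * b) - b * (a * a' - 1) \<in> M 1"
    by (rule rideal_diff[OF M_ideal rideal_multl[OF M_ideal ab] rideal_multl[OF M_ideal a']])
  then show False using b by (simp add: algebra_simps)
qed

lemma M1_power: "a ^ n \<in> M 1 \<Longrightarrow> a \<in> M 1"
  by (induction n) (use M_1 M1_prime in auto)

text \<open>Nakayama's lemma in a complete ring needs no finiteness of \<open>M n\<close>.\<close>

lemma complete_Nakayama:
  assumes gen: "M n \<subseteq> cmb UNIV (M (Suc n)) ys"
  shows "M n \<subseteq> cmb UNIV NN ys"
proof
  have step: "M (k + n) \<subseteq> cmb (M k) (M (Suc (k + n))) ys" for k
  proof (rule M_sub)
    show W: "rideal (cmb (M k) (M (Suc (k + n))) ys)" by (rule cmb_smod) (auto intro: M_ideal)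
    show "M (Suc (k + n)) \<subseteq> cmb (M k) (M (Suc (k + n))) ys" by (rule cmb_base[OF smod_0[OF M_ideal]])
    fix a b assume a: "a \<in> M k" and "b \<in> M n"
    then obtain c where c: "b - (\<Sum>i<length ys. c i * ys ! i) \<in> M (Suc n)" using gen using cmb_iff[of b UNIV "M (Suc n)" ys] by blast
    show "a * b \<in> cmb (M k) (M (Suc (k + n))) ys"
      unfolding cmb_iff
    proof (intro exI conjI allI impI)
      show "a * c i \<in> M k" for i by (rule rideal_multr[OF M_ideal a])
      have "a * (b - (\<Sum>i<length ys. c i * ys ! i)) \<in> M (k + Suc n)" by (rule M_mult[OF a c])
      then show "a * b - (\<Sum>i<length ys. a * c i * ys ! i) \<in> M (Suc (k + n))"
        by (simp add: algebra_simps sum_distrib_left)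
    qed
  qed
  fix t assume t: "t \<in> M n"
  have "\<forall>k r. r \<in> M (k + n) \<longrightarrow> (\<exists>c. (\<forall>i<length ys. c i \<in> M k) \<and> r - (\<Sum>i<length ys. c i * ys ! i) \<in> M (Suc (k + n)))"
    using step unfolding cmb_iff[symmetric] by blast
  then obtain c where c: "\<And>k r i. r \<in> M (k + n) \<Longrightarrow> i < length ys \<Longrightarrow> c k r i \<in> M k"
    "\<And>k r. r \<in> M (k + n) \<Longrightarrow> r - (\<Sum>i<length ys. c k r i * ys ! i) \<in> M (Suc (k + n))" by metis
  \<comment> \<open>Successive remainders: \<open>r k\<close> lies in \<open>M (k + n)\<close> and
    is reduced with coefficients from \<open>M k\<close>, so the partial sums \<open>s\<close> of
    the coefficients are Cauchy.\<close>
  define r where "r = rec_nat t (\<lambda>k r. r - (\<Sum>i<length ys. c k r i * ys ! i))"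
  have r0: "r 0 = t" and rS: "r (Suc k) = r k - (\<Sum>i<length ys. c k (r k) i * ys ! i)" for k unfolding r_def by auto
  have rM: "r k \<in> M (k + n)" for k
    by (induction k) (use t r0 rS c(2) in auto)
  define s where "s = (\<lambda>i m. \<Sum>k<m. c k (r k) i)"
  have "\<exists>l. \<forall>m. l - s i m \<in> M m" if "i < length ys" for i
    by (rule complete) (use c(1)[OF rM that] in \<open>simp add: s_def\<close>)
  then obtain l where l: "\<And>i m. i < length ys \<Longrightarrow> l i - s i m \<in> M m" by metis
  have tr: "t = r m + (\<Sum>i<length ys. s i m * ys ! i)" for m
    by (induction m) (auto simp: r0 rS s_def algebra_simps sum.distrib)
  have "t - (\<Sum>i<length ys. l i * ys ! i) \<in> NN"
  proof (rule NN_I)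
    fix m
    have "r m - (\<Sum>i<length ys. (l i - s i m) * ys ! i) \<in> M m"
    proof (rule rideal_diff[OF M_ideal])
      show "r m \<in> M m" using rM[of m] M_mono[of m "m + n"] by auto
      show "(\<Sum>i<length ys. (l i - s i m) * ys ! i) \<in> M m"
        using l by (intro smod_sum[OF M_ideal] rideal_multr[OF M_ideal]) simp
    qed
    then show "t - (\<Sum>i<length ys. l i * ys ! i) \<in> M m"
      by (subst tr[of m]) (simp add: algebra_simps sum_subtractf)
  qed
  then show "t \<in> cmb UNIV NN ys" unfolding cmb_iff by blast
qed

lemma unit: assumes "u \<notin> M 1" shows "\<exists>v. u * v - 1 \<in> NN"
proof -
  obtain b where b: "u * b - 1 \<in> M 1" using M_local[OF assms] by blast
  have "1 \<in> cmb UNIV (M 1) [u]"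
    using rideal_uminus[OF M_ideal b] by (intro cmb_ConsI[of b _ "- (u * b - 1)"]) (auto simp: algebra_simps)
  then have "cmb UNIV (M 1) [u] = UNIV" by (rule rideal_1[OF cmb_rideal[OF M_ideal]])
  then have "M 0 \<subseteq> cmb UNIV NN [u]" by (intro complete_Nakayama) auto
  then have "1 \<in> cmb UNIV NN [u]" using M_0 by blast
  then obtain k w where "w \<in> NN" "1 = k * u + w" by (auto elim!: cmb_ConsE)
  then have "u * k - 1 = - w" by (simp add: algebra_simps)
  then show ?thesis using rideal_uminus[OF NN_ideal \<open>w \<in> NN\<close>] by (intro exI[of _ k]) simp
qed

lemma frob: "(a + b) ^ p - (a ^ p + b ^ p) \<in> M n"
  using frob_add[OF NN_ideal p p_NN, of a b 1] NN_M by auto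

text \<open>One step of Cohen's theorem: \<open>B\<close> induces a coefficient field modulo
  \<open>M n\<close>, and \<open>C\<close> shall do so modulo \<open>M (Suc n)\<close>. The
  \<open>p\<close>-th powers of \<open>B\<close> give a start, because \<open>p\<close>-th powers of
  elements of \<open>M n\<close> fall into \<open>M (Suc n)\<close>. A maximal subring of
  \<open>B\<close> with the right intersection is then shown to reach all residue classes.\<close>

lemma coefficient_step:
  assumes n: "1 \<le> n" and B: "sring B" "M n \<subseteq> B" "B \<inter> M 1 \<subseteq> M n" "\<And>t. \<exists>b\<in>B. t - b \<in> M 1"
  shows "\<exists>C. sring C \<and> M (Suc n) \<subseteq> C \<and> C \<subseteq> B \<and> C \<inter> M 1 \<subseteq> M (Suc n) \<and> (\<forall>t. \<exists>c\<in>C. t - c \<in> M 1)"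
proof -
  let ?N = "M (Suc n)"
  have p2: "2 \<le> p" by (rule prime_ge_2_nat[OF p])
  have N: "rideal ?N" by (rule M_ideal)
  have sq: "a * b \<in> ?N" if "a \<in> M n" "b \<in> M n" for a b
    using M_mult[OF that] M_mono[of "Suc n" "n + n"] n by auto
  have powN: "b ^ p \<in> ?N" if "b \<in> M n" for b
  proof -
    have "b ^ p = (b * b) * b ^ (p - 2)" using p2 by (metis le_add_diff_inverse power2_eq_square power_add)
    then show ?thesis using rideal_multr[OF N sq[OF that that]] by simp
  qed
  define C0 where "C0 = {b ^ p + m |b m. b \<in> B \<and> m \<in> ?N}"
  have C0: "sring C0"
    unfolding sring_def
  proof (intro conjI ballI)
    show "1 \<in> C0" unfolding C0_def using sring_1[OF B(1)] smod_0[OF N] by force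
  next
    fix x y assume "x \<in> C0" "y \<in> C0"
    then obtain b m b' m' where x: "x = b ^ p + m" "b \<in> B" "m \<in> ?N" and y: "y = b' ^ p + m'" "b' \<in> B" "m' \<in> ?N"
      unfolding C0_def by blast
    have "b ^ p - ((b - b') ^ p + b' ^ p) \<in> ?N" using frob[of "b - b'" b'] by simp
    then have "(b ^ p - ((b - b') ^ p + b' ^ p)) + (m - m') \<in> ?N" by (rule smod_add[OF N _ rideal_diff[OF N x(3) y(3)]])
    moreover have "x - y = (b - b') ^ p + ((b ^ p - ((b - b') ^ p + b' ^ p)) + (m - m'))"
      unfolding x(1) y(1) by (simp add: algebra_simps)
    ultimately show "x - y \<in> C0" unfolding C0_def using sring_diff[OF B(1) x(2) y(2)] by blast
    have "x * y = (b * b') ^ p + (b ^ p * m' + m * y)" unfolding x(1) y(1) by (simp add: algebra_simps power_mult_distrib)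
    moreover have "b ^ p * m' + m * y \<in> ?N" by (intro smod_add[OF N] rideal_multl[OF N] rideal_multr[OF N] x y)
    ultimately show "x * y \<in> C0" unfolding C0_def using sring_mult[OF B(1) x(2) y(2)] by blast
  qed
  have NC0: "?N \<subseteq> C0"
  proof
    fix m assume "m \<in> ?N"
    moreover have "m = 0 ^ p + m" using p2 by (simp add: power_0_left)
    ultimately show "m \<in> C0" unfolding C0_def using sring_0[OF B(1)] by blast
  qed
  have C0B: "C0 \<subseteq> B"
  proof
    fix x assume "x \<in> C0"
    then obtain b m where b: "x = b ^ p + m" "b \<in> B" "m \<in> ?N" unfolding C0_def by blast
    have "m \<in> B" by (rule subsetD[OF B(2) subsetD[OF M_dec b(3)]])
    then show "x \<in> B" unfolding b(1) by (intro sring_add[OF B(1)] sring_power[OF B(1)] b(2))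
  qed
  have C0M: "C0 \<inter> M 1 \<subseteq> ?N"
  proof
    fix x assume x: "x \<in> C0 \<inter> M 1"
    then obtain b m where b: "x = b ^ p + m" "b \<in> B" "m \<in> ?N" unfolding C0_def by blast
    have "m \<in> M 1" using b(3) M_mono[of 1 "Suc n"] by auto
    then have "b ^ p \<in> M 1" using x b(1) rideal_diff[OF M_ideal, of x 1 m] by auto
    then have "b \<in> M n" using M1_power b(2) B(3) by blast
    then show "x \<in> ?N" using b smod_add[OF N powN] by blast
  qed
  define \<C> where "\<C> = {C. sring C \<and> C0 \<subseteq> C \<and> C \<subseteq> B \<and> C \<inter> M 1 \<subseteq> ?N}"
  have "\<exists>C\<in>\<C>. \<forall>Xx\<in>\<C>. C \<subseteq> Xx \<longrightarrow> Xx = C"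
  proof (rule subset_Zorn_nonempty)
    show "\<C> \<noteq> {}" unfolding \<C>_def using C0 C0B C0M by blast
    fix \<D> assume D: "\<D> \<noteq> {}" "subset.chain \<C> \<D>"
    have DX: "sring Xx" "C0 \<subseteq> Xx" "Xx \<subseteq> B" "Xx \<inter> M 1 \<subseteq> ?N" if "Xx \<in> \<D>" for Xx
      using D(2) that unfolding subset_chain_def \<C>_def by auto
    have Dtot: "Xx \<subseteq> Y \<or> Y \<subseteq> Xx" if "Xx \<in> \<D>" "Y \<in> \<D>" for Xx Y
      using D(2) that unfolding subset_chain_def by auto
    obtain X0 where X0: "X0 \<in> \<D>" using D(1) by auto
    have "sring (\<Union>\<D>)"
      unfolding sring_def
    proof (intro conjI ballI)
      show "1 \<in> \<Union>\<D>" using sring_1[OF DX(1)[OF X0]] X0 by (rule UnionI[rotated])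
      fix a b assume "a \<in> \<Union>\<D>" "b \<in> \<Union>\<D>"
      then obtain Xx Y where XY: "Xx \<in> \<D>" "Y \<in> \<D>" "a \<in> Xx" "b \<in> Y" by blast
      obtain Z where Z: "Z \<in> \<D>" "a \<in> Z" "b \<in> Z" using Dtot[OF XY(1,2)] XY by (metis subsetD)
      show "a - b \<in> \<Union>\<D>" "a * b \<in> \<Union>\<D>"
        using sring_diff[OF DX(1)[OF Z(1)] Z(2,3)] sring_mult[OF DX(1)[OF Z(1)] Z(2,3)] Z(1) by auto
    qed
    moreover have "C0 \<subseteq> \<Union>\<D>" using DX(2)[OF X0] X0 by auto
    moreover have "\<Union>\<D> \<subseteq> B" using DX(3) by auto
    moreover have "\<Union>\<D> \<inter> M 1 \<subseteq> ?N"
    proof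
      fix x assume "x \<in> \<Union>\<D> \<inter> M 1"
      then obtain Xx where "Xx \<in> \<D>" "x \<in> Xx \<inter> M 1" by auto
      then show "x \<in> ?N" using subsetD[OF DX(4)] by metis
    qed
    ultimately show "\<Union>\<D> \<in> \<C>" unfolding \<C>_def by (intro CollectI conjI)
  qed
  then obtain C where C\<C>: "C \<in> \<C>" and max: "\<And>Xx. Xx \<in> \<C> \<Longrightarrow> C \<subseteq> Xx \<Longrightarrow> Xx = C" by auto
  have C: "sring C" "C0 \<subseteq> C" "C \<subseteq> B" "C \<inter> M 1 \<subseteq> ?N" using C\<C> unfolding \<C>_def by auto
  have NC: "?N \<subseteq> C" using NC0 C(2) by blast
  \<comment> \<open>If \<open>b\<close> in \<open>B\<close> inverts \<open>d\<close> modulo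
    \<open>M 1\<close>, then \<open>d ^ (p - 1) * b ^ p\<close> is another inverse; it lies in
    \<open>C\<close> because \<open>b ^ p\<close> does.\<close>
  have inv: "\<exists>g\<in>C. d * g - 1 \<in> M 1" if d: "d \<in> C" "d \<notin> M 1" for d
  proof -
    obtain b' where b': "d * b' - 1 \<in> M 1" using M_local[OF d(2)] by blast
    obtain b where b: "b \<in> B" "b' - b \<in> M 1" using B(4) by blast
    have "(d * b' - 1) - d * (b' - b) \<in> M 1" by (rule rideal_diff[OF M_ideal b' rideal_multl[OF M_ideal b(2)]])
    then have "d * b - 1 \<in> M 1" by (simp add: algebra_simps)
    then have "(d * b) ^ p - 1 ^ p \<in> M 1" by (rule power_cong_ideal[OF M_ideal])
    moreover have "(d * b) ^ p = d * (d ^ (p - 1) * b ^ p)"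
      using p2 by (cases p) (simp_all add: power_mult_distrib mult.assoc)
    ultimately have "d * (d ^ (p - 1) * b ^ p) - 1 \<in> M 1" by simp
    moreover have "b ^ p \<in> C0" unfolding C0_def using b(1) smod_0[OF N] by force
    then have "d ^ (p - 1) * b ^ p \<in> C"
      using sring_mult[OF C(1) sring_power[OF C(1) d(1)]] subsetD[OF C(2)] by metis
    ultimately show ?thesis by blast
  qed
  have "\<exists>c\<in>C. t - c \<in> M 1" for t
  proof (rule ccontr)
    assume nt: "\<not> (\<exists>c\<in>C. t - c \<in> M 1)"
    obtain r where r: "r \<in> B" "t - r \<in> M 1" using B(4) by blast
    have r_not: "r - c \<notin> M 1" if "c \<in> C" for c
      using nt that smod_add[OF M_ideal r(2), of "r - c"] by auto
    \<comment> \<open>A monic relation of degree \<open>J\<close> for the residue class of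
      \<open>r\<close>. The least such degree is that of the class over the image of
      \<open>C\<close>; it is at most \<open>p\<close> because \<open>r ^ p\<close> lies in
      \<open>C\<close>.\<close>
    define rel where "rel = (\<lambda>J. 1 \<le> J \<and> (\<exists>c. (\<forall>j<J. c j \<in> C) \<and> r ^ J - (\<Sum>j<J. c j * r ^ j) \<in> M 1))"
    have rpC: "r ^ p \<in> C" using C(2) r(1) smod_0[OF N] unfolding C0_def by force
    have split0: "(\<Sum>j<p. (if j = 0 then r ^ p else 0) * y ^ j) = r ^ p" for y :: 'b
    proof -
      have "(\<Sum>j<p. (if j = 0 then r ^ p else 0) * y ^ j) = (\<Sum>j<p. if j = 0 then r ^ p else 0)"
        by (rule sum.cong) auto
      then show ?thesis using p2 by simp
    qed
    have relp: "rel p" unfolding rel_def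
      using p2 rpC sring_0[OF C(1)] smod_0[OF M_ideal] split0[of r]
      by (intro conjI exI[of _ "\<lambda>j. if j = 0 then r ^ p else 0"]) auto
    define J where "J = (LEAST J. rel J)"
    have J: "rel J" unfolding J_def using relp by (rule LeastI)
    have Jp: "J \<le> p" unfolding J_def using relp by (rule Least_le)
    have J1: "1 \<le> J" using J unfolding rel_def by blast
    have indep: "d j \<in> M 1" if d: "\<And>j. j < J \<Longrightarrow> d j \<in> C" "(\<Sum>j<J. d j * r ^ j) \<in> M 1" "j < J" for d j
    proof (rule ccontr)
      assume "d j \<notin> M 1"
      then obtain i where i: "i < J" "d i \<notin> M 1" "\<forall>k. k < J \<and> d k \<notin> M 1 \<longrightarrow> k \<le> i"
        using Nat.ex_has_greatest_nat[of "\<lambda>i. i < J \<and> d i \<notin> M 1" j J] d(3) by auto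
      have "(\<Sum>k<J. d k * r ^ k) = (\<Sum>k<Suc i. d k * r ^ k) + (\<Sum>k\<in>{Suc i..<J}. d k * r ^ k)"
        using sum.atLeastLessThan_concat[of 0 "Suc i" J "\<lambda>k. d k * r ^ k"] i(1)
        by (simp add: atLeast0LessThan)
      moreover have "(\<Sum>k\<in>{Suc i..<J}. d k * r ^ k) \<in> M 1"
        using i(3) by (intro smod_sum[OF M_ideal] rideal_multr[OF M_ideal]) force
      ultimately have s: "(\<Sum>k<i. d k * r ^ k) + d i * r ^ i \<in> M 1"
        using d(2) smod_cong[OF M_ideal sring_UNIV, of "\<Sum>k<J. d k * r ^ k" "\<Sum>k<Suc i. d k * r ^ k" 1] by simp
      obtain g where g: "g \<in> C" "d i * g - 1 \<in> M 1" using inv d(1) i by blast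
      have "g * ((\<Sum>k<i. d k * r ^ k) + d i * r ^ i) - (d i * g - 1) * r ^ i \<in> M 1"
        by (intro rideal_diff[OF M_ideal] rideal_multl[OF M_ideal s] rideal_multr[OF M_ideal g(2)])
      then have rr: "r ^ i - (\<Sum>k<i. - (g * d k) * r ^ k) \<in> M 1"
        by (simp add: algebra_simps sum_distrib_left sum_negf)
      show False
      proof (cases "i = 0")
        case True
        then show False using rr M_1 by simp
      next
        case False
        have "- (g * d k) \<in> C" if "k < i" for k
          using d(1) g(1) i(1) that by (intro sring_uminus[OF C(1)] sring_mult[OF C(1)]) auto
        then have "rel i" unfolding rel_def using False rr
          by (intro conjI exI[of _ "\<lambda>k. - (g * d k)"]) auto
        then have "J \<le> i" unfolding J_def by (rule Least_le)
        then show False using i(1) by simp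
      qed
    qed
    \<comment> \<open>The relation has to hold modulo \<open>M (Suc n)\<close> and not only modulo
      \<open>M 1\<close>. In degree \<open>p\<close>, the relation given by \<open>r ^ p\<close>
      itself is exact. In smaller degree the derivative is a unit, and one Newton step corrects
      \<open>r\<close>.\<close>
    have "\<exists>r' c. r' - r \<in> M n \<and> (\<forall>j<J. c j \<in> C) \<and> r' ^ J - (\<Sum>j<J. c j * r' ^ j) \<in> ?N"
    proof (cases "J = p")
      case True
      then show ?thesis using rpC sring_0[OF C(1)] smod_0[OF M_ideal] split0[of r]
        by (intro exI[of _ r] exI[of _ "\<lambda>j. if j = 0 then r ^ p else 0"]) auto
    next
      case False
      obtain c where c: "\<forall>j<J. c j \<in> C" "r ^ J - (\<Sum>j<J. c j * r ^ j) \<in> M 1" using J unfolding rel_def by blast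
      define f where "f = r ^ J - (\<Sum>j<J. c j * r ^ j)"
      have "f \<in> B" unfolding f_def
        using C(3) c(1) r(1) by (intro sring_diff[OF B(1)] sring_sum[OF B(1)] sring_mult[OF B(1)] sring_power[OF B(1)]) auto
      then have fM: "f \<in> M n" using c(2) B(3) unfolding f_def by blast
      define f' where "f' = of_nat J * r ^ (J - 1) - (\<Sum>j<J. c j * (of_nat j * r ^ (j - 1)))"
      have "f' \<notin> M 1"
      proof
        assume f': "f' \<in> M 1"
        \<comment> \<open>The coefficients of the derivative as a polynomial of degree below
          \<open>J\<close>. By minimality of \<open>J\<close> all of them would lie in
          \<open>M 1\<close>, also the leading one \<open>of_nat J\<close>, although
          \<open>p\<close> does not divide \<open>J\<close>.\<close>
        define d where "d = (\<lambda>i. if Suc i = J then of_nat J else - (of_nat (Suc i) * c (Suc i)))"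
        obtain J' where J': "J = Suc J'" using J1 by (cases J) auto
        have nC: "of_nat k \<in> C" for k by (induction k) (auto intro: sring_0[OF C(1)] sring_add[OF C(1)] sring_1[OF C(1)])
        have "(\<Sum>j<J. d j * r ^ j) = of_nat J * r ^ J' + (\<Sum>j<J'. - (of_nat (Suc j) * c (Suc j)) * r ^ j)"
          unfolding J' by (simp add: d_def J')
        also have "\<dots> = f'" unfolding f'_def J' sum.lessThan_Suc_shift
          by (simp add: sum_negf algebra_simps del: of_nat_Suc)
        finally have ds: "(\<Sum>j<J. d j * r ^ j) \<in> M 1" using f' by simp
        have dC: "d j \<in> C" if "j < J" for j
          unfolding d_def using that c(1) nC by (auto intro!: sring_uminus[OF C(1)] sring_mult[OF C(1)] simp del: of_nat_Suc)
        have "d J' \<in> M 1" by (rule indep[OF dC ds]) (simp_all add: J')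
        then have JM: "of_nat J \<in> M 1" unfolding d_def J' by simp
        have "\<not> p dvd J" using False Jp J1 by (intro nat_dvd_not_less) auto
        then have "coprime J p" using prime_imp_coprime[OF p] coprime_commute by blast
        moreover have "p \<noteq> 1" using p2 by simp
        ultimately obtain x y where "J * x = p * y + 1"
          using coprime_bezout_strong[of J p] by blast
        then have "(of_nat J * of_nat x :: 'b) = of_nat p * of_nat y + 1"
          by (metis of_nat_1 of_nat_add of_nat_mult)
        then have "(of_nat J * of_nat x - of_nat p * of_nat y :: 'b) = 1" by simp
        moreover have "(of_nat J * of_nat x - of_nat p * of_nat y :: 'b) \<in> M 1"
          by (intro rideal_diff[OF M_ideal] rideal_multr[OF M_ideal] JM p_M)
        ultimately show False using M_1 by simp
      qed
      then obtain w where w: "f' * w - 1 \<in> M 1" using M_local by blast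
      define \<nu> where "\<nu> = - (f * w)"
      have \<nu>: "\<nu> \<in> M n" unfolding \<nu>_def by (intro rideal_uminus[OF M_ideal] rideal_multr[OF M_ideal] fM)
      have taylor: "(r + \<nu>) ^ j - (r ^ j + of_nat j * r ^ (j - 1) * \<nu>) \<in> ?N" for j
      proof (induction j)
        case (Suc j)
        have "(r + \<nu>) ^ Suc j - (r ^ Suc j + of_nat (Suc j) * r ^ j * \<nu>) =
          (r + \<nu>) * ((r + \<nu>) ^ j - (r ^ j + of_nat j * r ^ (j - 1) * \<nu>)) + \<nu> * \<nu> * (of_nat j * r ^ (j - 1))"
          by (cases j) (simp_all add: algebra_simps)
        then show ?case using smod_add[OF N rideal_multl[OF N Suc, of "r + \<nu>"] rideal_multr[OF N sq[OF \<nu> \<nu>], of "of_nat j * r ^ (j - 1)"]]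
          by simp
      qed (simp add: smod_0[OF N])
      have "((r + \<nu>) ^ J - (r ^ J + of_nat J * r ^ (J - 1) * \<nu>)) -
          (\<Sum>j<J. c j * ((r + \<nu>) ^ j - (r ^ j + of_nat j * r ^ (j - 1) * \<nu>))) \<in> ?N"
        by (intro rideal_diff[OF N] taylor smod_sum[OF N] rideal_multl[OF N])
      then have "((r + \<nu>) ^ J - (\<Sum>j<J. c j * (r + \<nu>) ^ j)) - (f + f' * \<nu>) \<in> ?N"
        unfolding f_def f'_def by (simp add: algebra_simps sum.distrib sum_subtractf sum_distrib_left sum_distrib_right)
      moreover have "f + f' * \<nu> \<in> ?N"
        using rideal_uminus[OF M_ideal M_mult[OF fM w]] unfolding \<nu>_def by (simp add: algebra_simps)
      ultimately have "(r + \<nu>) ^ J - (\<Sum>j<J. c j * (r + \<nu>) ^ j) \<in> ?N" using smod_cong[OF N sring_UNIV] by blast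
      then show ?thesis using c(1) \<nu> by (intro exI[of _ "r + \<nu>"] exI[of _ c]) auto
    qed
    then obtain r' c where r': "r' - r \<in> M n" "\<forall>j<J. c j \<in> C" "r' ^ J - (\<Sum>j<J. c j * r' ^ j) \<in> ?N" by blast
    have r'1: "r' - r \<in> M 1" using r'(1) M_mono[OF n] by blast
    have r'B: "r' \<in> B" using sring_add[OF B(1) r(1), of "r' - r"] r'(1) B(2) by auto
    \<comment> \<open>The ring obtained by adjoining \<open>r'\<close>; the relation makes powers
      below \<open>J\<close> sufficient, and minimality of \<open>J\<close> keeps its intersection
      with \<open>M 1\<close> inside \<open>M (Suc n)\<close>. Maximality gives
      \<open>C' = C\<close>, so \<open>r'\<close> represents the missing class inside
      \<open>C\<close>.\<close>
    define C' where "C' = cmb C {0} (map (\<lambda>j. r' ^ j) [0..<J])"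
    have smC': "smod C C'" unfolding C'_def by (rule cmb_smod'[OF C(1)]) (simp add: smod_def)
    have powC': "r' ^ j \<in> C'" if "j < J" for j
      unfolding C'_def by (rule cmb_mem) (use that C(1) in auto)
    have 1: "1 \<in> C'" using powC'[of 0] J1 by simp
    have CC': "C \<subseteq> C'" using smod_scale[OF smC' _ 1] by auto
    have topC': "r' ^ J \<in> C'"
    proof -
      have "(\<Sum>j<J. c j * r' ^ j) \<in> C'" using r'(2) powC' by (intro smod_sum[OF smC'] smod_scale[OF smC']) auto
      then show ?thesis using r'(3) NC CC' smod_cong[OF smC' C(1), of "r' ^ J"] by blast
    qed
    have multr': "r' * x \<in> C'" if "x \<in> C'" for x
    proof -
      have "C' \<subseteq> {x. r' * x \<in> C'}" unfolding C'_def[of ]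
      proof (rule cmb_least)
        show "smod C {x. r' * x \<in> cmb C {0} (map ((^) r') [0..<J])}"
          using smC' unfolding C'_def smod_def by (auto simp: algebra_simps mult.left_commute[of r'])
        show "{0} \<subseteq> {x. r' * x \<in> cmb C {0} (map ((^) r') [0..<J])}"
          using smod_0[OF smC'] unfolding C'_def by auto
        have "r' * r' ^ j \<in> C'" if "j < J" for j
          using powC'[of "Suc j"] topC' that by (cases "Suc j = J") auto
        then show "set (map ((^) r') [0..<J]) \<subseteq> {x. r' * x \<in> cmb C {0} (map ((^) r') [0..<J])}"
          unfolding C'_def by auto
      qed
      then show ?thesis using that by blast
    qed
    have multpow: "r' ^ j * x \<in> C'" if "x \<in> C'" for x j
      by (induction j) (use that multr' in \<open>auto simp: mult.assoc\<close>)
    have C's: "sring C'"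
      unfolding sring_def
    proof (intro conjI ballI)
      show "1 \<in> C'" by (rule 1)
      fix x y assume x: "x \<in> C'" and y: "y \<in> C'"
      show "x - y \<in> C'" by (rule smod_diff[OF smC' C(1) x y])
      have "cmb C {0} (map (\<lambda>j. r' ^ j) [0..<J]) \<subseteq> {x. x * y \<in> C'}"
      proof (rule cmb_least)
        show "smod C {x. x * y \<in> C'}" using smC' unfolding smod_def by (auto simp: distrib_right mult.assoc)
      qed (use multpow[OF y] smod_0[OF smC'] in auto)
      then show "x * y \<in> C'" using x unfolding C'_def by blast
    qed
    have "C' \<subseteq> B" unfolding C'_def
      by (rule cmb_least[OF smod_mono[OF smod_sring[OF B(1)] C(3)]])
        (use sring_0[OF B(1)] sring_power[OF B(1) r'B] in auto)
    moreover have "C' \<inter> M 1 \<subseteq> ?N"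
    proof
      fix x assume x: "x \<in> C' \<inter> M 1"
      then have "x \<in> cmb C {0} (map (\<lambda>j. r' ^ j) [0..<J])" unfolding C'_def by blast
      then obtain d where d0: "\<forall>i<J. d i \<in> C" "x - (\<Sum>i<J. d i * map (\<lambda>j. r' ^ j) [0..<J] ! i) \<in> {0}"
        unfolding cmb_iff by auto
      moreover have "(\<Sum>i<J. d i * map (\<lambda>j. r' ^ j) [0..<J] ! i) = (\<Sum>i<J. d i * r' ^ i)"
        by (rule sum.cong) auto
      ultimately have d: "\<forall>i<J. d i \<in> C" "x = (\<Sum>i<J. d i * r' ^ i)" by auto
      have "(\<Sum>i<J. d i * (r' ^ i - r ^ i)) \<in> M 1"
        by (intro smod_sum[OF M_ideal] rideal_multl[OF M_ideal] power_cong_ideal[OF M_ideal r'1])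
      then have "x - (\<Sum>i<J. d i * r ^ i) \<in> M 1" unfolding d(2) by (simp add: algebra_simps sum_subtractf)
      then have "(\<Sum>i<J. d i * r ^ i) \<in> M 1" using x smod_cong[OF M_ideal sring_UNIV, of x _ 1] by blast
      then have "d i \<in> ?N" if "i < J" for i using indep[of d i] d(1) that C(4) by blast
      then show "x \<in> ?N" unfolding d(2) by (intro smod_sum[OF N] rideal_multr[OF N]) auto
    qed
    ultimately have "C' \<in> \<C>" unfolding \<C>_def using C's CC' C(2) by blast
    then have "C' = C" using max CC' by blast
    then have "r' \<in> C" using multr'[OF 1] by simp
    then show False using r_not r'1 rideal_uminus[OF M_ideal r'1] by auto
  qed
  then show ?thesis using C NC by blast
qed

text \<open>The subrings for the successive \<open>n\<close> are nested. Representatives chosen in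
  them form a Cauchy sequence, since their differences lie in \<open>M 1\<close> and hence deep in
  the filtration; the limit lies in the intersection.\<close>

lemma ex_coefficient_field:
  "\<exists>K. fmod K NN \<and> NN \<subseteq> K \<and> K \<inter> M 1 \<subseteq> NN \<and> (\<forall>t. \<exists>k\<in>K. t - k \<in> M 1)"
proof -
  define Q where "Q = (\<lambda>n B. sring B \<and> M (Suc n) \<subseteq> B \<and> B \<inter> M 1 \<subseteq> M (Suc n) \<and> (\<forall>t. \<exists>b\<in>B. t - b \<in> M 1))"
  have "\<exists>Bs. \<forall>n. Q n (Bs n) \<and> Bs (Suc n) \<subseteq> Bs n"
  proof (rule dependent_nat_choice)
    show "\<exists>B. Q 0 B" unfolding Q_def
      using smod_0[OF M_ideal] by (intro exI[of _ UNIV]) (metis (full_types) UNIV_I cancel_comm_monoid_add_class.diff_cancel inf_sup_ord(2) One_nat_def sring_UNIV subset_UNIV)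
    show "\<exists>C. Q (Suc n) C \<and> C \<subseteq> B" if "Q n B" for B n
      using coefficient_step[of "Suc n" B] that unfolding Q_def by auto
  qed
  then obtain Bs where Bs: "\<And>n. Q n (Bs n)" "\<And>n. Bs (Suc n) \<subseteq> Bs n" by blast
  define K where "K = (\<Inter>n. Bs n)"
  have B: "sring (Bs n)" "M (Suc n) \<subseteq> Bs n" "Bs n \<inter> M 1 \<subseteq> M (Suc n)" "\<exists>b\<in>Bs n. t - b \<in> M 1" for n t
    using Bs(1) unfolding Q_def by auto
  have K: "sring K" using B(1) unfolding K_def sring_def by blast
  have NK: "NN \<subseteq> K" using B(2) NN_M unfolding K_def by blast
  have KM: "K \<inter> M 1 \<subseteq> NN"
  proof
    fix x assume "x \<in> K \<inter> M 1"
    then have x: "x \<in> M (Suc n)" for n using B(3) unfolding K_def by blast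
    show "x \<in> NN" by (rule NN_I) (rule subsetD[OF M_dec x])
  qed
  have Ksur: "\<exists>k\<in>K. t - k \<in> M 1" for t
  proof -
    have "\<exists>b. \<forall>n. (b n \<in> Bs n \<and> t - b n \<in> M 1) \<and> b (Suc n) - b n \<in> M (Suc n)"
    proof (rule dependent_nat_choice)
      show "\<exists>b. b \<in> Bs 0 \<and> t - b \<in> M 1" using B(4) by blast
      fix b n assume b: "b \<in> Bs n \<and> t - b \<in> M 1"
      obtain b' where b': "b' \<in> Bs (Suc n)" "t - b' \<in> M 1" using B(4) by blast
      have "(t - b) - (t - b') \<in> M 1" by (rule rideal_diff[OF M_ideal]) (use b b' in auto)
      moreover have "b' - b \<in> Bs n" using sring_diff[OF B(1)] b b' Bs(2) by blast
      ultimately show "\<exists>b'. (b' \<in> Bs (Suc n) \<and> t - b' \<in> M 1) \<and> b' - b \<in> M (Suc n)"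
        using b' B(3)[of n] by (intro exI[of _ b']) auto
    qed
    then obtain b where b: "\<And>n. b n \<in> Bs n" "\<And>n. t - b n \<in> M 1" "\<And>n. b (Suc n) - b n \<in> M (Suc n)" by blast
    \<comment> \<open>Shifting by one place gains one index in the limit: \<open>l - b n\<close>
      lies in \<open>M (Suc n)\<close>, which is contained in \<open>Bs n\<close>.\<close>
    define b' where "b' = (\<lambda>n. case n of 0 \<Rightarrow> b 0 | Suc m \<Rightarrow> b m)"
    have "\<exists>l. \<forall>n. l - b' n \<in> M n"
      by (rule complete) (use b(3) in \<open>auto simp: b'_def smod_0[OF M_ideal] split: nat.splits\<close>)
    then obtain l where l: "\<And>n. l - b' n \<in> M n" by blast
    have lb: "l - b n \<in> M (Suc n)" for n using l[of "Suc n"] unfolding b'_def by simp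
    have "l \<in> Bs n" for n using sring_add[OF B(1) b(1)[of n], of "l - b n"] lb B(2) by auto
    then have "l \<in> K" unfolding K_def by blast
    moreover have "t - l \<in> M 1" using rideal_diff[OF M_ideal b(2)[of 0] , of "l - b 0"] lb[of 0] by simp
    ultimately show ?thesis by blast
  qed
  have "\<exists>l\<in>K. k * l - 1 \<in> NN" if k: "k \<in> K - NN" for k
  proof -
    have "k \<notin> M 1" using k KM by blast
    then obtain v where v: "k * v - 1 \<in> M 1" using M_local by blast
    obtain l where l: "l \<in> K" "v - l \<in> M 1" using Ksur by blast
    have "(k * v - 1) - k * (v - l) \<in> M 1" by (rule rideal_diff[OF M_ideal v rideal_multl[OF M_ideal l(2)]])
    then have "k * l - 1 \<in> M 1" by (simp add: algebra_simps)
    moreover have "k * l - 1 \<in> K" using k l sring_mult[OF K] sring_diff[OF K] sring_1[OF K] by blast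
    ultimately show ?thesis using KM l(1) by blast
  qed
  then have "fmod K NN" unfolding fmod_def using K NN_ideal by blast
  then show ?thesis using NK KM Ksur by blast
qed

end

subsection \<open>Power series in a complete local ring\<close>

text \<open>The power series in \<open>x\<close> with coefficients in \<open>A\<close>, coinductively: every element is
  \<open>a + x * t\<close> with \<open>a \<in> A\<close> and \<open>t\<close> again a power series.\<close>

definition psc :: "'b::comm_ring_1 set \<Rightarrow> 'b \<Rightarrow> 'b set" where
  "psc A x = \<Union>{Y. \<forall>t\<in>Y. \<exists>a\<in>A. \<exists>t'\<in>Y. t = a + x * t'}"

lemma psc_coind: "(\<And>t. t \<in> Y \<Longrightarrow> \<exists>a\<in>A. \<exists>t'\<in>Y. t = a + x * t') \<Longrightarrow> Y \<subseteq> psc A x"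
  unfolding psc_def by (intro Union_upper CollectI ballI)

lemma psc_unfold: "t \<in> psc A x \<Longrightarrow> \<exists>a\<in>A. \<exists>t'\<in>psc A x. t = a + x * t'"
  unfolding psc_def by blast

lemma psc_base: assumes "0 \<in> A" shows "A \<subseteq> psc A x"
proof (rule psc_coind)
  fix t assume "t \<in> A"
  then show "\<exists>a\<in>A. \<exists>t'\<in>A. t = a + x * t'" using assms by (intro bexI[of _ t] bexI[of _ 0]) auto
qed

lemma psc_sring: assumes A: "sring A" shows "sring (psc A x)"
  unfolding sring_def
proof (intro conjI ballI)
  let ?P = "psc A x"
  have AP: "A \<subseteq> ?P" by (rule psc_base[OF sring_0[OF A]])
  show "1 \<in> ?P" using AP sring_1[OF A] by blast
  fix t s assume ts: "t \<in> ?P" "s \<in> ?P"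
  have "{t - s |t s. t \<in> ?P \<and> s \<in> ?P} \<subseteq> ?P"
  proof (rule psc_coind)
    fix u assume "u \<in> {t - s |t s. t \<in> ?P \<and> s \<in> ?P}"
    then obtain t s where u: "u = t - s" "t \<in> ?P" "s \<in> ?P" by blast
    obtain a t' where t: "a \<in> A" "t' \<in> ?P" "t = a + x * t'" using psc_unfold[OF u(2)] by blast
    obtain b s' where s: "b \<in> A" "s' \<in> ?P" "s = b + x * s'" using psc_unfold[OF u(3)] by blast
    have "u = (a - b) + x * (t' - s')" unfolding u t s by (simp add: algebra_simps)
    then show "\<exists>a\<in>A. \<exists>t'\<in>{t - s |t s. t \<in> ?P \<and> s \<in> ?P}. u = a + x * t'"
      using sring_diff[OF A t(1) s(1)] t(2) s(2) by blast
  qed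
  then show "t - s \<in> ?P" using ts by blast
  \<comment> \<open>The remainder of a product of two series involves further products, so the
    coinduction runs over all finite sums of products.\<close>
  define Y where "Y = {t. \<exists>L. set L \<subseteq> ?P \<and> t \<in> cmb ?P {0} L}"
  have "\<exists>a\<in>A. \<exists>t'\<in>Y. t = a + x * t'" if "t \<in> cmb ?P {0} L" "set L \<subseteq> ?P" for t L
    using that
  proof (induction L arbitrary: t)
    case Nil
    have "0 \<in> Y" unfolding Y_def by (auto intro!: exI[of _ "[]"])
    then show ?case using Nil sring_0[OF A] by (intro bexI[of _ 0]) auto
  next
    case (Cons v L)
    obtain k w where kw: "k \<in> ?P" "w \<in> cmb ?P {0} L" "t = k * v + w" using cmb_ConsE[OF Cons.prems(1)] .
    obtain aw w' where w: "aw \<in> A" "w' \<in> Y" "w = aw + x * w'" using Cons.IH[OF kw(2)] Cons.prems(2) by auto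
    obtain L' where L': "set L' \<subseteq> ?P" "w' \<in> cmb ?P {0} L'" using w(2) unfolding Y_def by blast
    obtain k0 k' where k: "k0 \<in> A" "k' \<in> ?P" "k = k0 + x * k'" using psc_unfold[OF kw(1)] by blast
    have v: "v \<in> ?P" using Cons.prems(2) by simp
    obtain v0 v' where v': "v0 \<in> A" "v' \<in> ?P" "v = v0 + x * v'" using psc_unfold[OF v] by blast
    have "k' * v + (k0 * v' + w') \<in> cmb ?P {0} (v # v' # L')"
      by (intro cmb_ConsI[OF k(2) _ refl] cmb_ConsI[OF _ L'(2) refl]) (use AP k in blast)
    moreover have "set (v # v' # L') \<subseteq> ?P" using v v'(2) L'(1) by simp
    ultimately have Y: "k' * v + (k0 * v' + w') \<in> Y" unfolding Y_def by blast
    have "k * v = k0 * v + x * k' * v" unfolding k(3) by (simp add: algebra_simps)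
    moreover have "k0 * v = k0 * v0 + x * k0 * v'" unfolding v'(3) by (simp add: algebra_simps)
    ultimately have "t = (k0 * v0 + aw) + x * (k' * v + (k0 * v' + w'))"
      unfolding kw(3) w(3) by (simp add: algebra_simps)
    moreover have "k0 * v0 + aw \<in> A" by (intro sring_add[OF A] sring_mult[OF A] k(1) v'(1) w(1))
    ultimately show ?case using Y by blast
  qed
  then have "Y \<subseteq> ?P" by (intro psc_coind) (auto simp: Y_def)
  moreover have "t * s \<in> cmb ?P {0} [s]" using cmb_ConsI[OF ts(1), of 0 "{0}" "[]" _ s] by auto
  then have "t * s \<in> Y" unfolding Y_def using ts by (intro CollectI exI[of _ "[s]"]) auto
  ultimately show "t * s \<in> ?P" by blast
qed

lemma psc_x: "sring A \<Longrightarrow> x \<in> psc A x"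
proof -
  assume A: "sring A"
  have "{x, 1, 0} \<subseteq> psc A x"
  proof (rule psc_coind)
    fix t assume "t \<in> {x, 1, 0}"
    then have "t = (if t = x then 0 else t) + x * (if t = x then 1 else 0)" "(if t = x then 0 else t) \<in> A"
      using sring_0[OF A] sring_1[OF A] by auto
    then show "\<exists>a\<in>A. \<exists>t'\<in>{x, 1, 0}. t = a + x * t'" by (metis insertCI)
  qed
  then show ?thesis by blast
qed

locale clrK = clr M p for M :: "nat \<Rightarrow> 'b::comm_ring_1 set" and p +
  fixes K :: "'b set"
  assumes K: "fmod K NN" and NK: "NN \<subseteq> K" and KM: "K \<inter> M 1 \<subseteq> NN" and Ksur: "\<exists>k\<in>K. t - k \<in> M 1"
begin

lemma sK: "sring K" by (rule fmod_sring[OF K])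

text \<open>Power series in several variables, the last entry of the list being the innermost one.
  Weierstrass preparation therefore splits the list as \<open>zs @ [e]\<close> and ends with series
  in \<open>e\<close> alone.\<close>

primrec ser :: "'b list \<Rightarrow> 'b set" where
  "ser [] = K"
| "ser (x # xs) = psc (ser xs) x"

lemma ser_sring: "sring (ser xs)"
  by (induction xs) (auto intro: sK psc_sring)

lemma ser_tail: "ser xs \<subseteq> ser (x # xs)"
  using psc_base[OF sring_0[OF ser_sring]] by simp

lemma K_ser: "K \<subseteq> ser xs"
  by (induction xs) (use ser_tail in \<open>auto simp del: ser.simps(2)\<close>)

lemma NN_ser: "NN \<subseteq> ser xs" using NK K_ser by blast

lemma xs_ser: "set xs \<subseteq> ser xs"
proof (induction xs)
  case (Cons x xs)
  then show ?case using ser_tail[of xs x] psc_x[OF ser_sring, of x xs] by auto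
qed auto

lemma ser_gen: "ser xs \<subseteq> cmb (ser xs) K xs"
proof (induction xs)
  case (Cons x xs)
  show ?case
  proof
    fix t assume "t \<in> ser (x # xs)"
    then obtain a t' where t: "a \<in> ser xs" "t' \<in> ser (x # xs)" "t = a + x * t'" using psc_unfold by force
    have "a \<in> cmb (ser (x # xs)) K xs" using t(1) Cons cmb_mono[OF ser_tail[of xs x] order.refl, of K xs] by blast
    then show "t \<in> cmb (ser (x # xs)) K (x # xs)"
      by (rule cmb_ConsI[OF t(2)]) (simp add: t(3) algebra_simps)
  qed
qed auto

text \<open>Factors \<open>x\<close> are split off as long as the constant coefficient is zero. This
  stops, for otherwise \<open>t\<close> would lie in every \<open>M n\<close>.\<close>

lemma leading_term:
  assumes x: "x \<in> M 1" and A: "sring A" "NN \<subseteq> A" and t: "t \<in> psc A x" "t \<notin> NN"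
  shows "\<exists>\<beta>. \<exists>a\<in>A - NN. \<exists>t'\<in>psc A x. t - x ^ \<beta> * (a + x * t') \<in> NN"
proof (rule ccontr)
  assume neg: "\<not> ?thesis"
  have xM: "x ^ n \<in> M n" for n
    by (induction n) (use M_0 M_mult[OF x] in auto)
  have "\<exists>s\<in>psc A x. t - x ^ n * s \<in> NN" for n
  proof (induction n)
    case 0
    then show ?case using t(1) smod_0[OF NN_ideal] by (intro bexI[of _ t]) auto
  next
    case (Suc n)
    then obtain s where s: "s \<in> psc A x" "t - x ^ n * s \<in> NN" by blast
    obtain a t' where a: "a \<in> A" "t' \<in> psc A x" "s = a + x * t'" using psc_unfold[OF s(1)] by blast
    have "a \<in> NN" using neg s(2) a by blast
    then have "(t - x ^ n * s) + x ^ n * a \<in> NN" by (intro smod_add[OF NN_ideal] s(2) rideal_multl[OF NN_ideal])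
    then have "t - x ^ Suc n * t' \<in> NN" unfolding a(3) by (simp add: algebra_simps)
    then show ?case using a(2) by blast
  qed
  then have "t \<in> M n" for n
    using rideal_multr[OF M_ideal xM] NN_M smod_cong[OF M_ideal sring_UNIV] by (meson subsetD)
  then show False using t(2) NN_I by blast
qed

lemma unit_add: "u \<notin> M 1 \<Longrightarrow> m \<in> M 1 \<Longrightarrow> u + m \<notin> M 1"
  using rideal_diff[OF M_ideal, of "u + m" 1 m] by auto

text \<open>Substituting \<open>y = z - e ^ N\<close> with \<open>N\<close> large turns finitely many nonzero power series into a power
  of \<open>e\<close> times a unit modulo the \<open>ys\<close>.\<close>

lemma Weierstrass:
  assumes e: "e \<in> M 1"
  shows "set zs \<subseteq> M 1 \<Longrightarrow> set ts \<subseteq> ser (zs @ [e]) - NN \<Longrightarrow>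
    \<exists>ys. length ys = length zs \<and> set ys \<subseteq> M 1 \<and> (\<forall>z\<in>set zs. z \<in> cmb UNIV NN (e # ys)) \<and>
      (\<forall>y\<in>set ys. y \<in> cmb UNIV NN (zs @ [e])) \<and>
      (\<forall>t\<in>set ts. \<exists>w u. u \<notin> M 1 \<and> t - e ^ w * u \<in> cmb UNIV NN ys)"
proof (induction zs arbitrary: ts)
  case Nil
  have "\<exists>w u. u \<notin> M 1 \<and> t - e ^ w * u \<in> NN" if "t \<in> set ts" for t
  proof -
    have "t \<in> psc K e" "t \<notin> NN" using Nil.prems(2) that by auto
    then obtain \<beta> a t' where *: "a \<in> K - NN" "t - e ^ \<beta> * (a + e * t') \<in> NN"
      using leading_term[OF e sK NK] by blast
    have "a + e * t' \<notin> M 1" by (rule unit_add) (use * KM rideal_multr[OF M_ideal e] in auto)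
    then show ?thesis using * by blast
  qed
  then show ?case by (intro exI[of _ "[]"]) auto
next
  case (Cons z zs)
  let ?A = "ser (zs @ [e])"
  have "\<forall>t\<in>set ts. \<exists>\<beta> a t'. a \<in> ?A - NN \<and> t - z ^ \<beta> * (a + z * t') \<in> NN"
    using leading_term[OF _ ser_sring NN_ser, of z _ "zs @ [e]"] Cons.prems by fastforce
  then obtain \<beta> a t' where lt: "\<And>t. t \<in> set ts \<Longrightarrow> a t \<in> ?A - NN"
    "\<And>t. t \<in> set ts \<Longrightarrow> t - z ^ \<beta> t * (a t + z * t' t) \<in> NN" by metis
  obtain ys where ys: "length ys = length zs" "set ys \<subseteq> M 1" "\<forall>z\<in>set zs. z \<in> cmb UNIV NN (e # ys)"
    "\<forall>y\<in>set ys. y \<in> cmb UNIV NN (zs @ [e])"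
    "\<forall>t\<in>set (map a ts). \<exists>w u. u \<notin> M 1 \<and> t - e ^ w * u \<in> cmb UNIV NN ys"
    using Cons.IH[of "map a ts"] Cons.prems(1) lt(1) by (auto simp: image_subset_iff)
  then have "\<forall>t\<in>set ts. \<exists>w u. u \<notin> M 1 \<and> a t - e ^ w * u \<in> cmb UNIV NN ys" by auto
  then obtain w u where wu: "\<And>t. t \<in> set ts \<Longrightarrow> u t \<notin> M 1"
    "\<And>t. t \<in> set ts \<Longrightarrow> a t - e ^ w t * u t \<in> cmb UNIV NN ys" by metis
  \<comment> \<open>\<open>N\<close> exceeds every exponent \<open>w t\<close>, so after the
    substitution the term of lowest degree in \<open>z\<close> dominates and \<open>U\<close> below
    is still a unit.\<close>
  define N where "N = Suc (\<Sum>t\<in>set ts. w t)"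
  have wN: "w t < N" if "t \<in> set ts" for t
    unfolding N_def using member_le_sum[of t "set ts" w] that by (simp add: less_Suc_eq_le)
  define y where "y = z - e ^ N"
  define J where "J = cmb UNIV NN (y # ys)"
  have J: "rideal J" unfolding J_def by (rule cmb_rideal[OF NN_ideal])
  have NJ: "NN \<subseteq> J" unfolding J_def by (rule cmb_base) simp
  have ysJ: "cmb UNIV NN ys \<subseteq> J" unfolding J_def by (rule cmb_sub_mono[OF sring_UNIV NN_ideal]) auto
  have yJ: "y \<in> J" unfolding J_def by (rule cmb_mem) (auto simp: smod_0[OF NN_ideal])
  have eN: "e ^ N \<in> M 1" unfolding N_def using rideal_multr[OF M_ideal e] by simp
  have "\<exists>w' u'. u' \<notin> M 1 \<and> t - e ^ w' * u' \<in> J" if t: "t \<in> set ts" for t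
  proof -
    define U where "U = u t + e ^ (N - w t) * t' t"
    have "e ^ (N - w t) \<in> M 1" using wN[OF t] rideal_multr[OF M_ideal e] by (cases "N - w t") auto
    then have U: "U \<notin> M 1" unfolding U_def by (intro unit_add wu(1)[OF t] rideal_multr[OF M_ideal])
    have zN: "z - e ^ N \<in> J" using yJ unfolding y_def .
    have 1: "z ^ \<beta> t - (e ^ N) ^ \<beta> t \<in> J" by (rule power_cong_ideal[OF J zN])
    have 2: "a t - e ^ w t * u t \<in> J" using wu(2)[OF t] ysJ by blast
    have 3: "t - z ^ \<beta> t * (a t + z * t' t) \<in> J" using lt(2)[OF t] NJ by blast
    have "e ^ N = e ^ w t * e ^ (N - w t)" using wN[OF t] by (simp add: power_add[symmetric])
    then have "e ^ (N * \<beta> t + w t) * U = (e ^ N) ^ \<beta> t * (e ^ w t * u t + e ^ N * t' t)"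
      unfolding U_def by (simp add: power_add power_mult algebra_simps)
    then have "t - e ^ (N * \<beta> t + w t) * U = (t - z ^ \<beta> t * (a t + z * t' t)) +
       ((z ^ \<beta> t - (e ^ N) ^ \<beta> t) * (a t + z * t' t) + (e ^ N) ^ \<beta> t * ((a t - e ^ w t * u t) + (z - e ^ N) * t' t))"
      by (simp add: algebra_simps)
    also have "\<dots> \<in> J"
      by (intro smod_add[OF J] 3 rideal_multr[OF J] 1 rideal_multl[OF J] 2) (rule zN)
    finally show ?thesis using U by blast
  qed
  moreover have "y \<in> M 1" unfolding y_def using Cons.prems(1) eN rideal_diff[OF M_ideal] by auto
  moreover have "z' \<in> cmb UNIV NN (e # y # ys)" if "z' \<in> set (z # zs)" for z'
  proof (cases "z' = z")
    case True
    have "e ^ (N - 1) * e + y \<in> cmb UNIV NN (e # y # ys)"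
      by (rule cmb_ConsI[OF _ _ refl]) (use yJ J_def in auto)
    then show ?thesis unfolding True y_def N_def by (simp add: mult.commute)
  next
    case False
    then have "z' \<in> cmb UNIV NN (e # ys)" using ys(3) that by auto
    then show ?thesis using cmb_sub_mono[OF sring_UNIV NN_ideal order.refl order.refl, of "e # ys" "e # y # ys"] by auto
  qed
  moreover have "y' \<in> cmb UNIV NN ((z # zs) @ [e])" if "y' \<in> set (y # ys)" for y'
  proof (cases "y' = y")
    case True
    let ?Z = "cmb UNIV NN ((z # zs) @ [e])"
    have Z: "rideal ?Z" by (rule cmb_rideal[OF NN_ideal])
    have ze: "z \<in> ?Z" "e \<in> ?Z" by (auto intro!: cmb_mem simp: smod_0[OF NN_ideal] simp del: append_Cons)
    show ?thesis unfolding True y_def N_def power_Suc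
      by (rule rideal_diff[OF Z ze(1) rideal_multr[OF Z ze(2)]])
  next
    case False
    then have "y' \<in> cmb UNIV NN (zs @ [e])" using ys(4) that by auto
    then show ?thesis using cmb_sub_mono[OF sring_UNIV NN_ideal order.refl order.refl, of "zs @ [e]" "(z # zs) @ [e]"] by auto
  qed
  ultimately show ?case using ys(1,2) unfolding J_def by (intro exI[of _ "y # ys"]) auto
qed

subsection \<open>Systems of parameters\<close>

text \<open>Modulo \<open>J\<close> the list \<open>xs\<close> generates an ideal containing a power
  of the maximal ideal. The inclusion is required only up to every \<open>M k\<close>, so that
  \<open>J\<close> need not be closed; the length of the list is left free.\<close>

definition sop :: "'b list \<Rightarrow> 'b set \<Rightarrow> bool" where
  "sop xs J \<longleftrightarrow> set xs \<subseteq> M 1 \<and> (\<exists>n. \<forall>k. M n \<subseteq> cmb UNIV J xs + M k)"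

text \<open>The closure of \<open>J\<close> in the adic topology.\<close>

definition cl :: "'b set \<Rightarrow> 'b set" where "cl J = (\<Inter>k. J + M k)"

lemma cl_ideal: "rideal J \<Longrightarrow> rideal (cl J)"
proof -
  assume J: "rideal J"
  have *: "rideal (J + M k)" for k by (rule smod_set_plus[OF J M_ideal])
  show ?thesis unfolding cl_def smod_def using smod_0[OF *] smod_add[OF *] rideal_multl[OF *] by auto
qed

lemma cl_base: "J \<subseteq> cl J"
  unfolding cl_def using set_plus_upper1[OF smod_0[OF M_ideal], of J] by blast

lemma cl_mono: assumes "J \<subseteq> J'" shows "cl J \<subseteq> cl J'"
proof
  fix t assume t: "t \<in> cl J"
  have "t \<in> J' + M k" for k
    by (rule subsetD[OF set_plus_mono2[OF assms order.refl]]) (use t cl_def in auto)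
  then show "t \<in> cl J'" unfolding cl_def by auto
qed

lemma NN_cl: "rideal J \<Longrightarrow> NN \<subseteq> cl J"
  unfolding cl_def using set_zero_plus2[OF smod_0, of UNIV J] NN_M by blast

lemma cl_M1: "J \<subseteq> M 1 \<Longrightarrow> cl J \<subseteq> M 1"
  unfolding cl_def using set_plus_absorb[OF M_ideal, of J 1 "M 1"] by blast

text \<open>Modulo \<open>ys\<close> the element \<open>e\<close> is nilpotent and the other old
  parameters are multiples of \<open>e\<close>, so \<open>e\<close> can be omitted. The exponent
  grows to \<open>n * w\<close>, since \<open>M (n * j)\<close> falls into the multiples of
  \<open>e ^ j\<close>.\<close>

lemma sop_substitute:
  assumes J: "rideal J" and sop: "sop (zs @ [e]) J" and ys: "set ys \<subseteq> M 1"
    and zs: "\<forall>z\<in>set zs. z \<in> cmb UNIV NN (e # ys)"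
    and eu: "e ^ w * u \<in> cl (cmb UNIV J ys)" and u: "u \<notin> M 1"
  shows "sop ys J"
proof -
  define Y where "Y = cmb UNIV J ys"
  have Y: "rideal Y" unfolding Y_def by (rule cmb_rideal[OF J])
  obtain v where v: "u * v - 1 \<in> NN" using unit[OF u] by blast
  have clY: "rideal (cl Y)" by (rule cl_ideal[OF Y])
  have "(e ^ w * u) * v - e ^ w * (u * v - 1) \<in> cl Y"
    by (rule rideal_diff[OF clY rideal_multr[OF clY eu[folded Y_def]] subsetD[OF NN_cl[OF Y] rideal_multl[OF NN_ideal v]]])
  then have ew: "e ^ w \<in> cl Y" by (simp add: algebra_simps)
  obtain n where n: "\<And>k. M n \<subseteq> cmb UNIV J (zs @ [e]) + M k" using sop unfolding sop_def by blast
  have "M (n * w) \<subseteq> Y + M k" for k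
  proof -
    define Z where "Z = Y + M k"
    have Z: "rideal Z" unfolding Z_def by (rule smod_set_plus[OF Y M_ideal])
    have YZ: "Y \<subseteq> Z" and MZ: "M k \<subseteq> Z" unfolding Z_def
      by (rule set_plus_upper1[OF smod_0[OF M_ideal]], rule set_zero_plus2[OF smod_0[OF Y]])
    have Ze: "rideal (cmb UNIV Z [a])" for a by (rule cmb_rideal[OF Z])
    have ZZe: "Z \<subseteq> cmb UNIV Z [a]" for a by (rule cmb_base) simp
    have "cmb UNIV J (zs @ [e]) \<subseteq> cmb UNIV Z [e]"
    proof (rule cmb_least[OF Ze])
      have "J \<subseteq> Y" unfolding Y_def by (rule cmb_base) simp
      then show "J \<subseteq> cmb UNIV Z [e]" using YZ ZZe by blast
      have "cmb UNIV NN (e # ys) \<subseteq> cmb UNIV Z [e]"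
      proof (rule cmb_least[OF Ze])
        show "NN \<subseteq> cmb UNIV Z [e]" using NN_M[of k] MZ ZZe by blast
        have "set ys \<subseteq> Y" unfolding Y_def by (intro subsetI cmb_mem) (auto simp: smod_0[OF J])
        then show "set (e # ys) \<subseteq> cmb UNIV Z [e]" using YZ ZZe[of e] cmb_mem[of e "[e]" UNIV Z] smod_0[OF Z] by auto
      qed
      then show "set (zs @ [e]) \<subseteq> cmb UNIV Z [e]"
        using zs cmb_mem[of e "[e]" UNIV Z] smod_0[OF Z] by auto
    qed
    then have Mn: "M n \<subseteq> cmb UNIV Z [e]"
      using n[of k] set_plus_absorb[OF Ze, of "cmb UNIV J (zs @ [e])" e "M k"] MZ ZZe[of e] by blast
    have "M (n * j) \<subseteq> cmb UNIV Z [e ^ j]" for j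
    proof (induction j)
      case 0
      have "1 \<in> cmb UNIV Z [1]" by (rule cmb_mem) (auto simp: smod_0[OF Z])
      then have "cmb UNIV Z [1] = UNIV" by (rule rideal_1[OF Ze])
      then show ?case by simp
    next
      case (Suc j)
      have "M (n + n * j) \<subseteq> cmb UNIV Z [e ^ Suc j]"
      proof (rule M_sub[OF Ze])
        show "M k \<subseteq> cmb UNIV Z [e ^ Suc j]" using MZ ZZe by blast
        fix a b assume "a \<in> M n" "b \<in> M (n * j)"
        then obtain \<alpha> a' \<beta> b' where a: "a = \<alpha> * e + a'" "a' \<in> Z" and b: "b = \<beta> * e ^ j + b'" "b' \<in> Z"
          using subsetD[OF Mn] subsetD[OF Suc] by (fastforce elim!: cmb_ConsE)
        have "a * b = (\<alpha> * \<beta>) * e ^ Suc j + (\<alpha> * e * b' + a' * b)" unfolding a b by (simp add: algebra_simps)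
        moreover have "\<alpha> * e * b' + a' * b \<in> Z" by (intro smod_add[OF Z] rideal_multl[OF Z] rideal_multr[OF Z] a b)
        ultimately show "a * b \<in> cmb UNIV Z [e ^ Suc j]" by (intro cmb_ConsI[of "\<alpha> * \<beta>"]) auto
      qed
      then show ?case by simp
    qed
    moreover have "cmb UNIV Z [e ^ w] \<subseteq> Z"
      by (rule cmb_least[OF Z]) (use ew in \<open>auto simp: cl_def Z_def\<close>)
    ultimately show ?thesis unfolding Z_def by blast
  qed
  then show ?thesis unfolding sop_def Y_def[symmetric] using ys by blast
qed

lemma cmb_NN_cl: assumes J: "rideal J" shows "cmb UNIV NN ys \<subseteq> cl (cmb UNIV J ys)"
proof (rule cmb_least)
  show "rideal (cl (cmb UNIV J ys))" by (rule cl_ideal[OF cmb_rideal[OF J]])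
  show "NN \<subseteq> cl (cmb UNIV J ys)" by (rule NN_cl[OF cmb_rideal[OF J]])
  show "set ys \<subseteq> cl (cmb UNIV J ys)"
    by (intro subsetI subsetD[OF cl_base] cmb_mem) (auto simp: smod_0[OF J])
qed

definition minl :: "'b list \<Rightarrow> 'b set \<Rightarrow> bool" where
  "minl xs J \<longleftrightarrow> sop xs J \<and> (\<forall>ys. sop ys J \<longrightarrow> length xs \<le> length ys)"

lemma sop_mono: "sop xs J \<Longrightarrow> J \<subseteq> J' \<Longrightarrow> sop xs J'"
  unfolding sop_def
proof (elim conjE exE, intro conjI exI allI)
  fix n k assume "J \<subseteq> J'" "\<forall>k. M n \<subseteq> cmb UNIV J xs + M k"
  then show "M n \<subseteq> cmb UNIV J' xs + M k"
    using set_plus_mono2[OF cmb_mono[OF order.refl \<open>J \<subseteq> J'\<close>] order.refl, of UNIV xs "M k"] by (metis order.trans)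
qed

lemma sop_shrink:
  assumes J: "rideal J" "J \<subseteq> M 1" and sop: "sop xs J" and t: "t \<in> ser xs - NN" "t \<in> cl J"
  shows "\<exists>ys. length ys < length xs \<and> sop ys J"
proof (cases xs rule: rev_cases)
  case Nil
  then show ?thesis using t cl_M1[OF J(2)] KM by auto
next
  case (snoc zs e)
  have M1: "e \<in> M 1" "set zs \<subseteq> M 1" using sop unfolding snoc sop_def by auto
  obtain ys w u where ys: "length ys = length zs" "set ys \<subseteq> M 1" "\<forall>z\<in>set zs. z \<in> cmb UNIV NN (e # ys)"
    "u \<notin> M 1" "t - e ^ w * u \<in> cmb UNIV NN ys"
    using Weierstrass[OF M1, of "[t]"] t(1) unfolding snoc by auto
  have Y: "rideal (cmb UNIV J ys)" by (rule cmb_rideal[OF J(1)])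
  have clY: "rideal (cl (cmb UNIV J ys))" by (rule cl_ideal[OF Y])
  have 1: "t \<in> cl (cmb UNIV J ys)" by (rule subsetD[OF cl_mono[OF cmb_base] t(2)]) simp
  have 2: "t - e ^ w * u \<in> cl (cmb UNIV J ys)"
  proof -
    have "cmb UNIV NN ys \<subseteq> cl (cmb UNIV J ys)"
      by (rule cmb_NN_cl[OF J(1)])
    then show ?thesis using ys(5) by blast
  qed
  have "e ^ w * u \<in> cl (cmb UNIV J ys)" using rideal_diff[OF clY 1 2] by simp
  then have "sop ys J" using sop_substitute[OF J(1) sop[unfolded snoc] ys(2,3) _ ys(4)] by blast
  then show ?thesis using ys(1) snoc by (intro exI[of _ ys]) auto
qed

text \<open>By minimality no nonzero series vanishes modulo \<open>J\<close>. For a product, both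
  factors are prepared with the same \<open>ys\<close>, so the product is again a power of
  \<open>e\<close> times a unit; this is why preparation is stated for a list of series.\<close>

lemma minl_pdom:
  assumes J: "rideal J" "J \<subseteq> M 1" and minl: "minl xs J"
  shows "pdom (ser xs) (cl J)" "ser xs \<inter> cl J \<subseteq> NN"
proof -
  have sop: "sop xs J" using minl unfolding minl_def by blast
  show 0: "ser xs \<inter> cl J \<subseteq> NN"
  proof
    fix t assume "t \<in> ser xs \<inter> cl J"
    then show "t \<in> NN" using sop_shrink[OF J sop, of t] minl unfolding minl_def by (meson DiffI IntE not_le)
  qed
  have "a \<in> cl J \<or> b \<in> cl J" if ab: "a \<in> ser xs" "b \<in> ser xs" "a * b \<in> cl J" for a b
  proof (rule ccontr)
    assume "\<not> (a \<in> cl J \<or> b \<in> cl J)"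
    then have n: "a \<notin> NN" "b \<notin> NN" using NN_cl[OF J(1)] by auto
    show False
    proof (cases xs rule: rev_cases)
      case Nil
      then have "a \<notin> M 1" "b \<notin> M 1" using ab n KM by auto
      then show False using M1_prime ab(3) cl_M1[OF J(2)] by blast
    next
      case (snoc zs e)
      have M1: "e \<in> M 1" "set zs \<subseteq> M 1" using sop unfolding snoc sop_def by auto
      obtain ys where ys: "length ys = length zs" "set ys \<subseteq> M 1" "\<forall>z\<in>set zs. z \<in> cmb UNIV NN (e # ys)"
        "\<forall>t\<in>set [a, b]. \<exists>w u. u \<notin> M 1 \<and> t - e ^ w * u \<in> cmb UNIV NN ys"
        using Weierstrass[OF M1, of "[a, b]"] ab n unfolding snoc by auto
      then obtain w u w' u' where a: "u \<notin> M 1" "a - e ^ w * u \<in> cmb UNIV NN ys"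
        and b: "u' \<notin> M 1" "b - e ^ w' * u' \<in> cmb UNIV NN ys" by auto
      have Y: "rideal (cmb UNIV J ys)" by (rule cmb_rideal[OF J(1)])
      have clY: "rideal (cl (cmb UNIV J ys))" by (rule cl_ideal[OF Y])
      have I: "rideal (cmb UNIV NN ys)" by (rule cmb_rideal[OF NN_ideal])
      have s: "cmb UNIV NN ys \<subseteq> cl (cmb UNIV J ys)"
        by (rule cmb_NN_cl[OF J(1)])
      have "a * b - e ^ (w + w') * (u * u') = (a - e ^ w * u) * b + e ^ w * u * (b - e ^ w' * u')"
        by (simp add: algebra_simps power_add)
      then have 2: "a * b - e ^ (w + w') * (u * u') \<in> cl (cmb UNIV J ys)"
        using smod_add[OF I rideal_multr[OF I a(2)] rideal_multl[OF I b(2)]] s by auto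
      have 1: "a * b \<in> cl (cmb UNIV J ys)" by (rule subsetD[OF cl_mono[OF cmb_base] ab(3)]) simp
      have "e ^ (w + w') * (u * u') \<in> cl (cmb UNIV J ys)" using rideal_diff[OF clY 1 2] by simp
      moreover have "u * u' \<notin> M 1" using M1_prime a(1) b(1) by blast
      ultimately have "sop ys J" using sop_substitute[OF J(1) sop[unfolded snoc] ys(2,3)] by blast
      then show False using minl ys(1) unfolding minl_def snoc by fastforce
    qed
  qed
  then show "pdom (ser xs) (cl J)"
    unfolding pdom_def using ser_sring cl_ideal[OF J(1)] cl_M1[OF J(2)] M_1 by blast
qed

end

section \<open>Module-finiteness over power series\<close>

context clrK
begin

text \<open>Every \<open>t\<close> is a combination of \<open>us\<close>, plus
  \<open>x * s t\<close>, plus a combination of \<open>gs\<close>. Repeating this with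
  \<open>s t\<close> collects series in \<open>x\<close> as coefficients of \<open>us\<close>, while
  the coefficients of \<open>gs\<close> stay arbitrary.\<close>

lemma power_series_generation1:
  assumes x: "x \<in> M 1" and A: "sring A" "NN \<subseteq> A" and gen: "UNIV = cmb A (cmb UNIV NN (x # gs)) us"
  shows "UNIV = cmb (psc A x) (cmb UNIV NN gs) us"
proof -
  let ?m = "length us" and ?k = "length gs"
  have "\<forall>t. \<exists>c h s. (\<forall>i<?m. c i \<in> A) \<and> t - (\<Sum>i<?m. c i * us ! i) - s * x - (\<Sum>j<?k. h j * gs ! j) \<in> NN"
  proof
    fix t
    have "t \<in> cmb A (cmb UNIV NN (x # gs)) us" using gen by blast
    then obtain c where c: "\<forall>i<?m. c i \<in> A" "t - (\<Sum>i<?m. c i * us ! i) \<in> cmb UNIV NN (x # gs)"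
      unfolding cmb_iff[of t] by blast
    then obtain s w where "w \<in> cmb UNIV NN gs" "t - (\<Sum>i<?m. c i * us ! i) = s * x + w" by (auto elim!: cmb_ConsE)
    then have "t - (\<Sum>i<?m. c i * us ! i) - s * x \<in> cmb UNIV NN gs" by simp
    then show "\<exists>c h s. (\<forall>i<?m. c i \<in> A) \<and> t - (\<Sum>i<?m. c i * us ! i) - s * x - (\<Sum>j<?k. h j * gs ! j) \<in> NN"
      unfolding cmb_iff using c(1) by blast
  qed
  then obtain c h s where cA: "\<And>t i. i < ?m \<Longrightarrow> c t i \<in> A"
    and rel: "\<And>t. t - (\<Sum>i<?m. c t i * us ! i) - s t * x - (\<Sum>j<?k. h t j * gs ! j) \<in> NN" by metis
  \<comment> \<open>\<open>D f n t i\<close> is the sum of \<open>x ^ k * f ((s ^^ k) t) i\<close>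
    over \<open>k < n\<close>, a partial sum of the coefficient series.\<close>
  define D where "D = (\<lambda>f. rec_nat (\<lambda>t (i::nat). 0) (\<lambda>n d t i. f t i + x * d (s t) i))"
  have D0: "D f 0 t i = 0" and DS: "D f (Suc n) t i = f t i + x * D f n (s t) i" for f n t i
    unfolding D_def by auto
  have Cauchy: "D f (Suc n) t i - D f n t i \<in> M n" for f n t i
  proof (induction n arbitrary: t)
    case (Suc n)
    have "x * (D f (Suc n) (s t) i - D f n (s t) i) \<in> M (1 + n)" by (rule M_mult[OF x Suc])
    then show ?case by (subst (1 2) DS) (simp add: algebra_simps)
  qed (simp add: M_0)
  have "\<exists>l. \<forall>n. l - D f n t i \<in> M n" for f t i by (rule complete[OF Cauchy])
  then obtain l where l: "\<And>f t i n. l f t i - D f n t i \<in> M n" by metis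
  have lrel: "l f t i - (f t i + x * l f (s t) i) \<in> NN" for f t i
  proof (rule NN_I)
    fix n
    have "(l f t i - D f (Suc n) t i) - x * (l f (s t) i - D f n (s t) i) \<in> M n"
      by (rule rideal_diff[OF M_ideal subsetD[OF M_dec l] rideal_multl[OF M_ideal l]])
    then show "l f t i - (f t i + x * l f (s t) i) \<in> M n" unfolding DS by (simp add: algebra_simps)
  qed
  have lpsc: "l c t i \<in> psc A x" if i: "i < ?m" for t i
  proof -
    have "range (\<lambda>t. l c t i) \<subseteq> psc A x"
    proof (rule psc_coind)
      fix u assume "u \<in> range (\<lambda>t. l c t i)"
      then obtain t where u: "u = l c t i" by blast
      have "u = (c t i + (l c t i - (c t i + x * l c (s t) i))) + x * l c (s t) i" unfolding u by simp
      moreover have "c t i + (l c t i - (c t i + x * l c (s t) i)) \<in> A"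
        using cA[OF i] lrel A by (intro sring_add[OF A(1)]) auto
      ultimately show "\<exists>a\<in>A. \<exists>t'\<in>range (\<lambda>t. l c t i). u = a + x * t'" by blast
    qed
    then show ?thesis by blast
  qed
  have approx: "\<exists>r. t - (\<Sum>i<?m. D c n t i * us ! i) - (\<Sum>j<?k. D h n t j * gs ! j) - x ^ n * r \<in> NN" for n t
  proof (induction n arbitrary: t)
    case 0
    then show ?case using smod_0[OF NN_ideal] by (intro exI[of _ t]) (simp add: D0)
  next
    case (Suc n)
    obtain r where r: "s t - (\<Sum>i<?m. D c n (s t) i * us ! i) - (\<Sum>j<?k. D h n (s t) j * gs ! j) - x ^ n * r \<in> NN"
      using Suc by blast
    have "(t - (\<Sum>i<?m. c t i * us ! i) - s t * x - (\<Sum>j<?k. h t j * gs ! j)) +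
        x * (s t - (\<Sum>i<?m. D c n (s t) i * us ! i) - (\<Sum>j<?k. D h n (s t) j * gs ! j) - x ^ n * r) \<in> NN"
      by (rule smod_add[OF NN_ideal rel rideal_multl[OF NN_ideal r]])
    then have "t - (\<Sum>i<?m. D c (Suc n) t i * us ! i) - (\<Sum>j<?k. D h (Suc n) t j * gs ! j) - x ^ Suc n * r \<in> NN"
      unfolding DS by (simp add: algebra_simps sum.distrib sum_distrib_left)
    then show ?case by blast
  qed
  have xM: "x ^ n \<in> M n" for n by (induction n) (use M_0 M_mult[OF x] in auto)
  have "t \<in> cmb (psc A x) (cmb UNIV NN gs) us" for t
  proof -
    have "t - (\<Sum>i<?m. l c t i * us ! i) - (\<Sum>j<?k. l h t j * gs ! j) \<in> NN"
    proof (rule NN_I)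
      fix n
      obtain r where r: "t - (\<Sum>i<?m. D c n t i * us ! i) - (\<Sum>j<?k. D h n t j * gs ! j) - x ^ n * r \<in> NN"
        using approx by blast
      have 1: "(\<Sum>i<?m. (l c t i - D c n t i) * us ! i) \<in> M n"
        by (intro smod_sum[OF M_ideal] rideal_multr[OF M_ideal] l)
      have 2: "(\<Sum>j<?k. (l h t j - D h n t j) * gs ! j) \<in> M n"
        by (intro smod_sum[OF M_ideal] rideal_multr[OF M_ideal] l)
      have "(t - (\<Sum>i<?m. D c n t i * us ! i) - (\<Sum>j<?k. D h n t j * gs ! j) - x ^ n * r) + x ^ n * r -
        (\<Sum>i<?m. (l c t i - D c n t i) * us ! i) - (\<Sum>j<?k. (l h t j - D h n t j) * gs ! j) \<in> M n"
        by (intro rideal_diff[OF M_ideal] smod_add[OF M_ideal] subsetD[OF NN_M r] rideal_multr[OF M_ideal xM] 1 2)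
      then show "t - (\<Sum>i<?m. l c t i * us ! i) - (\<Sum>j<?k. l h t j * gs ! j) \<in> M n"
        by (simp add: algebra_simps sum_subtractf)
    qed
    then have "t - (\<Sum>i<?m. l c t i * us ! i) \<in> cmb UNIV NN gs" unfolding cmb_iff by blast
    then show ?thesis using lpsc unfolding cmb_iff[of t] by blast
  qed
  then show ?thesis by blast
qed

lemma power_series_generation:
  "set xs \<subseteq> M 1 \<Longrightarrow> UNIV = cmb K (cmb UNIV NN (xs @ gs)) us \<Longrightarrow> UNIV = cmb (ser xs) (cmb UNIV NN gs) us"
proof (induction xs arbitrary: gs)
  case (Cons x xs)
  have "cmb UNIV NN ((x # xs) @ gs) \<subseteq> cmb UNIV NN (xs @ (x # gs))"
    by (rule cmb_sub_mono[OF sring_UNIV NN_ideal]) auto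
  then have "UNIV = cmb K (cmb UNIV NN (xs @ (x # gs))) us"
    using Cons.prems(2) cmb_mono[OF order.refl, of "cmb UNIV NN ((x # xs) @ gs)" "cmb UNIV NN (xs @ (x # gs))" K us] by blast
  then have "UNIV = cmb (ser xs) (cmb UNIV NN (x # gs)) us" using Cons by simp
  then show ?case using power_series_generation1[OF _ ser_sring NN_ser, of x xs gs us] Cons.prems(1) by simp
qed simp

lemma M_n_fg: "\<exists>L. set L \<subseteq> M n \<and> M n \<subseteq> cmb UNIV (M (Suc n)) L"
proof (induction n)
  case 0
  have "1 \<in> cmb UNIV (M 1) [1]" by (rule cmb_mem) (auto simp: smod_0[OF M_ideal])
  then have "cmb UNIV (M 1) [1] = UNIV" by (rule rideal_1[OF cmb_rideal[OF M_ideal]])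
  then show ?case using M_0 by (intro exI[of _ "[1]"]) auto
next
  case (Suc n)
  obtain L where L: "set L \<subseteq> M n" "M n \<subseteq> cmb UNIV (M (Suc n)) L" using Suc by blast
  obtain zs where zs: "set zs \<subseteq> M 1" "M 1 \<subseteq> cmb UNIV (M 2) zs" using M_fin by blast
  define L' where "L' = concat (map (\<lambda>z. map ((*) z) L) zs)"
  let ?W = "cmb UNIV (M (Suc (Suc n))) L'"
  have W: "rideal ?W" by (rule cmb_rideal[OF M_ideal])
  have MW: "M (Suc (Suc n)) \<subseteq> ?W" by (rule cmb_base) simp
  have 1: "z * b \<in> ?W" if z: "z \<in> set zs" and b: "b \<in> M n" for z b
  proof -
    have "cmb UNIV (M (Suc n)) L \<subseteq> {b. z * b \<in> ?W}"
    proof (rule cmb_least)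
      show "rideal {b. z * b \<in> ?W}" using W unfolding smod_def by (auto simp: algebra_simps mult.left_commute[of z])
      have "z * b \<in> M (1 + Suc n)" if "b \<in> M (Suc n)" for b by (rule M_mult) (use z zs that in auto)
      then show "M (Suc n) \<subseteq> {b. z * b \<in> ?W}" using MW by auto
      have "z * l \<in> ?W" if "l \<in> set L" for l
        by (rule cmb_mem) (use z that in \<open>auto simp: L'_def smod_0[OF M_ideal]\<close>)
      then show "set L \<subseteq> {b. z * b \<in> ?W}" by auto
    qed
    then show ?thesis using L(2) b by blast
  qed
  have "M (1 + n) \<subseteq> ?W"
  proof (rule M_sub[OF W _ MW])
    fix a b assume a: "a \<in> M 1" and b: "b \<in> M n"
    have "cmb UNIV (M 2) zs \<subseteq> {a. a * b \<in> ?W}"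
    proof (rule cmb_least)
      show "rideal {a. a * b \<in> ?W}" using W unfolding smod_def by (auto simp: distrib_right mult.assoc)
      have "a * b \<in> M (2 + n)" if "a \<in> M 2" for a by (rule M_mult[OF that b])
      then show "M 2 \<subseteq> {a. a * b \<in> ?W}" using MW by auto
    qed (use 1 b in auto)
    then show "a * b \<in> ?W" using zs(2) a by blast
  qed
  moreover have "set L' \<subseteq> M (1 + n)" unfolding L'_def using M_mult[of _ 1 _ n] zs(1) L(1) by auto
  ultimately show ?case by (intro exI[of _ L']) simp
qed

lemma finite_K: "\<exists>us. UNIV = cmb K (M n) us"
proof (induction n)
  case 0
  then show ?case using M_0 by (intro exI[of _ "[]"]) auto
next
  case (Suc n)
  then obtain us where us: "UNIV = cmb K (M n) us" by blast
  obtain L where L: "set L \<subseteq> M n" "M n \<subseteq> cmb UNIV (M (Suc n)) L" using M_n_fg by blast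
  let ?W = "cmb K (M (Suc n)) L"
  have W: "smod K ?W" by (rule cmb_smod'[OF sK rideal_smod[OF M_ideal]])
  have "cmb UNIV (M (Suc n)) L' \<subseteq> ?W" if "set L' \<subseteq> set L" for L'
    using that
  proof (induction L')
    case Nil
    then show ?case using cmb_base[OF sring_0[OF sK]] by auto
  next
    case (Cons v L')
    show ?case
    proof
      fix t assume "t \<in> cmb UNIV (M (Suc n)) (v # L')"
      then obtain k w where t: "w \<in> cmb UNIV (M (Suc n)) L'" "t = k * v + w" by (auto elim!: cmb_ConsE)
      obtain \<kappa> where \<kappa>: "\<kappa> \<in> K" "k - \<kappa> \<in> M 1" using Ksur by blast
      have v: "v \<in> M n" "v \<in> set L" using Cons.prems L(1) by auto
      have "(k - \<kappa>) * v \<in> M (1 + n)" by (rule M_mult[OF \<kappa>(2) v(1)])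
      then have 1: "(k - \<kappa>) * v \<in> ?W" using cmb_base[OF sring_0[OF sK], of "M (Suc n)" L] by auto
      have 2: "\<kappa> * v \<in> ?W" by (intro smod_scale[OF W \<kappa>(1)] cmb_mem sK smod_0[OF M_ideal] v(2))
      have 3: "w \<in> ?W" using Cons t(1) by auto
      have "(k - \<kappa>) * v + \<kappa> * v + w \<in> ?W" by (intro smod_add[OF W] 1 2 3)
      then show "t \<in> ?W" unfolding t(2) by (simp add: algebra_simps)
    qed
  qed
  then have "M n \<subseteq> ?W" using L(2) by blast
  then have "UNIV \<subseteq> cmb K ?W us" using us cmb_mono[OF order.refl, of "M n" ?W K us] by blast
  then show ?case using cmb_append[of K "M (Suc n)" us L] by (intro exI[of _ "us @ L"]) auto
qed

lemma sop_NN: "sop xs NN \<Longrightarrow> \<exists>n. M n \<subseteq> cmb UNIV NN xs"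
proof -
  assume "sop xs NN"
  then obtain n where n: "\<And>k. M n \<subseteq> cmb UNIV NN xs + M k" unfolding sop_def by blast
  have "cmb UNIV NN xs + M (Suc n) \<subseteq> cmb UNIV (M (Suc n)) xs"
    by (rule set_plus_absorb[OF cmb_rideal[OF M_ideal] cmb_mono[OF order.refl NN_M] cmb_base]) simp
  then show ?thesis using complete_Nakayama[of n xs] n[of "Suc n"] by blast
qed

lemma cl_NN: "cl NN = NN"
proof
  have "NN + M k \<subseteq> M k" for k by (rule set_plus_absorb[OF M_ideal NN_M order.refl])
  then show "cl NN \<subseteq> NN" unfolding cl_def NN_def by blast
qed (rule cl_base)

lemma NN_M1: "NN \<subseteq> M 1" by (rule NN_M)

lemma minl_NN_generation:
  assumes "minl xs NN" shows "\<exists>us. UNIV = cmb (ser xs) NN us"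
proof -
  have sop: "sop xs NN" using assms unfolding minl_def by blast
  obtain n where n: "M n \<subseteq> cmb UNIV NN xs" using sop_NN[OF sop] by blast
  obtain us where us: "UNIV = cmb K (M n) us" using finite_K by blast
  have "UNIV = cmb K (cmb UNIV NN (xs @ [])) us"
    using us cmb_mono[OF order.refl n, of K us] by auto
  then show ?thesis using power_series_generation[of xs "[]" us] sop unfolding sop_def by auto
qed

text \<open>The quotient by \<open>J0\<close> is finite over the series in \<open>xs\<close>, so
  \<open>z\<close> divides some series \<open>a\<close> that is nonzero there. As \<open>a\<close>
  lies in \<open>J1\<close>, it shortens the parameters. This is the step that bounds chains of
  primes; the generators \<open>gs\<close> enter because finiteness is first proved modulo a
  finitely generated ideal.\<close>

lemma parameters_drop:
  assumes J0: "rideal J0" "cl J0 = J0" and J1: "rideal J1" "J0 \<subseteq> J1" "J1 \<subseteq> M 1" "cl J1 = J1"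
    and z: "z \<in> J1" "\<And>t. z * t \<in> J0 \<Longrightarrow> t \<in> J0"
    and gs: "\<And>k. J0 \<subseteq> cmb UNIV (M k) gs" "set gs \<subseteq> J0" and minl: "minl xs J0"
  shows "\<exists>ys. length ys < length xs \<and> sop ys J1"
proof -
  have sop: "sop xs J0" using minl unfolding minl_def by blast
  then obtain n where n: "\<And>k. M n \<subseteq> cmb UNIV J0 xs + M k" unfolding sop_def by blast
  have J0M: "J0 \<subseteq> M 1" using J1 by blast
  have r: "rideal (cmb UNIV (M (Suc n)) (xs @ gs))" by (rule cmb_rideal[OF M_ideal])
  have gs_sub: "cmb UNIV (M (Suc n)) gs \<subseteq> cmb UNIV (M (Suc n)) (xs @ gs)"
    by (rule cmb_sub_mono[OF sring_UNIV M_ideal]) auto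
  have "cmb UNIV J0 xs \<subseteq> cmb UNIV (M (Suc n)) (xs @ gs)"
  proof (rule cmb_least[OF r])
    show "J0 \<subseteq> cmb UNIV (M (Suc n)) (xs @ gs)" using gs(1)[of "Suc n"] gs_sub by blast
    show "set xs \<subseteq> cmb UNIV (M (Suc n)) (xs @ gs)" by (intro subsetI cmb_mem) (auto simp: smod_0[OF M_ideal])
  qed
  moreover have "M (Suc n) \<subseteq> cmb UNIV (M (Suc n)) (xs @ gs)" by (rule cmb_base) simp
  ultimately have "M n \<subseteq> cmb UNIV (M (Suc n)) (xs @ gs)"
    using n[of "Suc n"] set_plus_absorb[OF r] by (meson order.trans)
  then have Mn: "M n \<subseteq> cmb UNIV NN (xs @ gs)" by (rule complete_Nakayama)
  obtain us where us: "UNIV = cmb K (M n) us" using finite_K by blast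
  have "UNIV = cmb K (cmb UNIV NN (xs @ gs)) us" using us cmb_mono[OF order.refl Mn, of K us] by blast
  then have "UNIV = cmb (ser xs) (cmb UNIV NN gs) us"
    using power_series_generation sop unfolding sop_def by blast
  moreover have "cmb UNIV NN gs \<subseteq> J0" by (rule cmb_least[OF J0(1) _ gs(2)]) (use NN_cl[OF J0(1)] J0(2) in simp)
  ultimately have gen: "UNIV = cmb (ser xs) J0 us"
    using cmb_mono[OF order.refl, of "cmb UNIV NN gs" J0 "ser xs" us] by blast
  have D: "pdom (ser xs) J0" using minl_pdom(1)[OF J0(1) J0M minl] J0(2) by simp
  obtain g a where a: "a \<in> ser xs - J0" "a - z * g \<in> J0"
    using nonzerodivisor_multiple[OF D gen z(2)] by blast
  have "(a - z * g) + z * g \<in> J1" by (intro smod_add[OF J1(1)] subsetD[OF J1(2) a(2)] rideal_multr[OF J1(1) z(1)])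
  then have aJ: "a \<in> cl J1" unfolding J1(4) by simp
  have "a \<notin> NN" using a(1) NN_cl[OF J0(1)] J0(2) by auto
  then show ?thesis using sop_shrink[OF J1(1,3) sop_mono[OF sop J1(2)], of a] a(1) aJ by blast
qed

text \<open>Preparing \<open>c\<close> makes a power of \<open>e\<close> vanish modulo
  \<open>c\<close> and \<open>ys\<close>, and with it a power of each old parameter. If there are no
  parameters, \<open>c\<close> is a unit.\<close>

lemma ser_A2:
  assumes minl: "minl xs NN" and c: "c \<in> ser xs - NN"
  shows "(\<exists>b. c * b - 1 \<in> NN) \<or> (\<exists>ys. length ys < length xs \<and> (\<forall>x\<in>set xs. \<exists>w. x ^ w \<in> cmb UNIV NN (c # ys)) \<and>
         (\<forall>y\<in>set ys. \<exists>w. y ^ w \<in> cmb UNIV NN xs))"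
proof (cases xs rule: rev_cases)
  case Nil
  then have "c \<notin> M 1" using c KM by auto
  then show ?thesis using unit by blast
next
  case (snoc zs e)
  have M1: "e \<in> M 1" "set zs \<subseteq> M 1" using minl unfolding snoc minl_def sop_def by auto
  obtain ys w u where ys: "length ys = length zs" "set ys \<subseteq> M 1" "\<forall>z\<in>set zs. z \<in> cmb UNIV NN (e # ys)"
    "\<forall>y\<in>set ys. y \<in> cmb UNIV NN (zs @ [e])" and u: "u \<notin> M 1" "c - e ^ w * u \<in> cmb UNIV NN ys"
    using Weierstrass[OF M1, of "[c]"] c unfolding snoc by auto
  define J where "J = cmb UNIV NN (c # ys)"
  have J: "rideal J" unfolding J_def by (rule cmb_rideal[OF NN_ideal])
  have ysJ: "cmb UNIV NN ys \<subseteq> J" unfolding J_def by (rule cmb_sub_mono[OF sring_UNIV NN_ideal]) auto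
  have cJ: "c \<in> J" unfolding J_def by (rule cmb_mem) (auto simp: smod_0[OF NN_ideal])
  obtain v where v: "u * v - 1 \<in> NN" using unit[OF u(1)] by blast
  have "c - e ^ w * u \<in> J" using u(2) ysJ by blast
  then have 1: "e ^ w * u \<in> J" using rideal_diff[OF J cJ, of "c - e ^ w * u"] by simp
  have "u * v - 1 \<in> J" using v cmb_base[of UNIV NN "c # ys"] unfolding J_def by auto
  then have "(e ^ w * u) * v - e ^ w * (u * v - 1) \<in> J"
    by (intro rideal_diff[OF J rideal_multr[OF J 1]] rideal_multl[OF J])
  then have ew: "e ^ w \<in> J" by (simp add: algebra_simps)
  have "x ^ w \<in> J" if "x \<in> set xs" for x
  proof -
    have "x \<in> cmb UNIV NN (e # ys)"
    proof (cases "x = e")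
      case True
      then show ?thesis by (intro cmb_mem) (auto simp: smod_0[OF NN_ideal])
    next
      case False
      then show ?thesis using that ys(3) unfolding snoc by auto
    qed
    then obtain k r where x: "r \<in> cmb UNIV NN ys" "x = k * e + r" by (auto elim!: cmb_ConsE)
    have "x - k * e \<in> J" using x ysJ by auto
    then have "x ^ w - (k * e) ^ w \<in> J" by (rule power_cong_ideal[OF J])
    moreover have "(k * e) ^ w \<in> J" using rideal_multl[OF J ew] by (simp add: power_mult_distrib)
    ultimately show ?thesis using smod_add[OF J] by fastforce
  qed
  moreover have "\<exists>w. y ^ w \<in> cmb UNIV NN xs" if "y \<in> set ys" for y
    using ys(4) that unfolding snoc by (intro exI[of _ 1]) auto
  ultimately show ?thesis using ys(1) unfolding J_def snoc by (intro disjI2 exI[of _ ys]) auto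
qed

lemma nnring:
  assumes minl: "minl xs NN" and us: "UNIV = cmb (ser xs) NN us" and gs: "M s \<subseteq> cmb UNIV NN gs"
  shows "nnring NN K (ser xs) xs us gs p"
proof unfold_locales
  show "pdom (ser xs) NN" using minl_pdom(1)[OF NN_ideal NN_M1 minl] cl_NN by simp
  show "\<exists>w. x ^ w \<in> cmb UNIV NN gs" if "x \<in> set xs" for x
  proof -
    have "x ^ s \<in> M s"
    proof (induction s)
      case (Suc s)
      have "x * x ^ s \<in> M (1 + s)" by (rule M_mult[OF _ Suc]) (use that minl in \<open>auto simp: minl_def sop_def\<close>)
      then show ?case by simp
    qed (simp add: M_0)
    then show ?thesis using gs by blast
  qed
qed (use K K_ser xs_ser ser_gen us p p_NN ser_A2[OF minl] in auto)

lemma small_parameter: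
  assumes minl: "minl xs NN" and gs: "M s \<subseteq> cmb UNIV NN gs"
    and c: "M n \<subseteq> cmb UNIV NN (c # ys)" "set ys \<subseteq> M 1" "length ys < length xs"
  shows "\<exists>C. \<forall>e. \<exists>m. dimle K UNIV (cmb UNIV (frobseq p NN gs e) [c]) m \<and> m * p ^ e \<le> C * (p ^ e) ^ length xs"
proof -
  have yM: "y ^ s \<in> M s" if "y \<in> set ys" for y
  proof (induction s)
    case (Suc s)
    have "y * y ^ s \<in> M (1 + s)" by (rule M_mult[OF _ Suc]) (use that c(2) in auto)
    then show ?case by simp
  qed (simp add: M_0)
  obtain us where us: "UNIV = cmb K (M n) us" using finite_K by blast
  define P' where "P' = cmb UNIV NN [c]"
  have P': "rideal P'" unfolding P'_def by (rule cmb_rideal[OF NN_ideal])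
  have "cmb UNIV NN (c # ys) = cmb UNIV P' ys" unfolding P'_def by (rule cmb_swap[OF sring_UNIV NN_ideal])
  then have U: "UNIV \<subseteq> cmb K (cmb UNIV P' ys) us" using us cmb_mono[OF order.refl c(1), of K us] by auto
  have "\<exists>m. dimle K UNIV (cmb UNIV (frobseq p NN gs e) [c]) m \<and> m * p ^ e \<le> (length us * s ^ length ys) * (p ^ e) ^ length xs" for e
  proof -
    let ?q = "p ^ e"
    let ?Z = "cmb UNIV (frobseq p NN gs e) [c]"
    have F: "rideal (frobseq p NN gs e)" by (rule frobseq_rideal[OF NN_ideal])
    have Z: "rideal ?Z" by (rule cmb_rideal[OF F])
    obtain ns where ns: "length ns = length us * (s * ?q) ^ length ys"
      "UNIV \<subseteq> cmb K (cmb UNIV P' (map (\<lambda>y. y ^ (s * ?q)) ys)) ns"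
      using box[OF sring_UNIV sK _ P' _ U, of "s * ?q"] by auto
    have "cmb UNIV P' (map (\<lambda>y. y ^ (s * ?q)) ys) \<subseteq> ?Z"
    proof (rule cmb_least[OF Z])
      show "P' \<subseteq> ?Z" unfolding P'_def by (intro cmb_mono frobseq_base) auto
      have "y ^ (s * ?q) \<in> frobseq p NN gs e" if "y \<in> set ys" for y
        using frob_cmb[OF NN_ideal p p_NN sring_UNIV, of "y ^ s" gs e] yM[OF that] gs
        unfolding frobseq_def by (auto simp: power_mult)
      then show "set (map (\<lambda>y. y ^ (s * ?q)) ys) \<subseteq> ?Z" using cmb_base[of UNIV "frobseq p NN gs e" "[c]"] by auto
    qed
    then have "dimle K UNIV ?Z (length ns)"
      unfolding dimle_def using ns(2) cmb_mono[OF order.refl, of _ ?Z K ns] by (intro exI[of _ ns]) blast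
    moreover have "length ns * ?q \<le> (length us * s ^ length ys) * ?q ^ length xs"
    proof -
      have "length ns * ?q = (length us * s ^ length ys) * ?q ^ Suc (length ys)"
        unfolding ns(1) by (simp add: power_mult_distrib algebra_simps)
      also have "\<dots> \<le> (length us * s ^ length ys) * ?q ^ length xs"
        using c(3) prime_gt_0_nat[OF p] by (intro mult_left_mono power_increasing) auto
      finally show ?thesis .
    qed
    ultimately show ?thesis by blast
  qed
  then show ?thesis by blast
qed

end

lemma dimle_inside:
  assumes "fmod K P" "smod K U" "smod K V" "P \<subseteq> U" "U \<subseteq> V" "dimle K V U n"
  shows "\<exists>zs. set zs \<subseteq> V \<and> V \<subseteq> cmb K U zs \<and> length zs \<le> n"
proof -
  obtain vs where vs: "length vs \<le> n" "V \<subseteq> cmb K U vs" using assms(6) unfolding dimle_def by blast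
  obtain ws zs where "cmb K U vs \<subseteq> cmb K V ws \<and> set zs \<subseteq> V \<and> V \<subseteq> cmb K U zs \<and> length ws + length zs = length vs"
    using cmb_exchange[OF assms(1-5) vs(2)] by (elim exE)
  then show ?thesis using vs(1) by (intro exI[of _ zs]) simp
qed

context clrK
begin

subsection \<open>Lower bounds for colengths\<close>

lemma sop_cmb_mono:
  assumes "sop xs J" "cmb UNIV J xs \<subseteq> cmb UNIV J' ys" "set ys \<subseteq> M 1" shows "sop ys J'"
proof -
  obtain n where n: "\<And>k. M n \<subseteq> cmb UNIV J xs + M k" using assms(1) unfolding sop_def by blast
  have "M n \<subseteq> cmb UNIV J' ys + M k" for k
    by (rule order.trans[OF n set_plus_mono2[OF assms(2) order.refl]])
  then show ?thesis unfolding sop_def using assms(3) by blast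
qed

text \<open>Expansions in \<open>x\<close> are unique: a series in the remaining variables that is
  divisible by \<open>x\<close> is zero, and \<open>x\<close> is not a zero divisor on series. So
  coefficients may be compared as in a formal power series ring.\<close>

primrec uniq :: "'b list \<Rightarrow> bool" where
  "uniq [] \<longleftrightarrow> True"
| "uniq (x # xs) \<longleftrightarrow> x \<in> M 1 \<and> (\<forall>a\<in>ser xs. \<forall>t. a - x * t \<in> NN \<longrightarrow> a \<in> NN) \<and>
     (\<forall>t\<in>ser (x # xs). x * t \<in> NN \<longrightarrow> t \<in> NN) \<and> uniq xs"

lemma ser_append: "ser xs \<subseteq> ser (pre @ xs)"
  by (induction pre) (use ser_tail in \<open>auto simp del: ser.simps(2)\<close>)

lemma minl_uniq:
  assumes minl: "minl (pre @ xs) NN" shows "uniq xs"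
  using assms
proof (induction xs arbitrary: pre)
  case (Cons x xs)
  have sop: "sop (pre @ x # xs) NN" and min: "\<And>ys. sop ys NN \<Longrightarrow> length (pre @ x # xs) \<le> length ys"
    using Cons.prems unfolding minl_def by auto
  have M1: "set (pre @ x # xs) \<subseteq> M 1" using sop unfolding sop_def by blast
  obtain n where n: "\<And>k. M n \<subseteq> cmb UNIV NN (pre @ x # xs) + M k" using sop unfolding sop_def by blast
  have "a \<in> NN" if a: "a \<in> ser xs" "a - x * t \<in> NN" for a t
  proof (rule ccontr)
    assume aN: "a \<notin> NN"
    \<comment> \<open>Modulo the preceding variables and \<open>x\<close>, a nonzero
      \<open>a\<close> would shorten \<open>xs\<close> to some \<open>ys\<close>; putting
      \<open>pre\<close> and \<open>x\<close> back contradicts minimality of the whole list.\<close>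
    define J where "J = cmb UNIV NN (pre @ [x])"
    have J: "rideal J" unfolding J_def by (rule cmb_rideal[OF NN_ideal])
    have JM: "J \<subseteq> M 1" unfolding J_def by (rule cmb_least[OF M_ideal NN_M]) (use M1 in auto)
    have "x * t \<in> J" unfolding J_def by (intro rideal_multr[OF cmb_rideal[OF NN_ideal]] cmb_mem) (auto simp: smod_0[OF NN_ideal])
    moreover have "a - x * t \<in> J" using a(2) cmb_base[of UNIV NN "pre @ [x]"] unfolding J_def by auto
    ultimately have "(a - x * t) + x * t \<in> J" by (intro smod_add[OF J])
    then have aJ: "a \<in> cl J" using cl_base by auto
    have "cmb UNIV NN (pre @ x # xs) \<subseteq> cmb UNIV J xs"
    proof (rule cmb_least[OF cmb_rideal[OF J]])
      show "NN \<subseteq> cmb UNIV J xs" using cmb_base[of UNIV J xs] cmb_base[of UNIV NN "pre @ [x]"] unfolding J_def by auto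
      have "set (pre @ [x]) \<subseteq> J" unfolding J_def by (intro subsetI cmb_mem) (auto simp: smod_0[OF NN_ideal])
      then show "set (pre @ x # xs) \<subseteq> cmb UNIV J xs"
        using cmb_base[of UNIV J xs] cmb_mem[of _ xs UNIV J] smod_0[OF J] by auto
    qed
    then have "sop xs J" by (rule sop_cmb_mono[OF sop]) (use M1 in auto)
    then obtain ys where ys: "length ys < length xs" "sop ys J"
      using sop_shrink[OF J JM _ _ aJ] a(1) aN by blast
    have "cmb UNIV J ys \<subseteq> cmb UNIV NN (ys @ pre @ [x])" unfolding J_def cmb_append ..
    then have "sop (ys @ pre @ [x]) NN"
      by (rule sop_cmb_mono[OF ys(2)]) (use M1 ys(2) sop_def in auto)
    then show False using min ys(1) by fastforce
  qed
  moreover have "t \<in> NN" if t: "t \<in> ser (x # xs)" "x * t \<in> NN" for t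
  proof (rule ccontr)
    assume "t \<notin> NN"
    have D: "pdom (ser (pre @ x # xs)) NN" using minl_pdom(1)[OF NN_ideal NN_M1 Cons.prems] cl_NN by simp
    have "t \<in> ser (pre @ x # xs)" "x \<in> ser (pre @ x # xs)" using t(1) ser_append xs_ser by (blast, force)
    then have xN: "x \<in> NN" using pdom_mult[OF D, of x t] t(2) \<open>t \<notin> NN\<close> by blast
    have "cmb UNIV NN (pre @ x # xs) \<subseteq> cmb UNIV NN (pre @ xs)"
      by (rule cmb_sub_mono[OF sring_UNIV NN_ideal]) (use xN in auto)
    then have "sop (pre @ xs) NN" by (rule sop_cmb_mono[OF sop]) (use M1 in auto)
    then show False using min by fastforce
  qed
  moreover have "uniq xs" using Cons.IH[of "pre @ [x]"] Cons.prems by simp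
  ultimately show ?case using M1 by simp
qed simp

text \<open>The variables \<open>zs\<close> of the ring and the list \<open>xs\<close> of powers are
  separate, because the induction on variables needs powers of the remaining variables over the
  larger ring.\<close>

definition Xn :: "nat \<Rightarrow> 'b list \<Rightarrow> 'b list \<Rightarrow> 'b set" where
  "Xn n zs xs = cmb (ser zs) NN (map (\<lambda>x. x ^ n) xs)"

lemma Xn_smod: "smod (ser zs) (Xn n zs xs)"
  unfolding Xn_def by (rule cmb_smod'[OF ser_sring rideal_smod[OF NN_ideal]])

lemma NN_Xn: "NN \<subseteq> Xn n zs xs" unfolding Xn_def by (rule cmb_base[OF sring_0[OF ser_sring]])

lemma Xn_ser: "set xs \<subseteq> ser zs \<Longrightarrow> Xn n zs xs \<subseteq> ser zs"
  unfolding Xn_def by (rule cmb_least[OF smod_sring[OF ser_sring] NN_ser]) (auto intro: sring_power[OF ser_sring])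

lemma Xn_divide:
  "v \<in> Xn n (x # xs) ys \<Longrightarrow> \<exists>r\<in>Xn n xs ys. \<exists>v'\<in>Xn n (x # xs) ys. v - (r + x * v') \<in> NN"
  unfolding Xn_def
proof (induction ys arbitrary: v)
  case Nil
  then show ?case using smod_0[OF NN_ideal] by (intro bexI[of _ 0] bexI[of _ 0]) auto
next
  case (Cons y ys)
  obtain k w where kw: "k \<in> ser (x # xs)" "w \<in> cmb (ser (x # xs)) NN (map (\<lambda>x. x ^ n) ys)" "v = k * y ^ n + w"
    using Cons.prems by (auto elim!: cmb_ConsE simp del: ser.simps(2))
  obtain r v' where rv: "r \<in> cmb (ser xs) NN (map (\<lambda>x. x ^ n) ys)" "v' \<in> cmb (ser (x # xs)) NN (map (\<lambda>x. x ^ n) ys)"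
    "w - (r + x * v') \<in> NN" using Cons.IH[OF kw(2)] by blast
  obtain k0 k' where k: "k0 \<in> ser xs" "k' \<in> ser (x # xs)" "k = k0 + x * k'" using psc_unfold[of k "ser xs" x] kw(1) by auto
  have "v - ((k0 * y ^ n + r) + x * (k' * y ^ n + v')) \<in> NN"
    using rv(3) unfolding kw(3) k(3) by (simp add: algebra_simps)
  moreover have "k0 * y ^ n + r \<in> cmb (ser xs) NN (map (\<lambda>x. x ^ n) (y # ys))"
    using cmb_ConsI[OF k(1) rv(1) refl] by simp
  moreover have "k' * y ^ n + v' \<in> cmb (ser (x # xs)) NN (map (\<lambda>x. x ^ n) (y # ys))"
    using cmb_ConsI[OF k(2) rv(2) refl] by simp
  ultimately show ?case by blast
qed

text \<open>The part \<open>v\<close> splits into a term without \<open>x\<close> and a multiple of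
  \<open>x\<close>. By uniqueness the former is zero as long as \<open>j\<close> is positive, and a
  factor \<open>x\<close> can be cancelled.\<close>

lemma coefficient_mem:
  assumes U: "uniq (x # xs)"
  shows "a \<in> ser xs \<Longrightarrow> a' \<in> ser (x # xs) \<Longrightarrow> v \<in> Xn n (x # xs) xs \<Longrightarrow> \<tau> \<in> ser (x # xs) \<Longrightarrow>
    x ^ j * (a + x * a') - (v + x ^ Suc j * \<tau>) \<in> NN \<Longrightarrow> a \<in> Xn n xs xs"
proof (induction j arbitrary: a a' v \<tau>)
  case 0
  obtain r v' where r: "r \<in> Xn n xs xs" "v' \<in> Xn n (x # xs) xs" "v - (r + x * v') \<in> NN" using Xn_divide[OF 0(3)] by blast
  have rA: "r \<in> ser xs" using Xn_ser[OF xs_ser] r(1) by blast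
  have "(x ^ 0 * (a + x * a') - (v + x ^ Suc 0 * \<tau>)) + (v - (r + x * v')) \<in> NN" by (rule smod_add[OF NN_ideal 0(5) r(3)])
  then have "(a - r) - x * (\<tau> + v' - a') \<in> NN" by (simp add: algebra_simps)
  then have "a - r \<in> NN" using U sring_diff[OF ser_sring 0(1) rA] by auto
  then have "(a - r) + r \<in> Xn n xs xs" using NN_Xn r(1) by (intro smod_add[OF Xn_smod]) auto
  then show ?case by simp
next
  case (Suc j)
  obtain r v' where r: "r \<in> Xn n xs xs" "v' \<in> Xn n (x # xs) xs" "v - (r + x * v') \<in> NN" using Xn_divide[OF Suc.prems(3)] by blast
  have rA: "r \<in> ser xs" using Xn_ser[OF xs_ser] r(1) by blast
  let ?B = "x ^ j * (a + x * a') - (v' + x ^ Suc j * \<tau>)"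
  have "(x ^ Suc j * (a + x * a') - (v + x ^ Suc (Suc j) * \<tau>)) + (v - (r + x * v')) \<in> NN"
    by (rule smod_add[OF NN_ideal Suc.prems(5) r(3)])
  then have 1: "x * ?B - r \<in> NN" by (simp add: algebra_simps)
  then have "r - x * ?B \<in> NN" using rideal_uminus[OF NN_ideal 1] by simp
  then have rN: "r \<in> NN" using U rA by auto
  then have 2: "x * ?B \<in> NN" using smod_add[OF NN_ideal 1 rN] by simp
  have x: "x \<in> ser (x # xs)" using xs_ser[of "x # xs"] by simp
  have "v' \<in> ser (x # xs)" using Xn_ser[of xs "x # xs" n] xs_ser[of "x # xs"] r(2) by auto
  moreover have "a \<in> ser (x # xs)" using Suc.prems(1) ser_tail by blast
  ultimately have "?B \<in> ser (x # xs)"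
    using x Suc.prems by (intro sring_diff[OF ser_sring] sring_add[OF ser_sring] sring_mult[OF ser_sring] sring_power[OF ser_sring])
  then have "?B \<in> NN" using 2 U by (auto simp del: ser.simps(2))
  then show ?case using Suc.IH[OF Suc.prems(1,2) r(2) Suc.prems(4)] by blast
qed

lemma Xn_Cons_coefficient:
  assumes U: "uniq (x # xs)" and a: "a \<in> ser xs" "a' \<in> ser (x # xs)" and j: "j < n"
    and mem: "x ^ j * (a + x * a') \<in> Xn n (x # xs) (x # xs)"
  shows "a \<in> Xn n xs xs"
proof -
  obtain \<tau> v where v: "\<tau> \<in> ser (x # xs)" "v \<in> Xn n (x # xs) xs" "x ^ j * (a + x * a') = \<tau> * x ^ n + v"
    using mem unfolding Xn_def by (auto elim!: cmb_ConsE simp del: ser.simps(2))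
  have x: "x \<in> ser (x # xs)" using xs_ser[of "x # xs"] by simp
  obtain i where "n = Suc j + i" using j less_iff_Suc_add[of j n] by auto
  then have "x ^ n = x ^ Suc j * x ^ i" by (simp only: power_add)
  then have "x ^ j * (a + x * a') - (v + x ^ Suc j * (x ^ i * \<tau>)) \<in> NN"
    unfolding v(3) using smod_0[OF NN_ideal] by (simp add: algebra_simps)
  then show ?thesis
    by (rule coefficient_mem[OF U a v(2), rotated]) (intro sring_mult[OF ser_sring] sring_power[OF ser_sring] x v(1))
qed

text \<open>Let \<open>a\<close> start with \<open>x ^ \<beta> * a0\<close>. For
  \<open>i < n - \<beta>\<close>, the layer between the multiples of \<open>x ^ i * a\<close> and of
  \<open>x ^ Suc i * a\<close> is at least as large as the multiples of \<open>a0\<close> in one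
  variable less. The offset \<open>N0\<close> depends on \<open>a\<close> but not on
  \<open>n\<close>.\<close>

lemma colength_lower_bound:
  "uniq xs \<Longrightarrow> a \<in> ser xs - NN \<Longrightarrow>
    \<exists>N0. \<forall>n m. dimle K ((*) a ` ser xs) (Xn n xs xs) m \<longrightarrow> (n - N0) ^ length xs \<le> m"
proof (induction xs arbitrary: a)
  case Nil
  have "1 \<le> m" if "dimle K ((*) a ` K) NN m" for m
  proof (rule ccontr)
    assume "\<not> 1 \<le> m"
    then have "dimle K ((*) a ` K) NN 0" using that by (cases m) auto
    then have "(*) a ` K \<subseteq> NN" using dimle_0[of K "(*) a ` K" NN] by blast
    then have "a * 1 \<in> NN" using sring_1[OF sK] by blast
    then show False using Nil by simp
  qed
  then show ?case by (simp add: Xn_def)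
next
  case (Cons x xs)
  note U = Cons.prems(1)
  let ?A = "ser (x # xs)" and ?A' = "ser xs"
  have xM: "x \<in> M 1" and Uxs: "uniq xs" using U by auto
  have xA: "x \<in> ?A" using xs_ser[of "x # xs"] by simp
  obtain \<beta> a0 a' where lt: "a0 \<in> ?A' - NN" "a' \<in> ?A" "a - x ^ \<beta> * (a0 + x * a') \<in> NN"
    using leading_term[OF xM ser_sring NN_ser, of a xs] Cons.prems(2) by auto
  obtain N' where N': "\<And>n m. dimle K ((*) a0 ` ?A') (Xn n xs xs) m \<Longrightarrow> (n - N') ^ length xs \<le> m"
    using Cons.IH[OF Uxs lt(1)] by blast
  have "(n - max \<beta> N') ^ length (x # xs) \<le> m" if dim: "dimle K ((*) a ` ?A) (Xn n (x # xs) (x # xs)) m" for n m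
  proof -
    define Xx where "Xx = Xn n (x # xs) (x # xs)"
    define B where "B = (n - N') ^ length xs"
    define Z where "Z = (\<lambda>i. cmb ?A Xx [x ^ i * a])"
    have Xx: "smod ?A Xx" unfolding Xx_def by (rule Xn_smod)
    have KA: "K \<subseteq> ?A" by (rule K_ser)
    have Z: "smod ?A (Z i)" for i unfolding Z_def by (rule cmb_smod'[OF ser_sring Xx])
    have ZK: "smod K (Z i)" for i by (rule smod_mono[OF Z KA])
    have XZ: "Xx \<subseteq> Z i" for i unfolding Z_def by (rule cmb_base[OF sring_0[OF ser_sring]])
    have NX: "NN \<subseteq> Xx" unfolding Xx_def by (rule NN_Xn)
    have ZS: "Z (Suc i) \<subseteq> Z i" for i
    proof -
      have "x ^ i * a \<in> Z i" unfolding Z_def by (rule cmb_mem[OF _ ser_sring smod_0[OF Xx]]) simp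
      then have "x * (x ^ i * a) \<in> Z i" by (rule smod_scale[OF Z xA])
      moreover have "Z (Suc i) = cmb ?A Xx [x ^ Suc i * a]" by (simp only: Z_def)
      ultimately show ?thesis using cmb_least[OF Z XZ, of "[x ^ Suc i * a]" i] by (simp add: mult.assoc)
    qed
    have drop: "B \<le> m1" if i: "i < n - \<beta>" and d: "dimle K (Z i) (Z (Suc i)) m1" for i m1
    proof -
      obtain vs where vs: "set vs \<subseteq> Z i" "Z i \<subseteq> cmb K (Z (Suc i)) vs" "length vs \<le> m1"
        using dimle_inside[OF K ZK ZK _ ZS d] NX XZ by blast
      have "\<forall>l<length vs. \<exists>\<alpha>\<in>?A. \<exists>w\<in>Xx. vs ! l = \<alpha> * (x ^ i * a) + w"
      proof (intro allI impI)
        fix l assume "l < length vs"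
        then have "vs ! l \<in> cmb ?A Xx [x ^ i * a]" using vs(1) unfolding Z_def by auto
        then show "\<exists>\<alpha>\<in>?A. \<exists>w\<in>Xx. vs ! l = \<alpha> * (x ^ i * a) + w" by (elim cmb_ConsE) (simp only: cmb.simps(1), blast)
      qed
      then obtain \<alpha> w where \<alpha>: "\<And>l. l < length vs \<Longrightarrow> \<alpha> l \<in> ?A" "\<And>l. l < length vs \<Longrightarrow> w l \<in> Xx"
        "\<And>l. l < length vs \<Longrightarrow> vs ! l = \<alpha> l * (x ^ i * a) + w l" by metis
      have "\<forall>l<length vs. \<exists>\<alpha>0\<in>?A'. \<exists>\<alpha>'\<in>?A. \<alpha> l = \<alpha>0 + x * \<alpha>'" using \<alpha>(1) psc_unfold[of _ ?A' x] by auto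
      then obtain \<alpha>0 \<alpha>' where \<alpha>0: "\<And>l. l < length vs \<Longrightarrow> \<alpha>0 l \<in> ?A'" "\<And>l. l < length vs \<Longrightarrow> \<alpha>' l \<in> ?A"
        "\<And>l. l < length vs \<Longrightarrow> \<alpha> l = \<alpha>0 l + x * \<alpha>' l" by metis
      \<comment> \<open>Constant terms of the coefficients \<open>\<alpha>\<close>, times
        \<open>a0\<close>. Comparing coefficients of \<open>x ^ (i + \<beta>)\<close> shows that
        they generate the multiples of \<open>a0\<close> modulo the powers.\<close>
      define us where "us = map (\<lambda>l. a0 * \<alpha>0 l) [0..<length vs]"
      have "(*) a0 ` ?A' \<subseteq> cmb K (Xn n xs xs) us"
      proof
        fix t assume "t \<in> (*) a0 ` ?A'"
        then obtain \<gamma> where \<gamma>: "\<gamma> \<in> ?A'" "t = a0 * \<gamma>" by blast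
        have \<gamma>A: "\<gamma> \<in> ?A" using \<gamma>(1) ser_tail by blast
        have "\<gamma> * (x ^ i * a) \<in> Z i" unfolding Z_def by (rule cmb_ConsI[OF \<gamma>A]) (use smod_0[OF Xx] in auto)
        then obtain \<kappa> where \<kappa>: "\<forall>l<length vs. \<kappa> l \<in> K" "\<gamma> * (x ^ i * a) - (\<Sum>l<length vs. \<kappa> l * vs ! l) \<in> Z (Suc i)"
          using iffD1[OF cmb_iff subsetD[OF vs(2)]] by blast
        then obtain \<delta> z where \<delta>: "\<delta> \<in> ?A" "z \<in> Xx" "\<gamma> * (x ^ i * a) - (\<Sum>l<length vs. \<kappa> l * vs ! l) = \<delta> * (x ^ Suc i * a) + z"
          unfolding Z_def by (auto elim!: cmb_ConsE simp del: ser.simps(2))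
        define \<epsilon> where "\<epsilon> = \<gamma> - (\<Sum>l<length vs. \<kappa> l * \<alpha> l) - x * \<delta>"
        have "(\<Sum>l<length vs. \<kappa> l * vs ! l) = (\<Sum>l<length vs. \<kappa> l * \<alpha> l) * (x ^ i * a) + (\<Sum>l<length vs. \<kappa> l * w l)"
          using \<alpha>(3) by (simp add: algebra_simps sum.distrib sum_distrib_left)
        then have "x ^ i * a * \<epsilon> = z + (\<Sum>l<length vs. \<kappa> l * w l)"
          using \<delta>(3) unfolding \<epsilon>_def by (simp add: algebra_simps)
        moreover have "z + (\<Sum>l<length vs. \<kappa> l * w l) \<in> Xx"
          using \<kappa>(1) \<alpha>(2) KA by (intro smod_add[OF Xx] \<delta>(2) smod_sum[OF Xx] smod_scale[OF Xx]) auto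
        ultimately have 1: "x ^ i * a * \<epsilon> \<in> Xx" by simp
        have "(a - x ^ \<beta> * (a0 + x * a')) * (x ^ i * \<epsilon>) \<in> Xx" using rideal_multr[OF NN_ideal lt(3)] NX by blast
        then have "x ^ i * a * \<epsilon> - (a - x ^ \<beta> * (a0 + x * a')) * (x ^ i * \<epsilon>) \<in> Xx"
          by (rule smod_diff[OF Xx ser_sring 1])
        then have 2: "x ^ (i + \<beta>) * ((a0 + x * a') * \<epsilon>) \<in> Xx" by (simp add: algebra_simps power_add)
        define \<epsilon>0 where "\<epsilon>0 = \<gamma> - (\<Sum>l<length vs. \<kappa> l * \<alpha>0 l)"
        define \<epsilon>' where "\<epsilon>' = - (\<Sum>l<length vs. \<kappa> l * \<alpha>' l) - \<delta>"
        have \<epsilon>0: "\<epsilon>0 \<in> ?A'" unfolding \<epsilon>0_def using \<kappa>(1) \<alpha>0(1) K_ser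
          by (intro sring_diff[OF ser_sring] \<gamma>(1) sring_sum[OF ser_sring] sring_mult[OF ser_sring]) auto
        have \<epsilon>': "\<epsilon>' \<in> ?A" unfolding \<epsilon>'_def using \<kappa>(1) \<alpha>0(2) KA
          by (intro sring_diff[OF ser_sring] \<delta>(1) sring_uminus[OF ser_sring] sring_sum[OF ser_sring] sring_mult[OF ser_sring]) auto
        have "(\<Sum>l<length vs. \<kappa> l * \<alpha> l) = (\<Sum>l<length vs. \<kappa> l * \<alpha>0 l) + x * (\<Sum>l<length vs. \<kappa> l * \<alpha>' l)"
          using \<alpha>0(3) by (simp add: algebra_simps sum.distrib sum_distrib_left)
        then have e: "\<epsilon> = \<epsilon>0 + x * \<epsilon>'" unfolding \<epsilon>_def \<epsilon>0_def \<epsilon>'_def by (simp add: algebra_simps)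
        have "(a0 + x * a') * \<epsilon> = a0 * \<epsilon>0 + x * (a0 * \<epsilon>' + a' * \<epsilon>0 + x * a' * \<epsilon>')"
          unfolding e by (simp add: algebra_simps)
        then have 3: "x ^ (i + \<beta>) * (a0 * \<epsilon>0 + x * (a0 * \<epsilon>' + a' * \<epsilon>0 + x * a' * \<epsilon>')) \<in> Xx" using 2 by simp
        have a0A: "a0 \<in> ?A" and \<epsilon>0A: "\<epsilon>0 \<in> ?A" using lt(1) \<epsilon>0 ser_tail by blast+
        have "a0 * \<epsilon>0 \<in> Xn n xs xs"
        proof (rule Xn_Cons_coefficient[OF U _ _ _ 3[unfolded Xx_def]])
          show "a0 * \<epsilon>0 \<in> ?A'" using lt(1) by (intro sring_mult[OF ser_sring] \<epsilon>0) auto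
          show "a0 * \<epsilon>' + a' * \<epsilon>0 + x * a' * \<epsilon>' \<in> ?A"
            by (intro sring_add[OF ser_sring] sring_mult[OF ser_sring] a0A \<epsilon>' lt(2) \<epsilon>0A xA)
          show "i + \<beta> < n" using i by simp
        qed
        moreover have "(\<Sum>l<length us. \<kappa> l * us ! l) = (\<Sum>l<length vs. \<kappa> l * (a0 * \<alpha>0 l))"
          unfolding us_def by (rule sum.cong) auto
        ultimately have "t - (\<Sum>l<length us. \<kappa> l * us ! l) \<in> Xn n xs xs"
          unfolding \<gamma>(2) \<epsilon>0_def by (simp add: algebra_simps sum_distrib_left)
        then show "t \<in> cmb K (Xn n xs xs) us" unfolding cmb_iff using \<kappa>(1) by (intro exI[of _ \<kappa>]) (auto simp: us_def)
      qed
      then have "dimle K ((*) a0 ` ?A') (Xn n xs xs) m1" unfolding dimle_def using vs(3)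
        by (intro exI[of _ us]) (auto simp: us_def)
      then show ?thesis unfolding B_def by (rule N')
    qed
    have chain: "i \<le> n - \<beta> \<Longrightarrow> \<exists>m'. dimle K (Z i) Xx m' \<and> m' + i * B \<le> m" for i
    proof (induction i)
      case 0
      obtain us where us: "length us \<le> m" "(*) a ` ?A \<subseteq> cmb K Xx us" using dim unfolding dimle_def Xx_def by blast
      have XK: "smod K (cmb K Xx us)" by (rule cmb_smod'[OF sK smod_mono[OF Xx KA]])
      have "Z 0 \<subseteq> cmb K Xx us"
      proof
        fix t assume "t \<in> Z 0"
        then obtain k w where t: "k \<in> ?A" "w \<in> Xx" "t = k * a + w" unfolding Z_def by (auto elim!: cmb_ConsE simp del: ser.simps(2))
        have "a * k \<in> cmb K Xx us" using us(2) t(1) by blast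
        moreover have "w \<in> cmb K Xx us" using cmb_base[OF sring_0[OF sK]] t(2) by blast
        ultimately have "a * k + w \<in> cmb K Xx us" by (rule smod_add[OF XK])
        then show "t \<in> cmb K Xx us" unfolding t(3) by (simp add: mult.commute)
      qed
      then show ?case using us(1) unfolding dimle_def by auto
    next
      case (Suc i)
      then obtain m' where m': "dimle K (Z i) Xx m'" "m' + i * B \<le> m" by auto
      obtain m1 m2 where m12: "dimle K (Z i) (Z (Suc i)) m1" "dimle K (Z (Suc i)) Xx m2" "m1 + m2 = m'"
        using dimle_split[OF K smod_mono[OF Xx KA] ZK ZK NX XZ ZS m'(1)] by blast
      have "B \<le> m1" by (rule drop[OF _ m12(1)]) (use Suc.prems in simp)
      then show ?case using m12 m'(2) by (intro exI[of _ m2]) auto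
    qed
    obtain m' where "m' + (n - \<beta>) * B \<le> m" using chain[of "n - \<beta>"] by auto
    then have "(n - \<beta>) * B \<le> m" by simp
    moreover have "(n - max \<beta> N') ^ length (x # xs) \<le> (n - \<beta>) * B"
      unfolding B_def by (simp, intro mult_le_mono power_mono) auto
    ultimately show ?thesis by (rule order.trans[rotated])
  qed
  then show ?case by blast
qed

text \<open>The map \<open>\<phi>\<close> is linear over the series and sends 1 to a nonzero
  \<open>a\<close>, so it carries generators of the whole ring to generators of the multiples of
  \<open>a\<close>, where the preceding bound applies. The exponent \<open>n0\<close> puts the
  \<open>p ^ n0\<close>-th powers of \<open>gs\<close> into the ideal of \<open>xs\<close>.\<close>

lemma colength_growth:
  assumes minl: "minl xs NN" and gs: "set gs \<subseteq> M 1"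
  shows "\<exists>e0 N0. \<forall>e m. dimle K UNIV (frobseq p NN gs (e0 + e)) m \<longrightarrow> (p ^ e - N0) ^ length xs \<le> m"
proof -
  let ?A = "ser xs"
  have D: "pdom ?A NN" using minl_pdom(1)[OF NN_ideal NN_M1 minl] cl_NN by simp
  have A: "sring ?A" by (rule ser_sring)
  obtain us where us: "UNIV = cmb ?A NN us" using minl_NN_generation[OF minl] by blast
  \<comment> \<open>The independent lists are made to end in 1, so that their last coordinate
    \<open>\<phi>\<close> does not vanish at 1.\<close>
  define Q where "Q = (\<lambda>ts. lindep ?A NN (ts @ [1]))"
  have Q0: "Q []" unfolding Q_def lindep_def by auto
  have Qlen: "length ts \<le> length us" if "Q ts" for ts
    using dep_of_gens[OF D, of "ts @ [1]" us] us that unfolding Q_def by (metis length_append_singleton less_Suc_eq not_le subset_UNIV)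
  obtain ts where ts: "Q ts" "\<And>t. \<not> Q (t # ts)" using ex_max_list[of Q, OF Q0 Qlen] by blast
  define L where "L = ts @ [1]"
  define m where "m = length ts"
  have indL: "lindep ?A NN L" using ts(1) unfolding Q_def L_def .
  have lenL: "length L = Suc m" unfolding L_def m_def by simp
  let ?V = "cmb ?A NN L"
  have V: "smod ?A ?V" by (rule cmb_smod'[OF A rideal_smod[OF NN_ideal]])
  have NV: "NN \<subseteq> ?V" by (rule cmb_base[OF sring_0[OF A]])
  obtain a where a: "a \<in> ?A - NN" "\<forall>u\<in>set us. a * u \<in> ?V"
    using common_multiple[OF D V, of us "\<lambda>u. u"] lindep_Cons_dep[OF D indL] ts(2) unfolding Q_def L_def by auto
  have aV: "a * t \<in> ?V" for t
  proof -
    have "cmb ?A NN us \<subseteq> {t. a * t \<in> ?V}"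
    proof (rule cmb_least)
      show "smod ?A {t. a * t \<in> ?V}"
        using V unfolding smod_def by (auto simp: algebra_simps mult.left_commute[of a])
    qed (use a NV rideal_multl[OF NN_ideal] in auto)
    then show ?thesis using us by blast
  qed
  have "\<forall>b. \<exists>c. (\<forall>i<Suc m. c i \<in> ?A) \<and> a * b - (\<Sum>i<Suc m. c i * L ! i) \<in> NN"
    using aV unfolding cmb_iff lenL by blast
  then obtain \<sigma> where \<sigma>: "\<And>b i. i < Suc m \<Longrightarrow> \<sigma> b i \<in> ?A" "\<And>b. a * b - (\<Sum>i<Suc m. \<sigma> b i * L ! i) \<in> NN"
    by metis
  define \<phi> where "\<phi> = (\<lambda>b. \<sigma> b m)"
  have \<phi>A: "\<phi> b \<in> ?A" for b unfolding \<phi>_def by (rule \<sigma>(1)) simp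
  have coord: "\<phi> b - c m \<in> NN"
    if c: "\<And>i. i < Suc m \<Longrightarrow> c i \<in> ?A" "a * b - (\<Sum>i<Suc m. c i * L ! i) \<in> NN" for b c
  proof -
    have "(\<Sum>i<Suc m. (\<sigma> b i - c i) * L ! i) \<in> NN"
      using rideal_diff[OF NN_ideal c(2) \<sigma>(2)[of b]] by (simp add: algebra_simps sum_subtractf)
    then show ?thesis unfolding \<phi>_def
      using lindepD[OF indL, of "\<lambda>i. \<sigma> b i - c i" m] \<sigma>(1) c(1) sring_diff[OF A] unfolding lenL by auto
  qed
  have \<phi>_add: "\<phi> (b + b') - (\<phi> b + \<phi> b') \<in> NN" for b b'
  proof -
    have "a * (b + b') - (\<Sum>i<Suc m. (\<sigma> b i + \<sigma> b' i) * L ! i) \<in> NN"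
      using smod_add[OF NN_ideal \<sigma>(2)[of b] \<sigma>(2)[of b']] by (simp add: algebra_simps sum.distrib)
    from coord[OF _ this] show ?thesis unfolding \<phi>_def using \<sigma>(1) sring_add[OF A] by auto
  qed
  have \<phi>_scale: "\<phi> (g * b) - g * \<phi> b \<in> NN" if g: "g \<in> ?A" for g b
  proof -
    have "a * (g * b) - (\<Sum>i<Suc m. (g * \<sigma> b i) * L ! i) \<in> NN"
      using rideal_multl[OF NN_ideal \<sigma>(2)[of b], of g] by (simp add: algebra_simps sum_distrib_left)
    from coord[OF _ this] show ?thesis unfolding \<phi>_def using \<sigma>(1) g sring_mult[OF A] by auto
  qed
  have \<phi>_NN: "\<phi> b \<in> NN" if "b \<in> NN" for b
    using coord[of "\<lambda>_. 0" b] sring_0[OF A] rideal_multl[OF NN_ideal that] by simp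
  have \<phi>_1: "\<phi> 1 - a \<in> NN"
  proof -
    have "(\<Sum>i<Suc m. (if i = m then a else 0) * L ! i) = (\<Sum>i<Suc m. if i = m then a * L ! i else 0)"
      by (rule sum.cong) auto
    also have "\<dots> = a" unfolding L_def m_def by (simp add: sum.delta)
    finally have "a * 1 - (\<Sum>i<Suc m. (if i = m then a else 0) * L ! i) \<in> NN" using smod_0[OF NN_ideal] by simp
    from coord[OF _ this] show ?thesis using a(1) sring_0[OF A] by auto
  qed
  have \<phi>_X: "f \<in> cmb UNIV NN (map (\<lambda>x. x ^ n) ys) \<Longrightarrow> set ys \<subseteq> ?A \<Longrightarrow> \<phi> f \<in> Xn n xs ys" for f n ys
    unfolding Xn_def
  proof (induction ys arbitrary: f)
    case Nil
    then show ?case using \<phi>_NN by simp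
  next
    case (Cons y ys)
    let ?Z = "cmb ?A NN (map (\<lambda>x. x ^ n) (y # ys))"
    obtain k w where kw: "w \<in> cmb UNIV NN (map (\<lambda>x. x ^ n) ys)" "f = k * y ^ n + w"
      using Cons.prems(1) by (auto elim!: cmb_ConsE)
    have Z: "smod ?A ?Z" by (rule cmb_smod'[OF A rideal_smod[OF NN_ideal]])
    have NZ: "NN \<subseteq> ?Z" by (rule cmb_base[OF sring_0[OF A]])
    have yn: "y ^ n \<in> ?A" using Cons.prems(2) by (intro sring_power[OF A]) auto
    have "\<phi> k * y ^ n + \<phi> w \<in> ?Z"
      using Cons.prems(2) by (simp only: list.map, intro cmb_ConsI[OF \<phi>A _ refl] Cons.IH[OF kw(1)]) simp
    moreover have "(\<phi> (y ^ n * k + w) - (\<phi> (y ^ n * k) + \<phi> w)) + (\<phi> (y ^ n * k) - y ^ n * \<phi> k) \<in> ?Z"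
      using smod_add[OF NN_ideal \<phi>_add \<phi>_scale[OF yn]] NZ by blast
    ultimately have "(\<phi> (y ^ n * k + w) - (\<phi> (y ^ n * k) + \<phi> w)) + (\<phi> (y ^ n * k) - y ^ n * \<phi> k) + (\<phi> k * y ^ n + \<phi> w) \<in> ?Z"
      by (rule smod_add[OF Z, rotated])
    then show ?case unfolding kw(2) by (simp add: algebra_simps)
  qed
  obtain N0 where N0: "\<And>n m. dimle K ((*) a ` ?A) (Xn n xs xs) m \<Longrightarrow> (n - N0) ^ length xs \<le> m"
    using colength_lower_bound[OF minl_uniq[of "[]" xs] a(1)] minl by auto
  obtain n0 where n0: "M n0 \<subseteq> cmb UNIV NN xs" using sop_NN minl unfolding minl_def by blast
  have gM: "g ^ s \<in> M s" if "g \<in> set gs" for g s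
  proof (induction s)
    case (Suc s)
    have "g * g ^ s \<in> M (1 + s)" by (rule M_mult[OF _ Suc]) (use that gs in auto)
    then show ?case by simp
  qed (simp add: M_0)
  have "(p ^ e - N0) ^ length xs \<le> m" if dim: "dimle K UNIV (frobseq p NN gs (n0 + e)) m" for e m
  proof (rule N0)
    let ?Xx = "Xn (p ^ e) xs xs"
    have Xx: "smod K ?Xx" by (rule smod_mono[OF Xn_smod K_ser])
    have F: "frobseq p NN gs (n0 + e) \<subseteq> cmb UNIV NN (map (\<lambda>x. x ^ (p ^ e)) xs)"
      unfolding frobseq_def
    proof (rule cmb_least[OF cmb_rideal[OF NN_ideal] cmb_base])
      have "g ^ (p ^ (n0 + e)) \<in> cmb UNIV NN (map (\<lambda>x. x ^ (p ^ e)) xs)" if "g \<in> set gs" for g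
      proof -
        have "g ^ (p ^ n0) \<in> M n0" using gM[OF that, of "p ^ n0"] M_mono[OF le_prime_power[OF p, of n0]] by blast
        then have "(g ^ (p ^ n0)) ^ (p ^ e) \<in> cmb UNIV NN (map (\<lambda>x. x ^ (p ^ e)) xs)"
          using n0 by (intro frob_cmb[OF NN_ideal p p_NN sring_UNIV]) blast
        then show ?thesis by (simp add: power_mult[symmetric] power_add)
      qed
      then show "set (map (\<lambda>g. g ^ p ^ (n0 + e)) gs) \<subseteq> cmb UNIV NN (map (\<lambda>x. x ^ (p ^ e)) xs)" by auto
    qed simp
    obtain vs where vs: "length vs \<le> m" "UNIV \<subseteq> cmb K (frobseq p NN gs (n0 + e)) vs" using dim unfolding dimle_def by blast
    define Y where "Y = cmb K ?Xx (map \<phi> vs)"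
    have Y: "smod K Y" unfolding Y_def by (rule cmb_smod'[OF sK Xx])
    have XY: "?Xx \<subseteq> Y" unfolding Y_def by (rule cmb_base[OF sring_0[OF sK]])
    have NY: "NN \<subseteq> Y" using NN_Xn XY by blast
    have \<phi>Y: "t \<in> cmb K (frobseq p NN gs (n0 + e)) ws \<Longrightarrow> set ws \<subseteq> set vs \<Longrightarrow> \<phi> t \<in> Y" for t ws
    proof (induction ws arbitrary: t)
      case Nil
      then show ?case using \<phi>_X[of t "p ^ e" xs] F xs_ser XY by auto
    next
      case (Cons v ws)
      obtain k w where kw: "k \<in> K" "w \<in> cmb K (frobseq p NN gs (n0 + e)) ws" "t = k * v + w"
        using cmb_ConsE[OF Cons.prems(1)] .
      have w: "\<phi> w \<in> Y" using Cons.IH[OF kw(2)] Cons.prems(2) by simp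
      have "\<phi> v \<in> Y" unfolding Y_def by (rule cmb_mem[OF _ sK smod_0[OF Xx]]) (use Cons.prems(2) in auto)
      then have "k * \<phi> v \<in> Y" by (rule smod_scale[OF Y kw(1)])
      moreover have "(\<phi> (k * v + w) - (\<phi> (k * v) + \<phi> w)) + (\<phi> (k * v) - k * \<phi> v) \<in> Y"
        using smod_add[OF NN_ideal \<phi>_add \<phi>_scale] K_ser kw(1) NY by blast
      ultimately have "(\<phi> (k * v + w) - (\<phi> (k * v) + \<phi> w)) + (\<phi> (k * v) - k * \<phi> v) + k * \<phi> v + \<phi> w \<in> Y"
        by (intro smod_add[OF Y smod_add[OF Y, rotated] w])
      then show ?case unfolding kw(3) by simp
    qed
    have "a * \<alpha> \<in> Y" if "\<alpha> \<in> ?A" for \<alpha>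
    proof -
      have "\<phi> (\<alpha> * 1) \<in> Y" by (rule \<phi>Y[OF _ order.refl]) (use vs in auto)
      moreover have "- (\<phi> (\<alpha> * 1) - \<alpha> * \<phi> 1) - \<alpha> * (\<phi> 1 - a) \<in> Y"
        using NY rideal_diff[OF NN_ideal rideal_uminus[OF NN_ideal \<phi>_scale[OF that]] rideal_multl[OF NN_ideal \<phi>_1]] by blast
      ultimately have "\<phi> (\<alpha> * 1) + (- (\<phi> (\<alpha> * 1) - \<alpha> * \<phi> 1) - \<alpha> * (\<phi> 1 - a)) \<in> Y" by (rule smod_add[OF Y])
      then show ?thesis by (simp add: algebra_simps)
    qed
    then show "dimle K ((*) a ` ?A) ?Xx m"
      unfolding dimle_def Y_def using vs(1) by (intro exI[of _ "map \<phi> vs"]) auto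
  qed
  then show ?thesis by blast
qed

end

subsection \<open>Noetherian local rings\<close>

text \<open>A Noetherian local ring is represented as a quotient of a type-class ring by the ideal \<open>N0\<close>.\<close>

locale nloc =
  fixes N0 Mx :: "'b::comm_ring_1 set"
  assumes N0: "rideal N0" and Mx: "rideal Mx" and Mx1: "1 \<notin> Mx" and NMx: "N0 \<subseteq> Mx"
    and loc: "a \<notin> Mx \<Longrightarrow> \<exists>b. a * b - 1 \<in> N0"
    and noeth: "\<A> \<noteq> {} \<Longrightarrow> (\<And>I. I \<in> \<A> \<Longrightarrow> rideal I \<and> N0 \<subseteq> I) \<Longrightarrow> \<exists>I\<in>\<A>. \<forall>J\<in>\<A>. I \<subseteq> J \<longrightarrow> J = I"
begin

primrec Mp :: "nat \<Rightarrow> 'b set" where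
  "Mp 0 = UNIV"
| "Mp (Suc n) = {t. \<exists>L. set L \<subseteq> {a * b |a b. a \<in> Mx \<and> b \<in> Mp n} \<and> t \<in> cmb UNIV N0 L}"

definition tprime :: "'b set \<Rightarrow> bool" where
  "tprime P \<longleftrightarrow> rideal P \<and> N0 \<subseteq> P \<and> 1 \<notin> P \<and> (\<forall>a b. a * b \<in> P \<longrightarrow> a \<in> P \<or> b \<in> P)"

definition tchain :: "nat \<Rightarrow> (nat \<Rightarrow> 'b set) \<Rightarrow> bool" where
  "tchain n C \<longleftrightarrow> (\<forall>i\<le>n. tprime (C i)) \<and> (\<forall>i<n. C i \<subset> C (Suc i))"

text \<open>Products with one factor from each ideal; for inclusions into an ideal these elements
  are enough, and sums need not be formed.\<close>

primrec prods :: "'b set list \<Rightarrow> 'b set" where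
  "prods [] = {1}"
| "prods (Q # Qs) = {q * s |q s. q \<in> Q \<and> s \<in> prods Qs}"

lemma prods_append: "t \<in> prods (Qs @ Rs) \<Longrightarrow> \<exists>q\<in>prods Qs. \<exists>r\<in>prods Rs. t = q * r"
proof (induction Qs arbitrary: t)
  case (Cons Q Qs)
  then obtain q s where "q \<in> Q" "s \<in> prods (Qs @ Rs)" "t = q * s" by auto
  moreover from this(2) obtain q' r where "q' \<in> prods Qs" "r \<in> prods Rs" "s = q' * r" using Cons.IH by blast
  ultimately show ?case by (intro bexI[of _ "q * q'"] bexI[of _ r]) (auto simp: mult.assoc)
qed auto

lemma prime_Mx: "tprime P \<Longrightarrow> P \<subseteq> Mx"
proof
  fix a assume P: "tprime P" "a \<in> P"
  show "a \<in> Mx"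
  proof (rule ccontr)
    assume "a \<notin> Mx"
    then obtain b where "a * b - 1 \<in> P" using loc P unfolding tprime_def by blast
    then have "a * b - (a * b - 1) \<in> P"
      using P rideal_multr[of P a b] rideal_diff[of P "a * b" "a * b - 1"] unfolding tprime_def by blast
    then show False using P unfolding tprime_def by simp
  qed
qed

lemma tprime_Mx: "tprime Mx"
proof -
  have "a \<in> Mx \<or> b \<in> Mx" if ab: "a * b \<in> Mx" for a b
  proof (rule ccontr)
    assume "\<not> (a \<in> Mx \<or> b \<in> Mx)"
    then obtain a' where a': "a * a' - 1 \<in> Mx" and b: "b \<notin> Mx" using loc NMx by blast
    have "a' * (a * b) - b * (a * a' - 1) \<in> Mx"
      by (rule rideal_diff[OF Mx rideal_multl[OF Mx ab] rideal_multl[OF Mx a']])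
    then show False using b by (simp add: algebra_simps)
  qed
  then show ?thesis unfolding tprime_def using Mx NMx Mx1 by blast
qed

lemma tprime_power: "tprime P \<Longrightarrow> a ^ n \<in> P \<Longrightarrow> a \<in> P"
  by (induction n) (auto simp: tprime_def)

lemma ex_maximal_ideal:
  assumes "rideal I0" "N0 \<subseteq> I0" "Q I0"
  shows "\<exists>I. rideal I \<and> N0 \<subseteq> I \<and> Q I \<and> (\<forall>J. rideal J \<longrightarrow> I \<subseteq> J \<longrightarrow> Q J \<longrightarrow> J = I)"
proof -
  let ?A = "{I. rideal I \<and> N0 \<subseteq> I \<and> Q I}"
  have ne: "?A \<noteq> {}" using assms by auto
  have "\<exists>I\<in>?A. \<forall>J\<in>?A. I \<subseteq> J \<longrightarrow> J = I" by (rule noeth[OF ne]) simp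
  then obtain I where I: "I \<in> ?A" "\<forall>J\<in>?A. I \<subseteq> J \<longrightarrow> J = I" by (elim bexE)
  have "J = I" if "rideal J" "I \<subseteq> J" "Q J" for J
    using I(2)[rule_format, of J] that order.trans[of N0 I J] I(1) by simp
  then show ?thesis using I(1) by (intro exI[of _ I]) simp
qed

text \<open>Noetherian induction: a maximal counterexample is not prime, so it contains a product of
  two elements outside it. The lists for the two ideals enlarged by these elements can be
  concatenated.\<close>

lemma prime_products:
  assumes "rideal I" "N0 \<subseteq> I"
  shows "\<exists>Qs. (\<forall>Q\<in>set Qs. tprime Q \<and> I \<subseteq> Q) \<and> prods Qs \<subseteq> I"
proof (rule ccontr)
  define good where "good = (\<lambda>I. \<exists>Qs. (\<forall>Q\<in>set Qs. tprime Q \<and> I \<subseteq> Q) \<and> prods Qs \<subseteq> I)"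
  assume "\<not> ?thesis"
  then have "\<not> good I" unfolding good_def .
  then obtain J where J: "rideal J" "N0 \<subseteq> J" "\<not> good J" "\<And>J'. rideal J' \<Longrightarrow> J \<subseteq> J' \<Longrightarrow> \<not> good J' \<Longrightarrow> J' = J"
    using ex_maximal_ideal[of I "\<lambda>I. \<not> good I"] assms by auto
  have J1: "1 \<notin> J"
  proof
    assume "1 \<in> J"
    then have "good J" unfolding good_def by (intro exI[of _ "[]"]) auto
    then show False using J(3) by simp
  qed
  have "\<not> tprime J"
  proof
    assume "tprime J"
    then have "good J" unfolding good_def by (intro exI[of _ "[J]"]) auto
    then show False using J(3) by simp
  qed
  then obtain a b where ab: "a * b \<in> J" "a \<notin> J" "b \<notin> J" unfolding tprime_def using J(1,2) J1 by blast
  have g: "good (cmb UNIV J [x])" if "x \<notin> J" for x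
  proof (rule ccontr)
    assume "\<not> good (cmb UNIV J [x])"
    then have "cmb UNIV J [x] = J" by (intro J(4) cmb_rideal[OF J(1)] cmb_base) auto
    then show False using cmb_mem[of x "[x]" UNIV J] smod_0[OF J(1)] that by auto
  qed
  obtain Qs where Qs0: "\<forall>Q\<in>set Qs. tprime Q \<and> cmb UNIV J [a] \<subseteq> Q" and Qs3: "prods Qs \<subseteq> cmb UNIV J [a]"
    using g[OF ab(2)] unfolding good_def by (elim exE conjE)
  have Qs: "tprime Q" "cmb UNIV J [a] \<subseteq> Q" if "Q \<in> set Qs" for Q using Qs0 that by auto
  obtain Rs where Rs0: "\<forall>Q\<in>set Rs. tprime Q \<and> cmb UNIV J [b] \<subseteq> Q" and Rs3: "prods Rs \<subseteq> cmb UNIV J [b]"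
    using g[OF ab(3)] unfolding good_def by (elim exE conjE)
  have Rs: "tprime Q" "cmb UNIV J [b] \<subseteq> Q" if "Q \<in> set Rs" for Q using Rs0 that by auto
  have base: "J \<subseteq> cmb UNIV J [x]" for x by (rule cmb_base) simp
  have "prods (Qs @ Rs) \<subseteq> J"
  proof
    fix t assume "t \<in> prods (Qs @ Rs)"
    then obtain q r where t: "q \<in> prods Qs" "r \<in> prods Rs" "t = q * r" using prods_append by blast
    have "q \<in> cmb UNIV J [a]" "r \<in> cmb UNIV J [b]" using t Qs3 Rs3 by auto
    then obtain k w k' w' where "w \<in> J" "w' \<in> J" "q = k * a + w" "r = k' * b + w'" by (auto elim!: cmb_ConsE)
    then have "t = (k * k') * (a * b) + (k * a * w' + w * r)" "w \<in> J" "w' \<in> J" unfolding t(3) by (auto simp: algebra_simps)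
    then show "t \<in> J"
      using smod_add[OF J(1) rideal_multl[OF J(1) ab(1)] smod_add[OF J(1) rideal_multl[OF J(1)] rideal_multr[OF J(1)]]] by simp
  qed
  moreover have "tprime Q \<and> J \<subseteq> Q" if "Q \<in> set (Qs @ Rs)" for Q
  proof -
    have "tprime Q" using that Qs(1) Rs(1) by auto
    moreover have "J \<subseteq> Q" using that order.trans[OF base Qs(2)] order.trans[OF base Rs(2)] by auto
    ultimately show ?thesis by blast
  qed
  ultimately have "good J" unfolding good_def by (intro exI[of _ "Qs @ Rs"]) blast
  then show False using J(3) by simp
qed

lemma prime_contains_factor: "tprime P \<Longrightarrow> prods Qs \<subseteq> P \<Longrightarrow> \<exists>Q\<in>set Qs. Q \<subseteq> P"
proof (induction Qs)
  case Nil
  then show ?case unfolding tprime_def by auto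
next
  case (Cons Q Qs)
  show ?case
  proof (cases "Q \<subseteq> P")
    case False
    then obtain q where q: "q \<in> Q" "q \<notin> P" by blast
    have "prods Qs \<subseteq> P"
    proof
      fix s assume "s \<in> prods Qs"
      then have "q * s \<in> P" using Cons.prems(2) q(1) by auto
      then show "s \<in> P" using Cons.prems(1) q(2) unfolding tprime_def by blast
    qed
    then show ?thesis using Cons by auto
  qed auto
qed

text \<open>The multiplier \<open>c\<close> strengthens the induction: it stores the factors already
  taken out of a product.\<close>

lemma Mp_least:
  "rideal I \<Longrightarrow> N0 \<subseteq> I \<Longrightarrow> (\<And>s. s \<in> prods (replicate k Mx) \<Longrightarrow> s * c \<in> I) \<Longrightarrow> t \<in> Mp k \<Longrightarrow> t * c \<in> I"
proof (induction k arbitrary: c t)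
  case 0
  then show ?case using rideal_multl[of I c t] by auto
next
  case (Suc k)
  obtain L where L: "set L \<subseteq> {a * b |a b. a \<in> Mx \<and> b \<in> Mp k}" "t \<in> cmb UNIV N0 L" using Suc.prems(4) by auto
  have "b * (a * c) \<in> I" if "a \<in> Mx" "b \<in> Mp k" for a b
  proof (rule Suc.IH[OF Suc.prems(1,2) _ that(2)])
    fix s assume "s \<in> prods (replicate k Mx)"
    then have "a * s \<in> prods (replicate (Suc k) Mx)" using that(1) by auto
    from Suc.prems(3)[OF this] show "s * (a * c) \<in> I" by (simp add: ac_simps)
  qed
  then have 1: "(a * b) * c \<in> I" if "a \<in> Mx" "b \<in> Mp k" for a b using that by (simp add: ac_simps)
  have "cmb UNIV N0 L \<subseteq> {t. t * c \<in> I}"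
  proof (rule cmb_least)
    show "rideal {t. t * c \<in> I}" using Suc.prems(1) unfolding smod_def by (auto simp: distrib_right mult.assoc)
    show "N0 \<subseteq> {t. t * c \<in> I}" using Suc.prems(2) rideal_multr[OF N0] by blast
  qed (use L(1) 1 in blast)
  then show ?case using L(2) by blast
qed

lemma Mp_subset_of_factors:
  assumes "rideal I" "N0 \<subseteq> I" "prods Qs \<subseteq> I" "\<forall>Q\<in>set Qs. Q = Mx"
  shows "Mp (length Qs) \<subseteq> I"
proof -
  have "Qs = replicate (length Qs) Mx" using assms(4) by (simp add: replicate_length_same)
  then show ?thesis using Mp_least[OF assms(1,2), of "length Qs" 1] assms(3) by auto
qed

lemma Mp_subset_of_radical:
  assumes I: "rideal I" "N0 \<subseteq> I" and "\<And>a. a \<in> Mx \<Longrightarrow> \<exists>l. a ^ l \<in> I"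
  shows "\<exists>k. Mp k \<subseteq> I"
proof -
  obtain Qs where Qs: "\<forall>Q\<in>set Qs. tprime Q \<and> I \<subseteq> Q" "prods Qs \<subseteq> I" using prime_products[OF I] by blast
  have "Q = Mx" if "Q \<in> set Qs" for Q
    using Qs(1) that assms(3) tprime_power[of Q] prime_Mx[of Q] by blast
  then show ?thesis using Mp_subset_of_factors[OF I Qs(2)] by blast
qed

text \<open>A prime contained in another one is dropped from the list. Otherwise an element
  \<open>y\<close> avoiding all primes but possibly \<open>Q\<close> is corrected, if it lies in
  \<open>Q\<close>, by some \<open>z\<close> outside \<open>Q\<close> that belongs to all the
  others.\<close>

lemma prime_avoidance:
  "(\<And>Q. Q \<in> set Qs \<Longrightarrow> tprime Q) \<Longrightarrow> (\<And>Q. Q \<in> set Qs \<Longrightarrow> Q \<noteq> Mx) \<Longrightarrow> \<exists>y\<in>Mx. \<forall>Q\<in>set Qs. y \<notin> Q"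
proof (induction "length Qs" arbitrary: Qs rule: less_induct)
  case less
  show ?case
  proof (cases Qs)
    case Nil
    then show ?thesis using smod_0[OF Mx] by auto
  next
    case (Cons Q Rs)
    have Q: "tprime Q" "Q \<noteq> Mx" using less.prems Cons by auto
    show ?thesis
    proof (cases "\<exists>R\<in>set Rs. R \<subseteq> Q")
      case True
      then obtain R where R: "R \<in> set Rs" "R \<subseteq> Q" by blast
      have "length (Q # remove1 R Rs) < length Qs" using R(1) unfolding Cons
        by (simp add: length_remove1) (metis Suc_pred length_pos_if_in_set lessI)
      moreover have sub: "set (Q # remove1 R Rs) \<subseteq> set Qs" unfolding Cons using set_remove1_subset[of R Rs] by auto
      ultimately obtain y where y: "y \<in> Mx" "\<forall>Q'\<in>set (Q # remove1 R Rs). y \<notin> Q'"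
        using less.hyps[of "Q # remove1 R Rs"] less.prems by blast
      have "y \<notin> Q'" if "Q' \<in> set Qs" for Q'
      proof (cases "Q' = R")
        case True
        then show ?thesis using y(2) R(2) by auto
      next
        case False
        then have "Q' \<in> set (Q # remove1 R Rs)" using that unfolding Cons by simp
        then show ?thesis using y(2) by blast
      qed
      then show ?thesis using y(1) by blast
    next
      case False
      obtain y where y: "y \<in> Mx" "\<forall>R\<in>set Rs. y \<notin> R" using less.hyps[of Rs] less.prems unfolding Cons by auto
      show ?thesis
      proof (cases "y \<in> Q")
        case False
        then show ?thesis using y unfolding Cons by auto
      next
        case True
        have "\<exists>z. z \<in> Mx \<and> z \<notin> Q \<and> (\<forall>R\<in>set Rs'. z \<in> R)" if "set Rs' \<subseteq> set Rs" for Rs'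
          using that
        proof (induction Rs')
          case Nil
          then show ?case using prime_Mx[OF Q(1)] Q(2) by auto
        next
          case (Cons R Rs')
          then obtain z where z: "z \<in> Mx" "z \<notin> Q" "\<forall>R\<in>set Rs'. z \<in> R" by auto
          obtain r where r: "r \<in> R" "r \<notin> Q" using False Cons.prems by auto
          have R: "rideal S" if "S \<in> set (R # Rs')" for S
            using less.prems(1)[of S] that Cons.prems unfolding \<open>Qs = Q # Rs\<close> tprime_def by auto
          have "r * z \<notin> Q" using Q(1) r(2) z(2) unfolding tprime_def by blast
          moreover have "r * z \<in> Mx" by (rule rideal_multl[OF Mx z(1)])
          moreover have "r * z \<in> S" if "S \<in> set (R # Rs')" for S
            using that r(1) z(3) rideal_multl[OF R[OF that], of z r] rideal_multr[OF R[OF that], of r z] by auto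
          ultimately show ?case by blast
        qed
        then obtain z where z: "z \<in> Mx" "z \<notin> Q" "\<forall>R\<in>set Rs. z \<in> R" by blast
        have id: "rideal S" if "S \<in> set Qs" for S using less.prems(1)[OF that] unfolding tprime_def by blast
        have "y + z \<notin> Q" using rideal_diff[OF id, of Q "y + z" y] True z(2) Cons by auto
        moreover have "y + z \<notin> R" if "R \<in> set Rs" for R
          using rideal_diff[OF id, of R "y + z" z] that y(2) z(3) Cons by auto
        ultimately show ?thesis using smod_add[OF Mx y(1) z(1)] unfolding Cons by (intro bexI[of _ "y + z"]) auto
      qed
    qed
  qed
qed

lemma chain_extend: "tchain n C \<Longrightarrow> tprime Q \<Longrightarrow> Q \<subset> C 0 \<Longrightarrow> tchain (Suc n) (\<lambda>i. case i of 0 \<Rightarrow> Q | Suc j \<Rightarrow> C j)"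
  unfolding tchain_def by (auto split: nat.splits simp: less_Suc_eq_0_disj)

text \<open>Let \<open>y\<close> avoid the nonmaximal primes of a product contained in
  \<open>I\<close>. A chain of primes above \<open>I\<close> and \<open>y\<close> either starts at
  the maximal ideal or can be prolonged downwards by one of these primes, so adjoining
  \<open>y\<close> lowers the bound.\<close>

lemma parameters_exist:
  "rideal I \<Longrightarrow> N0 \<subseteq> I \<Longrightarrow> (\<And>n C. tchain n C \<Longrightarrow> I \<subseteq> C 0 \<Longrightarrow> n \<le> d) \<Longrightarrow>
   \<exists>ys k. length ys \<le> d \<and> set ys \<subseteq> Mx \<and> Mp k \<subseteq> cmb UNIV I ys"
proof (induction d arbitrary: I)
  case 0
  obtain Qs where Qs: "\<forall>Q\<in>set Qs. tprime Q \<and> I \<subseteq> Q" "prods Qs \<subseteq> I" using prime_products[OF 0(1,2)] by blast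
  have "Q = Mx" if Q: "Q \<in> set Qs" for Q
  proof (rule ccontr)
    assume "Q \<noteq> Mx"
    then have "Q \<subset> Mx" using prime_Mx Qs(1) Q by blast
    then have "tchain 1 (\<lambda>i. if i = 0 then Q else Mx)" unfolding tchain_def using Qs(1) Q tprime_Mx by auto
    from 0(3)[OF this] show False using Qs(1) Q by auto
  qed
  then have "Mp (length Qs) \<subseteq> I" using Mp_subset_of_factors[OF 0(1,2) Qs(2)] by blast
  then show ?case by (intro exI[of _ "[]"] exI[of _ "length Qs"]) auto
next
  case (Suc d)
  obtain Qs where Qs: "\<forall>Q\<in>set Qs. tprime Q \<and> I \<subseteq> Q" "prods Qs \<subseteq> I" using prime_products[OF Suc.prems(1,2)] by blast
  have "\<exists>y\<in>Mx. \<forall>Q\<in>set (filter (\<lambda>Q. Q \<noteq> Mx) Qs). y \<notin> Q"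
    by (rule prime_avoidance) (use Qs(1) in simp_all)
  then obtain y where y: "y \<in> Mx" "\<forall>Q\<in>set (filter (\<lambda>Q. Q \<noteq> Mx) Qs). y \<notin> Q" by (elim bexE)
  define I' where "I' = cmb UNIV I [y]"
  have I': "rideal I'" unfolding I'_def by (rule cmb_rideal[OF Suc.prems(1)])
  have II': "I \<subseteq> I'" unfolding I'_def by (rule cmb_base) simp
  have yI': "y \<in> I'" unfolding I'_def by (rule cmb_mem) (auto simp: smod_0[OF Suc.prems(1)])
  have "n \<le> d" if C: "tchain n C" "I' \<subseteq> C 0" for n C
  proof -
    have C0: "tprime (C 0)" using C(1) unfolding tchain_def by auto
    obtain Q where Q: "Q \<in> set Qs" "Q \<subseteq> C 0"
      using prime_contains_factor[OF C0 order.trans[OF Qs(2) order.trans[OF II' C(2)]]] by auto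
    show ?thesis
    proof (cases "Q = Mx")
      case True
      have "\<not> 0 < n"
      proof
        assume "0 < n"
        then have "C 0 \<subset> C (Suc 0)" "tprime (C (Suc 0))" using C(1) unfolding tchain_def by auto
        then show False using Q True prime_Mx by blast
      qed
      then show ?thesis by simp
    next
      case False
      then have "y \<notin> Q" using y(2) Q(1) by auto
      then have "Q \<subset> C 0" using Q(2) yI' C(2) by blast
      then have "tchain (Suc n) (\<lambda>i. case i of 0 \<Rightarrow> Q | Suc j \<Rightarrow> C j)" using chain_extend[OF C(1)] Qs(1) Q(1) by blast
      from Suc.prems(3)[OF this] show ?thesis using Qs(1) Q(1) by auto
    qed
  qed
  then obtain ys k where ys: "length ys \<le> d" "set ys \<subseteq> Mx" "Mp k \<subseteq> cmb UNIV I' ys"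
    using Suc.IH[OF I'] Suc.prems(2) II' by blast
  then show ?case unfolding I'_def cmb_append[symmetric] using y(1)
    by (intro exI[of _ "ys @ [y]"] exI[of _ k]) auto
qed

text \<open>Every chain of primes containing \<open>c\<close> can be prolonged downwards by a
  minimal prime, so \<open>c\<close> can serve as the first parameter.\<close>

lemma parameters_exist_nonminimal:
  assumes d: "\<And>n C. tchain n C \<Longrightarrow> n \<le> d" and c: "c \<in> Mx"
    and min: "\<And>P. tprime P \<Longrightarrow> (\<And>Q. tprime Q \<Longrightarrow> Q \<subseteq> P \<Longrightarrow> Q = P) \<Longrightarrow> c \<notin> P"
  shows "\<exists>ys k. length ys < d \<and> set ys \<subseteq> Mx \<and> Mp k \<subseteq> cmb UNIV N0 (c # ys)"
proof -
  define I where "I = cmb UNIV N0 [c]"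
  have I: "rideal I" unfolding I_def by (rule cmb_rideal[OF N0])
  have NI: "N0 \<subseteq> I" unfolding I_def by (rule cmb_base) simp
  have cI: "c \<in> I" unfolding I_def by (rule cmb_mem) (auto simp: smod_0[OF N0])
  obtain Qs where Qs: "\<forall>Q\<in>set Qs. tprime Q \<and> N0 \<subseteq> Q" "prods Qs \<subseteq> N0" using prime_products[OF N0 order.refl] by blast
  have bound: "Suc n \<le> d" if C: "tchain n C" "I \<subseteq> C 0" for n C
  proof -
    have C0: "tprime (C 0)" using C(1) unfolding tchain_def by auto
    \<comment> \<open>A minimal member below \<open>C 0\<close> of the finite list \<open>Qs\<close>
      is a minimal prime of the ring, since every smaller prime contains some member of the
      list.\<close>
    define \<Q> where "\<Q> = {Q \<in> set Qs. Q \<subseteq> C 0}"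
    have "\<Q> \<noteq> {}"
      using prime_contains_factor[OF C0 order.trans[OF Qs(2) order.trans[OF NI C(2)]]] unfolding \<Q>_def by auto
    then obtain Q where Q: "Q \<in> \<Q>" "\<And>R. R \<in> \<Q> \<Longrightarrow> R \<subseteq> Q \<Longrightarrow> Q = R"
      using finite_has_minimal[of \<Q>] unfolding \<Q>_def by auto
    have "tprime Q" using Q(1) Qs(1) unfolding \<Q>_def by auto
    have "R = Q" if R: "tprime R" "R \<subseteq> Q" for R
    proof -
      have "N0 \<subseteq> R" using R(1) unfolding tprime_def by auto
      then obtain Q' where Q': "Q' \<in> set Qs" "Q' \<subseteq> R"
        using prime_contains_factor[OF R(1) order.trans[OF Qs(2)]] by auto
      then have "Q' \<in> \<Q>" "Q' \<subseteq> Q" using Q(1) R(2) unfolding \<Q>_def by auto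
      then have "Q = Q'" by (rule Q(2))
      then show ?thesis using R(2) Q'(2) by auto
    qed
    then have "c \<notin> Q" by (rule min[OF \<open>tprime Q\<close>])
    then have "Q \<subset> C 0" using cI C(2) Q(1) unfolding \<Q>_def by blast
    from d[OF chain_extend[OF C(1) \<open>tprime Q\<close> this]] show ?thesis .
  qed
  have "I \<subseteq> Mx" unfolding I_def by (rule cmb_least[OF Mx NMx]) (use c in simp)
  \<comment> \<open>The chain consisting of the maximal ideal alone shows that \<open>d\<close> is
    positive, so one parameter can be saved.\<close>
  then have "Suc 0 \<le> d" using bound[of 0 "\<lambda>_. Mx"] tprime_Mx unfolding tchain_def by auto
  then obtain d' where d': "d = Suc d'" by (cases d) auto
  have "n \<le> d'" if "tchain n C" "I \<subseteq> C 0" for n C using bound[OF that] d' by simp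
  then obtain ys k where ys: "length ys \<le> d'" "set ys \<subseteq> Mx" "Mp k \<subseteq> cmb UNIV I ys"
    using parameters_exist[OF I NI] by blast
  have "cmb UNIV N0 (c # ys) = cmb UNIV I ys" unfolding I_def by (rule cmb_swap[OF sring_UNIV N0])
  then show ?thesis using ys d' by (intro exI[of _ ys] exI[of _ k]) auto
qed

lemma prods_power: "a \<in> Mx \<Longrightarrow> a ^ k \<in> Mp k"
proof (induction k)
  case (Suc k)
  have "a * a ^ k \<in> cmb UNIV N0 [a * a ^ k]" by (rule cmb_mem) (auto simp: smod_0[OF N0])
  moreover have "set [a * a ^ k] \<subseteq> {a * b |a b. a \<in> Mx \<and> b \<in> Mp k}" using Suc by auto
  ultimately show ?case unfolding Mp.simps power_Suc by blast
qed auto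

lemma Mp_ideal: "rideal (Mp k)"
proof (cases k)
  case (Suc n)
  show ?thesis
    unfolding smod_def Suc
  proof (intro conjI ballI)
    show "0 \<in> Mp (Suc n)" using smod_0[OF N0] by (auto intro!: exI[of _ "[]"])
  next
    fix a b assume "a \<in> Mp (Suc n)" "b \<in> Mp (Suc n)"
    then obtain L L' where L: "set L \<subseteq> {a * b |a b. a \<in> Mx \<and> b \<in> Mp n}" "a \<in> cmb UNIV N0 L"
      "set L' \<subseteq> {a * b |a b. a \<in> Mx \<and> b \<in> Mp n}" "b \<in> cmb UNIV N0 L'" by auto
    have "a \<in> cmb UNIV N0 (L @ L')" by (rule subsetD[OF cmb_sub_mono[OF sring_UNIV N0 order.refl order.refl] L(2)]) auto
    moreover have "b \<in> cmb UNIV N0 (L @ L')" by (rule subsetD[OF cmb_sub_mono[OF sring_UNIV N0 order.refl order.refl] L(4)]) auto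
    ultimately have "a + b \<in> cmb UNIV N0 (L @ L')" by (rule smod_add[OF cmb_rideal[OF N0]])
    moreover have "set (L @ L') \<subseteq> {a * b |a b. a \<in> Mx \<and> b \<in> Mp n}" using L by auto
    ultimately show "a + b \<in> Mp (Suc n)" unfolding Mp.simps by blast
  next
    fix k a assume "a \<in> Mp (Suc n)"
    then show "k * a \<in> Mp (Suc n)" unfolding Mp.simps using rideal_multl[OF cmb_rideal[OF N0]] by blast
  qed
qed simp

text \<open>A weak Artin--Rees lemma: multiplication by \<open>z\<close> on the domain modulo \<open>P\<close> is a homeomorphism
  onto its image for the adic topology.\<close>

lemma weak_Artin_Rees:
  assumes P: "tprime P" and z: "z \<notin> P"
  shows "\<exists>N. \<forall>r. z * r \<in> P + Mp N \<longrightarrow> r \<in> P + Mp k"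
proof -
  have rP: "rideal P" "N0 \<subseteq> P" using P unfolding tprime_def by auto
  define C where "C = {u + z * m |u m. u \<in> P \<and> m \<in> Mp k}"
  define B where "B = cmb UNIV P [z]"
  have C: "rideal C"
    unfolding smod_def
  proof (intro conjI ballI)
    show "0 \<in> C" unfolding C_def using smod_0[OF rP(1)] smod_0[OF Mp_ideal] by force
  next
    fix a b assume "a \<in> C" "b \<in> C"
    then obtain u m u' m' where "a = u + z * m" "b = u' + z * m'" "u \<in> P" "u' \<in> P" "m \<in> Mp k" "m' \<in> Mp k" unfolding C_def by blast
    then have "a + b = (u + u') + z * (m + m')" "u + u' \<in> P" "m + m' \<in> Mp k"
      using smod_add[OF rP(1)] smod_add[OF Mp_ideal] by (auto simp: algebra_simps)
    then show "a + b \<in> C" unfolding C_def by blast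
  next
    fix l a assume "a \<in> C"
    then obtain u m where "a = u + z * m" "u \<in> P" "m \<in> Mp k" unfolding C_def by blast
    then have "l * a = l * u + z * (l * m)" by (simp add: algebra_simps)
    moreover have "l * u \<in> P" by (rule rideal_multl[OF rP(1) \<open>u \<in> P\<close>])
    moreover have "l * m \<in> Mp k" by (rule rideal_multl[OF Mp_ideal \<open>m \<in> Mp k\<close>])
    ultimately show "l * a \<in> C" unfolding C_def by blast
  qed
  have PC: "P \<subseteq> C" unfolding C_def using smod_0[OF Mp_ideal] by force
  have CB: "C \<subseteq> B"
  proof
    fix t assume "t \<in> C"
    then obtain u m where "t = u + z * m" "u \<in> P" unfolding C_def by blast
    then show "t \<in> B" unfolding B_def by (intro cmb_ConsI[of m _ u]) (auto simp: algebra_simps)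
  qed
  \<comment> \<open>\<open>H\<close> is maximal among the ideals meeting \<open>B\<close> only in
    \<open>C\<close>. Once it contains some \<open>Mp N\<close>, a multiple \<open>z * r\<close> in
    \<open>P + Mp N\<close> lies in \<open>C\<close>, and \<open>z\<close> can be cancelled modulo
    \<open>P\<close>.\<close>
  have "\<exists>H. rideal H \<and> N0 \<subseteq> H \<and> (C \<subseteq> H \<and> H \<inter> B \<subseteq> C) \<and>
      (\<forall>J. rideal J \<longrightarrow> H \<subseteq> J \<longrightarrow> C \<subseteq> J \<and> J \<inter> B \<subseteq> C \<longrightarrow> J = H)"
    by (rule ex_maximal_ideal[of C]) (use C PC rP(2) in auto)
  then obtain H where H: "rideal H" "C \<subseteq> H" "H \<inter> B \<subseteq> C"
    and max0: "\<forall>J. rideal J \<longrightarrow> H \<subseteq> J \<longrightarrow> C \<subseteq> J \<and> J \<inter> B \<subseteq> C \<longrightarrow> J = H" by (elim exE conjE)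
  have max: "J = H" if "rideal J" "H \<subseteq> J" "J \<inter> B \<subseteq> C" for J
    using max0[rule_format, OF that(1,2)] order.trans[OF H(2) that(2)] that(3) by simp
  have NH: "N0 \<subseteq> H" and PH: "P \<subseteq> H" using H(2) PC rP(2) by auto
  have "\<exists>l. a ^ l \<in> H" if a: "a \<in> Mx" for a
  proof -
    define q where "q = (\<lambda>j. {t. a ^ j * t \<in> H})"
    have q: "rideal (q j)" for j using H(1) unfolding q_def smod_def by (auto simp: algebra_simps mult.left_commute)
    have qmono: "q i \<subseteq> q (i + j)" for i j
    proof
      fix t assume "t \<in> q i"
      then have "a ^ j * (a ^ i * t) \<in> H" unfolding q_def by (metis (mono_tags) mem_Collect_eq rideal_multl[OF H(1)])
      then show "t \<in> q (i + j)" unfolding q_def by (simp add: power_add ac_simps)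
    qed
    have "N0 \<subseteq> q j" for j unfolding q_def using rideal_multl[OF N0] NH by auto
    have "\<exists>I\<in>range q. \<forall>J\<in>range q. I \<subseteq> J \<longrightarrow> J = I"
      by (rule noeth) (use q \<open>\<And>j. N0 \<subseteq> q j\<close> in auto)
    then obtain j where j: "\<And>i. q j \<subseteq> q i \<Longrightarrow> q i = q j" by auto
    \<comment> \<open>The part \<open>j\<close> reaches the stable range of the colon ideals, the
      part \<open>k\<close> puts \<open>a ^ l\<close> into \<open>Mp k\<close>. Together they show
      that adjoining \<open>a ^ l\<close> to \<open>H\<close> adds nothing to the intersection with
      \<open>B\<close>.\<close>
    define l where "l = j + k"
    have stab: "s \<in> q l" if "a ^ (l + l) * s \<in> H" for s
    proof -
      have "q (j + (k + l)) = q j" by (rule j[OF qmono])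
      moreover have "s \<in> q (j + (k + l))" using that unfolding q_def l_def by (simp add: add.assoc)
      ultimately show ?thesis using qmono[of j k] unfolding l_def by blast
    qed
    define H' where "H' = cmb UNIV H [a ^ l]"
    have "H' \<inter> B \<subseteq> C"
    proof
      fix b assume b: "b \<in> H' \<inter> B"
      then obtain s h where bs: "b = s * a ^ l + h" "h \<in> H" unfolding H'_def by (auto elim!: cmb_ConsE)
      obtain r u where bz: "b = r * z + u" "u \<in> P" using b unfolding B_def by (auto elim!: cmb_ConsE)
      have "a ^ l * r \<in> Mp k"
        using rideal_multr[OF Mp_ideal prods_power[OF a, of k], of "a ^ j * r"] unfolding l_def by (simp add: power_add ac_simps)
      then have "a ^ l * u + z * (a ^ l * r) \<in> C" unfolding C_def using rideal_multl[OF rP(1) bz(2)] by blast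
      then have "a ^ l * b \<in> H" using H(2) unfolding bz(1) by (auto simp: algebra_simps)
      then have "a ^ l * b - a ^ l * h \<in> H" by (rule rideal_diff[OF H(1) _ rideal_multl[OF H(1) bs(2)]])
      then have "a ^ (l + l) * s \<in> H" unfolding bs(1) by (simp add: algebra_simps power_add)
      then have "s * a ^ l \<in> H" using stab unfolding q_def by (simp add: mult.commute)
      then have "b \<in> H" unfolding bs(1) by (rule smod_add[OF H(1) _ bs(2)])
      then show "b \<in> C" using H(3) b by blast
    qed
    then have "H' = H" unfolding H'_def by (intro max cmb_rideal[OF H(1)] cmb_base) auto
    then show ?thesis using cmb_mem[of "a ^ l" "[a ^ l]" UNIV H] smod_0[OF H(1)] unfolding H'_def by auto
  qed
  then obtain N where N: "Mp N \<subseteq> H" using Mp_subset_of_radical[OF H(1) NH] by blast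
  have "r \<in> P + Mp k" if r: "z * r \<in> P + Mp N" for r
  proof -
    have "z * r \<in> H" using set_plus_absorb[OF H(1) PH N] r by blast
    moreover have "z * r \<in> B" unfolding B_def by (rule cmb_ConsI[of r _ 0]) (auto simp: smod_0[OF rP(1)] mult.commute)
    ultimately have "z * r \<in> C" using H(3) by blast
    then obtain u m where um: "z * r = u + z * m" "u \<in> P" "m \<in> Mp k" unfolding C_def by blast
    then have "z * (r - m) \<in> P" by (simp add: algebra_simps)
    then have "r - m \<in> P" using P z unfolding tprime_def by blast
    then have "(r - m) + m \<in> P + Mp k" using um(3) by (rule set_plus_intro)
    then show ?thesis by simp
  qed
  then show ?thesis by blast
qed

end

subsection \<open>Generic rings mapping onto a ring with carrier\<close>

text \<open>Integer polynomials with a variable for every element of a type \<open>'c\<close>.  They form a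
  type-class ring through which the rings with carriers of the theorem are studied.\<close>

definition var :: "'c \<Rightarrow> 'c multiset \<Rightarrow>\<^sub>0 int" where "var c = frag_of {#c#}"

text \<open>Homomorphisms from a type-class ring to a ring with carrier, the bridge between the two
  notions of ring.\<close>

definition rhom :: "('a, 'r) ring_scheme \<Rightarrow> ('b::comm_ring_1 \<Rightarrow> 'a) \<Rightarrow> bool" where
  "rhom R h \<longleftrightarrow> (\<forall>f. h f \<in> carrier R) \<and> (\<forall>f g. h (f + g) = h f \<oplus>\<^bsub>R\<^esub> h g) \<and>
    (\<forall>f g. h (f * g) = h f \<otimes>\<^bsub>R\<^esub> h g) \<and> h 1 = \<one>\<^bsub>R\<^esub>"

lemma frag_of_mult: "frag_of (m::'c multiset) * frag_of m' = frag_of (m + m')"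
  by (simp add: mult_single)

lemma var_induct:
  assumes 1: "P 1" and var: "\<And>c. P (var c)" and diff: "\<And>a b. P a \<Longrightarrow> P b \<Longrightarrow> P (a - b)"
    and mult: "\<And>a b. P a \<Longrightarrow> P b \<Longrightarrow> P (a * b)"
  shows "P f"
proof -
  have m: "P (frag_of m)" for m
  proof (induction m)
    case empty
    have "frag_of {#} = (1::'a multiset \<Rightarrow>\<^sub>0 int)" by (simp flip: zero_multiset_def)
    then show ?case using 1 by simp
  next
    case (add c m)
    have "frag_of (add_mset c m) = var c * frag_of m" unfolding var_def frag_of_mult by simp
    then show ?case using mult[OF var add] by simp
  qed
  have 0: "P 0" using diff[OF 1 1] by simp
  show ?thesis by (rule frag_induction[of f UNIV P]) (use m diff 0 in auto)
qed

context cring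
begin

lemma rhom_closed: "rhom R h \<Longrightarrow> h f \<in> carrier R"
  and rhom_add: "rhom R h \<Longrightarrow> h (f + g) = h f \<oplus> h g"
  and rhom_mult: "rhom R h \<Longrightarrow> h (f * g) = h f \<otimes> h g"
  and rhom_one: "rhom R h \<Longrightarrow> h 1 = \<one>"
  unfolding rhom_def by auto

lemma rhom_zero: "rhom R h \<Longrightarrow> h 0 = \<zero>"
  using rhom_add[of h 0 0] rhom_closed[of h 0] by (metis add.l_cancel_one' add_0)

lemma rhom_diff: assumes h: "rhom R h" shows "h (f - g) = h f \<ominus> h g"
proof -
  have "h f = h (f - g) \<oplus> h g" using rhom_add[OF h, of "f - g" g] by simp
  then have "h f \<ominus> h g = (h (f - g) \<oplus> h g) \<ominus> h g" by simp
  also have "\<dots> = h (f - g)" using rhom_closed[OF h] by algebra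
  finally show ?thesis by simp
qed

lemma rhom_power: "rhom R h \<Longrightarrow> h (f ^ n) = h f [^] n"
  by (induction n) (auto simp: rhom_one rhom_mult rhom_closed m_comm)

lemma rhom_of_nat: "rhom R h \<Longrightarrow> h (of_nat n) = [n] \<cdot> \<one>"
  by (induction n) (auto simp: rhom_zero rhom_add rhom_one a_comm)

text \<open>Universal property of the polynomial ring: \<open>mv\<close> evaluates monomials, and
  the free abelian group on the monomials extends it additively.\<close>

lemma ex_rhom:
  assumes v: "\<And>c. v c \<in> carrier R"
  shows "\<exists>h. rhom R h \<and> (\<forall>c. h (var c) = v c)"
proof -
  define mv where "mv = (\<lambda>m. finprod R (\<lambda>c. v c [^] count m c) (set_mset m))"
  have mv_sup: "mv m = finprod R (\<lambda>c. v c [^] count m c) S" if "finite S" "set_mset m \<subseteq> S" for m S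
    unfolding mv_def by (rule finprod_mono_neutral_cong_left) (use that v in \<open>auto simp: not_in_iff\<close>)
  have mvc: "mv m \<in> carrier R" for m unfolding mv_def using v by (intro finprod_closed) auto
  have mv_mult: "mv (m + m') = mv m \<otimes> mv m'" for m m'
  proof -
    let ?S = "set_mset (m + m')"
    have "mv (m + m') = finprod R (\<lambda>c. v c [^] count m c \<otimes> v c [^] count m' c) ?S"
      unfolding mv_def by (intro finprod_cong) (use v in \<open>auto simp: nat_pow_mult simp_implies_def\<close>)
    also have "\<dots> = finprod R (\<lambda>c. v c [^] count m c) ?S \<otimes> finprod R (\<lambda>c. v c [^] count m' c) ?S"
      using v by (intro finprod_multf) auto
    also have "\<dots> = mv m \<otimes> mv m'" by (simp add: mv_sup[of ?S])
    finally show ?thesis .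
  qed
  obtain h where h: "h \<in> hom (free_Abelian_group UNIV) (add_monoid R)" "\<And>x. x \<in> UNIV \<Longrightarrow> h (frag_of x) = mv x"
    using comm_group.free_Abelian_group_universal[OF a_comm_group, of mv UNIV] mvc by auto
  have hc: "h f \<in> carrier R" for f using h(1) unfolding hom_def by auto
  have hadd: "h (f + g) = h f \<oplus> h g" for f g using h(1) unfolding hom_def by auto
  have hdiff: "h (f - g) = h f \<ominus> h g" for f g
  proof -
    have "h f = h (f - g) \<oplus> h g" using hadd[of "f - g" g] by simp
    then have "h f \<ominus> h g = (h (f - g) \<oplus> h g) \<ominus> h g" by simp
    also have "\<dots> = h (f - g)" using hc by algebra
    finally show ?thesis by simp
  qed
  have h0: "h 0 = \<zero>" using hdiff[of 0 0] hc[of 0] by (simp add: a_minus_def r_neg)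
  have mult1: "h (frag_of m * g) = mv m \<otimes> h g" for m g
  proof (rule frag_induction[of g UNIV])
    show "h (frag_of m * 0) = mv m \<otimes> h 0" using mvc h0 by simp
  next
    fix m' show "h (frag_of m * frag_of m') = mv m \<otimes> h (frag_of m')" by (simp add: frag_of_mult h(2) mv_mult)
  next
    fix a b assume "h (frag_of m * a) = mv m \<otimes> h a" "h (frag_of m * b) = mv m \<otimes> h b"
    then show "h (frag_of m * (a - b)) = mv m \<otimes> h (a - b)"
      unfolding right_diff_distrib hdiff using mvc hc by algebra
  qed simp
  have hmult: "h (f * g) = h f \<otimes> h g" for f g
  proof (rule frag_induction[of f UNIV])
    show "h (0 * g) = h 0 \<otimes> h g" using hc h0 by simp
  next
    fix m show "h (frag_of m * g) = h (frag_of m) \<otimes> h g" by (simp add: mult1 h(2))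
  next
    fix a b assume "h (a * g) = h a \<otimes> h g" "h (b * g) = h b \<otimes> h g"
    then show "h ((a - b) * g) = h (a - b) \<otimes> h g"
      unfolding left_diff_distrib hdiff using hc by algebra
  qed simp
  have "h 1 = mv {#}" using h(2)[of "{#}"] by (simp flip: zero_multiset_def)
  also have "\<dots> = \<one>" unfolding mv_def by simp
  finally have "rhom R h" unfolding rhom_def using hc hadd hmult by auto
  moreover have "h (var c) = v c" for c
    using h(2)[of "{#c#}"] v unfolding var_def mv_def by simp
  ultimately show ?thesis by blast
qed

lemma rhom_congruence:
  assumes h: "rhom R h" "rhom R h'" and I: "ideal I R" and v: "\<And>c. h (var c) \<ominus> h' (var c) \<in> I"
  shows "h f \<ominus> h' f \<in> I"
proof -
  interpret I: ideal I R by (rule I)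
  note C = rhom_closed[OF h(1)] rhom_closed[OF h(2)]
  show ?thesis
  proof (rule var_induct[of "\<lambda>f. h f \<ominus> h' f \<in> I"])
    show "h 1 \<ominus> h' 1 \<in> I" by (simp add: rhom_one h I.zero_closed r_neg a_minus_def)
    show "h (var c) \<ominus> h' (var c) \<in> I" for c by (rule v)
  next
    fix a b assume ab: "h a \<ominus> h' a \<in> I" "h b \<ominus> h' b \<in> I"
    have "h (a - b) \<ominus> h' (a - b) = (h a \<ominus> h' a) \<ominus> (h b \<ominus> h' b)"
      unfolding rhom_diff[OF h(1)] rhom_diff[OF h(2)] using C by algebra
    then show "h (a - b) \<ominus> h' (a - b) \<in> I"
      using I.a_closed[OF ab(1) I.a_inv_closed[OF ab(2)]] by (simp add: a_minus_def)
    have "h (a * b) \<ominus> h' (a * b) = h a \<otimes> (h b \<ominus> h' b) \<oplus> (h a \<ominus> h' a) \<otimes> h' b"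
      unfolding rhom_mult[OF h(1)] rhom_mult[OF h(2)] using C by algebra
    then show "h (a * b) \<ominus> h' (a * b) \<in> I"
      using I.a_closed[OF I.I_l_closed[OF ab(2) C(1)] I.I_r_closed[OF ab(1) C(2)]] by simp
  qed
qed

lemma ideal_diff_cong:
  assumes I: "ideal I R" and C: "x \<in> carrier R" "y \<in> carrier R" and d: "x \<ominus> y \<in> I"
  shows "x \<in> I \<longleftrightarrow> y \<in> I"
proof -
  interpret I: ideal I R by (rule I)
  have 1: "x = (x \<ominus> y) \<oplus> y" and 2: "y = x \<oplus> \<ominus> (x \<ominus> y)" using C by algebra+
  show ?thesis
  proof
    assume "x \<in> I"
    then show "y \<in> I" by (subst 2) (rule I.a_closed[OF _ I.a_inv_closed[OF d]])
  next
    assume "y \<in> I"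
    then show "x \<in> I" by (subst 1) (rule I.a_closed[OF d])
  qed
qed

lemma rhom_vimage_rideal:
  assumes h: "rhom R h" and I: "ideal I R" shows "rideal {f. h f \<in> I}"
proof -
  interpret I: ideal I R by (rule I)
  show ?thesis unfolding smod_def
    by (auto simp: rhom_zero[OF h] rhom_add[OF h] rhom_mult[OF h] I.zero_closed I.a_closed I.I_l_closed rhom_closed[OF h])
qed

end

context cring
begin

lemma ideal_intro:
  assumes sub: "G \<subseteq> carrier R" and z: "\<zero> \<in> G" and add: "\<And>a b. a \<in> G \<Longrightarrow> b \<in> G \<Longrightarrow> a \<oplus> b \<in> G"
    and mult: "\<And>r a. r \<in> carrier R \<Longrightarrow> a \<in> G \<Longrightarrow> r \<otimes> a \<in> G"
  shows "ideal G R"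
proof (rule idealI[OF ring_axioms])
  show "subgroup G (add_monoid R)"
  proof (unfold_locales)
    show "inv\<^bsub>add_monoid R\<^esub> x \<in> G" if "x \<in> G" for x
    proof -
      have "\<ominus> x = (\<ominus> \<one>) \<otimes> x" using that sub by (metis l_minus l_one one_closed subsetD)
      then show ?thesis using mult[of "\<ominus> \<one>" x] that unfolding a_inv_def[symmetric] by simp
    qed
  qed (use sub z add in auto)
  show "a \<in> G \<Longrightarrow> x \<in> carrier R \<Longrightarrow> a \<otimes> x \<in> G" for a x using mult[of x a] sub m_comm[of a x] by auto
qed (use mult in auto)

end

section \<open>A type-class model of the completion\<close>

locale nlr = cring R for R (structure) + fixes p :: nat
  assumes ex1_max: "\<exists>!M. maximalideal M R" and noeth: "noetherian_ring R"
    and p: "Factorial_Ring.prime p" and char: "has_characteristic R p"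
begin

definition mx :: "'a set" where "mx = max_ideal R"

abbreviation mp :: "nat \<Rightarrow> 'a set" where "mp n \<equiv> ideal_power R mx n"

lemma mx: "maximalideal mx R"
  unfolding mx_def max_ideal_def by (rule theI'[OF ex1_max])

lemma mx_ideal: "ideal mx R" and one_notin_mx: "\<one> \<notin> mx"
proof -
  show i: "ideal mx R" by (rule maximalideal.axioms(1)[OF mx])
  show "\<one> \<notin> mx" using maximalideal.I_notcarr[OF mx] ideal.one_imp_carrier[OF i] by blast
qed

lemma char_p: "[p] \<cdot> \<one> = \<zero>" using char unfolding has_characteristic_def by (metis dvd_refl)

lemma ex_maximal:
  assumes "\<A> \<noteq> {}" "\<And>I. I \<in> \<A> \<Longrightarrow> ideal I R"
  shows "\<exists>I\<in>\<A>. \<forall>J\<in>\<A>. I \<subseteq> J \<longrightarrow> J = I"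
proof (rule subset_Zorn_nonempty[OF assms(1)])
  fix \<C> assume C: "\<C> \<noteq> {}" "subset.chain \<A> \<C>"
  have "subset.chain {I. ideal I R} \<C>" using C(2) assms(2) unfolding pred_on.chain_def by auto
  then have "\<Union>\<C> \<in> \<C>" by (rule noetherian_ring.ideal_chain_is_trivial[OF noeth C(1)])
  then show "\<Union>\<C> \<in> \<A>" using C(2) unfolding pred_on.chain_def by auto
qed

lemma proper_ideal_mx:
  assumes I: "ideal I R" "I \<noteq> carrier R" shows "I \<subseteq> mx"
proof -
  have "\<exists>N\<in>{N. ideal N R \<and> I \<subseteq> N \<and> \<one> \<notin> N}. \<forall>J\<in>{N. ideal N R \<and> I \<subseteq> N \<and> \<one> \<notin> N}. N \<subseteq> J \<longrightarrow> J = N"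
    by (rule ex_maximal) (use I ideal.one_imp_carrier in auto)
  then obtain N where N: "ideal N R" "I \<subseteq> N" "\<one> \<notin> N"
    "\<And>J. ideal J R \<Longrightarrow> \<one> \<notin> J \<Longrightarrow> N \<subseteq> J \<Longrightarrow> J = N" by auto
  have "maximalideal N R"
  proof (rule maximalidealI[OF N(1)])
    show "carrier R \<noteq> N" using N(3) by auto
    show "J = N \<or> J = carrier R" if "ideal J R" "N \<subseteq> J" "J \<subseteq> carrier R" for J
      using N(4)[OF that(1) _ that(2)] ideal.one_imp_carrier[OF that(1)] by blast
  qed
  then have "N = mx" using ex1_max mx by blast
  then show ?thesis using N(2) by simp
qed

lemma unit_outside_mx:
  assumes "x \<in> carrier R" "x \<notin> mx" shows "\<exists>y\<in>carrier R. x \<otimes> y = \<one>"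
proof -
  have i: "ideal (PIdl x) R" by (rule cgenideal_ideal[OF assms(1)])
  have "x \<in> PIdl x" by (rule cgenideal_self[OF assms(1)])
  then have "PIdl x = carrier R" using proper_ideal_mx[OF i] assms by blast
  then have "\<one> \<in> PIdl x" by simp
  then show ?thesis unfolding cgenideal_def using m_comm[OF assms(1)] by auto
qed

lemma mp_ideal: "ideal (mp n) R"
  using monoid.nat_pow_closed[OF comm_monoid.axioms(1)[OF ideals_set_is_comm_monoid], of mx n] mx_ideal
  by (simp add: ideals_set_def)

lemma mp_0: "mp 0 = carrier R" by (simp add: ideals_set_def)

lemma mp_Suc: "mp (Suc n) = mp n \<cdot> mx" by (simp add: ideals_set_def)

lemma mp_1: "mp (Suc 0) = mx"
  using monoid.nat_pow_eone[OF comm_monoid.axioms(1)[OF ideals_set_is_comm_monoid], of mx] mx_ideal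
  by (simp add: ideals_set_def)

lemma mp_add: "mp (i + j) = mp i \<cdot> mp j"
  using monoid.nat_pow_mult[OF comm_monoid.axioms(1)[OF ideals_set_is_comm_monoid], of mx i j] mx_ideal
  by (simp add: ideals_set_def)

lemma mp_dec: "mp (Suc n) \<subseteq> mp n" unfolding mp_Suc using ideal_prod_inter[OF mp_ideal mx_ideal] by blast

lemma mp_mono: "n \<le> k \<Longrightarrow> mp k \<subseteq> mp n" using lift_Suc_antimono_le[of mp, OF mp_dec] by blast

lemma mp_zero: "\<zero> \<in> mp n" by (rule additive_subgroup.zero_closed[OF ideal.axioms(1)[OF mp_ideal]])

lemma mp_closed: "mp n \<subseteq> carrier R" using ideal.Icarr[OF mp_ideal] by blast

text \<open>Representatives for an element of the inverse limit, where \<open>c n\<close> matters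
  only modulo \<open>mp n\<close>.\<close>

definition coh :: "(nat \<Rightarrow> 'a) \<Rightarrow> bool" where
  "coh c \<longleftrightarrow> (\<forall>n. c n \<in> carrier R) \<and> (\<forall>n. c (Suc n) \<ominus> c n \<in> mp n)"

text \<open>There is one variable for every sequence of ring elements. A coherent sequence is thus
  itself the name of a variable, so limits exist by construction.\<close>

type_synonym 'c prg = "(nat \<Rightarrow> 'c) multiset \<Rightarrow>\<^sub>0 int"

text \<open>The ring homomorphisms \<open>E n\<close> realise the ring \<open>'a prg\<close> modulo \<open>\<Inter>n. M n\<close> as the completion
  of \<open>R\<close>, and \<open>ev\<close> maps it onto \<open>R\<close> itself.\<close>

definition E :: "nat \<Rightarrow> 'a prg \<Rightarrow> 'a" where
  "E n = (SOME h. rhom R h \<and> (\<forall>c. h (var c) = (if coh c then c n else \<zero>)))"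

definition ev :: "'a prg \<Rightarrow> 'a" where
  "ev = (SOME h. rhom R h \<and> (\<forall>c. h (var c) = (if c 0 \<in> carrier R then c 0 else \<zero>)))"

definition io :: "'a \<Rightarrow> 'a prg" where "io r = var (\<lambda>_. r)"

text \<open>Both \<open>E n\<close> and \<open>ev\<close> are of this kind, so an element built from
  \<open>io\<close> can be evaluated at all levels of the completion and in \<open>R\<close> at
  once. The map \<open>io\<close> itself is not a homomorphism.\<close>

definition sec :: "('a prg \<Rightarrow> 'a) \<Rightarrow> bool" where
  "sec h \<longleftrightarrow> rhom R h \<and> (\<forall>r\<in>carrier R. h (io r) = r)"

definition M :: "nat \<Rightarrow> 'a prg set" where "M n = {f. E n f \<in> mp n}"

lemma E: "rhom R (E n)" "E n (var c) = (if coh c then c n else \<zero>)"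
proof -
  have "\<exists>h. rhom R h \<and> (\<forall>c. h (var c) = (if coh c then c n else \<zero>))"
    by (rule ex_rhom) (auto simp: coh_def)
  from someI_ex[OF this] show "rhom R (E n)" "E n (var c) = (if coh c then c n else \<zero>)"
    unfolding E_def[symmetric] by auto
qed

lemma ev: "rhom R ev" "ev (var c) = (if c 0 \<in> carrier R then c 0 else \<zero>)"
proof -
  have "\<exists>h :: 'a prg \<Rightarrow> 'a. rhom R h \<and> (\<forall>c. h (var c) = (if c 0 \<in> carrier R then c 0 else \<zero>))"
    by (rule ex_rhom) auto
  from someI_ex[OF this] show "rhom R ev" "ev (var c) = (if c 0 \<in> carrier R then c 0 else \<zero>)"
    unfolding ev_def[symmetric] by auto
qed

lemma sec_E: "sec (E n)"
proof -
  have "coh (\<lambda>_. r)" if "r \<in> carrier R" for r unfolding coh_def using that mp_zero by (simp add: a_minus_def r_neg)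
  then show ?thesis unfolding sec_def io_def by (auto simp: E)
qed

lemma sec_ev: "sec ev" unfolding sec_def io_def by (auto simp: ev)

lemma sec_rhom: "sec h \<Longrightarrow> rhom R h" and sec_io: "sec h \<Longrightarrow> r \<in> carrier R \<Longrightarrow> h (io r) = r"
  unfolding sec_def by auto

lemma coh_le: assumes c: "coh c" and "n \<le> k" shows "c k \<ominus> c n \<in> mp n"
  using assms(2)
proof (induction k rule: dec_induct)
  case base
  then show ?case using c mp_zero unfolding coh_def by (simp add: a_minus_def r_neg)
next
  case (step k)
  interpret I: ideal "mp n" R by (rule mp_ideal)
  have C: "c i \<in> carrier R" for i using c unfolding coh_def by blast
  have "c (Suc k) \<ominus> c k \<in> mp n" using c mp_mono[OF step(1)] unfolding coh_def by blast
  from I.a_closed[OF this step(3)] have "(c (Suc k) \<ominus> c k) \<oplus> (c k \<ominus> c n) \<in> mp n" .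
  moreover have "(c (Suc k) \<ominus> c k) \<oplus> (c k \<ominus> c n) = c (Suc k) \<ominus> c n" using C by algebra
  ultimately show ?case by simp
qed

lemma E_coh: assumes "n \<le> k" shows "E k f \<ominus> E n f \<in> mp n"
  by (rule rhom_congruence[OF E(1) E(1) mp_ideal]) (use coh_le[OF _ assms] mp_zero in \<open>auto simp: E a_minus_def\<close>)

lemma E_closed: "E n f \<in> carrier R" by (rule rhom_closed[OF E(1)])
lemma ev_closed: "ev f \<in> carrier R" by (rule rhom_closed[OF ev(1)])

lemma E_mem_iff: "n \<le> k \<Longrightarrow> ideal I R \<Longrightarrow> mp n \<subseteq> I \<Longrightarrow> E k f \<in> I \<longleftrightarrow> E n f \<in> I"
  by (rule ideal_diff_cong[OF _ E_closed E_closed]) (use E_coh in auto)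

lemma M_iff: "n \<le> k \<Longrightarrow> f \<in> M n \<longleftrightarrow> E k f \<in> mp n"
  unfolding M_def using E_mem_iff[OF _ mp_ideal order.refl] by blast

text \<open>One element of the ideal generated by \<open>L\<close> evaluates to \<open>x\<close>
  under all sections simultaneously. Ideal membership in \<open>R\<close> is transferred to the
  model in this form.\<close>

definition rep :: "'a prg list \<Rightarrow> 'a \<Rightarrow> bool" where
  "rep L x \<longleftrightarrow> (\<exists>l\<in>cmb UNIV {0} L. \<forall>h. sec h \<longrightarrow> h l = x)"

lemma rideal_0: "rideal {0}" by (simp add: smod_def)

lemma rep_add: assumes "rep L x" "rep L y" shows "rep L (x \<oplus> y)"
proof -
  obtain l l' where "l \<in> cmb UNIV {0} L" "l' \<in> cmb UNIV {0} L" "\<And>h. sec h \<Longrightarrow> h l = x" "\<And>h. sec h \<Longrightarrow> h l' = y"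
    using assms unfolding rep_def by auto
  then show ?thesis unfolding rep_def
    by (intro bexI[of _ "l + l'"] smod_add[OF cmb_rideal[OF rideal_0]]) (auto simp: rhom_add[OF sec_rhom])
qed

lemma rep_mult: assumes r: "r \<in> carrier R" and "rep L x" shows "rep L (r \<otimes> x)"
proof -
  obtain l where "l \<in> cmb UNIV {0} L" "\<And>h. sec h \<Longrightarrow> h l = x" using assms unfolding rep_def by auto
  then show ?thesis unfolding rep_def
    by (intro bexI[of _ "io r * l"] rideal_multl[OF cmb_rideal[OF rideal_0]]) (auto simp: rhom_mult[OF sec_rhom] sec_io r)
qed

lemma rep_zero: "rep L \<zero>"
  unfolding rep_def by (intro bexI[of _ 0] smod_0[OF cmb_rideal[OF rideal_0]]) (auto simp: rhom_zero[OF sec_rhom])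

lemma rep_append: assumes "rep L x" "set L \<subseteq> set L'" shows "rep L' x"
  using assms(1) cmb_sub_mono[OF sring_UNIV rideal_0 order.refl order.refl, of L L'] assms(2) unfolding rep_def by blast

lemma rep_genideal:
  assumes "set zs \<subseteq> carrier R" "x \<in> Idl (set zs)" shows "rep (map io zs) x"
proof -
  define G where "G = {x \<in> carrier R. rep (map io zs) x}"
  have "ideal G R" by (rule ideal_intro) (auto simp: G_def rep_zero rep_add rep_mult)
  moreover have "set zs \<subseteq> G"
  proof
    fix z assume z: "z \<in> set zs"
    have "io z \<in> cmb UNIV {0} (map io zs)" by (rule cmb_mem) (use z in auto)
    then have "rep (map io zs) z" unfolding rep_def using sec_io assms(1) z by blast
    then show "z \<in> G" using z assms(1) unfolding G_def by blast
  qed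
  ultimately have "Idl (set zs) \<subseteq> G" by (rule genideal_minimal)
  then show ?thesis using assms(2) unfolding G_def by blast
qed

lemma rep_prod:
  assumes ab: "\<AA> \<subseteq> carrier R" "\<BB> \<subseteq> carrier R" and x: "x \<in> \<AA> \<cdot> \<BB>"
  shows "\<exists>L. set L \<subseteq> {io a * io b |a b. a \<in> \<AA> \<and> b \<in> \<BB>} \<and> rep L x"
  using x
proof (induction x rule: ideal_prod.induct)
  case (prod i j)
  have "io i * io j \<in> cmb UNIV {0} [io i * io j]" by (rule cmb_mem) auto
  moreover have "h (io i * io j) = i \<otimes> j" if "sec h" for h
    using rhom_mult[OF sec_rhom[OF that]] sec_io[OF that subsetD[OF ab(1) prod(1)]] sec_io[OF that subsetD[OF ab(2) prod(2)]] by simp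
  ultimately have "rep [io i * io j] (i \<otimes> j)" unfolding rep_def by blast
  then show ?case using prod by (intro exI[of _ "[io i * io j]"]) auto
next
  case (sum s t)
  then obtain L L' where L: "set L \<subseteq> {io a * io b |a b. a \<in> \<AA> \<and> b \<in> \<BB>}" "rep L s"
    "set L' \<subseteq> {io a * io b |a b. a \<in> \<AA> \<and> b \<in> \<BB>}" "rep L' t" by blast
  have "rep (L @ L') (s \<oplus> t)" by (rule rep_add[OF rep_append[OF L(2)] rep_append[OF L(4)]]) auto
  then show ?case using L by (intro exI[of _ "L @ L'"]) auto
qed

lemma rep_mem:
  assumes "rep L (E n t)" shows "t \<in> cmb UNIV (M n) L"
proof -
  obtain l where l: "l \<in> cmb UNIV {0} L" "E n l = E n t" using assms sec_E unfolding rep_def by blast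
  have Mi: "rideal (M n)" unfolding M_def by (rule rhom_vimage_rideal[OF E(1) mp_ideal])
  have "t - l \<in> M n" unfolding M_def using mp_zero l(2) E_closed by (simp add: rhom_diff[OF E(1)] a_minus_def r_neg)
  then have 1: "t - l \<in> cmb UNIV (M n) L" using cmb_base[of UNIV "M n" L] by blast
  have "l \<in> cmb UNIV (M n) L" using l(1) cmb_mono[OF order.refl, of "{0}" "M n" UNIV L] smod_0[OF Mi] by blast
  from smod_add[OF cmb_rideal[OF Mi] 1 this] show ?thesis by simp
qed

lemma noeth_gens: "ideal I R \<Longrightarrow> \<exists>zs. set zs \<subseteq> carrier R \<and> I = Idl (set zs)"
  using noetherian_ring.finetely_gen[OF noeth] finite_list by metis

lemma io_M: "r \<in> mp n \<Longrightarrow> io r \<in> M n"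
  unfolding M_def using sec_io[OF sec_E subsetD[OF mp_closed]] by auto

sublocale clr M p
proof
  show Mi: "rideal (M n)" for n unfolding M_def by (rule rhom_vimage_rideal[OF E(1) mp_ideal])
  show "M 0 = UNIV" unfolding M_def using E_closed mp_0 by auto
  show "a * b \<in> M (i + j)" if "a \<in> M i" "b \<in> M j" for a b i j
  proof -
    have "E (i + j) a \<in> mp i" "E (i + j) b \<in> mp j" using that M_iff[of i "i + j" a] M_iff[of j "i + j" b] by auto
    then have "E (i + j) a \<otimes> E (i + j) b \<in> mp (i + j)" unfolding mp_add by (rule ideal_prod.prod)
    then show ?thesis unfolding M_def by (simp add: rhom_mult[OF E(1)])
  qed
  show "M (Suc n) \<subseteq> M n" for n
  proof
    fix t assume "t \<in> M (Suc n)"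
    then have "E (Suc n) t \<in> mp n" using mp_dec unfolding M_def by blast
    then show "t \<in> M n" using M_iff[of n "Suc n"] by auto
  qed
  show "1 \<notin> M 1" unfolding M_def using one_notin_mx mp_1 by (simp add: rhom_one[OF E(1)])
  show "\<exists>b. a * b - 1 \<in> M 1" if "a \<notin> M 1" for a
  proof -
    have "E 1 a \<notin> mx" using that mp_1 unfolding M_def by simp
    then obtain y where y: "y \<in> carrier R" "E 1 a \<otimes> y = \<one>" using unit_outside_mx[OF E_closed] by blast
    then have "a * io y - 1 \<in> M 1"
      unfolding M_def using mp_zero[of 1] sec_io[OF sec_E y(1)]
      by (simp del: One_nat_def add: rhom_diff[OF E(1)] rhom_mult[OF E(1)] rhom_one[OF E(1)] a_minus_def r_neg)
    then show ?thesis by blast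
  qed
  show "\<exists>L. set L \<subseteq> {a * b |a b. a \<in> M i \<and> b \<in> M j} \<and> t \<in> cmb UNIV (M k) L" if t: "t \<in> M (i + j)" for t i j k
  proof -
    \<comment> \<open>The level is at least \<open>i + j\<close>, to see the membership of
      \<open>t\<close>, and at least \<open>k\<close>, to leave an error in
      \<open>M k\<close>.\<close>
    let ?N = "max (i + j) k"
    have "E ?N t \<in> mp i \<cdot> mp j" using M_iff[of "i + j" ?N t] t mp_add by simp
    then obtain L where L: "set L \<subseteq> {io a * io b |a b. a \<in> mp i \<and> b \<in> mp j}" "rep L (E ?N t)"
      using rep_prod[OF mp_closed mp_closed] by blast
    have "M ?N \<subseteq> M k"
    proof
      fix s assume "s \<in> M ?N"
      then have "E ?N s \<in> mp k" using mp_mono[of k ?N] unfolding M_def by auto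
      then show "s \<in> M k" using M_iff[of k ?N] by auto
    qed
    then have "t \<in> cmb UNIV (M k) L" using rep_mem[OF L(2)] cmb_mono[OF order.refl, of "M ?N" "M k" UNIV L] by blast
    moreover have "set L \<subseteq> {a * b |a b. a \<in> M i \<and> b \<in> M j}" using L(1) io_M by blast
    ultimately show ?thesis by blast
  qed
  show "\<exists>zs. set zs \<subseteq> M 1 \<and> M 1 \<subseteq> cmb UNIV (M 2) zs"
  proof -
    obtain zs where zs: "set zs \<subseteq> carrier R" "mx = Idl (set zs)" using noeth_gens[OF mx_ideal] by blast
    have "set (map io zs) \<subseteq> M 1" using io_M[of _ 1] zs genideal_self[OF zs(1)] mp_1 by auto
    moreover have "M 1 \<subseteq> cmb UNIV (M 2) (map io zs)"
    proof
      fix t assume "t \<in> M 1"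
      then have "E 2 t \<in> mx" using M_iff[of 1 2 t] mp_1 by simp
      then show "t \<in> cmb UNIV (M 2) (map io zs)" by (intro rep_mem rep_genideal[OF zs(1)]) (simp flip: zs(2))
    qed
    ultimately show ?thesis by blast
  qed
  show "\<exists>l. \<forall>i. l - s i \<in> M i" if s: "\<And>i. s (Suc i) - s i \<in> M i" for s
  proof -
    \<comment> \<open>The diagonal: the \<open>n\<close>-th term of the sequence evaluated at level
      \<open>n\<close>. The variable with this name is the limit.\<close>
    define c where "c = (\<lambda>n. E n (s n))"
    have "c (Suc n) \<ominus> c n \<in> mp n" for n
    proof -
      interpret I: ideal "mp n" R by (rule mp_ideal)
      have "E (Suc n) (s (Suc n) - s n) \<in> mp n" using s[of n] M_iff[of n "Suc n"] by simp
      then have "E (Suc n) (s (Suc n)) \<ominus> E (Suc n) (s n) \<in> mp n" by (simp add: rhom_diff[OF E(1)])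
      from I.a_closed[OF this E_coh[of n "Suc n" "s n"]]
      have "(E (Suc n) (s (Suc n)) \<ominus> E (Suc n) (s n)) \<oplus> (E (Suc n) (s n) \<ominus> E n (s n)) \<in> mp n" by simp
      moreover have "(E (Suc n) (s (Suc n)) \<ominus> E (Suc n) (s n)) \<oplus> (E (Suc n) (s n) \<ominus> E n (s n))
          = E (Suc n) (s (Suc n)) \<ominus> E n (s n)"
        using E_closed[of "Suc n" "s (Suc n)"] E_closed[of "Suc n" "s n"] E_closed[of n "s n"] by algebra
      ultimately show ?thesis unfolding c_def by simp
    qed
    then have "coh c" unfolding coh_def c_def using E_closed by blast
    then have "var c - s i \<in> M i" for i
      unfolding M_def using mp_zero E_closed by (simp add: rhom_diff[OF E(1)] E(2) c_def a_minus_def r_neg)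
    then show ?thesis by blast
  qed
  show "Factorial_Ring.prime p" by (rule p)
  show "of_nat p \<in> M n" for n
    unfolding M_def using mp_zero char_p by (simp add: rhom_of_nat[OF E(1)])
qed

end

section \<open>The ring itself as a quotient of the model\<close>

context nlr
begin

definition ker :: "'a prg set" where "ker = {f. ev f \<in> {\<zero>}}"

definition pull :: "'a set \<Rightarrow> 'a prg set" where "pull I = {f. ev f \<in> I}"

lemma pull_rideal: "ideal I R \<Longrightarrow> rideal (pull I)" unfolding pull_def by (rule rhom_vimage_rideal[OF ev(1)])

lemma ker_rideal: "rideal ker" unfolding ker_def by (rule rhom_vimage_rideal[OF ev(1) zeroideal])

lemma ker_pull: "ideal I R \<Longrightarrow> ker \<subseteq> pull I"
  unfolding ker_def pull_def using additive_subgroup.zero_closed[OF ideal.axioms(1)] by auto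

lemma ev_io: "r \<in> carrier R \<Longrightarrow> ev (io r) = r" by (rule sec_io[OF sec_ev])

lemma ker_diff: "ev f = ev g \<Longrightarrow> f - g \<in> ker"
  unfolding ker_def using ev_closed[of g] by (simp add: rhom_diff[OF ev(1)] a_minus_def r_neg)

lemma ev_image_ideal: assumes I: "rideal I" shows "ideal (ev ` I) R"
proof (rule ideal_intro)
  show "ev ` I \<subseteq> carrier R" using ev_closed by blast
  show "\<zero> \<in> ev ` I" using smod_0[OF I] rhom_zero[OF ev(1)] by force
  show "a \<oplus> b \<in> ev ` I" if "a \<in> ev ` I" "b \<in> ev ` I" for a b
  proof -
    from that obtain f g where "f \<in> I" "g \<in> I" "a = ev f" "b = ev g" by blast
    then show ?thesis using smod_add[OF I, of f g] rhom_add[OF ev(1), of f g] by force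
  qed
  show "r \<otimes> a \<in> ev ` I" if "r \<in> carrier R" "a \<in> ev ` I" for r a
  proof -
    from that(2) obtain f where "f \<in> I" "a = ev f" by blast
    then show ?thesis using rideal_multl[OF I, of f "io r"] rhom_mult[OF ev(1), of "io r" f] ev_io[OF that(1)] by force
  qed
qed

lemma pull_image: assumes I: "rideal I" "ker \<subseteq> I" shows "pull (ev ` I) = I"
proof -
  have "f \<in> I" if "g \<in> I" "ev f = ev g" for f g
    using smod_add[OF I(1) subsetD[OF I(2) ker_diff[OF that(2)]] that(1)] by simp
  then show ?thesis unfolding pull_def by blast
qed

lemma image_pull: "I \<subseteq> carrier R \<Longrightarrow> ev ` pull I = I"
proof (intro equalityI subsetI)
  fix x assume "I \<subseteq> carrier R" "x \<in> I"
  then have "ev (io x) = x" using ev_io by blast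
  then show "x \<in> ev ` pull I" using \<open>x \<in> I\<close> unfolding pull_def by (intro image_eqI[of _ _ "io x"]) auto
qed (auto simp: pull_def)

text \<open>Through \<open>ev\<close>, the ring \<open>R\<close> becomes a quotient of the same
  polynomial ring that models its completion, so both can be treated on one type.\<close>

sublocale Rl: nloc ker "pull mx"
proof
  show "rideal ker" by (rule ker_rideal)
  show "rideal (pull mx)" by (rule pull_rideal[OF mx_ideal])
  show "1 \<notin> pull mx" unfolding pull_def using one_notin_mx rhom_one[OF ev(1)] by simp
  show "ker \<subseteq> pull mx" by (rule ker_pull[OF mx_ideal])
  show "\<exists>b. a * b - 1 \<in> ker" if "a \<notin> pull mx" for a
  proof -
    have "ev a \<notin> mx" using that unfolding pull_def by simp
    from unit_outside_mx[OF ev_closed this] obtain y where y: "y \<in> carrier R" "ev a \<otimes> y = \<one>" by (elim bexE)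
    then have "ev (a * io y) = ev 1" by (simp add: rhom_mult[OF ev(1)] rhom_one[OF ev(1)] ev_io)
    then show ?thesis using ker_diff by blast
  qed
  show "\<exists>I\<in>\<A>. \<forall>J\<in>\<A>. I \<subseteq> J \<longrightarrow> J = I" if A: "\<A> \<noteq> {}" "\<And>I. I \<in> \<A> \<Longrightarrow> rideal I \<and> ker \<subseteq> I" for \<A>
  proof -
    have "\<exists>I\<in>(`) ev ` \<A>. \<forall>J\<in>(`) ev ` \<A>. I \<subseteq> J \<longrightarrow> J = I"
      by (rule ex_maximal) (use A ev_image_ideal in auto)
    then obtain I where I: "I \<in> \<A>" "\<And>J. J \<in> \<A> \<Longrightarrow> ev ` I \<subseteq> ev ` J \<Longrightarrow> ev ` J = ev ` I" by auto
    have "J = I" if "J \<in> \<A>" "I \<subseteq> J" for J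
      using I(2)[OF that(1) image_mono[OF that(2)]] pull_image A(2)[OF that(1)] A(2)[OF I(1)] by metis
    then show ?thesis using I(1) by blast
  qed
qed

lemma rep_ev: assumes "rep L (ev f)" shows "f \<in> cmb UNIV ker L"
proof -
  obtain l where l: "l \<in> cmb UNIV {0} L" "ev l = ev f" using assms sec_ev unfolding rep_def by blast
  have "l \<in> cmb UNIV ker L" using l(1) cmb_mono[OF order.refl, of "{0}" ker UNIV L] smod_0[OF ker_rideal] by blast
  moreover have "f - l \<in> cmb UNIV ker L" using ker_diff[of f l] l(2) cmb_base[of UNIV ker L] by auto
  ultimately have "(f - l) + l \<in> cmb UNIV ker L" by (intro smod_add[OF cmb_rideal[OF ker_rideal]])
  then show ?thesis by simp
qed

lemma Mp_pull: "Rl.Mp n = pull (mp n)"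
proof (induction n)
  case 0
  have "pull (mp 0) = UNIV" using mp_0 ev_closed unfolding pull_def by auto
  then show ?case unfolding Rl.Mp.simps by (rule sym)
next
  case (Suc n)
  have S: "mp (Suc n) = mx \<cdot> mp n" using mp_add[of 1 n] mp_1 by simp
  show ?case
  proof
    show "Rl.Mp (Suc n) \<subseteq> pull (mp (Suc n))"
    proof
      fix t assume "t \<in> Rl.Mp (Suc n)"
      then obtain L where L: "set L \<subseteq> {a * b |a b. a \<in> pull mx \<and> b \<in> pull (mp n)}" "t \<in> cmb UNIV ker L"
        unfolding Rl.Mp.simps Suc.IH by blast
      have "set L \<subseteq> pull (mp (Suc n))"
        using L(1) ideal_prod.prod[of _ mx _ "mp n" R] unfolding pull_def S by (auto simp: rhom_mult[OF ev(1)])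
      then have "cmb UNIV ker L \<subseteq> pull (mp (Suc n))"
        by (rule cmb_least[OF pull_rideal[OF mp_ideal] ker_pull[OF mp_ideal]])
      then show "t \<in> pull (mp (Suc n))" using L(2) by blast
    qed
    show "pull (mp (Suc n)) \<subseteq> Rl.Mp (Suc n)"
    proof
      fix t assume "t \<in> pull (mp (Suc n))"
      then have "ev t \<in> mx \<cdot> mp n" unfolding pull_def S by simp
      then obtain L where L: "set L \<subseteq> {io a * io b |a b. a \<in> mx \<and> b \<in> mp n}" "rep L (ev t)"
        using rep_prod[OF _ mp_closed] ideal.Icarr[OF mx_ideal] by blast
      have io: "io a \<in> pull I" if "a \<in> I" "I \<subseteq> carrier R" for a I unfolding pull_def using ev_io that by auto
      have "set L \<subseteq> {a * b |a b. a \<in> pull mx \<and> b \<in> pull (mp n)}"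
        using L(1) io[OF _ mp_closed, of _ n] io[of _ mx] ideal.Icarr[OF mx_ideal] by blast
      then show "t \<in> Rl.Mp (Suc n)" unfolding Rl.Mp.simps Suc.IH using rep_ev[OF L(2)] by blast
    qed
  qed
qed

lemma tprime_pull: assumes P: "primeideal P R" shows "Rl.tprime (pull P)"
proof -
  interpret P: primeideal P R by (rule P)
  have "\<one> \<notin> P" using P.I_notcarr P.one_imp_carrier by auto
  then show ?thesis unfolding Rl.tprime_def using pull_rideal[OF P.is_ideal] ker_pull[OF P.is_ideal] P.I_prime[OF ev_closed ev_closed]
    unfolding pull_def by (auto simp: rhom_mult[OF ev(1)] rhom_one[OF ev(1)])
qed

lemma tprime_image: assumes Q: "Rl.tprime Q" shows "primeideal (ev ` Q) R"
proof (rule primeidealI[OF ev_image_ideal is_cring])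
  have Q': "rideal Q" "ker \<subseteq> Q" "1 \<notin> Q" and pr: "\<And>a b. a * b \<in> Q \<Longrightarrow> a \<in> Q \<or> b \<in> Q"
    using Q unfolding Rl.tprime_def by auto
  have mem: "ev f \<in> ev ` Q \<longleftrightarrow> f \<in> Q" for f using pull_image[OF Q'(1,2)] unfolding pull_def by blast
  show "rideal Q" by (rule Q'(1))
  show "carrier R \<noteq> ev ` Q" using mem[of 1] Q'(3) rhom_one[OF ev(1)] by auto
  show "a \<in> ev ` Q \<or> b \<in> ev ` Q" if "a \<in> carrier R" "b \<in> carrier R" "a \<otimes> b \<in> ev ` Q" for a b
    using pr[of "io a" "io b"] mem[of "io a * io b"] mem[of "io a"] mem[of "io b"] that by (simp add: rhom_mult[OF ev(1)] ev_io)
qed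

text \<open>The cosets of the \<open>E n f\<close> form an element of the completion. This
  assignment is multiplicative and vanishes exactly on \<open>NN\<close>, so nilpotents are
  transported to the completion.\<close>

lemma NN_radical:
  assumes red: "reduced_ring (completion R (max_ideal R))" and t: "t ^ n \<in> NN"
  shows "t \<in> NN"
proof -
  let ?C = "completion R mx"
  have hom: "(+>) (mp n) \<in> ring_hom R (R Quot mp n)" for n by (rule ideal.rcos_ring_hom[OF mp_ideal])
  define x where "x = (\<lambda>f n. mp n +> E n f)"
  have xc: "x f \<in> carrier ?C" for f
  proof -
    have "x f n \<in> carrier (R Quot mp n)" for n unfolding x_def by (rule ring_hom_closed[OF hom E_closed])
    moreover have "x f (Suc n) \<subseteq> x f n" for n
    proof
      fix y assume "y \<in> x f (Suc n)"
      then obtain h where h: "h \<in> mp (Suc n)" "y = h \<oplus> E (Suc n) f" unfolding x_def a_r_coset_def' by blast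
      interpret I: ideal "mp n" R by (rule mp_ideal)
      have hc: "h \<in> carrier R" using h(1) mp_closed by blast
      have "h \<oplus> (E (Suc n) f \<ominus> E n f) \<in> mp n" by (rule I.a_closed[OF subsetD[OF mp_dec h(1)] E_coh]) simp
      moreover have "y = (h \<oplus> (E (Suc n) f \<ominus> E n f)) \<oplus> E n f"
        unfolding h(2) using hc E_closed[of "Suc n" f] E_closed[of n f] by algebra
      ultimately show "y \<in> x f n" unfolding x_def a_r_coset_def' by blast
    qed
    ultimately show ?thesis unfolding completion_def by simp
  qed
  have xmult: "x f \<otimes>\<^bsub>?C\<^esub> x g = x (f * g)" for f g
    unfolding completion_def x_def by (simp add: rhom_mult[OF E(1)] ring_hom_mult[OF hom] E_closed)
  have xone: "\<one>\<^bsub>?C\<^esub> = x 1"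
    unfolding completion_def x_def by (simp add: rhom_one[OF E(1)] ring_hom_one[OF hom])
  have xzero: "x f = \<zero>\<^bsub>?C\<^esub> \<longleftrightarrow> f \<in> NN" for f
  proof -
    have "x f = \<zero>\<^bsub>?C\<^esub> \<longleftrightarrow> (\<forall>n. mp n +> E n f = mp n)"
      unfolding completion_def x_def FactRing_def by (simp add: fun_eq_iff)
    also have "\<dots> \<longleftrightarrow> (\<forall>n. E n f \<in> mp n)"
    proof (rule arg_cong[of _ _ All], rule ext)
      fix n
      interpret I: ideal "mp n" R by (rule mp_ideal)
      show "mp n +> E n f = mp n \<longleftrightarrow> E n f \<in> mp n"
        using I.a_rcos_const[of "E n f"] I.a_rcos_self[OF E_closed, of n f] by auto
    qed
    finally show ?thesis unfolding NN_def M_def by auto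
  qed
  have "x t [^]\<^bsub>?C\<^esub> n = x (t ^ n)" for n
    by (induction n) (auto simp: nat_pow_def xone xmult mult.commute)
  then have "x t [^]\<^bsub>?C\<^esub> n = \<zero>\<^bsub>?C\<^esub>" using t xzero by simp
  then have "x t = \<zero>\<^bsub>?C\<^esub>" using red xc unfolding reduced_ring_def mx_def[symmetric] by blast
  then show ?thesis using xzero by simp
qed

end

context nlr
begin

definition KK :: "'a prg set" where
  "KK = (SOME K. fmod K NN \<and> NN \<subseteq> K \<and> K \<inter> M 1 \<subseteq> NN \<and> (\<forall>t. \<exists>k\<in>K. t - k \<in> M 1))"

sublocale clrK M p KK
  using someI_ex[OF ex_coefficient_field] unfolding KK_def[symmetric] by unfold_locales blast+

text \<open>The extension of an ideal to the completion, defined at all levels at once and therefore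
  closed. For an ideal containing a power of the maximal ideal, a single level decides membership
  (\<open>up_iff\<close>).\<close>

definition up :: "'a set \<Rightarrow> 'a prg set" where "up \<AA> = {f. \<forall>n. E n f \<in> set_add R \<AA> (mp n)}"

lemma add_mp_ideal: "ideal \<AA> R \<Longrightarrow> ideal (set_add R \<AA> (mp n)) R"
  using add_ideals mp_ideal by blast

lemma add_mp_iff: "x \<in> set_add R \<AA> (mp n) \<longleftrightarrow> (\<exists>a\<in>\<AA>. \<exists>b\<in>mp n. x = a \<oplus> b)"
  unfolding set_add_def' by auto

lemma add_mp_upper: "ideal \<AA> R \<Longrightarrow> \<AA> \<subseteq> set_add R \<AA> (mp n)" "ideal \<AA> R \<Longrightarrow> mp n \<subseteq> set_add R \<AA> (mp n)"
proof -
  assume a: "ideal \<AA> R"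
  interpret a: ideal \<AA> R by (rule a)
  show "\<AA> \<subseteq> set_add R \<AA> (mp n)" using mp_zero[of n] a.Icarr unfolding subset_iff add_mp_iff by (metis r_zero)
  show "mp n \<subseteq> set_add R \<AA> (mp n)" using a.zero_closed mp_closed[of n] unfolding subset_iff add_mp_iff by (metis l_zero)
qed

lemma up_rideal: assumes "ideal \<AA> R" shows "rideal (up \<AA>)"
proof -
  have "rideal {f. E n f \<in> set_add R \<AA> (mp n)}" for n by (rule rhom_vimage_rideal[OF E(1) add_mp_ideal[OF assms]])
  then show ?thesis unfolding up_def smod_def by auto
qed

lemma up_mono: assumes "\<AA> \<subseteq> \<BB>" shows "up \<AA> \<subseteq> up \<BB>"
  using assms unfolding up_def subset_iff mem_Collect_eq add_mp_iff by blast

lemma up_iff: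
  assumes a: "ideal \<AA> R" and N: "mp N \<subseteq> \<AA>" shows "f \<in> up \<AA> \<longleftrightarrow> E N f \<in> \<AA>"
proof
  interpret a: ideal \<AA> R by (rule a)
  have "set_add R \<AA> (mp N) \<subseteq> \<AA>" unfolding subset_iff add_mp_iff using a.a_closed N by auto
  then show "f \<in> up \<AA> \<Longrightarrow> E N f \<in> \<AA>" unfolding up_def by blast
  assume f: "E N f \<in> \<AA>"
  show "f \<in> up \<AA>" unfolding up_def
  proof (intro CollectI allI)
    fix n
    have i: "ideal (set_add R \<AA> (mp n)) R" by (rule add_mp_ideal[OF a])
    have "E (max N n) f \<in> set_add R \<AA> (mp n)"
      using E_mem_iff[OF _ a N, of "max N n" f] f add_mp_upper(1)[OF a, of n] by auto
    then show "E n f \<in> set_add R \<AA> (mp n)" using E_mem_iff[OF _ i add_mp_upper(2)[OF a], of "max N n" f] by simp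
  qed
qed

lemma cl_up: assumes a: "ideal \<AA> R" shows "cl (up \<AA>) = up \<AA>"
proof
  show "cl (up \<AA>) \<subseteq> up \<AA>"
  proof
    fix f assume f: "f \<in> cl (up \<AA>)"
    show "f \<in> up \<AA>" unfolding up_def
    proof (intro CollectI allI)
      fix n
      interpret i: ideal "set_add R \<AA> (mp n)" R by (rule add_mp_ideal[OF a])
      have "f \<in> up \<AA> + M n" using f unfolding cl_def by blast
      then obtain u m where um: "f = u + m" "u \<in> up \<AA>" "m \<in> M n" by (rule set_plus_elim)
      have "E n u \<in> set_add R \<AA> (mp n)" using um(2) unfolding up_def by blast
      moreover have "E n m \<in> set_add R \<AA> (mp n)" using um(3) add_mp_upper(2)[OF a] unfolding M_def by blast
      ultimately show "E n f \<in> set_add R \<AA> (mp n)" unfolding um(1) rhom_add[OF E(1)] by (rule i.a_closed)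
    qed
  qed
qed (rule cl_base)

lemma io_up: "ideal \<AA> R \<Longrightarrow> r \<in> \<AA> \<Longrightarrow> io r \<in> up \<AA>"
  unfolding up_def using sec_io[OF sec_E ideal.Icarr] subsetD[OF add_mp_upper(1)] by auto

lemma up_gens:
  assumes gs: "set gs \<subseteq> carrier R" shows "up (Idl (set gs)) \<subseteq> cmb UNIV (M k) (map io gs)"
proof
  fix f assume "f \<in> up (Idl (set gs))"
  then obtain a b where ab: "a \<in> Idl (set gs)" "b \<in> mp k" "E k f = a \<oplus> b" unfolding up_def mem_Collect_eq add_mp_iff by blast
  have ac: "a \<in> carrier R" "b \<in> carrier R" using ideal.Icarr[OF genideal_ideal[OF gs] ab(1)] ab(2) mp_closed by auto
  have r: "rideal (cmb UNIV (M k) (map io gs))" by (rule cmb_rideal[OF M_ideal])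
  have "E k (f - io b) = a" using ac ab(3) sec_io[OF sec_E ac(2), of k] by (simp add: rhom_diff[OF E(1)] a_minus_def a_assoc r_neg)
  then have "rep (map io gs) (E k (f - io b))" using rep_genideal[OF gs ab(1)] by simp
  then have 1: "f - io b \<in> cmb UNIV (M k) (map io gs)" by (rule rep_mem)
  have "io b \<in> cmb UNIV (M k) (map io gs)" using io_M[OF ab(2)] cmb_base[of UNIV "M k"] by auto
  from smod_add[OF r 1 this] show "f \<in> cmb UNIV (M k) (map io gs)" by simp
qed

lemma up_M1: assumes "ideal \<AA> R" "\<AA> \<subseteq> mx" shows "up \<AA> \<subseteq> M 1"
proof
  fix f assume "f \<in> up \<AA>"
  then have "E 1 f \<in> set_add R \<AA> (mp 1)" unfolding up_def by blast
  then have "E 1 f \<in> mp 1"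
    using assms(2) additive_subgroup.a_closed[OF ideal.axioms(1)[OF mp_ideal[of 1]]] mp_1 unfolding add_mp_iff by auto
  then show "f \<in> M 1" unfolding M_def by blast
qed

lemma NN_up: "ideal \<AA> R \<Longrightarrow> NN \<subseteq> up \<AA>"
  unfolding NN_def up_def M_def using add_mp_upper(2) by blast

lemma sopI: assumes "set xs \<subseteq> M 1" "M n \<subseteq> cmb UNIV NN xs" shows "sop xs NN"
proof -
  have "M n \<subseteq> cmb UNIV NN xs + M k" for k
    using assms(2) set_plus_upper1[OF smod_0[OF M_ideal], of "cmb UNIV NN xs" k] by blast
  then show ?thesis unfolding sop_def using assms(1) by blast
qed

lemma ex_minl: assumes J: "rideal J" "NN \<subseteq> J" shows "\<exists>xs. minl xs J"
proof -
  obtain zs where zs: "set zs \<subseteq> M 1" "M 1 \<subseteq> cmb UNIV (M (Suc 1)) zs" using M_fin by (auto simp: numeral_2_eq_2)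
  have "sop zs NN" by (rule sopI[OF zs(1) complete_Nakayama[OF zs(2)]])
  then have s: "\<exists>n ys. sop ys J \<and> length ys = n" using sop_mono[OF _ J(2)] by blast
  define n where "n = (LEAST n. \<exists>ys. sop ys J \<and> length ys = n)"
  obtain xs where "sop xs J" "length xs = n" using LeastI_ex[OF s] unfolding n_def by blast
  moreover have "n \<le> length ys" if "sop ys J" for ys unfolding n_def by (rule Least_le) (use that in blast)
  ultimately show ?thesis unfolding minl_def by blast
qed

text \<open>An element \<open>z\<close> of \<open>Q\<close> outside \<open>P\<close> remains a
  nonzerodivisor modulo the extension of \<open>P\<close>. This is usually a consequence of
  flatness; here the weak Artin-Rees lemma in \<open>R\<close> lets \<open>z\<close> be cancelled
  level by level.\<close>

lemma chain_step:
  assumes P: "primeideal P R" and Q: "primeideal Q R" and PQ: "P \<subset> Q" and minl: "minl xs (up P)"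
  shows "\<exists>ys. length ys < length xs \<and> sop ys (up Q)"
proof -
  have Pi: "ideal P R" and Qi: "ideal Q R" using P Q primeideal.axioms(1) by auto
  have Qmx: "Q \<subseteq> mx" using proper_ideal_mx[OF Qi] primeideal.I_notcarr[OF Q] by blast
  obtain z where z: "z \<in> Q" "z \<notin> P" using PQ by blast
  have zc: "z \<in> carrier R" using ideal.Icarr[OF Qi z(1)] .
  obtain gs where gs: "set gs \<subseteq> carrier R" "P = Idl (set gs)" using noeth_gens[OF Pi] by blast
  show ?thesis
  proof (rule parameters_drop[OF up_rideal[OF Pi] cl_up[OF Pi] up_rideal[OF Qi] up_mono up_M1[OF Qi Qmx] cl_up[OF Qi]
        io_up[OF Qi z(1)] _ _ _ minl])
    show "P \<subseteq> Q" using PQ by blast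
    show "up P \<subseteq> cmb UNIV (M k) (map io gs)" for k unfolding gs(2) by (rule up_gens[OF gs(1)])
    show "set (map io gs) \<subseteq> up P" using io_up[OF Pi] genideal_self[OF gs(1)] gs(2) by auto
    show "t \<in> up P" if t: "io z * t \<in> up P" for t
      unfolding up_def
    proof (intro CollectI allI)
      fix k
      have "io z \<notin> pull P" using z(2) ev_io[OF zc] unfolding pull_def by simp
      then obtain N where N: "\<And>r. io z * r \<in> pull P + Rl.Mp N \<Longrightarrow> r \<in> pull P + Rl.Mp k"
        using Rl.weak_Artin_Rees[OF tprime_pull[OF P]] by blast
      \<comment> \<open>Level \<open>N\<close> allows \<open>z\<close> to be cancelled, and level
        \<open>k\<close> is where the conclusion is wanted.\<close>
      define n where "n = max N k"
      have "E n (io z * t) \<in> set_add R P (mp n)" using t unfolding up_def by blast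
      then obtain a b where ab: "a \<in> P" "b \<in> mp n" "z \<otimes> E n t = a \<oplus> b"
        unfolding add_mp_iff rhom_mult[OF E(1)] sec_io[OF sec_E zc] by blast
      have C: "a \<in> carrier R" "b \<in> carrier R" using ideal.Icarr[OF Pi ab(1)] subsetD[OF mp_closed ab(2)] by auto
      have bN: "b \<in> mp N" using ab(2) mp_mono[of N n] unfolding n_def by auto
      have Tc: "E n t \<in> carrier R" by (rule E_closed)
      let ?r = "io (E n t)"
      have "ev (io z * ?r - io b) = a"
        using C Tc ab(3) by (simp add: rhom_diff[OF ev(1)] rhom_mult[OF ev(1)] ev_io zc a_minus_def a_assoc r_neg)
      then have "io z * ?r - io b \<in> pull P" unfolding pull_def using ab(1) by simp
      moreover have "io b \<in> Rl.Mp N" unfolding Mp_pull using bN ev_io[OF C(2)] by (simp add: pull_def)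
      ultimately have "(io z * ?r - io b) + io b \<in> pull P + Rl.Mp N" by (rule set_plus_intro)
      then have "?r \<in> pull P + Rl.Mp k" using N by simp
      then obtain u m where um: "?r = u + m" "u \<in> pull P" "m \<in> Rl.Mp k" by (rule set_plus_elim)
      have "E n t = ev u \<oplus> ev m" using arg_cong[OF um(1), of ev] ev_io[OF Tc] by (simp add: rhom_add[OF ev(1)])
      then have "E n t \<in> set_add R P (mp k)" unfolding add_mp_iff using um(2,3) unfolding Mp_pull by (auto simp: pull_def)
      then show "E k t \<in> set_add R P (mp k)"
        using E_mem_iff[OF _ add_mp_ideal[OF Pi] add_mp_upper(2)[OF Pi], of k n t] unfolding n_def by simp
    qed
  qed
qed

text \<open>Minimal parameters modulo the extended primes become strictly shorter along the
  chain.\<close>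

lemma prime_chain_bound:
  assumes C: "prime_chain R n C" and minl: "minl xs NN" shows "n \<le> length xs"
proof -
  have P: "primeideal (C i) R" if "i \<le> n" for i using C that unfolding prime_chain_def by blast
  have Pi: "ideal (C i) R" if "i \<le> n" for i using P[OF that] primeideal.axioms(1) by blast
  have "i \<le> n \<Longrightarrow> \<exists>ys. length ys + i \<le> length xs \<and> minl ys (up (C i))" for i
  proof (induction i)
    case 0
    obtain ys where ys: "minl ys (up (C 0))" using ex_minl[OF up_rideal NN_up] Pi[OF 0] by blast
    have "sop xs (up (C 0))" using sop_mono[OF _ NN_up[OF Pi[OF 0]]] minl unfolding minl_def by blast
    then have "length ys \<le> length xs" using ys unfolding minl_def by blast
    then show ?case using ys by auto
  next
    case (Suc i)
    then obtain ys where ys: "length ys + i \<le> length xs" "minl ys (up (C i))" by auto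
    have "C i \<subset> C (Suc i)" using C Suc.prems unfolding prime_chain_def by auto
    then obtain zs where zs: "length zs < length ys" "sop zs (up (C (Suc i)))"
      using chain_step[OF P P _ ys(2)] Suc.prems by (metis Suc_leD)
    obtain ws where ws: "minl ws (up (C (Suc i)))" using ex_minl[OF up_rideal NN_up] Pi[OF Suc.prems] by blast
    have "length ws \<le> length zs" using ws zs(2) unfolding minl_def by blast
    then show ?case using ws ys zs by (intro exI[of _ ws]) auto
  qed
  then show ?thesis by (metis add_leD2 order.refl)
qed

lemma tchain_image: assumes "Rl.tchain n C" shows "prime_chain R n (\<lambda>i. ev ` C i)"
  unfolding prime_chain_def
proof (intro conjI allI impI)
  show "primeideal (ev ` C i) R" if "i \<le> n" for i using assms that tprime_image unfolding Rl.tchain_def by blast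
  show "ev ` C i \<subset> ev ` C (Suc i)" if i: "i < n" for i
  proof -
    have "Rl.tprime (C i)" "Rl.tprime (C (Suc i))" and sub: "C i \<subset> C (Suc i)" using assms i unfolding Rl.tchain_def by auto
    then have "pull (ev ` C i) = C i" "pull (ev ` C (Suc i)) = C (Suc i)" using pull_image unfolding Rl.tprime_def by auto
    then show ?thesis using sub by (metis image_mono psubset_eq)
  qed
qed

lemma sop_of_R:
  assumes ys: "set ys \<subseteq> pull mx" and k: "Rl.Mp k \<subseteq> cmb UNIV ker ys"
  shows "M k \<subseteq> cmb UNIV NN (map (io \<circ> ev) ys)"
proof (rule complete_Nakayama)
  have c: "set (map ev ys) \<subseteq> carrier R" using ev_closed by auto
  let ?G = "Idl (set (map ev ys))"
  have G: "ideal ?G R" by (rule genideal_ideal[OF c])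
  have "cmb UNIV ker ys \<subseteq> pull ?G"
    by (rule cmb_least[OF pull_rideal[OF G] ker_pull[OF G]]) (use genideal_self[OF c] in \<open>auto simp: pull_def\<close>)
  then have "pull (mp k) \<subseteq> pull ?G" using k unfolding Mp_pull by blast
  then have mG: "mp k \<subseteq> ?G" using image_pull[OF mp_closed[of k]] image_pull[of ?G] ideal.Icarr[OF G] by blast
  show "M k \<subseteq> cmb UNIV (M (Suc k)) (map (io \<circ> ev) ys)"
  proof
    fix t assume "t \<in> M k"
    then have "E (Suc k) t \<in> ?G" using M_iff[of k "Suc k" t] mG by auto
    from rep_mem[OF rep_genideal[OF c this]] show "t \<in> cmb UNIV (M (Suc k)) (map (io \<circ> ev) ys)" by simp
  qed
qed

lemma sop_of_R_M1: "set ys \<subseteq> pull mx \<Longrightarrow> set (map (io \<circ> ev) ys) \<subseteq> M 1"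
  using io_M[of _ 1] mp_1 unfolding pull_def by auto

text \<open>Parameters of the completion bound the chains of primes in \<open>R\<close>. Conversely
  \<open>R\<close> has at most as many parameters as the length of a longest chain, and these are
  parameters of the completion, so minimality of \<open>xs\<close> gives equality.\<close>

lemma krull_dim_eq:
  assumes minl: "minl xs NN"
  shows "krull_dim R = enat (length xs)"
proof -
  define S where "S = {n. \<exists>C. prime_chain R n C}"
  have "primeideal mx R" using maximalideal_prime[OF mx] .
  then have "prime_chain R 0 (\<lambda>_. mx)" unfolding prime_chain_def by simp
  then have S0: "0 \<in> S" unfolding S_def by blast
  have Sb: "n \<le> length xs" if "n \<in> S" for n using prime_chain_bound[OF _ minl] that unfolding S_def by blast
  then have fin: "finite S" by (meson finite_atMost finite_subset atMost_iff subsetI)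
  define d where "d = Max S"
  have d: "d \<in> S" unfolding d_def by (rule Max_in[OF fin]) (use S0 in auto)
  have "n \<le> d" if "Rl.tchain n C" for n C
    unfolding d_def by (rule Max_ge[OF fin]) (use tchain_image[OF that] in \<open>auto simp: S_def\<close>)
  then obtain ys k where ys: "length ys \<le> d" "set ys \<subseteq> pull mx" "Rl.Mp k \<subseteq> cmb UNIV ker ys"
    using Rl.parameters_exist[OF ker_rideal order.refl] by blast
  have "sop (map (io \<circ> ev) ys) NN" by (rule sopI[OF sop_of_R_M1[OF ys(2)] sop_of_R[OF ys(2,3)]])
  then have "length xs \<le> length (map (io \<circ> ev) ys)" using minl unfolding minl_def by blast
  then have "d = length xs" using ys(1) Sb[OF d] by simp
  then have 1: "length xs \<in> S" using d by simp
  show ?thesis unfolding krull_dim_def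
  proof (rule antisym)
    show "Sup {enat n |n. \<exists>C. prime_chain R n C} \<le> enat (length xs)"
      by (rule Sup_least) (use prime_chain_bound[OF _ minl] in auto)
    show "enat (length xs) \<le> Sup {enat n |n. \<exists>C. prime_chain R n C}"
      by (rule Sup_upper) (use 1 in \<open>auto simp: S_def\<close>)
  qed
qed

end

section \<open>Length as codimension over the coefficient field\<close>

context cring
begin

lemma submodule_preimage:
  assumes I: "ideal I R" and N: "submodule N R (quotient_module R I)"
  shows "ideal {r \<in> carrier R. I +> r \<in> N} R" "I \<subseteq> {r \<in> carrier R. I +> r \<in> N}"
    "N = (+>) I ` {r \<in> carrier R. I +> r \<in> N}"
proof -
  interpret I: ideal I R by (rule I)
  interpret N: submodule N R "quotient_module R I" by (rule N)
  have add: "(I +> r) <+>\<^bsub>R\<^esub> (I +> s) \<in> N" if "I +> r \<in> N" "I +> s \<in> N" for r s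
    using N.m_closed[OF that] by (simp add: quotient_module_def FactRing_def)
  have zero: "I \<in> N" using N.one_closed by (simp add: quotient_module_def FactRing_def)
  show "ideal {r \<in> carrier R. I +> r \<in> N} R"
  proof (rule ideal_intro)
    show "\<zero> \<in> {r \<in> carrier R. I +> r \<in> N}" using zero I.a_rcos_const[OF I.zero_closed] by simp
    show "a \<oplus> b \<in> {r \<in> carrier R. I +> r \<in> N}"
      if "a \<in> {r \<in> carrier R. I +> r \<in> N}" "b \<in> {r \<in> carrier R. I +> r \<in> N}" for a b
      using that add[of a b] by (simp add: I.a_rcos_sum)
    show "r \<otimes> a \<in> {r \<in> carrier R. I +> r \<in> N}" if "r \<in> carrier R" "a \<in> {r \<in> carrier R. I +> r \<in> N}" for r a
      using that N.smult_closed[of r "I +> a"] by (simp add: quotient_module_def FactRing_def I.rcoset_mult_add)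
  qed auto
  show "I \<subseteq> {r \<in> carrier R. I +> r \<in> N}" using zero I.a_rcos_const I.Icarr by auto
  have "x \<in> (+>) I ` {r \<in> carrier R. I +> r \<in> N}" if "x \<in> N" for x
  proof -
    have "x \<in> a_rcosets I" using N.subset that by (auto simp: quotient_module_def FactRing_def)
    then obtain r where "r \<in> carrier R" "x = I +> r" unfolding A_RCOSETS_def' by blast
    then show ?thesis using that by blast
  qed
  then show "N = (+>) I ` {r \<in> carrier R. I +> r \<in> N}" by auto
qed

lemma submodule_image:
  assumes I: "ideal I R" and B: "ideal B R"
  shows "submodule ((+>) I ` B) R (quotient_module R I)"
proof -
  interpret I: ideal I R by (rule I)
  interpret B: ideal B R by (rule B)
  interpret q: ring_hom_ring R "R Quot I" "(+>) I" by (rule I.rcos_ring_hom_ring)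
  have g: "group (add_monoid (R Quot I))" by (rule q.S.add.group_axioms)
  have s: "subgroup ((+>) I ` B) (add_monoid (R Quot I))"
  proof (rule group.subgroupI[OF g])
    show "(+>) I ` B \<subseteq> carrier (add_monoid (R Quot I))" using B.Icarr by auto
    show "(+>) I ` B \<noteq> {}" using B.zero_closed by blast
    show "inv\<^bsub>add_monoid (R Quot I)\<^esub> a \<in> (+>) I ` B" if "a \<in> (+>) I ` B" for a
    proof -
      from that obtain b where b: "b \<in> B" "a = I +> b" by blast
      have "inv\<^bsub>add_monoid (R Quot I)\<^esub> a = I +> (\<ominus> b)"
        using q.hom_a_inv[OF B.Icarr[OF b(1)]] unfolding b(2) a_inv_def by simp
      then show ?thesis using B.a_inv_closed[OF b(1)] by blast
    qed
    show "a \<otimes>\<^bsub>add_monoid (R Quot I)\<^esub> b \<in> (+>) I ` B" if "a \<in> (+>) I ` B" "b \<in> (+>) I ` B" for a b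
    proof -
      from that obtain a' b' where ab: "a' \<in> B" "a = I +> a'" "b' \<in> B" "b = I +> b'" by blast
      then have "a \<otimes>\<^bsub>add_monoid (R Quot I)\<^esub> b = I +> (a' \<oplus> b')" using q.hom_add B.Icarr by simp
      then show ?thesis using B.a_closed[OF ab(1,3)] by blast
    qed
  qed
  show ?thesis
  proof (rule submodule.intro)
    show "subgroup ((+>) I ` B) (add_monoid (quotient_module R I))" using s unfolding subgroup_def m_inv_def by (simp add: quotient_module_def)
    show "submodule_axioms ((+>) I ` B) R (quotient_module R I)"
    proof
      fix a x assume a: "a \<in> carrier R" and "x \<in> (+>) I ` B"
      then obtain b where b: "b \<in> B" "x = I +> b" by blast
      have "a \<odot>\<^bsub>quotient_module R I\<^esub> x = I +> (a \<otimes> b)"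
        using q.hom_mult[OF a B.Icarr[OF b(1)]] by (simp add: quotient_module_def b(2))
      then show "a \<odot>\<^bsub>quotient_module R I\<^esub> x \<in> (+>) I ` B" using B.I_l_closed[OF b(1) a] by blast
    qed
  qed
qed

lemma coset_mem:
  assumes I: "ideal I R" and B: "ideal B R" "I \<subseteq> B" and r: "r \<in> carrier R" "I +> r \<in> (+>) I ` B"
  shows "r \<in> B"
proof -
  interpret I: ideal I R by (rule I)
  interpret B: ideal B R by (rule B)
  from r(2) obtain s where s: "s \<in> B" "I +> r = I +> s" by blast
  have "r \<in> I +> s" using I.a_rcos_self[OF r(1)] s(2) by simp
  then obtain h where "h \<in> I" "r = h \<oplus> s" unfolding a_r_coset_def' by blast
  then show ?thesis using B.a_closed s(1) B(2) by blast
qed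

text \<open>The correspondence between submodules of the quotient and ideals above \<open>I\<close>
  preserves strict inclusions, so chains of ideals compute the length.\<close>

lemma module_length_quotient:
  assumes I: "ideal I R"
  shows "module_length R (quotient_module R I) =
    Sup {enat n |n. \<exists>B. (\<forall>i\<le>n. ideal (B i) R \<and> I \<subseteq> B i) \<and> (\<forall>i<n. B i \<subset> B (Suc i))}"
proof -
  have "(\<exists>N. (\<forall>i\<le>n. submodule (N i) R (quotient_module R I)) \<and> (\<forall>i<n. N i \<subset> N (Suc i))) \<longleftrightarrow>
      (\<exists>B. (\<forall>i\<le>n. ideal (B i) R \<and> I \<subseteq> B i) \<and> (\<forall>i<n. B i \<subset> B (Suc i)))" for n
  proof
    assume "\<exists>N. (\<forall>i\<le>n. submodule (N i) R (quotient_module R I)) \<and> (\<forall>i<n. N i \<subset> N (Suc i))"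
    then obtain N where N: "\<And>i. i \<le> n \<Longrightarrow> submodule (N i) R (quotient_module R I)" "\<And>i. i < n \<Longrightarrow> N i \<subset> N (Suc i)" by blast
    define B where "B = (\<lambda>i. {r \<in> carrier R. I +> r \<in> N i})"
    have im: "N i = (+>) I ` B i" if "i \<le> n" for i unfolding B_def by (rule submodule_preimage(3)[OF I N(1)[OF that]])
    have "B i \<subset> B (Suc i)" if "i < n" for i
    proof
      show "B i \<subseteq> B (Suc i)" using N(2)[OF that] unfolding B_def by blast
      show "B i \<noteq> B (Suc i)" using im[of i] im[of "Suc i"] N(2)[OF that] that by auto
    qed
    then show "\<exists>B. (\<forall>i\<le>n. ideal (B i) R \<and> I \<subseteq> B i) \<and> (\<forall>i<n. B i \<subset> B (Suc i))"
      using submodule_preimage(1,2)[OF I N(1)] unfolding B_def by (intro exI[of _ B]) (auto simp: B_def)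
  next
    assume "\<exists>B. (\<forall>i\<le>n. ideal (B i) R \<and> I \<subseteq> B i) \<and> (\<forall>i<n. B i \<subset> B (Suc i))"
    then obtain B where B: "\<And>i. i \<le> n \<Longrightarrow> ideal (B i) R" "\<And>i. i \<le> n \<Longrightarrow> I \<subseteq> B i" "\<And>i. i < n \<Longrightarrow> B i \<subset> B (Suc i)" by blast
    have "(+>) I ` B i \<subset> (+>) I ` B (Suc i)" if i: "i < n" for i
    proof
      show "(+>) I ` B i \<subseteq> (+>) I ` B (Suc i)" using B(3)[OF i] by blast
      obtain r where r: "r \<in> B (Suc i)" "r \<notin> B i" using B(3)[OF i] by blast
      have "r \<in> carrier R" using ideal.Icarr[OF B(1) r(1)] i by simp
      then have "I +> r \<notin> (+>) I ` B i" using coset_mem[OF I B(1,2)] r(2) i by (meson less_imp_le)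
      then show "(+>) I ` B i \<noteq> (+>) I ` B (Suc i)" using r(1) by blast
    qed
    then show "\<exists>N. (\<forall>i\<le>n. submodule (N i) R (quotient_module R I)) \<and> (\<forall>i<n. N i \<subset> N (Suc i))"
      using submodule_image[OF I B(1)] by (intro exI[of _ "\<lambda>i. (+>) I ` B i"]) auto
  qed
  then show ?thesis unfolding module_length_def by simp
qed

end

context nlr
begin

lemma finite_up:
  assumes I: "ideal I R" and N: "mp N \<subseteq> I" shows "\<exists>n. dimle KK UNIV (up I) n"
proof -
  obtain us where us: "UNIV = cmb KK (M N) us" using finite_K by blast
  have "M N \<subseteq> up I" using up_iff[OF I N] N unfolding M_def by blast
  then have "UNIV \<subseteq> cmb KK (up I) us" using us cmb_mono[OF order.refl, of "M N" "up I" KK us] by simp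
  then show ?thesis unfolding dimle_def by blast
qed

lemma up_strict:
  assumes A: "ideal A R" "mp N \<subseteq> A" and B: "ideal B R" "A \<subset> B"
  shows "cod KK UNIV (up A) = cod KK UNIV (up B) + cod KK (up B) (up A)" "0 < cod KK (up B) (up A)"
proof -
  obtain n where n: "dimle KK UNIV (up A) n" using finite_up[OF A] by blast
  have sub: "up A \<subseteq> up B" using up_mono B(2) by blast
  have s: "smod KK (up A)" "smod KK (up B)" using rideal_smod up_rideal A B by auto
  show "cod KK UNIV (up A) = cod KK UNIV (up B) + cod KK (up B) (up A)"
    by (rule cod_add[OF K s smod_UNIV NN_up[OF A(1)] sub subset_UNIV n])
  show "0 < cod KK (up B) (up A)"
  proof (rule ccontr)
    assume "\<not> 0 < cod KK (up B) (up A)"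
    then have "up B \<subseteq> up A" using dimle_cod[OF dimle_subset[OF n subset_UNIV order.refl], of "up B"] by (simp add: dimle_0)
    moreover obtain r where r: "r \<in> B" "r \<notin> A" using B(2) by blast
    moreover have "E N (io r) = r" by (rule sec_io[OF sec_E ideal.Icarr[OF B(1) r(1)]])
    ultimately show False using io_up[OF B(1) r(1)] up_iff[OF A, of "io r"] by auto
  qed
qed

text \<open>An element \<open>r\<close> outside \<open>A\<close> of the last power of the maximal
  ideal not contained in \<open>A\<close> is killed by that ideal modulo \<open>A\<close>.
  Coefficients of \<open>r\<close> thus matter only up to their residue class, which
  \<open>KK\<close> represents, so adjoining \<open>r\<close> costs one dimension.\<close>

lemma ex_simple_extension:
  assumes A: "ideal A R" "mp N \<subseteq> A" "A \<noteq> carrier R"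
  shows "\<exists>B. ideal B R \<and> A \<subset> B \<and> cod KK UNIV (up A) = Suc (cod KK UNIV (up B))"
proof -
  interpret A: ideal A R by (rule A)
  define n where "n = (LEAST n. mp n \<subseteq> A)"
  have n: "mp n \<subseteq> A" unfolding n_def by (rule LeastI[of _ N]) (rule A(2))
  have "n \<noteq> 0" using n mp_0 A(3) A.a_subset by (metis subset_antisym)
  then obtain l where l: "n = Suc l" by (cases n) auto
  have "\<not> mp l \<subseteq> A" using not_less_Least[of l "\<lambda>n. mp n \<subseteq> A"] l unfolding n_def by auto
  then obtain r where r: "r \<in> mp l" "r \<notin> A" by blast
  have rc: "r \<in> carrier R" using r(1) mp_closed by blast
  have mr: "m \<otimes> r \<in> A" if "m \<in> mx" for m
    using ideal_prod.prod[OF that r(1), of R] mp_add[of 1 l] mp_1 n l by auto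
  define B where "B = {s \<otimes> r \<oplus> b |s b. s \<in> carrier R \<and> b \<in> A}"
  have B: "ideal B R"
  proof (rule ideal_intro)
    show "B \<subseteq> carrier R" using rc A.Icarr unfolding B_def by auto
    show "\<zero> \<in> B" unfolding B_def using A.zero_closed rc by (intro CollectI exI[of _ \<zero>]) simp
  next
    fix x y assume "x \<in> B" "y \<in> B"
    then obtain s b s' b' where *: "s \<in> carrier R" "b \<in> A" "s' \<in> carrier R" "b' \<in> A" "x = s \<otimes> r \<oplus> b" "y = s' \<otimes> r \<oplus> b'" unfolding B_def by blast
    have "x \<oplus> y = (s \<oplus> s') \<otimes> r \<oplus> (b \<oplus> b')" unfolding *(5,6) using * rc A.Icarr[OF *(2)] A.Icarr[OF *(4)] by algebra
    then show "x \<oplus> y \<in> B" unfolding B_def using * A.a_closed by blast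
  next
    fix t x assume t: "t \<in> carrier R" and "x \<in> B"
    then obtain s b where *: "s \<in> carrier R" "b \<in> A" "x = s \<otimes> r \<oplus> b" unfolding B_def by blast
    have "t \<otimes> x = (t \<otimes> s) \<otimes> r \<oplus> t \<otimes> b" unfolding *(3) using * rc t A.Icarr[OF *(2)] by algebra
    then show "t \<otimes> x \<in> B" unfolding B_def using * t A.I_l_closed by blast
  qed
  have "r = \<one> \<otimes> r \<oplus> \<zero>" using rc by simp
  then have rB: "r \<in> B" unfolding B_def using A.zero_closed by blast
  have AB: "A \<subset> B"
  proof
    have "b = \<zero> \<otimes> r \<oplus> b" if "b \<in> A" for b using rc A.Icarr[OF that] by simp
    then show "A \<subseteq> B" unfolding B_def by blast
    show "A \<noteq> B" using rB r(2) by blast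
  qed
  have "up B \<subseteq> cmb KK (up A) [io r]"
  proof
    fix f assume f: "f \<in> up B"
    have NA: "mp (Suc N) \<subseteq> A" and NB: "mp (Suc N) \<subseteq> B" using mp_dec[of N] A(2) AB by auto
    obtain s b where sb: "s \<in> carrier R" "b \<in> A" "E (Suc N) f = s \<otimes> r \<oplus> b"
      using f up_iff[OF B NB] unfolding B_def by blast
    obtain k where k: "k \<in> KK" "io s - k \<in> M 1" using Ksur by blast
    have "E (Suc N) (io s - k) \<in> mx" using k(2) M_iff[of 1 "Suc N"] mp_1 by simp
    then have m: "s \<ominus> E (Suc N) k \<in> mx" by (simp add: rhom_diff[OF E(1)] sec_io[OF sec_E sb(1)])
    have "E (Suc N) (f - k * io r) = (s \<ominus> E (Suc N) k) \<otimes> r \<oplus> b"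
      unfolding rhom_diff[OF E(1)] rhom_mult[OF E(1)] sec_io[OF sec_E rc] sb(3)
      using sb(1) rc A.Icarr[OF sb(2)] E_closed[of "Suc N" k] by algebra
    then have "E (Suc N) (f - k * io r) \<in> A" using A.a_closed[OF mr[OF m] sb(2)] by simp
    then have "f - k * io r \<in> up A" using up_iff[OF A(1) NA] by simp
    then have "k * io r + (f - k * io r) \<in> cmb KK (up A) [io r]" by (rule cmb_singleton_mem[OF k(1)])
    then show "f \<in> cmb KK (up A) [io r]" by simp
  qed
  then have "dimle KK (up B) (up A) 1" unfolding dimle_def by (intro exI[of _ "[io r]"]) simp
  from cod_le[OF this] up_strict[OF A(1,2) B AB] show ?thesis using B AB by (intro exI[of _ B]) auto
qed

text \<open>Strict inclusions of ideals stay strict after extension, which bounds the chains;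
  repeated simple extensions give a chain of full length.\<close>

theorem length_eq_cod:
  assumes I: "ideal I R" and N: "mp N \<subseteq> I"
  shows "module_length R (quotient_module R I) = enat (cod KK UNIV (up I))"
proof -
  have le: "n \<le> cod KK UNIV (up I)"
    if B: "\<And>i. i \<le> n \<Longrightarrow> ideal (B i) R \<and> I \<subseteq> B i" "\<And>i. i < n \<Longrightarrow> B i \<subset> B (Suc i)" for n B
  proof -
    have "i \<le> n \<Longrightarrow> cod KK UNIV (up (B i)) + i \<le> cod KK UNIV (up I)" for i
    proof (induction i)
      case 0
      obtain m where "dimle KK UNIV (up I) m" using finite_up[OF I N] by blast
      then have "dimle KK UNIV (up (B 0)) (cod KK UNIV (up I))"
        using dimle_subset[OF dimle_cod order.refl up_mono] B(1)[OF 0] by blast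
      then show ?case using cod_le by simp
    next
      case (Suc i)
      have i: "ideal (B i) R" "mp N \<subseteq> B i" "ideal (B (Suc i)) R" "B i \<subset> B (Suc i)"
        using Suc.prems B(1)[of i] B(1)[of "Suc i"] B(2)[of i] N by auto
      show ?case using up_strict[OF i] Suc by simp
    qed
    from this[of n] show ?thesis by simp
  qed
  have ex: "\<exists>C. (\<forall>i\<le>n. ideal (C i) R \<and> B \<subseteq> C i) \<and> (\<forall>i<n. C i \<subset> C (Suc i))"
    if "ideal B R" "mp N \<subseteq> B" "cod KK UNIV (up B) = n" for n B
    using that
  proof (induction n arbitrary: B)
    case 0
    then show ?case by (intro exI[of _ "\<lambda>_. B"]) auto
  next
    case (Suc n)
    have "B \<noteq> carrier R"
    proof
      assume "B = carrier R"
      then have "up B = UNIV" using up_iff[OF Suc.prems(1,2)] E_closed by auto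
      then have "cod KK UNIV (up B) \<le> 0" using cod_le[OF dimle_refl, of UNIV "up B" KK] by simp
      then show False using Suc.prems(3) by simp
    qed
    then obtain B' where B': "ideal B' R" "B \<subset> B'" "cod KK UNIV (up B) = Suc (cod KK UNIV (up B'))"
      using ex_simple_extension[OF Suc.prems(1,2)] by blast
    obtain C where C: "\<And>i. i \<le> n \<Longrightarrow> ideal (C i) R \<and> B' \<subseteq> C i" "\<And>i. i < n \<Longrightarrow> C i \<subset> C (Suc i)"
      using Suc.IH[OF B'(1) order.trans[OF Suc.prems(2) psubset_imp_subset[OF B'(2)]]] B'(3) Suc.prems(3) by auto
    define D where "D = (\<lambda>i. case i of 0 \<Rightarrow> B | Suc j \<Rightarrow> C j)"
    have "ideal (D i) R \<and> B \<subseteq> D i" if "i \<le> Suc n" for i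
      using that C(1) B'(2) Suc.prems(1) unfolding D_def by (cases i) auto
    moreover have "D i \<subset> D (Suc i)" if "i < Suc n" for i
      using that C(1)[of 0] C(2) B'(2) unfolding D_def by (cases i) auto
    ultimately show ?case by (intro exI[of _ D]) auto
  qed
  show ?thesis
    unfolding module_length_quotient[OF I]
  proof (rule antisym)
    show "Sup {enat n |n. \<exists>B. (\<forall>i\<le>n. ideal (B i) R \<and> I \<subseteq> B i) \<and> (\<forall>i<n. B i \<subset> B (Suc i))} \<le> enat (cod KK UNIV (up I))"
    proof (rule Sup_least)
      fix x assume "x \<in> {enat n |n. \<exists>B. (\<forall>i\<le>n. ideal (B i) R \<and> I \<subseteq> B i) \<and> (\<forall>i<n. B i \<subset> B (Suc i))}"
      then obtain n B where nB: "x = enat n" "\<forall>i\<le>n. ideal (B i) R \<and> I \<subseteq> B i" "\<forall>i<n. B i \<subset> B (Suc i)" by blast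
      have "n \<le> cod KK UNIV (up I)" by (rule le[of n B]) (use nB in blast)+
      then show "x \<le> enat (cod KK UNIV (up I))" using nB(1) by simp
    qed
    show "enat (cod KK UNIV (up I)) \<le> Sup {enat n |n. \<exists>B. (\<forall>i\<le>n. ideal (B i) R \<and> I \<subseteq> B i) \<and> (\<forall>i<n. B i \<subset> B (Suc i))}"
      by (rule Sup_upper) (use ex[OF I N refl] in blast)
  qed
qed

end

subsection \<open>The inequality\<close>

lemma dimle_generators:
  assumes K: "sring K" and m: "dimle K UNIV J m" and J: "rideal J" "rideal J'"
    and as: "\<And>a u. a \<in> set as \<Longrightarrow> u \<in> J \<Longrightarrow> a * u \<in> J'"
  shows "dimle K (cmb UNIV J' as) J' (length as * m)"
  using as
proof (induction as)
  case Nil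
  then show ?case by (simp add: dimle_refl)
next
  case (Cons a as)
  have r: "rideal (cmb UNIV J' as)" by (rule cmb_rideal[OF J(2)])
  have "dimle K (cmb UNIV (cmb UNIV J' as) [a]) (cmb UNIV J' as) m"
    by (rule dimle_cyclic[OF K m rideal_smod[OF J(1)] r]) (use Cons.prems cmb_base[of UNIV J' as] in auto)
  from dimle_trans[OF this Cons.IH] show ?case using Cons.prems cmb_append[of UNIV J' "[a]" as] by simp
qed

lemma colon_rideal: "rideal F \<Longrightarrow> rideal {t. c * t \<in> F}"
  unfolding smod_def mem_Collect_eq by (auto simp: distrib_left mult.left_commute[of c])

context clrK
begin

lemma frobseq_product:
  assumes F: "rideal F" "NN \<subseteq> F" and ij: "\<And>i j. i \<in> set ig \<Longrightarrow> j \<in> set jg \<Longrightarrow> (i * j) ^ p ^ e \<in> F"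
    and w: "w \<in> frobseq p NN ig e" and v: "v \<in> frobseq p NN jg e"
  shows "w * v \<in> F"
proof -
  have NF: "c * t \<in> F" if "t \<in> NN" for c t using rideal_multl[OF NN_ideal that] F(2) by blast
  have "frobseq p NN jg e \<subseteq> {t. i ^ p ^ e * t \<in> F}" if "i \<in> set ig" for i
    unfolding frobseq_def
    by (rule cmb_least[OF colon_rideal[OF F(1)]]) (use ij[OF that] NF in \<open>auto simp: power_mult_distrib\<close>)
  then have iv: "v * i ^ p ^ e \<in> F" if "i \<in> set ig" for i
    using subsetD[OF _ v, of "{t. i ^ p ^ e * t \<in> F}"] that by (simp add: mult.commute)
  have "frobseq p NN ig e \<subseteq> {t. v * t \<in> F}"
    unfolding frobseq_def by (rule cmb_least[OF colon_rideal[OF F(1)]]) (use iv NF in auto)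
  then show ?thesis using w by (auto simp: mult.commute)
qed

text \<open>\<open>F\<close> stands for the bracket power of the product and \<open>G\<close> adds
  that of the reduction. The generators of \<open>G\<close> over \<open>F\<close> are killed by the
  bracket power of the first ideal; those of the second bracket power over \<open>G\<close> are
  killed by \<open>c\<close> as well.\<close>

lemma frobseq_mult_inequality:
  assumes F: "rideal F" "NN \<subseteq> F" and ij: "\<And>i j. i \<in> set ig \<Longrightarrow> j \<in> set jg \<Longrightarrow> (i * j) ^ p ^ e \<in> F"
    and h: "set hg \<subseteq> cmb UNIV NN jg" and c: "\<And>j. j \<in> set jg \<Longrightarrow> c * j ^ p ^ e \<in> frobseq p NN hg e"
    and l: "dimle K UNIV (frobseq p NN ig e) l" and l': "dimle K UNIV (frobseq p NN jg e) l'"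
    and m: "dimle K UNIV (cmb UNIV (frobseq p NN ig e) [c]) m"
  shows "dimle K UNIV F (l' + length jg * m + length hg * l)"
proof -
  let ?I = "frobseq p NN ig e" and ?J = "frobseq p NN jg e"
  let ?js = "map (\<lambda>g. g ^ p ^ e) jg" and ?hs = "map (\<lambda>g. g ^ p ^ e) hg"
  have I: "rideal ?I" and J: "rideal ?J" by (rule frobseq_rideal[OF NN_ideal])+
  note prod = frobseq_product[OF F ij]
  define G where "G = cmb UNIV F ?hs"
  have G: "rideal G" unfolding G_def by (rule cmb_rideal[OF F(1)])
  have FG: "F \<subseteq> G" unfolding G_def by (rule cmb_base) simp
  have jsJ: "set ?js \<subseteq> ?J" unfolding frobseq_def by (intro subsetI cmb_mem) (auto simp: smod_0[OF NN_ideal])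
  have hJ: "g ^ p ^ e \<in> ?J" if "g \<in> set hg" for g
    unfolding frobseq_def by (rule frob_cmb[OF NN_ideal p p_NN sring_UNIV]) (use h that in blast)
  have "dimle K (cmb UNIV F ?hs) F (length ?hs * l)"
    by (rule dimle_generators[OF sK l I F(1)]) (use prod hJ in \<open>auto simp: mult.commute\<close>)
  then have 1: "dimle K G F (length hg * l)" unfolding G_def by simp
  have "dimle K (cmb UNIV G ?js) G (length ?js * m)"
  proof (rule dimle_generators[OF sK m cmb_rideal[OF I] G])
    fix a u assume a: "a \<in> set ?js" and u: "u \<in> cmb UNIV ?I [c]"
    obtain k w where kw: "u = k * c + w" "w \<in> ?I" using u by (auto elim!: cmb_ConsE)
    have hG: "frobseq p NN hg e \<subseteq> G" unfolding frobseq_def G_def by (rule cmb_mono[OF order.refl F(2)])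
    have "c * a \<in> G" using a c hG by auto
    then have "k * (c * a) \<in> G" by (rule rideal_multl[OF G])
    moreover have "w * a \<in> G" using prod[OF _ _ kw(2) subsetD[OF jsJ a]] FG by blast
    ultimately have "k * (c * a) + w * a \<in> G" by (rule smod_add[OF G])
    then show "a * u \<in> G" unfolding kw(1) by (simp add: algebra_simps)
  qed
  then have "dimle K (cmb UNIV G ?js) G (length jg * m)" by simp
  then have 2: "dimle K ?J G (length jg * m)"
    by (rule dimle_subset) (use cmb_mono[OF order.refl order.trans[OF F(2) FG], of UNIV ?js] in \<open>auto simp: frobseq_def\<close>)
  show ?thesis using dimle_trans[OF dimle_trans[OF l' 2] 1] by simp
qed

end

section \<open>Bracket powers and their lengths\<close>

context nlr
begin

lemma ideal_contains_mp:
  assumes I: "ideal I R" and rad: "\<And>x. x \<in> mx \<Longrightarrow> \<exists>n::nat. x [^] n \<in> I"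
  shows "\<exists>N. mp N \<subseteq> I"
proof -
  have "\<exists>l. a ^ l \<in> pull I" if "a \<in> pull mx" for a
    using rad[of "ev a"] that unfolding pull_def mem_Collect_eq rhom_power[OF ev(1)] .
  then obtain k where "Rl.Mp k \<subseteq> pull I" using Rl.Mp_subset_of_radical[OF pull_rideal[OF I] ker_pull[OF I]] by blast
  then have "ev ` pull (mp k) \<subseteq> ev ` pull I" unfolding Mp_pull by (rule image_mono)
  moreover have "ev ` pull I = I" by (rule image_pull) (use ideal.Icarr[OF I] in blast)
  ultimately have "mp k \<subseteq> I" unfolding image_pull[OF mp_closed] by simp
  then show ?thesis by (rule exI)
qed

lemma power_mp: "x \<in> mx \<Longrightarrow> x [^] n \<in> mp n"
proof (induction n)
  case (Suc n)
  then have "x [^] n \<otimes> x \<in> mp n \<cdot> mx" by (intro ideal_prod.prod) auto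
  then show ?case unfolding mp_Suc unfolding nat_pow_Suc .
next
  case 0
  show ?case unfolding mp_0 by simp
qed

lemma of_nat_ker: "of_nat p \<in> ker" unfolding ker_def using char_p by (simp add: rhom_of_nat[OF ev(1)])

lemma bracket_ideal: "I \<subseteq> carrier R \<Longrightarrow> ideal (bracket_power R I q) R"
  unfolding bracket_power_def by (rule genideal_ideal) auto

lemma bracket_mem: "I \<subseteq> carrier R \<Longrightarrow> x \<in> I \<Longrightarrow> x [^] q \<in> bracket_power R I q"
  unfolding bracket_power_def by (rule subsetD[OF genideal_self]) auto

text \<open>All elements are raised to the power in the definition; that the generators suffice is
  additivity of Frobenius, applied to a lift in the polynomial ring.\<close>

lemma bracket_gens:
  assumes gs: "set gs \<subseteq> carrier R"
  shows "bracket_power R (Idl (set gs)) (p ^ e) = Idl (set (map (\<lambda>g. g [^] (p ^ e)) gs))"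
proof
  let ?q = "p ^ e" and ?I = "Idl (set gs)" and ?gs = "map (\<lambda>g. g [^] (p ^ e)) gs"
  have Ic: "?I \<subseteq> carrier R" using ideal.Icarr[OF genideal_ideal[OF gs]] by blast
  have c: "set ?gs \<subseteq> carrier R" using gs by auto
  have B: "ideal (Idl (set ?gs)) R" by (rule genideal_ideal[OF c])
  show "Idl (set ?gs) \<subseteq> bracket_power R ?I ?q"
    by (rule genideal_minimal[OF bracket_ideal[OF Ic]]) (use bracket_mem[OF Ic] genideal_self[OF gs] in auto)
  have "x [^] ?q \<in> Idl (set ?gs)" if x: "x \<in> ?I" for x
  proof -
    obtain l where l: "l \<in> cmb UNIV {0} (map io gs)" "ev l = x"
      using rep_genideal[OF gs x] sec_ev unfolding rep_def by blast
    have "l \<in> cmb UNIV ker (map io gs)" using l(1) cmb_mono[OF order.refl, of "{0}" ker UNIV] smod_0[OF ker_rideal] by blast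
    from frob_cmb[OF ker_rideal p of_nat_ker sring_UNIV this]
    have "l ^ ?q \<in> cmb UNIV ker (map (\<lambda>t. t ^ ?q) (map io gs))" .
    moreover have "cmb UNIV ker (map (\<lambda>t. t ^ ?q) (map io gs)) \<subseteq> pull (Idl (set ?gs))"
    proof (rule cmb_least[OF pull_rideal[OF B] ker_pull[OF B]])
      show "set (map (\<lambda>t. t ^ ?q) (map io gs)) \<subseteq> pull (Idl (set ?gs))"
        using genideal_self[OF c] gs unfolding pull_def by (auto simp: rhom_power[OF ev(1)] subset_iff ev_io)
    qed
    ultimately show ?thesis unfolding pull_def using l(2) by (auto simp: rhom_power[OF ev(1)])
  qed
  then show "bracket_power R ?I ?q \<subseteq> Idl (set ?gs)"
    unfolding bracket_power_def by (intro genideal_minimal[OF B]) auto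
qed

lemma bracket_contains_mp:
  assumes I: "ideal I R" "mp N \<subseteq> I" shows "\<exists>N'. mp N' \<subseteq> bracket_power R I q"
proof (rule ideal_contains_mp)
  have Ic: "I \<subseteq> carrier R" using ideal.Icarr[OF I(1)] by blast
  show "ideal (bracket_power R I q) R" by (rule bracket_ideal[OF Ic])
  show "\<exists>n::nat. x [^] n \<in> bracket_power R I q" if x: "x \<in> mx" for x
  proof -
    have "(x [^] N) [^] q \<in> bracket_power R I q" by (rule bracket_mem[OF Ic subsetD[OF I(2) power_mp[OF x]]])
    then show ?thesis using nat_pow_pow[OF ideal.Icarr[OF mx_ideal x]] by auto
  qed
qed

lemma mp_generation:
  assumes gs: "set gs \<subseteq> carrier R" and N: "mp N \<subseteq> Idl (set gs)"
  shows "M N \<subseteq> cmb UNIV NN (map io gs)"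
proof (rule complete_Nakayama)
  show "M N \<subseteq> cmb UNIV (M (Suc N)) (map io gs)"
  proof
    fix t assume "t \<in> M N"
    then have "E (Suc N) t \<in> Idl (set gs)" using M_iff[of N "Suc N"] N by auto
    then show "t \<in> cmb UNIV (M (Suc N)) (map io gs)" by (intro rep_mem rep_genideal[OF gs])
  qed
qed

lemma up_genideal:
  assumes gs: "set gs \<subseteq> carrier R" and N: "mp N \<subseteq> Idl (set gs)"
  shows "up (Idl (set gs)) = cmb UNIV NN (map io gs)"
proof
  have I: "ideal (Idl (set gs)) R" by (rule genideal_ideal[OF gs])
  show "cmb UNIV NN (map io gs) \<subseteq> up (Idl (set gs))"
    by (rule cmb_least[OF up_rideal[OF I] NN_up[OF I]]) (use io_up[OF I] genideal_self[OF gs] in auto)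
  have "cmb UNIV (M N) (map io gs) \<subseteq> cmb UNIV NN (map io gs)"
    by (rule cmb_least[OF cmb_rideal[OF NN_ideal] mp_generation[OF gs N]]) (auto intro!: cmb_mem simp: smod_0[OF NN_ideal])
  then show "up (Idl (set gs)) \<subseteq> cmb UNIV NN (map io gs)" using up_gens[OF gs, of N] by blast
qed

text \<open>Lifting commutes with powers only modulo \<open>NN\<close>, so lifts of powers are
  exchanged for powers of lifts inside the generated ideals.\<close>

lemma map_io_power:
  assumes gs: "set gs \<subseteq> carrier R"
  shows "cmb UNIV NN (map io (map (\<lambda>g. g [^] q) gs)) = cmb UNIV NN (map (\<lambda>t. t ^ q) (map io gs))"
proof -
  have d: "io (g [^] q) - io g ^ q \<in> NN" if "g \<in> set gs" for g
    using that gs mp_zero unfolding NN_def M_def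
    by (auto simp: rhom_diff[OF E(1)] rhom_power[OF E(1)] sec_io[OF sec_E] subset_iff a_minus_def r_neg)
  show ?thesis
  proof
    show "cmb UNIV NN (map io (map (\<lambda>g. g [^] q) gs)) \<subseteq> cmb UNIV NN (map (\<lambda>t. t ^ q) (map io gs))" (is "_ \<subseteq> ?W")
    proof (rule cmb_least[OF cmb_rideal[OF NN_ideal] cmb_base])
      have "io (g [^] q) \<in> ?W" if "g \<in> set gs" for g
      proof -
        have 1: "io g ^ q \<in> ?W" by (rule cmb_mem) (use that in \<open>auto simp: smod_0[OF NN_ideal]\<close>)
        have "io (g [^] q) - io g ^ q \<in> ?W" using d[OF that] cmb_base[of UNIV NN] by auto
        from smod_add[OF cmb_rideal[OF NN_ideal] 1 this] show ?thesis by simp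
      qed
      then show "set (map io (map (\<lambda>g. g [^] q) gs)) \<subseteq> ?W" by auto
    qed simp
    show "cmb UNIV NN (map (\<lambda>t. t ^ q) (map io gs)) \<subseteq> cmb UNIV NN (map io (map (\<lambda>g. g [^] q) gs))" (is "_ \<subseteq> ?W")
    proof (rule cmb_least[OF cmb_rideal[OF NN_ideal] cmb_base])
      have "io g ^ q \<in> ?W" if "g \<in> set gs" for g
      proof -
        have 1: "io (g [^] q) \<in> ?W" by (rule cmb_mem) (use that in \<open>auto simp: smod_0[OF NN_ideal]\<close>)
        have "io (g [^] q) - io g ^ q \<in> ?W" using d[OF that] cmb_base[of UNIV NN] by auto
        from rideal_diff[OF cmb_rideal[OF NN_ideal] 1 this] show ?thesis by simp
      qed
      then show "set (map (\<lambda>t. t ^ q) (map io gs)) \<subseteq> ?W" by auto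
    qed simp
  qed
qed

lemma bracket_length:
  assumes gs: "set gs \<subseteq> carrier R" and N: "mp N \<subseteq> Idl (set gs)"
  shows "module_length R (quotient_module R (bracket_power R (Idl (set gs)) (p ^ e))) =
      enat (cod KK UNIV (frobseq p NN (map io gs) e))"
    and "\<exists>n. dimle KK UNIV (frobseq p NN (map io gs) e) n"
proof -
  let ?gs = "map (\<lambda>g. g [^] (p ^ e)) gs"
  have c: "set ?gs \<subseteq> carrier R" using gs by auto
  have B: "ideal (Idl (set ?gs)) R" by (rule genideal_ideal[OF c])
  obtain N' where N': "mp N' \<subseteq> Idl (set ?gs)" using bracket_contains_mp[OF genideal_ideal[OF gs] N, of "p ^ e"] bracket_gens[OF gs] by auto
  have "up (Idl (set ?gs)) = frobseq p NN (map io gs) e"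
    unfolding up_genideal[OF c N'] map_io_power[OF gs] frobseq_def ..
  then show "module_length R (quotient_module R (bracket_power R (Idl (set gs)) (p ^ e))) =
      enat (cod KK UNIV (frobseq p NN (map io gs) e))" "\<exists>n. dimle KK UNIV (frobseq p NN (map io gs) e) n"
    using length_eq_cod[OF B N'] finite_up[OF B N'] bracket_gens[OF gs] by auto
qed

end

context nlr
begin

lemma rep_NN:
  assumes "rep L x" and t: "\<And>n. E n t = x" shows "t \<in> cmb UNIV NN L"
proof -
  obtain l where l: "l \<in> cmb UNIV {0} L" "\<And>n. E n l = x" using assms(1) sec_E unfolding rep_def by blast
  have xc: "x \<in> carrier R" using E_closed[of 0 t] t by simp
  have "t - l \<in> NN" unfolding NN_def M_def using mp_zero t l(2) xc by (simp add: rhom_diff[OF E(1)] a_minus_def r_neg)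
  then have 1: "t - l \<in> cmb UNIV NN L" using cmb_base[of UNIV NN] by auto
  have "l \<in> cmb UNIV NN L" using l(1) cmb_mono[OF order.refl, of "{0}" NN UNIV] smod_0[OF NN_ideal] by blast
  from smod_add[OF cmb_rideal[OF NN_ideal] 1 this] show ?thesis by simp
qed

lemma bracket_rep:
  assumes gs: "set gs \<subseteq> carrier R" and t: "\<And>n. E n t = x" and x: "x \<in> bracket_power R (Idl (set gs)) (p ^ e)"
  shows "t \<in> frobseq p NN (map io gs) e"
proof -
  have c: "set (map (\<lambda>g. g [^] (p ^ e)) gs) \<subseteq> carrier R" using gs by auto
  have "rep (map io (map (\<lambda>g. g [^] (p ^ e)) gs)) x" by (rule rep_genideal[OF c]) (use x bracket_gens[OF gs] in simp)
  from rep_NN[OF this t] show ?thesis unfolding map_io_power[OF gs] frobseq_def .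
qed

lemma io_M1: "set gs \<subseteq> mx \<Longrightarrow> set (map io gs) \<subseteq> M 1"
  using io_M[of _ 1] mp_1 by auto

lemma io_unit:
  assumes c: "c \<in> carrier R" "c \<notin> mx" and F: "rideal F" "NN \<subseteq> F"
  shows "cmb UNIV F [io c] = UNIV"
proof -
  have "io c \<notin> M 1" unfolding M_def using sec_io[OF sec_E c(1)] c(2) mp_1 by simp
  then obtain v where "io c * v - 1 \<in> NN" using unit by blast
  then have "- (io c * v - 1) \<in> F" using rideal_uminus[OF NN_ideal] F(2) by blast
  then have "v * io c + (- (io c * v - 1)) \<in> cmb UNIV F [io c]" by (rule cmb_singleton_mem[OF UNIV_I])
  then have "1 \<in> cmb UNIV F [io c]" by (simp add: mult.commute)
  then show ?thesis by (rule rideal_1[OF cmb_rideal[OF F(1)]])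
qed

text \<open>A nonunit \<open>c\<close> outside the minimal primes starts a system of parameters of
  \<open>R\<close>, which remains one in the completion, so \<open>small_parameter\<close> applies.
  A unit leaves nothing to estimate.\<close>

lemma nonminimal_small:
  assumes minl: "minl xs NN" and gs: "M s \<subseteq> cmb UNIV NN gs"
    and c: "c \<in> carrier R" "\<And>P. minimal_prime P R \<Longrightarrow> c \<notin> P"
  shows "\<exists>C. \<forall>e. \<exists>m. dimle KK UNIV (cmb UNIV (frobseq p NN gs e) [io c]) m \<and> m * p ^ e \<le> C * (p ^ e) ^ length xs"
proof (cases "c \<in> mx")
  case False
  have "cmb UNIV (frobseq p NN gs e) [io c] = UNIV" for e
    by (rule io_unit[OF c(1) False frobseq_rideal[OF NN_ideal] frobseq_base])
  then have "dimle KK UNIV (cmb UNIV (frobseq p NN gs e) [io c]) 0" for e by (simp add: dimle_refl)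
  then show ?thesis by (intro exI[of _ 0] allI exI[of _ "0::nat"]) auto
next
  case True
  have ioc: "io c \<in> pull mx" unfolding pull_def using True ev_io[OF c(1)] by simp
  have min: "io c \<notin> P" if P: "Rl.tprime P" and Pmin: "\<And>Q. Rl.tprime Q \<Longrightarrow> Q \<subseteq> P \<Longrightarrow> Q = P" for P
  proof -
    have Pp: "pull (ev ` P) = P" using P pull_image unfolding Rl.tprime_def by auto
    have "minimal_prime (ev ` P) R" unfolding minimal_prime_def
    proof (intro conjI allI impI)
      show "primeideal (ev ` P) R" by (rule tprime_image[OF P])
      fix Q assume Q: "primeideal Q R" "Q \<subseteq> ev ` P"
      have "pull Q \<subseteq> pull (ev ` P)" using Q(2) unfolding pull_def by blast
      then have "pull Q = P" using Pmin[OF tprime_pull[OF Q(1)]] Pp by simp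
      then show "Q = ev ` P" using image_pull[of Q] ideal.Icarr[OF primeideal.axioms(1)[OF Q(1)]] by blast
    qed
    from c(2)[OF this] have "c \<notin> ev ` P" .
    then show ?thesis using ev_io[OF c(1)] by (metis imageI)
  qed
  have "\<exists>ys k. length ys < length xs \<and> set ys \<subseteq> pull mx \<and> Rl.Mp k \<subseteq> cmb UNIV ker (io c # ys)"
    by (rule Rl.parameters_exist_nonminimal[OF _ ioc]) (rule prime_chain_bound[OF tchain_image minl], assumption, rule min)
  then obtain ys k where ys: "length ys < length xs" "set ys \<subseteq> pull mx" "Rl.Mp k \<subseteq> cmb UNIV ker (io c # ys)" by blast
  have "M k \<subseteq> cmb UNIV NN (map (io \<circ> ev) (io c # ys))" by (rule sop_of_R[OF _ ys(3)]) (use ys(2) ioc in auto)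
  then have "M k \<subseteq> cmb UNIV NN (io c # map (io \<circ> ev) ys)" using ev_io[OF c(1)] by simp
  from small_parameter[OF minl gs this sop_of_R_M1[OF ys(2)]] ys(1) show ?thesis by simp
qed

text \<open>\<open>HK_mult\<close> is defined by \<open>lim\<close>, which carries information only
  for convergent sequences. The length of \<open>xs\<close> is the Krull dimension, so the two
  normalisations agree.\<close>

lemma HK_limit:
  assumes red: "reduced_ring (completion R (max_ideal R))" and minl: "minl xs NN"
    and gs: "set gs \<subseteq> carrier R" and N: "mp N \<subseteq> Idl (set gs)"
  shows "(\<lambda>e. real (cod KK UNIV (frobseq p NN (map io gs) e)) / real (p ^ e) ^ length xs)
    \<longlonglongrightarrow> HK_mult p R (Idl (set gs))"
proof -
  obtain us where us: "UNIV = cmb (ser xs) NN us" using minl_NN_generation[OF minl] by blast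
  have nn: "nnring NN KK (ser xs) xs us (map io gs) p" by (rule nnring[OF minl us mp_generation[OF gs N]])
  have rad: "nnring.radical NN" unfolding nnring.radical_def[OF nn] using NN_radical[OF red] by blast
  have "convergent (\<lambda>e. real (cod KK UNIV (frobseq p NN (map io gs) e)) / real (p ^ e) ^ length xs)"
    by (rule nnring.colength_converges_radical[OF nn rad])
  then show ?thesis
    unfolding HK_mult_def krull_dim_eq[OF minl] bracket_length(1)[OF gs N] convergent_LIMSEQ_iff by simp
qed

text \<open>For large \<open>e\<close> the lower bound \<open>(p ^ e - N0) ^ d\<close> is at least
  \<open>(p ^ e / 2) ^ d\<close>. Expressed in terms of \<open>p ^ (e + e0)\<close> this becomes the
  constant \<open>b\<close>.\<close>

lemma HK_positive:
  assumes red: "reduced_ring (completion R (max_ideal R))" and minl: "minl xs NN"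
    and gs: "set gs \<subseteq> mx" and N: "mp N \<subseteq> Idl (set gs)"
  shows "0 < HK_mult p R (Idl (set gs))"
proof -
  let ?d = "length xs" and ?L = "\<lambda>e. cod KK UNIV (frobseq p NN (map io gs) e)"
  have gsc: "set gs \<subseteq> carrier R" using gs ideal.Icarr[OF mx_ideal] by blast
  have p0: "0 < p" "1 < p" using p prime_gt_0_nat prime_gt_1_nat by auto
  obtain e0 N0 where low: "\<And>e m. dimle KK UNIV (frobseq p NN (map io gs) (e0 + e)) m \<Longrightarrow> (p ^ e - N0) ^ ?d \<le> m"
    using colength_growth[OF minl io_M1[OF gs]] by blast
  define b where "b = (1 / (2 * real p ^ e0)) ^ ?d"
  have b: "0 < b" unfolding b_def using p0 by simp
  have "(\<lambda>e. real (?L (e + e0)) / real (p ^ (e + e0)) ^ ?d) \<longlonglongrightarrow> HK_mult p R (Idl (set gs))"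
    by (rule LIMSEQ_ignore_initial_segment[OF HK_limit[OF red minl gsc N]])
  moreover have "\<exists>n. \<forall>e\<ge>n. b \<le> real (?L (e + e0)) / real (p ^ (e + e0)) ^ ?d"
  proof (intro exI allI impI)
    fix e assume e: "2 * N0 \<le> e"
    have "e < p ^ e" using p0 by (simp add: power_gt_expt)
    then have half: "real (p ^ e) \<le> 2 * real (p ^ e - N0)" using e by linarith
    have "(p ^ e - N0) ^ ?d \<le> ?L (e0 + e)" by (rule low) (use bracket_length(2)[OF gsc N] dimle_cod in blast)
    then have l: "real (p ^ e - N0) ^ ?d \<le> real (?L (e + e0))" by (metis add.commute of_nat_le_iff of_nat_power)
    have "b * real (p ^ (e + e0)) ^ ?d = (real (p ^ e) / 2) ^ ?d"
    proof -
      have "1 / (2 * real p ^ e0) * real (p ^ (e + e0)) = real (p ^ e) / 2" using p0 by (simp add: power_add)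
      then show ?thesis by (simp only: b_def power_mult_distrib[symmetric])
    qed
    also have "\<dots> \<le> real (p ^ e - N0) ^ ?d" by (rule power_mono) (use half in auto)
    also note l
    finally show "b \<le> real (?L (e + e0)) / real (p ^ (e + e0)) ^ ?d" using p0 by (simp add: pos_le_divide_eq)
  qed
  ultimately have "b \<le> HK_mult p R (Idl (set gs))" by (rule LIMSEQ_le_const)
  then show ?thesis using b by simp
qed

definition primary :: "'a set \<Rightarrow> bool" where
  "primary I \<longleftrightarrow> ideal I R \<and> I \<subseteq> mx \<and> (\<exists>N. mp N \<subseteq> I)"

lemma max_primary_primary: assumes "max_primary I R" shows "primary I"
proof -
  have I: "ideal I R" "I \<noteq> carrier R" "radical_of R I = mx" using assms unfolding max_primary_def primary_ideal_def mx_def by auto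
  have "\<exists>N. mp N \<subseteq> I" by (rule ideal_contains_mp[OF I(1)]) (use I(3) in \<open>auto simp: radical_of_def\<close>)
  then show ?thesis unfolding primary_def using I proper_ideal_mx by blast
qed

lemma ideal_prod_mono: "A \<subseteq> A' \<Longrightarrow> B \<subseteq> B' \<Longrightarrow> A \<cdot> B \<subseteq> A' \<cdot> B'"
proof
  fix x assume *: "A \<subseteq> A'" "B \<subseteq> B'" and "x \<in> A \<cdot> B"
  from this(3) show "x \<in> A' \<cdot> B'"
    by (induction rule: ideal_prod.induct) (use * in \<open>auto intro: ideal_prod.intros\<close>)
qed

lemma primary_prod: assumes I: "primary I" and J: "primary J" shows "primary (I \<cdot> J)"
proof -
  obtain N N' where N: "mp N \<subseteq> I" "mp N' \<subseteq> J" using I J unfolding primary_def by blast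
  have id: "ideal I R" "ideal J R" using I J unfolding primary_def by auto
  have "mp (N + N') \<subseteq> I \<cdot> J" unfolding mp_add by (rule ideal_prod_mono[OF N])
  moreover have "I \<cdot> J \<subseteq> mx" using ideal_prod_inter[OF id] I unfolding primary_def by blast
  ultimately show ?thesis unfolding primary_def using ideal_prod_is_ideal[OF id] by blast
qed

lemma primary_gens: assumes "primary I" shows "\<exists>gs N. set gs \<subseteq> mx \<and> set gs \<subseteq> carrier R \<and> I = Idl (set gs) \<and> mp N \<subseteq> Idl (set gs)"
proof -
  obtain gs where gs: "set gs \<subseteq> carrier R" "I = Idl (set gs)" using noeth_gens assms unfolding primary_def by blast
  then show ?thesis using assms genideal_self[OF gs(1)] unfolding primary_def by (intro exI[of _ gs]) blast
qed

text \<open>The multipliers of the finitely many elements are multiplied together; the product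
  avoids the minimal primes because these are prime.\<close>

lemma common_multiplier:
  assumes H: "H \<subseteq> carrier R"
  shows "set js \<subseteq> tight_closure p R H \<Longrightarrow> \<exists>c\<in>carrier R. (\<forall>P. minimal_prime P R \<longrightarrow> c \<notin> P) \<and>
    (\<forall>\<^sub>F e in sequentially. \<forall>x\<in>set js. c \<otimes> x [^] (p ^ e) \<in> bracket_power R H (p ^ e))"
proof (induction js)
  case Nil
  have "\<one> \<notin> P" if "minimal_prime P R" for P
  proof -
    have "primeideal P R" using that unfolding minimal_prime_def by blast
    then show ?thesis using primeideal.I_notcarr ideal.one_imp_carrier primeideal.axioms(1) by metis
  qed
  then show ?case by (intro bexI[of _ \<one>]) auto
next
  case (Cons x js)
  obtain c where c: "c \<in> carrier R" "\<And>P. minimal_prime P R \<Longrightarrow> c \<notin> P"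
    "\<forall>\<^sub>F e in sequentially. \<forall>x\<in>set js. c \<otimes> x [^] (p ^ e) \<in> bracket_power R H (p ^ e)"
    using Cons.IH Cons.prems by auto
  obtain b where b: "b \<in> carrier R" "\<And>P. minimal_prime P R \<Longrightarrow> b \<notin> P"
    "\<forall>\<^sub>F e in sequentially. b \<otimes> x [^] (p ^ e) \<in> bracket_power R H (p ^ e)" and x: "x \<in> carrier R"
    using Cons.prems unfolding tight_closure_def by auto
  have js: "y \<in> carrier R" if "y \<in> set js" for y using Cons.prems that unfolding tight_closure_def by auto
  show ?case
  proof (intro bexI[of _ "b \<otimes> c"] conjI allI impI)
    show "b \<otimes> c \<notin> P" if P: "minimal_prime P R" for P
      using primeideal.I_prime[of P R b c] b(1,2) c(1,2) P unfolding minimal_prime_def by blast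
    show "\<forall>\<^sub>F e in sequentially. \<forall>y\<in>set (x # js). (b \<otimes> c) \<otimes> y [^] (p ^ e) \<in> bracket_power R H (p ^ e)"
      using c(3) b(3)
    proof eventually_elim
      case (elim e)
      interpret B: ideal "bracket_power R H (p ^ e)" R by (rule bracket_ideal[OF H])
      show ?case
      proof
        fix y assume y: "y \<in> set (x # js)"
        show "(b \<otimes> c) \<otimes> y [^] (p ^ e) \<in> bracket_power R H (p ^ e)"
        proof (cases "y = x")
          case True
          have "(b \<otimes> c) \<otimes> y [^] (p ^ e) = c \<otimes> (b \<otimes> x [^] (p ^ e))" using True b(1) c(1) x by (simp add: m_ac)
          then show ?thesis using B.I_l_closed[OF elim(2) c(1)] by simp
        next
          case False
          then have yj: "y \<in> set js" using y by simp
          have "(b \<otimes> c) \<otimes> y [^] (p ^ e) = b \<otimes> (c \<otimes> y [^] (p ^ e))" using b(1) c(1) js[OF yj] by (simp add: m_ac)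
          then show ?thesis using B.I_l_closed[of "c \<otimes> y [^] (p ^ e)" b] elim(1) yj b(1) by simp
        qed
      qed
    qed
  qed (use b c in auto)
qed

lemma ideal_tight_closure: assumes J: "J \<subseteq> carrier R" shows "J \<subseteq> tight_closure p R J"
proof
  fix x assume x: "x \<in> J"
  have one: "\<one> \<notin> P" if "minimal_prime P R" for P
  proof -
    have "primeideal P R" using that unfolding minimal_prime_def by blast
    then show ?thesis using primeideal.I_notcarr ideal.one_imp_carrier primeideal.axioms(1) by metis
  qed
  have "\<one> \<otimes> x [^] (p ^ e) \<in> bracket_power R J (p ^ e)" for e
    using bracket_mem[OF J x, of "p ^ e"] x J by auto
  then show "x \<in> tight_closure p R J" unfolding tight_closure_def using one x J by (auto intro!: bexI[of _ \<one>])
qed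

theorem HK_mult_inequality:
  assumes red: "reduced_ring (completion R (max_ideal R))" and I: "primary I" and J: "primary J"
    and H: "star_reduction p R J H"
  shows "HK_mult p R (I \<cdot> J) \<le> real (min_num_gens R H) * HK_mult p R I + HK_mult p R J"
proof -
  obtain xs where minl: "minl xs NN" using ex_minl[OF NN_ideal order.refl] by blast
  let ?d = "length xs"
  obtain ig N1 where ig: "set ig \<subseteq> carrier R" "I = Idl (set ig)" "mp N1 \<subseteq> Idl (set ig)" using primary_gens[OF I] by blast
  obtain jg N2 where jg: "set jg \<subseteq> carrier R" "J = Idl (set jg)" "mp N2 \<subseteq> Idl (set jg)" using primary_gens[OF J] by blast
  obtain zs N3 where zs: "set zs \<subseteq> carrier R" "I \<cdot> J = Idl (set zs)" "mp N3 \<subseteq> Idl (set zs)" using primary_gens[OF primary_prod[OF I J]] by blast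
  have Hi: "ideal H R" and HJ: "H \<subseteq> J" and HT: "tight_closure p R H = tight_closure p R J"
    using H unfolding star_reduction_def by auto
  have Jc: "J \<subseteq> carrier R" using ideal.Icarr[OF genideal_ideal[OF jg(1)]] jg(2) by blast
  have Hc: "H \<subseteq> carrier R" using HJ Jc by (rule order.trans)
  have IJc: "I \<cdot> J \<subseteq> carrier R" using ideal.Icarr[OF genideal_ideal[OF zs(1)]] zs(2) by blast
  \<comment> \<open>Noetherianity shows that the \<open>LEAST\<close> in \<open>min_num_gens\<close>
    is attained, so \<open>hg\<close> can list exactly that many generators of
    \<open>H\<close>.\<close>
  have "\<exists>n. \<exists>A\<subseteq>carrier R. finite A \<and> card A = n \<and> Idl A = H"
    using noeth_gens[OF Hi] by (metis List.finite_set)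
  from LeastI_ex[OF this] obtain A where A: "A \<subseteq> carrier R" "finite A" "card A = min_num_gens R H" "Idl A = H"
    unfolding min_num_gens_def by blast
  obtain hg where hg': "set hg = A" "distinct hg" using finite_distinct_list[OF A(2)] by blast
  have hg: "set hg \<subseteq> carrier R" "H = Idl (set hg)" "length hg = min_num_gens R H"
    using hg' A distinct_card[OF hg'(2)] by auto
  \<comment> \<open>\<open>J\<close> lies in its tight closure, which is that of \<open>H\<close>;
    so one \<open>c\<close> multiplies the \<open>q\<close>-th powers of the generators of
    \<open>J\<close> into the bracket power of \<open>H\<close> for all large
    \<open>q\<close>.\<close>
  have "set jg \<subseteq> tight_closure p R H" using ideal_tight_closure[OF Jc] genideal_self[OF jg(1)] jg(2) HT by blast
  from common_multiplier[OF Hc this] obtain c where c: "c \<in> carrier R" "\<And>P. minimal_prime P R \<Longrightarrow> c \<notin> P"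
    "\<forall>\<^sub>F e in sequentially. \<forall>x\<in>set jg. c \<otimes> x [^] (p ^ e) \<in> bracket_power R H (p ^ e)" by blast
  obtain e1 where e1: "\<And>e x. e1 \<le> e \<Longrightarrow> x \<in> set jg \<Longrightarrow> c \<otimes> x [^] (p ^ e) \<in> bracket_power R H (p ^ e)"
    using c(3) unfolding eventually_sequentially by blast
  obtain C where C: "\<And>e. \<exists>m. dimle KK UNIV (cmb UNIV (frobseq p NN (map io ig) e) [io c]) m \<and> m * p ^ e \<le> C * (p ^ e) ^ ?d"
    using nonminimal_small[OF minl mp_generation[OF ig(1,3)] c(1,2)] by blast
  define L where "L = (\<lambda>gs e. cod KK UNIV (frobseq p NN (map io gs) e))"
  let ?a = "\<lambda>gs e. real (L gs e) / real (p ^ e) ^ ?d"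
  have p0: "1 < p" "0 < p" using p prime_gt_1_nat prime_gt_0_nat by auto
  \<comment> \<open>The middle layer contributes \<open>length jg * m\<close>, where
    \<open>m * p ^ e \<le> C * (p ^ e) ^ d\<close>; after normalisation this is the term that tends
    to zero.\<close>
  have key: "?a zs e \<le> ?a jg e + real (length hg) * ?a ig e + real (length jg) * real C * (1 / real p) ^ e" if e: "e1 \<le> e" for e
  proof -
    obtain m where m: "dimle KK UNIV (cmb UNIV (frobseq p NN (map io ig) e) [io c]) m" "m * p ^ e \<le> C * (p ^ e) ^ ?d" using C by blast
    let ?F = "frobseq p NN (map io zs) e"
    have "dimle KK UNIV ?F (L jg e + length (map io jg) * m + length (map io hg) * L ig e)"
    proof (rule frobseq_mult_inequality[OF frobseq_rideal[OF NN_ideal] frobseq_base _ _ _ _ _ m(1)])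
      show "dimle KK UNIV (frobseq p NN (map io ig) e) (L ig e)" "dimle KK UNIV (frobseq p NN (map io jg) e) (L jg e)"
        using bracket_length(2)[OF ig(1,3)] bracket_length(2)[OF jg(1,3)] dimle_cod unfolding L_def by blast+
      show "(i * j) ^ p ^ e \<in> ?F" if "i \<in> set (map io ig)" "j \<in> set (map io jg)" for i j
      proof -
        from that obtain i' j' where ij: "i' \<in> set ig" "i = io i'" "j' \<in> set jg" "j = io j'" by auto
        have cc: "i' \<in> carrier R" "j' \<in> carrier R" using ij ig(1) jg(1) by auto
        have "i' \<otimes> j' \<in> I \<cdot> J"
          by (rule ideal_prod.prod) (use ij genideal_self[OF ig(1)] genideal_self[OF jg(1)] ig(2) jg(2) in auto)
        then have "(i' \<otimes> j') [^] (p ^ e) \<in> bracket_power R (Idl (set zs)) (p ^ e)" using bracket_mem[OF IJc] zs(2) by simp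
        from bracket_rep[OF zs(1) _ this] show ?thesis unfolding ij(2,4)
          using cc by (simp add: rhom_power[OF E(1)] rhom_mult[OF E(1)] sec_io[OF sec_E])
      qed
      show "set (map io hg) \<subseteq> cmb UNIV NN (map io jg)"
      proof
        fix h assume "h \<in> set (map io hg)"
        then obtain h' where h: "h' \<in> set hg" "h = io h'" by auto
        have "h' \<in> Idl (set jg)" using h(1) genideal_self[OF hg(1)] hg(2) HJ jg(2) by blast
        then show "h \<in> cmb UNIV NN (map io jg)" unfolding h(2)
          by (rule rep_NN[OF rep_genideal[OF jg(1)]]) (use h(1) hg(1) sec_io[OF sec_E] in blast)
      qed
      show "io c * j ^ p ^ e \<in> frobseq p NN (map io hg) e" if "j \<in> set (map io jg)" for j
      proof -
        from that obtain j' where j: "j' \<in> set jg" "j = io j'" by auto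
        have cc: "j' \<in> carrier R" using j jg(1) by auto
        have "c \<otimes> j' [^] (p ^ e) \<in> bracket_power R (Idl (set hg)) (p ^ e)" using e1[OF e j(1)] hg(2) by simp
        from bracket_rep[OF hg(1) _ this] show ?thesis unfolding j(2)
          using cc c(1) by (simp add: rhom_power[OF E(1)] rhom_mult[OF E(1)] sec_io[OF sec_E])
      qed
    qed
    then have "L zs e \<le> L jg e + length jg * m + length hg * L ig e" unfolding L_def by (intro cod_le) simp
    then have 1: "real (L zs e) \<le> real (L jg e) + real (length jg) * real m + real (length hg) * real (L ig e)"
      by (metis of_nat_add of_nat_le_iff of_nat_mult)
    have "real m * real p ^ e \<le> real C * real (p ^ e) ^ ?d" using m(2) by (metis of_nat_le_iff of_nat_mult of_nat_power)
    then have 2: "real m / real (p ^ e) ^ ?d \<le> real C * (1 / real p) ^ e"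
      using p0 by (simp add: field_simps)
    have "?a zs e \<le> (real (L jg e) + real (length jg) * real m + real (length hg) * real (L ig e)) / real (p ^ e) ^ ?d"
      by (rule divide_right_mono[OF 1]) simp
    also have "\<dots> = ?a jg e + real (length hg) * ?a ig e + real (length jg) * (real m / real (p ^ e) ^ ?d)"
      by (simp add: add_divide_distrib)
    also have "\<dots> \<le> ?a jg e + real (length hg) * ?a ig e + real (length jg) * (real C * (1 / real p) ^ e)"
      by (intro add_left_mono mult_left_mono[OF 2]) simp
    finally show ?thesis by (simp add: mult.assoc)
  qed
  have lim: "?a gs \<longlonglongrightarrow> HK_mult p R (Idl (set gs))" if "set gs \<subseteq> carrier R" "mp N \<subseteq> Idl (set gs)" for gs N
    unfolding L_def by (rule HK_limit[OF red minl that])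
  have limI: "?a ig \<longlonglongrightarrow> HK_mult p R I" and limJ: "?a jg \<longlonglongrightarrow> HK_mult p R J"
    and limIJ: "?a zs \<longlonglongrightarrow> HK_mult p R (I \<cdot> J)"
    unfolding ig(2) jg(2) zs(2)[unfolded ig(2) jg(2)] by (rule lim[OF ig(1,3)], rule lim[OF jg(1,3)], rule lim[OF zs(1,3)])
  have "(\<lambda>e. ?a jg e + real (length hg) * ?a ig e + real (length jg) * real C * (1 / real p) ^ e)
      \<longlonglongrightarrow> HK_mult p R J + real (length hg) * HK_mult p R I + real (length jg) * real C * 0"
    by (intro tendsto_add tendsto_mult tendsto_const LIMSEQ_power_zero limI limJ) (use p0 in auto)
  from LIMSEQ_le[OF limIJ this] key have "HK_mult p R (I \<cdot> J) \<le> HK_mult p R J + real (length hg) * HK_mult p R I" by auto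
  then show ?thesis using hg(3) by simp
qed

end

theorem proposition3p1:
  fixes R :: "('a, 'b) ring_scheme" and p :: nat and I J :: "'a set"
  assumes "local_ring R" and "noetherian_ring R" and "excellent_ring R"
    and "Factorial_Ring.prime p" and "has_characteristic R p"
    and "reduced_ring (completion R (max_ideal R))"
    and "equidimensional (completion R (max_ideal R))"
    and "max_primary I R" and "max_primary J R"
  shows "ereal (HK_mult p R (I \<cdot>\<^bsub>R\<^esub> J)) \<le>
    ereal_of_enat (star_spread p R J) * ereal (HK_mult p R I) + ereal (HK_mult p R J)"
proof -
  interpret nlr R p
    using assms(1,2,4,5) unfolding local_ring_def nlr_def nlr_axioms_def by auto
  have I: "primary I" and J: "primary J" using max_primary_primary assms(8,9) by auto
  let ?S = "{enat (min_num_gens R K) |K. minimal_star_reduction p R J K}"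
  show ?thesis
  proof (cases "?S = {}")
    \<comment> \<open>The infimum of the empty set is infinite. Positivity of the multiplicity of
      \<open>I\<close> is essential here, since infinity times zero is zero in the extended
      reals.\<close>
    case True
    obtain xs where minl: "minl xs NN" using ex_minl[OF NN_ideal order.refl] by blast
    obtain gs N where gs: "set gs \<subseteq> mx" "I = Idl\<^bsub>R\<^esub> (set gs)" "mp N \<subseteq> Idl\<^bsub>R\<^esub> (set gs)" using primary_gens[OF I] by blast
    have "0 < HK_mult p R I" using HK_positive[OF assms(6) minl gs(1,3)] gs(2) by simp
    moreover have "star_spread p R J = \<infinity>" unfolding star_spread_def True by (simp add: Inf_enat_def)
    ultimately show ?thesis by simp
  next
    case False
    \<comment> \<open>An infimum of a nonempty set of extended naturals is attained, which provides
      the reduction \<open>K\<close>.\<close>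
    have "star_spread p R J \<in> ?S" unfolding star_spread_def Inf_enat_def using False by (auto intro: LeastI)
    then obtain K where K: "star_spread p R J = enat (min_num_gens R K)" "minimal_star_reduction p R J K" by blast
    have "star_reduction p R J K" using K(2) unfolding minimal_star_reduction_def by blast
    from HK_mult_inequality[OF assms(6) I J this] show ?thesis unfolding K(1) by simp
  qed
qed

end
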